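(* Let $M$ be a 3-dimensional complex manifold and $S \subset M$ a closed subset of complex codimension 2 or more. Then every holomorphic scalar conservation law on $M \setminus S$ extends to a holomorphic scalar conservation law on $M$.
   Context: A subset $S$ of a complex manifold $M$ is of complex codimension 2 or more if every $s \in S$ has an open neighbourhood $U_s \subset M$ such that $S \cap U_s$ is contained in a complex analytic subvariety of $U_s$ of complex codimension at least 2. Let $G \subset \mathrm{GL}(3,\mathbb C)$ be the group of matrices $$\begin{pmatrix} g^2&0&0\\0&g&0\\0&h&g^{-1}\end{pmatrix},\qquad g\in\mathbb C\setminus\{0\},\ h\in\mathbb C.$$ For a 3-dimensional complex manifold $N$, $FTN$ is the principal right $\mathrm{GL}(3,\mathbb C)$-bundle of complex linear isomorphisms $u:T_mN\to\mathbb C^3$ with action $r_ku=k^{-1}u$. A holomorphic $G$-structure on $N$ is a holomorphic principal right $G$-bundle $E\to N$ with a holomorphic $G$-equivariant bundle map $\phi: E\to FTN$ over the identity of $N$. Its soldering form is the $\mathbb C^3$-valued 1-form on $E$ with components $\omega^1,\omega^2,\omega^3$ whose value at $e \in E$ on a tangent vector $v$ is $\phi(e)(\pi'(e)v)$, where $\pi : E \to N$ is the bundle projection. A holomorphic scalar conservation law on $N$ is identified with its associated first order structure (in the sense of Bryant, Griffiths and Hsu): a holomorphic $G$-structure $E \to FTN$ such that near each point of $E$ there are holomorphic 1-forms $\varphi,\mu$, the components of a $\mathfrak g$-valued pseudoconnection $$\begin{pmatrix}2\varphi&0&0\\0&\varphi&0\\0&\mu&-\varphi\end{pmatrix}$$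 (i.e. a $\mathfrak g$-valued 1-form taking the value $A$ on the vector field generating the right action of $e^{tA}$, for each $A\in\mathfrak g$), and a holomorphic function $K$, satisfying $$d\begin{pmatrix}\omega^1\\\omega^2\\\omega^3\end{pmatrix}=-\begin{pmatrix}2\varphi&0&0\\0&\varphi&0\\0&\mu&-\varphi\end{pmatrix}\wedge\begin{pmatrix}\omega^1\\\omega^2\\\omega^3\end{pmatrix}+\begin{pmatrix}K\,\omega^2\wedge\omega^3\\\omega^1\wedge\omega^3\\0\end{pmatrix}.$$ Such a structure on $M\setminus S$ extends to $M$ if there is such a structure on $M$ whose restriction to $M\setminus S$ is isomorphic to it as a $G$-structure (over the identity map of $M \setminus S$). *)

theory Defs
  imports "HOL-Analysis.Analysis"
begin

section \<open>Complex manifolds\<close>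

text \<open>Real differentiable with complex linear derivative; only used for open \<open>S\<close>.\<close>

definition holo_Cn :: "(complex^'n \<Rightarrow> complex) \<Rightarrow> (complex^'n) set \<Rightarrow> bool" where
  "holo_Cn f S \<longleftrightarrow>
     (\<forall>x\<in>S. \<exists>f'. (f has_derivative f') (at x) \<and> (\<forall>c v. f' (c *s v) = c * f' v))"

text \<open>
  A manifold modelled on \<open>complex^'n\<close> is given by an atlas alone: the underlying set is the union of
  the chart domains and the topology is the one for which all charts are homeomorphisms. Values of a
  chart outside its domain are irrelevant; charts with empty domain are allowed.
\<close>

type_synonym ('a, 'n) chart = "'a set \<times> ('a \<Rightarrow> complex^'n)"
type_synonym ('a, 'n) atlas = "('a, 'n) chart set"

definition points :: "('a, 'n) atlas \<Rightarrow> 'a set" where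
  "points A = (\<Union>(U, \<kappa>)\<in>A. U)"

definition mtop :: "('a, 'n::finite) atlas \<Rightarrow> 'a topology" where
  "mtop A = topology (\<lambda>W. W \<subseteq> points A \<and> (\<forall>(U, \<kappa>)\<in>A. open (\<kappa> ` (W \<inter> U))))"

definition compatible_charts :: "('a, 'n::finite) atlas \<Rightarrow> bool" where
  "compatible_charts A \<longleftrightarrow>
     (\<forall>(U, \<kappa>)\<in>A. inj_on \<kappa> U) \<and>
     (\<forall>(U, \<kappa>)\<in>A. \<forall>(V, \<eta>)\<in>A. open (\<kappa> ` (U \<inter> V)) \<and>
        (\<forall>i. holo_Cn (\<lambda>z. \<eta> (inv_into U \<kappa> z) $ i) (\<kappa> ` (U \<inter> V))))"

definition complex_manifold :: "('a, 'n::finite) atlas \<Rightarrow> bool" where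
  "complex_manifold A \<longleftrightarrow>
     compatible_charts A \<and> Hausdorff_space (mtop A) \<and> second_countable (mtop A)"

lemma compatible_chartsD:
  assumes "compatible_charts A" "(U, \<kappa>) \<in> A" "(V, \<eta>) \<in> A"
  shows "inj_on \<kappa> U" "open (\<kappa> ` (U \<inter> V))"
    "holo_Cn (\<lambda>z. \<eta> (inv_into U \<kappa> z) $ i) (\<kappa> ` (U \<inter> V))"
proof -
  show "inj_on \<kappa> U"
    using assms(1,2) unfolding compatible_charts_def by blast
  have "\<forall>(V, \<eta>)\<in>A. open (\<kappa> ` (U \<inter> V)) \<and>
          (\<forall>i. holo_Cn (\<lambda>z. \<eta> (inv_into U \<kappa> z) $ i) (\<kappa> ` (U \<inter> V)))"
    using bspec[OF conjunct2[OF assms(1)[unfolded compatible_charts_def]] assms(2)]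
    by (simp only: prod.case)
  note * = bspec[OF this assms(3), unfolded prod.case]
  show "open (\<kappa> ` (U \<inter> V))"
    using * by (rule conjunct1)
  show "holo_Cn (\<lambda>z. \<eta> (inv_into U \<kappa> z) $ i) (\<kappa> ` (U \<inter> V))"
    using * by blast
qed

lemma openin_mtop:
  assumes "compatible_charts A"
  shows "openin (mtop A) W \<longleftrightarrow> W \<subseteq> points A \<and> (\<forall>(U, \<kappa>)\<in>A. open (\<kappa> ` (W \<inter> U)))"
proof -
  let ?P = "\<lambda>W. W \<subseteq> points A \<and> (\<forall>(U, \<kappa>)\<in>A. open (\<kappa> ` (W \<inter> U)))"
  have inj: "inj_on \<kappa> U" if "(U, \<kappa>) \<in> A" for U \<kappa>
    using compatible_chartsD(1)[OF assms that that] .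
  have int: "?P (S \<inter> T)" if "?P S" "?P T" for S T
  proof -
    have "open (\<kappa> ` (S \<inter> T \<inter> U))" if A: "(U, \<kappa>) \<in> A" for U \<kappa>
    proof -
      have "\<kappa> ` (S \<inter> T \<inter> U) = \<kappa> ` ((S \<inter> U) \<inter> (T \<inter> U))"
        by (rule arg_cong[where f = "image \<kappa>"]) auto
      also have "\<dots> = \<kappa> ` (S \<inter> U) \<inter> \<kappa> ` (T \<inter> U)"
        by (rule inj_on_image_Int[OF inj[OF A]]) auto
      finally show ?thesis
        using \<open>?P S\<close> \<open>?P T\<close> A by auto
    qed
    then show ?thesis
      using that by auto
  qed
  have un: "?P (\<Union>K)" if K: "\<forall>S\<in>K. ?P S" for K
  proof -
    have "open (\<kappa> ` (\<Union>K \<inter> U))" if A: "(U, \<kappa>) \<in> A" for U \<kappa>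
    proof -
      have "\<kappa> ` (\<Union>K \<inter> U) = (\<Union>S\<in>K. \<kappa> ` (S \<inter> U))"
        by auto
      moreover have "\<forall>S\<in>K. open (\<kappa> ` (S \<inter> U))"
        using K A by blast
      ultimately show ?thesis
        by (simp add: open_UN)
    qed
    then show ?thesis
      using K by blast
  qed
  have "istopology ?P"
    unfolding istopology_def using int un by blast
  then show ?thesis
    by (simp add: mtop_def topology_inverse')
qed

lemma topspace_mtop:
  assumes "compatible_charts A"
  shows "topspace (mtop A) = points A"
proof
  show "topspace (mtop A) \<subseteq> points A"
    using openin_mtop[OF assms] openin_topspace by blast
  have "openin (mtop A) (points A)"
    unfolding openin_mtop[OF assms]
  proof (intro conjI subset_refl ballI, clarify)
    fix U \<kappa> assume U: "(U, \<kappa>) \<in> A"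
    then have "points A \<inter> U = U \<inter> U"
      by (auto simp: points_def)
    moreover have "open (\<kappa> ` (U \<inter> U))"
      by (rule compatible_chartsD(2)[OF assms U U])
    ultimately show "open (\<kappa> ` (points A \<inter> U))"
      by (simp only:)
  qed
  then show "points A \<subseteq> topspace (mtop A)"
    by (rule openin_subset)
qed

definition open_sub :: "('a, 'n) atlas \<Rightarrow> 'a set \<Rightarrow> ('a, 'n) atlas" where
  "open_sub A W = (\<lambda>(U, \<kappa>). (U \<inter> W, \<kappa>)) ` A"

definition prod_atlas ::
    "('a, 'n::finite) atlas \<Rightarrow> ('b, 'm::finite) atlas \<Rightarrow> ('a \<times> 'b, 'n + 'm) atlas" where
  "prod_atlas A B = {(U \<times> V, \<lambda>(p, q). \<chi> i. case i of Inl j \<Rightarrow> \<kappa> p $ j | Inr j \<Rightarrow> \<eta> q $ j) | U \<kappa> V \<eta>.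
     (U, \<kappa>) \<in> A \<and> (V, \<eta>) \<in> B}"

definition holo_map :: "('a, 'n::finite) atlas \<Rightarrow> ('b, 'm::finite) atlas \<Rightarrow> ('a \<Rightarrow> 'b) \<Rightarrow> bool" where
  "holo_map A B F \<longleftrightarrow> continuous_map (mtop A) (mtop B) F \<and>
     (\<forall>(U, \<kappa>)\<in>A. \<forall>(V, \<eta>)\<in>B. \<forall>i.
        holo_Cn (\<lambda>z. \<eta> (F (inv_into U \<kappa> z)) $ i) (\<kappa> ` (U \<inter> F -` V)))"

definition biholo :: "('a, 'n::finite) atlas \<Rightarrow> ('b, 'm::finite) atlas \<Rightarrow> ('a \<Rightarrow> 'b) \<Rightarrow> bool" where
  "biholo A B F \<longleftrightarrow> bij_betw F (points A) (points B) \<and>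
     holo_map A B F \<and> holo_map B A (inv_into (points A) F)"

definition holo_fun :: "('a, 'n::finite) atlas \<Rightarrow> 'a set \<Rightarrow> ('a \<Rightarrow> complex) \<Rightarrow> bool" where
  "holo_fun A W f \<longleftrightarrow> (\<forall>(U, \<kappa>)\<in>A. holo_Cn (\<lambda>z. f (inv_into U \<kappa> z)) (\<kappa> ` (U \<inter> W)))"

definition holo_near :: "('a, 'n::finite) atlas \<Rightarrow> 'a \<Rightarrow> ('a \<Rightarrow> complex) \<Rightarrow> bool" where
  "holo_near A p f \<longleftrightarrow> (\<exists>W. openin (mtop A) W \<and> p \<in> W \<and> holo_fun A W f)"


section \<open>Analytic subvarieties and codimension\<close>

definition analytic_subvariety :: "('a, 'n::finite) atlas \<Rightarrow> 'a set \<Rightarrow> 'a set \<Rightarrow> bool" where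
  "analytic_subvariety A U V \<longleftrightarrow> V \<subseteq> U \<and>
     (\<forall>p\<in>U. \<exists>W F. openin (mtop A) W \<and> p \<in> W \<and> W \<subseteq> U \<and> finite F \<and> (\<forall>f\<in>F. holo_fun A W f) \<and>
        V \<inter> W = {q \<in> W. \<forall>f\<in>F. f q = 0})"

text \<open>
  Dimension of an analytic set at a point, as in Grauert and Remmert, Coherent Analytic Sheaves,
  Ch. 5: the least number of holomorphic functions near \<open>p\<close> whose common zero set in \<open>V\<close> has \<open>p\<close>
  as an isolated point. (Local coordinates show that such a number exists.)
\<close>

definition analytic_dim :: "('a, 'n::finite) atlas \<Rightarrow> 'a set \<Rightarrow> 'a \<Rightarrow> nat" where
  "analytic_dim A V p = (LEAST d. \<exists>W (f :: nat \<Rightarrow> 'a \<Rightarrow> complex). openin (mtop A) W \<and> p \<in> W \<and>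
     (\<forall>i<d. holo_fun A W (f i)) \<and> {q \<in> V \<inter> W. \<forall>i<d. f i q = 0} = {p})"

definition codim_ge :: "nat \<Rightarrow> ('a, 'n::finite) atlas \<Rightarrow> 'a set \<Rightarrow> bool" where
  "codim_ge k A S \<longleftrightarrow> (\<forall>s\<in>S. \<exists>U V. openin (mtop A) U \<and> s \<in> U \<and> analytic_subvariety A U V \<and>
     (\<forall>p\<in>V. analytic_dim A V p + k \<le> CARD('n)) \<and> S \<inter> U \<subseteq> V)"


section \<open>Tangent vectors and the frame bundle\<close>

text \<open>
  A tangent vector at \<open>p\<close> is a derivation at \<open>p\<close> of the functions holomorphic near \<open>p\<close>, with value \<open>0\<close>
  on all other functions as a normalisation. Such a derivation depends only on germs: if \<open>f = g\<close> on a
  neighbourhood with indicator function \<open>h\<close>, apply the Leibniz rule to \<open>h * (f - g) = 0\<close>.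
  With this description the tangent space of an open submanifold is literally that of the manifold,
  see \<open>tangent_space_open_sub\<close>.
\<close>

type_synonym 'a tvec = "('a \<Rightarrow> complex) \<Rightarrow> complex"

definition tangent_space :: "('a, 'n::finite) atlas \<Rightarrow> 'a \<Rightarrow> 'a tvec set" where
  "tangent_space A p = {v.
     (\<forall>f. \<not> holo_near A p f \<longrightarrow> v f = 0) \<and>
     (\<forall>f g c. holo_near A p f \<longrightarrow> holo_near A p g \<longrightarrow>
        v (\<lambda>q. f q + g q) = v f + v g \<and>
        v (\<lambda>q. c * f q) = c * v f \<and>
        v (\<lambda>q. f q * g q) = f p * v g + g p * v f)}"

text \<open>Derivative in the direction \<open>x\<close> of a chart.\<close>

definition chart_vec ::
    "('a, 'n::finite) atlas \<Rightarrow> ('a, 'n) chart \<Rightarrow> complex^'n \<Rightarrow> 'a \<Rightarrow> 'a tvec" where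
  "chart_vec A = (\<lambda>(U, \<kappa>) x p f.
     if holo_near A p f then deriv (\<lambda>t. f (inv_into U \<kappa> (\<kappa> p + t *s x))) 0 else 0)"

definition pushforward ::
    "('b, 'm::finite) atlas \<Rightarrow> ('a \<Rightarrow> 'b) \<Rightarrow> 'a \<Rightarrow> 'a tvec \<Rightarrow> 'b tvec" where
  "pushforward B F p v = (\<lambda>f. if holo_near B (F p) f then v (\<lambda>q. f (F q)) else 0)"

text \<open>Complex linearity on a space of tangent vectors, with pointwise operations.\<close>

definition tlinear_on :: "'a tvec set \<Rightarrow> ('a tvec \<Rightarrow> complex) \<Rightarrow> bool" where
  "tlinear_on T \<alpha> \<longleftrightarrow> (\<forall>v\<in>T. \<forall>w\<in>T. \<forall>c.
     \<alpha> (\<lambda>f. v f + w f) = \<alpha> v + \<alpha> w \<and> \<alpha> (\<lambda>f. c * v f) = c * \<alpha> v)"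

type_synonym ('a, 'n) frame = "'a \<times> ('a tvec \<Rightarrow> complex^'n)"

definition frames :: "('a, 'n::finite) atlas \<Rightarrow> ('a, 'n) frame set" where
  "frames A = {(p, u). p \<in> points A \<and> u \<in> extensional (tangent_space A p) \<and>
     (\<forall>i. tlinear_on (tangent_space A p) (\<lambda>v. u v $ i)) \<and>
     bij_betw u (tangent_space A p) UNIV}"

text \<open>
  The frame bundle as a complex manifold: a chart of the base gives as coordinates of \<open>(p, u)\<close> the
  coordinates of \<open>p\<close> and the matrix entries of \<open>u\<close> in the coordinate basis at \<open>p\<close>.
\<close>

definition frame_bundle :: "('a, 'n::finite) atlas \<Rightarrow> (('a, 'n) frame, 'n + 'n \<times> 'n) atlas" where
  "frame_bundle A = {({(p, u) \<in> frames A. p \<in> U},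
     \<lambda>(p, u). \<chi> k. case k of
         Inl i \<Rightarrow> \<kappa> p $ i
       | Inr (i, j) \<Rightarrow> u (chart_vec A (U, \<kappa>) (axis j 1) p) $ i) | U \<kappa>. (U, \<kappa>) \<in> A}"

definition frame_act ::
    "('a, 'n::finite) atlas \<Rightarrow> complex^'n^'n \<Rightarrow> ('a, 'n) frame \<Rightarrow> ('a, 'n) frame" where
  "frame_act A k = (\<lambda>(p, u). (p, restrict (\<lambda>v. matrix_inv k *v u v) (tangent_space A p)))"


section \<open>Differential forms\<close>

type_synonym 'a one_form = "'a \<Rightarrow> 'a tvec \<Rightarrow> complex"
type_synonym 'a two_form = "'a \<Rightarrow> 'a tvec \<Rightarrow> 'a tvec \<Rightarrow> complex"

definition holo_one_form :: "('a, 'n::finite) atlas \<Rightarrow> 'a set \<Rightarrow> 'a one_form \<Rightarrow> bool" where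
  "holo_one_form A W \<alpha> \<longleftrightarrow> (\<forall>p\<in>W. tlinear_on (tangent_space A p) (\<alpha> p)) \<and>
     (\<forall>(U, \<kappa>)\<in>A. \<forall>i. holo_fun A (U \<inter> W) (\<lambda>q. \<alpha> q (chart_vec A (U, \<kappa>) (axis i 1) q)))"

definition wedge :: "'a one_form \<Rightarrow> 'a one_form \<Rightarrow> 'a two_form" where
  "wedge \<alpha> \<beta> p v w = \<alpha> p v * \<beta> p w - \<alpha> p w * \<beta> p v"

text \<open>
  Computed in an arbitrarily chosen chart around \<open>p\<close>; for holomorphic forms the result does not depend
  on the choice. Note that \<open>v (\<lambda>q. \<kappa> q $ i)\<close> is the \<open>i\<close>-th coordinate of \<open>v\<close>.
\<close>

definition ext_deriv :: "('a, 'n::finite) atlas \<Rightarrow> 'a one_form \<Rightarrow> 'a two_form" where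
  "ext_deriv A \<alpha> p v w =
     (let (U, \<kappa>) = (SOME c. c \<in> A \<and> p \<in> fst c);
          D = (\<lambda>i q. chart_vec A (U, \<kappa>) (axis i 1) q)
      in \<Sum>i\<in>UNIV. \<Sum>j\<in>UNIV. v (\<lambda>q. \<kappa> q $ i) * w (\<lambda>q. \<kappa> q $ j) *
           (D i p (\<lambda>q. \<alpha> q (D j q)) - D j p (\<lambda>q. \<alpha> q (D i q))))"


section \<open>The group \<open>G\<close>\<close>

definition G_mat :: "complex \<Rightarrow> complex \<Rightarrow> complex^3^3" where
  "G_mat g h = vector [vector [g\<^sup>2, 0, 0], vector [0, g, 0], vector [0, h, inverse g]]"

definition G_group :: "(complex^3^3) set" where
  "G_group = {G_mat g h | g h. g \<noteq> 0}"

text \<open>The complex Lie group structure: the entries \<open>g\<close> and \<open>h\<close> are global coordinates.\<close>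

definition G_atlas :: "(complex^3^3, 2) atlas" where
  "G_atlas = {(G_group, \<lambda>k. vector [k $ 2 $ 2, k $ 3 $ 2])}"

definition \<gg>_mat :: "complex \<Rightarrow> complex \<Rightarrow> complex^3^3" where
  "\<gg>_mat a b = vector [vector [2 * a, 0, 0], vector [0, a, 0], vector [0, b, - a]]"

primrec mat_power :: "complex^'n^'n \<Rightarrow> nat \<Rightarrow> complex^'n^'n" where
  "mat_power X 0 = mat 1"
| "mat_power X (Suc k) = X ** mat_power X k"

definition mat_exp :: "complex^'n^'n \<Rightarrow> complex^'n^'n" where
  "mat_exp X = (\<Sum>k. (1 / fact k) *\<^sub>R mat_power X k)"


section \<open>Holomorphic \<open>G\<close>-structures\<close>

text \<open>The total space has dimension \<open>3 + dim G = 5\<close>.\<close>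

record ('a, 'e) gstruct =
  total :: "('e, 5) atlas"
  proj :: "'e \<Rightarrow> 'a"
  act :: "'e \<Rightarrow> complex^3^3 \<Rightarrow> 'e"
  to_frame :: "'e \<Rightarrow> ('a, 3) frame"

definition principal_G_bundle :: "('a, 3) atlas \<Rightarrow> ('a, 'e) gstruct \<Rightarrow> bool" where
  "principal_G_bundle N E \<longleftrightarrow>
     complex_manifold (total E) \<and>
     holo_map (total E) N (proj E) \<and>
     holo_map (prod_atlas (total E) G_atlas) (total E) (\<lambda>(e, k). act E e k) \<and>
     (\<forall>e\<in>points (total E). act E e (mat 1) = e) \<and>
     (\<forall>e\<in>points (total E). \<forall>k\<in>G_group. \<forall>l\<in>G_group. act E e (k ** l) = act E (act E e k) l) \<and>
     (\<forall>e\<in>points (total E). \<forall>k\<in>G_group. proj E (act E e k) = proj E e) \<and>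
     (\<forall>m\<in>points N. \<exists>U \<psi>. openin (mtop N) U \<and> m \<in> U \<and>
        biholo (prod_atlas (open_sub N U) G_atlas) (open_sub (total E) (proj E -` U)) \<psi> \<and>
        (\<forall>p\<in>U. \<forall>k\<in>G_group. proj E (\<psi> (p, k)) = p \<and>
           (\<forall>l\<in>G_group. \<psi> (p, k ** l) = act E (\<psi> (p, k)) l)))"

definition G_structure :: "('a, 3) atlas \<Rightarrow> ('a, 'e) gstruct \<Rightarrow> bool" where
  "G_structure N E \<longleftrightarrow>
     principal_G_bundle N E \<and>
     holo_map (total E) (frame_bundle N) (to_frame E) \<and>
     (\<forall>e\<in>points (total E). fst (to_frame E e) = proj E e) \<and>
     (\<forall>e\<in>points (total E). \<forall>k\<in>G_group. to_frame E (act E e k) = frame_act N k (to_frame E e))"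

definition restrict_G :: "('a, 'e) gstruct \<Rightarrow> 'a set \<Rightarrow> ('a, 'e) gstruct" where
  "restrict_G E W = E\<lparr>total := open_sub (total E) (proj E -` W)\<rparr>"

definition G_isomorphic :: "('a, 'e) gstruct \<Rightarrow> ('a, 'f) gstruct \<Rightarrow> bool" where
  "G_isomorphic E F \<longleftrightarrow> (\<exists>\<Phi>. biholo (total E) (total F) \<Phi> \<and>
     (\<forall>e\<in>points (total E). proj F (\<Phi> e) = proj E e \<and> to_frame F (\<Phi> e) = to_frame E e \<and>
        (\<forall>k\<in>G_group. \<Phi> (act E e k) = act F (\<Phi> e) k)))"

definition soldering :: "('a, 3) atlas \<Rightarrow> ('a, 'e) gstruct \<Rightarrow> 'e \<Rightarrow> 'e tvec \<Rightarrow> complex^3" where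
  "soldering N E e v = snd (to_frame E e) (pushforward N (proj E) e v)"

text \<open>The vector field generating the right action of \<open>exp (t X)\<close>.\<close>

definition fundamental :: "('a, 'e) gstruct \<Rightarrow> complex^3^3 \<Rightarrow> 'e \<Rightarrow> 'e tvec" where
  "fundamental E X e = (\<lambda>f. if holo_near (total E) e f
     then deriv (\<lambda>t. f (act E e (mat_exp (\<chi> i. t *s X $ i)))) 0 else 0)"


section \<open>Scalar conservation laws\<close>

definition scalar_conservation_law :: "('a, 3) atlas \<Rightarrow> ('a, 'e) gstruct \<Rightarrow> bool" where
  "scalar_conservation_law N E \<longleftrightarrow>
     G_structure N E \<and>
     (\<forall>e\<^sub>0\<in>points (total E). \<exists>W \<phi> \<mu> K.
        openin (mtop (total E)) W \<and> e\<^sub>0 \<in> W \<and>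
        holo_one_form (total E) W \<phi> \<and> holo_one_form (total E) W \<mu> \<and> holo_fun (total E) W K \<and>
        (let \<Gamma> = (\<lambda>e v. \<gg>_mat (\<phi> e v) (\<mu> e v));
             \<omega> = (\<lambda>i e v. soldering N E e v $ i)
         in (\<forall>e\<in>W. \<forall>a b. \<Gamma> e (fundamental E (\<gg>_mat a b) e) = \<gg>_mat a b) \<and>
            (\<forall>e\<in>W. \<forall>v\<in>tangent_space (total E) e. \<forall>w\<in>tangent_space (total E) e.
               (\<chi> i. ext_deriv (total E) (\<omega> i) e v w) =
               - (\<chi> i. \<Sum>j\<in>UNIV. wedge (\<lambda>e v. \<Gamma> e v $ i $ j) (\<omega> j) e v w)
               + vector [K e * wedge (\<omega> 2) (\<omega> 3) e v w, wedge (\<omega> 1) (\<omega> 3) e v w, 0])))"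


section \<open>Tangent vectors of open submanifolds\<close>

lemma points_open_sub: "points (open_sub A W) = points A \<inter> W"
  by (auto simp: points_def open_sub_def)

lemma inv_into_chart_Int:
  assumes "inj_on \<kappa> U" "z \<in> \<kappa> ` (U \<inter> W)"
  shows "inv_into (U \<inter> W) \<kappa> z = inv_into U \<kappa> z"
proof -
  obtain q where q: "q \<in> U" "q \<in> W" "z = \<kappa> q"
    using assms(2) by auto
  have "inj_on \<kappa> (U \<inter> W)"
    using assms(1) inj_on_subset by blast
  then show ?thesis
    using q assms(1) by (simp add: inv_into_f_f)
qed

lemma holo_Cn_cong:
  assumes "open S" "\<And>z. z \<in> S \<Longrightarrow> f z = g z"
  shows "holo_Cn f S \<longleftrightarrow> holo_Cn g S"
proof -
  have "holo_Cn k S" if h: "holo_Cn h S" and eq: "\<And>z. z \<in> S \<Longrightarrow> h z = k z" for h k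
    unfolding holo_Cn_def
  proof
    fix x assume x: "x \<in> S"
    then obtain f' where f': "(h has_derivative f') (at x)" "\<forall>c v. f' (c *s v) = c * f' v"
      using h unfolding holo_Cn_def by blast
    have "(k has_derivative f') (at x)"
      using has_derivative_transform_within_open[OF f'(1) assms(1) x eq] by simp
    with f'(2) show "\<exists>f'. (k has_derivative f') (at x) \<and> (\<forall>c v. f' (c *s v) = c * f' v)"
      by blast
  qed
  from this[of f g] this[of g f] show ?thesis
    using assms(2) by auto
qed

lemma compatible_open_sub:
  assumes A: "compatible_charts A" and W: "openin (mtop A) W"
  shows "compatible_charts (open_sub A W)"
proof -
  have openI: "open (\<kappa> ` (U \<inter> W \<inter> (V \<inter> W)))" if "(U, \<kappa>) \<in> A" "(V, \<eta>) \<in> A" for U \<kappa> V \<eta>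
  proof -
    note i = compatible_chartsD(1)[OF A that] and o = compatible_chartsD(2)[OF A that]
    have "open (\<kappa> ` (W \<inter> U))"
      using W that unfolding openin_mtop[OF A] by auto
    moreover have "\<kappa> ` (U \<inter> W \<inter> (V \<inter> W)) = \<kappa> ` ((U \<inter> V) \<inter> (W \<inter> U))"
      by (rule arg_cong[where f = "image \<kappa>"]) auto
    moreover have "\<kappa> ` ((U \<inter> V) \<inter> (W \<inter> U)) = \<kappa> ` (U \<inter> V) \<inter> \<kappa> ` (W \<inter> U)"
      by (rule inj_on_image_Int[OF i]) auto
    ultimately show ?thesis
      using o by auto
  qed
  have "holo_Cn (\<lambda>z. \<eta> (inv_into (U \<inter> W) \<kappa> z) $ i) (\<kappa> ` (U \<inter> W \<inter> (V \<inter> W)))"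
    if UV: "(U, \<kappa>) \<in> A" "(V, \<eta>) \<in> A" for U \<kappa> V \<eta> i
  proof -
    note inj = compatible_chartsD(1)[OF A UV]
    from compatible_chartsD(3)[OF A UV, of i]
    have "holo_Cn (\<lambda>z. \<eta> (inv_into U \<kappa> z) $ i) (\<kappa> ` (U \<inter> W \<inter> (V \<inter> W)))"
      unfolding holo_Cn_def by blast
    then show ?thesis
      by (subst holo_Cn_cong[OF openI[OF UV], where g = "\<lambda>z. \<eta> (inv_into U \<kappa> z) $ i"])
         (auto simp: inv_into_chart_Int[OF inj])
  qed
  moreover have "inj_on \<kappa> (U \<inter> W)" if "(U, \<kappa>) \<in> A" for U \<kappa>
  proof (rule inj_on_subset)
    show "inj_on \<kappa> U"
      by (rule compatible_chartsD(1)[OF A that that])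
  qed auto
  ultimately show ?thesis
    using openI unfolding compatible_charts_def open_sub_def by auto
qed

lemma openin_open_sub:
  assumes A: "compatible_charts A" and W: "openin (mtop A) W"
  shows "openin (mtop (open_sub A W)) V \<longleftrightarrow> openin (mtop A) V \<and> V \<subseteq> W"
proof -
  have "V \<subseteq> W \<Longrightarrow> V \<inter> (U \<inter> W) = V \<inter> U" for U
    by auto
  then show ?thesis
    unfolding openin_mtop[OF A] openin_mtop[OF compatible_open_sub[OF A W]] points_open_sub
    by (auto simp: open_sub_def split_beta)
qed

lemma holo_fun_open_sub:
  assumes A: "compatible_charts A" and W: "openin (mtop A) W"
    and V: "openin (mtop A) V" "V \<subseteq> W"
  shows "holo_fun (open_sub A W) V f \<longleftrightarrow> holo_fun A V f"
proof -
  have "holo_Cn (\<lambda>z. f (inv_into (U \<inter> W) \<kappa> z)) (\<kappa> ` (U \<inter> W \<inter> V)) \<longleftrightarrow>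
        holo_Cn (\<lambda>z. f (inv_into U \<kappa> z)) (\<kappa> ` (U \<inter> V))" if U: "(U, \<kappa>) \<in> A" for U \<kappa>
  proof -
    note inj = compatible_chartsD(1)[OF A U U]
    have eq: "U \<inter> W \<inter> V = U \<inter> V"
      using V(2) by auto
    have "open (\<kappa> ` (V \<inter> U))"
      using V(1) U unfolding openin_mtop[OF A] by auto
    then have "open (\<kappa> ` (U \<inter> V))"
      by (simp add: Int_commute)
    moreover have "f (inv_into (U \<inter> W) \<kappa> z) = f (inv_into U \<kappa> z)" if "z \<in> \<kappa> ` (U \<inter> V)" for z
      using inv_into_chart_Int[OF inj, of z W] that V(2) by auto
    ultimately show ?thesis
      unfolding eq by (rule holo_Cn_cong)
  qed
  then show ?thesis
    unfolding holo_fun_def open_sub_def by (auto simp: split_beta)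
qed

lemma tangent_space_open_sub:
  assumes A: "compatible_charts A" and W: "openin (mtop A) W" and p: "p \<in> W"
  shows "tangent_space (open_sub A W) p = tangent_space A p"
proof -
  have "holo_near (open_sub A W) p f \<longleftrightarrow> holo_near A p f" for f
  proof
    assume "holo_near (open_sub A W) p f"
    then show "holo_near A p f"
      unfolding holo_near_def openin_open_sub[OF A W] using holo_fun_open_sub[OF A W] by blast
  next
    assume "holo_near A p f"
    then obtain V where V: "openin (mtop A) V" "p \<in> V" "holo_fun A V f"
      unfolding holo_near_def by blast
    have VW: "openin (mtop A) (V \<inter> W)"
      using V(1) W by blast
    have "holo_fun A (V \<inter> W) f"
      unfolding holo_fun_def
    proof clarify
      fix U \<kappa> assume "(U, \<kappa>) \<in> A"
      then have "holo_Cn (\<lambda>z. f (inv_into U \<kappa> z)) (\<kappa> ` (U \<inter> V))"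
        using V(3) by (auto simp: holo_fun_def)
      then show "holo_Cn (\<lambda>z. f (inv_into U \<kappa> z)) (\<kappa> ` (U \<inter> (V \<inter> W)))"
        unfolding holo_Cn_def by blast
    qed
    then have "holo_fun (open_sub A W) (V \<inter> W) f"
      using holo_fun_open_sub[OF A W VW] by blast
    then show "holo_near (open_sub A W) p f"
      unfolding holo_near_def openin_open_sub[OF A W] using VW V(2) p by blast
  qed
  then show ?thesis
    unfolding tangent_space_def by simp
qed

end

theory Submission imports Defs "HOL-Complex_Analysis.Conformal_Mappings" begin

text \<open>
  The image of the structure in the frame bundle determines it, so it suffices to extend this set of
  frames across \<open>S\<close>. In a chart, the frames of determinant \<open>1\<close> in it form, off \<open>S\<close>, the local
  coframes \<open>m\<close> up to a sign \<open>\<epsilon>\<close> and a shear: \<open>m\<^sub>1\<close>, the products \<open>m\<^sub>2\<^sub>i m\<^sub>2\<^sub>j\<close>, the minors of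
  \<open>(m\<^sub>2, m\<^sub>3)\<close>, and also \<open>m\<^sub>2\<^sub>i \<partial>\<^sub>j m\<^sub>2\<^sub>k\<close> and \<open>(\<partial>\<^sub>j m\<^sub>2\<^sub>k)\<^sup>2\<close>, are therefore well defined
  holomorphic functions, and they extend by Hartogs' theorem. The second structure equation gives
  \<open>dm\<^sub>2 \<and> m\<^sub>2 = - m\<^sub>1 \<and> m\<^sub>2 \<and> m\<^sub>3\<close>, a linear relation with constant term \<open>-1\<close> between the functions
  \<open>m\<^sub>2\<^sub>i \<partial>\<^sub>j m\<^sub>2\<^sub>k\<close>, so that they do not all vanish at a point of \<open>S\<close>. As their squares are
  \<open>m\<^sub>2\<^sub>i\<^sup>2 (\<partial>\<^sub>j m\<^sub>2\<^sub>k)\<^sup>2\<close>, some \<open>m\<^sub>2\<^sub>i\<^sup>2\<close> is not zero there and has a holomorphic square root, and a coframe with determinant \<open>1\<close> can be recovered on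
  a full neighbourhood. The structure equations do not involve a choice of connection once they are
  written as \<open>adapted\<close>, and pass to \<open>S\<close> by continuity.

  Hartogs' theorem for \<open>S\<close> only needs that almost every complex line through a point of \<open>S\<close> meets the
  analytic set, which has dimension at most one, in that point alone.
\<close>

section \<open>Holomorphic functions of several variables\<close>

text \<open>Without the structure equations the extension fails. In coordinates x, y, z the rows m1
  = dz and m2 = x dy - y dx, with any local m3 such that m2 \<and> m3 = dx \<and> dy, define a
  G-structure off the line x = y = 0. The invariants all extend, but m2 vanishes on the line and no
  coframe of the structure exists there. This is the obstacle: the products of entries of the second
  row may extend by zero. What excludes it is the term
  \<open>\<omega>\<^sup>1 \<and> \<omega>\<^sup>3\<close> of the second equation, whose coefficient
  is the constant 1; this is why derivatives of the second row are extended as well. The sign is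
  never followed along paths off \<open>S\<close>: a square root of an extended function fixes it
  near the point in question.

  The connection forms are not extended at all. They are recomputed on \<open>M\<close> from the
  derivatives of the extended coframes (\<open>sol_a\<close>, \<open>sol_b\<close>,
  \<open>sol_K\<close>) and then transported along the fibres (\<open>phi\<close>,
  \<open>mu\<close>, \<open>KK\<close>).\<close>

definition holo_at :: "(complex^'n \<Rightarrow> complex) \<Rightarrow> complex^'n \<Rightarrow> bool" where
  "holo_at f z \<longleftrightarrow> (\<exists>f'. (f has_derivative f') (at z) \<and> (\<forall>c v. f' (c *s v) = c * f' v))"

text \<open>One-variable \<open>deriv\<close> along a coordinate line, so that Cauchy's formula for
  one variable applies to it directly.\<close>

definition pd :: "'n \<Rightarrow> (complex^'n \<Rightarrow> complex) \<Rightarrow> complex^'n \<Rightarrow> complex" where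
  "pd i f z = deriv (\<lambda>t. f (z + t *s axis i 1)) 0"

lemma holo_Cn_iff: "holo_Cn f S \<longleftrightarrow> (\<forall>z\<in>S. holo_at f z)"
  by (simp add: holo_Cn_def holo_at_def)

lemma bounded_linear_smult: "bounded_linear (\<lambda>t::complex. t *s (v::complex^'n))"
  unfolding linear_conv_bounded_linear[symmetric]
  by (rule linearI) (simp_all add: vec_eq_iff algebra_simps)

lemma norm_smult_axis: "norm (u *s axis i (1::complex) :: complex^'n) = cmod u"
proof -
  have "u *s axis i (1::complex) = (axis i u :: complex^'n)"
    by (simp add: vec_eq_iff axis_def)
  then show ?thesis by (simp add: norm_eq_sqrt_inner inner_axis_axis)
qed

lemma vec_expand: "(v::complex^'n) = (\<Sum>i\<in>UNIV. v $ i *s axis i 1)"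
  by (simp add: vec_eq_iff axis_def if_distrib cong: if_cong)

lemma holo_line_strong:
  fixes f :: "complex^'n \<Rightarrow> complex"
  assumes "(f has_derivative f') (at (z + t *s v))" "\<And>c v. f' (c *s v) = c * f' v"
  shows "((\<lambda>t. f (z + t *s v)) has_field_derivative f' v) (at t)"
proof -
  have "((\<lambda>t. z + t *s v) has_derivative (\<lambda>t. t *s v)) (at t)"
    by (rule has_derivative_eq_rhs[OF has_derivative_add[OF has_derivative_const
          bounded_linear_imp_has_derivative[OF bounded_linear_smult]]]) simp
  from diff_chain_at[OF this assms(1)]
  have "((\<lambda>t. f (z + t *s v)) has_derivative f' \<circ> (\<lambda>t. t *s v)) (at t)" by (simp only: comp_def)
  moreover have "f' \<circ> (\<lambda>t. t *s v) = (*) (f' v)"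
    by (rule ext) (simp add: assms(2))
  ultimately show ?thesis
    unfolding has_field_derivative_def by simp
qed

lemma holo_at_deriv:
  assumes "holo_at f z"
  shows "(f has_derivative (\<lambda>v. \<Sum>i\<in>UNIV. v $ i * pd i f z)) (at z)"
proof -
  obtain f' where f': "(f has_derivative f') (at z)" "\<And>c v. f' (c *s v) = c * f' v"
    using assms unfolding holo_at_def by blast
  have pd: "pd i f z = f' (axis i 1)" for i
    unfolding pd_def by (rule DERIV_imp_deriv, rule holo_line_strong) (use f' in auto)
  interpret bounded_linear f' using f'(1) by (rule has_derivative_bounded_linear)
  have "f' v = (\<Sum>i\<in>UNIV. v $ i * pd i f z)" for v
    by (subst vec_expand[of v], simp add: sum f'(2) pd)
  then have "f' = (\<lambda>v. \<Sum>i\<in>UNIV. v $ i * pd i f z)" by blast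
  with f'(1) show ?thesis by simp
qed

text \<open>A complex linear derivative written in coordinates has the partial derivatives as its
  coefficients. Together with \<open>holo_at_deriv\<close> this turns each rule for Frechet
  derivatives into a rule for \<open>pd\<close>.\<close>

lemma holo_atI:
  assumes "(f has_derivative (\<lambda>v. \<Sum>i\<in>UNIV. v $ i * a i)) (at z)"
  shows "holo_at f z" "pd i f z = a i"
proof -
  show "holo_at f z"
    unfolding holo_at_def using assms by (intro exI conjI, assumption) (simp add: sum_distrib_left mult.assoc)
  have "((\<lambda>t. f (z + t *s axis i 1)) has_field_derivative (\<Sum>j\<in>UNIV. axis i 1 $ j * a j)) (at 0)"
    by (rule holo_line_strong) (use assms in \<open>auto simp: sum_distrib_left mult.assoc\<close>)
  moreover have "(\<Sum>j\<in>UNIV. axis i 1 $ j * a j) = a i"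
    by (simp add: axis_def if_distrib if_distribR cong: if_cong)
  ultimately show "pd i f z = a i"
    unfolding pd_def by (simp add: DERIV_imp_deriv)
qed

lemma holo_line:
  assumes "holo_at f (z + t *s v)"
  shows "((\<lambda>t. f (z + t *s v)) has_field_derivative (\<Sum>i\<in>UNIV. v $ i * pd i f (z + t *s v))) (at t)"
  by (rule holo_line_strong[OF holo_at_deriv[OF assms]]) (simp add: sum_distrib_left mult.assoc)

lemma holo_at_isCont: "holo_at f z \<Longrightarrow> isCont f z"
  using holo_at_deriv has_derivative_continuous by blast

lemma holo_at_continuous_on: "(\<And>z. z \<in> S \<Longrightarrow> holo_at f z) \<Longrightarrow> continuous_on S f"
  by (simp add: continuous_at_imp_continuous_on holo_at_isCont)

lemma holo_at_cong:
  assumes "holo_at f z" "eventually (\<lambda>w. f w = g w) (nhds z)"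
  shows "holo_at g z" "pd i g z = pd i f z"
proof -
  have z: "f z = g z" using assms(2) eventually_nhds_x_imp_x by force
  have ev: "eventually (\<lambda>w. f w = g w) (at z)" using assms(2) by (simp add: eventually_at_filter eventually_mono)
  have "(g has_derivative (\<lambda>v. \<Sum>i\<in>UNIV. v $ i * pd i f z)) (at z)"
    by (rule has_derivative_transform_eventually[OF holo_at_deriv[OF assms(1)] ev z]) auto
  from holo_atI[OF this] show "holo_at g z" "pd i g z = pd i f z" by auto
qed

lemma holo_at_const: "holo_at (\<lambda>z. c) z" and pd_const: "pd i (\<lambda>z. c) z = 0"
proof -
  have "((\<lambda>z. c) has_derivative (\<lambda>v. \<Sum>i\<in>UNIV. v $ i * 0)) (at z)" by simp
  from holo_atI[OF this] show "holo_at (\<lambda>z. c) z" "pd i (\<lambda>z. c) z = 0" by auto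
qed

lemma holo_at_coord: "holo_at (\<lambda>z. z $ j) z" and pd_coord: "pd i (\<lambda>z. z $ j) z = (if i = j then 1 else 0)"
proof -
  have "((\<lambda>z::complex^'a. z $ j) has_derivative (\<lambda>v. \<Sum>i\<in>UNIV. v $ i * (if i = j then 1 else 0))) (at z)"
    by (simp add: if_distrib cong: if_cong) (rule bounded_linear_imp_has_derivative[OF bounded_linear_vec_nth])
  from holo_atI[OF this] show "holo_at (\<lambda>z. z $ j) z" "pd i (\<lambda>z. z $ j) z = (if i = j then 1 else 0)" by auto
qed

lemma holo_at_add: "holo_at (\<lambda>z. f z + g z) z"
  and pd_add: "pd i (\<lambda>z. f z + g z) z = pd i f z + pd i g z" if "holo_at f z" "holo_at g z"
proof -
  have "((\<lambda>z. f z + g z) has_derivative (\<lambda>v. \<Sum>i\<in>UNIV. v $ i * (pd i f z + pd i g z))) (at z)"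
    using has_derivative_add[OF that[THEN holo_at_deriv]] by (simp add: sum.distrib distrib_left)
  from holo_atI[OF this] show "holo_at (\<lambda>z. f z + g z) z" "pd i (\<lambda>z. f z + g z) z = pd i f z + pd i g z" by auto
qed

lemma holo_at_mult: "holo_at (\<lambda>z. f z * g z) z"
  and pd_mult: "pd i (\<lambda>z. f z * g z) z = f z * pd i g z + g z * pd i f z" if "holo_at f z" "holo_at g z"
proof -
  have "((\<lambda>z. f z * g z) has_derivative (\<lambda>v. \<Sum>i\<in>UNIV. v $ i * (f z * pd i g z + g z * pd i f z))) (at z)"
    using has_derivative_mult[OF that[THEN holo_at_deriv]]
    by (simp add: sum.distrib algebra_simps sum_distrib_left sum_distrib_right)
  from holo_atI[OF this] show "holo_at (\<lambda>z. f z * g z) z"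
    "pd i (\<lambda>z. f z * g z) z = f z * pd i g z + g z * pd i f z" by auto
qed

lemma holo_at_diff: "holo_at (\<lambda>z. f z - g z) z" if "holo_at f z" "holo_at g z"
proof -
  have "((\<lambda>z. f z - g z) has_derivative (\<lambda>v. \<Sum>i\<in>UNIV. v $ i * (pd i f z - pd i g z))) (at z)"
    using has_derivative_diff[OF that[THEN holo_at_deriv]] by (simp add: sum_subtractf right_diff_distrib)
  then show ?thesis by (rule holo_atI)
qed

lemma holo_at_outer:
  assumes "holo_at f z" "\<phi> field_differentiable (at (f z))"
  shows "holo_at (\<lambda>z. \<phi> (f z)) z"
proof -
  obtain d where "(\<phi> has_field_derivative d) (at (f z))"
    using assms(2) field_differentiable_def by blast
  then have "(\<phi> has_derivative (\<lambda>t. d * t)) (at (f z))" by (simp add: has_field_derivative_def)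
  from diff_chain_at[OF holo_at_deriv[OF assms(1)] this]
  have "((\<lambda>z. \<phi> (f z)) has_derivative (\<lambda>v. \<Sum>i\<in>UNIV. v $ i * (d * pd i f z))) (at z)"
    by (simp add: comp_def sum_distrib_left mult.left_commute)
  then show ?thesis by (rule holo_atI)
qed

lemma holo_at_inverse: "holo_at f z \<Longrightarrow> f z \<noteq> 0 \<Longrightarrow> holo_at (\<lambda>z. inverse (f z)) z"
  by (rule holo_at_outer) (auto intro!: derivative_intros)

lemma has_derivative_components:
  fixes F :: "complex^'m \<Rightarrow> complex^'n"
  assumes "\<And>k. holo_at (\<lambda>z. F z $ k) z"
  shows "(F has_derivative (\<lambda>v. \<chi> k. \<Sum>i\<in>UNIV. v $ i * pd i (\<lambda>z. F z $ k) z)) (at z)"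
proof (subst has_derivative_componentwise_within, intro ballI)
  fix b :: "complex^'n" assume "b \<in> Basis"
  then obtain k u where b: "b = axis k u" by (auto simp: Basis_vec_def)
  have "((\<lambda>z. F z $ k \<bullet> u) has_derivative (\<lambda>v. (\<Sum>i\<in>UNIV. v $ i * pd i (\<lambda>z. F z $ k) z) \<bullet> u)) (at z)"
    by (rule bounded_linear.has_derivative[OF bounded_linear_inner_left holo_at_deriv[OF assms]])
  then show "((\<lambda>x. F x \<bullet> b) has_derivative
      (\<lambda>x. (\<chi> k. \<Sum>i\<in>UNIV. x $ i * pd i (\<lambda>z. F z $ k) z) \<bullet> b)) (at z)"
    unfolding b by (simp add: inner_axis)
qed

lemma holo_at_compose:
  fixes F :: "complex^'m \<Rightarrow> complex^'n"
  assumes "\<And>k. holo_at (\<lambda>z. F z $ k) z" "holo_at f (F z)"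
  shows "holo_at (\<lambda>z. f (F z)) z"
proof -
  have eq: "(\<lambda>v. \<Sum>i\<in>UNIV. v $ i * pd i f (F z)) \<circ> (\<lambda>v. \<chi> k. \<Sum>i\<in>UNIV. v $ i * pd i (\<lambda>z. F z $ k) z) =
     (\<lambda>v. \<Sum>i\<in>UNIV. v $ i * (\<Sum>k\<in>UNIV. pd k f (F z) * pd i (\<lambda>z. F z $ k) z))"
    by (rule ext) (simp add: sum_distrib_left sum_distrib_right, subst sum.swap, simp add: mult_ac)
  from diff_chain_at[OF has_derivative_components[OF assms(1)] holo_at_deriv[OF assms(2)], unfolded eq]
  have "((\<lambda>z. f (F z)) has_derivative
     (\<lambda>v. \<Sum>i\<in>UNIV. v $ i * (\<Sum>k\<in>UNIV. pd k f (F z) * pd i (\<lambda>z. F z $ k) z))) (at z)"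
    by (simp only: comp_def)
  then show ?thesis by (rule holo_atI)
qed

lemma continuous_on_locally:
  assumes "\<And>x. x \<in> S \<Longrightarrow> \<exists>T. open T \<and> x \<in> T \<and> continuous_on (S \<inter> T) f"
  shows "continuous_on S f"
  unfolding continuous_on_topological
proof (intro ballI allI impI)
  fix x B assume x: "x \<in> S" and B: "open B" "f x \<in> B"
  obtain T where T: "open T" "x \<in> T" "continuous_on (S \<inter> T) f" using assms[OF x] by blast
  then obtain A where "open A" "x \<in> A" "\<forall>y\<in>S \<inter> T. y \<in> A \<longrightarrow> f y \<in> B"
    using x B unfolding continuous_on_topological by (metis IntI)
  then show "\<exists>A. open A \<and> x \<in> A \<and> (\<forall>y\<in>S. y \<in> A \<longrightarrow> f y \<in> B)"
    using T by (intro exI[of _ "A \<inter> T"]) auto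
qed

section \<open>Cauchy integrals over circles and their dependence on parameters\<close>

definition circ :: "real \<Rightarrow> real \<Rightarrow> complex" where
  "circ r s = of_real r * exp (2 * of_real pi * \<i> * of_real s)"

lemma norm_circ: "0 \<le> r \<Longrightarrow> norm (circ r s) = r"
  by (simp add: circ_def norm_mult)

lemma circ_nz: "0 < r \<Longrightarrow> circ r s \<noteq> 0"
  by (simp add: circ_def)

lemma continuous_on_circ: "continuous_on S (circ r)"
  unfolding circ_def[abs_def] by (intro continuous_intros)

lemma continuous_on_circ_comp[continuous_intros]: "continuous_on S f \<Longrightarrow> continuous_on S (\<lambda>x. circ r (f x))"
  using continuous_on_compose2[OF continuous_on_circ, of S f UNIV] by auto

lemma contour_integral_circlepath_circ:
  "contour_integral (circlepath z r) f = 2 * of_real pi * \<i> * integral {0..1} (\<lambda>s. f (z + circ r s) * circ r s)"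
proof -
  have "contour_integral (circlepath z r) f =
     integral {0..1} (\<lambda>s. (2 * of_real pi * \<i>) * (f (z + circ r s) * circ r s))"
    unfolding contour_integral_integral
    by (rule integral_cong) (simp add: vector_derivative_circlepath, simp add: circlepath circ_def)
  then show ?thesis by simp
qed

lemma continuous_on_smult[continuous_intros]:
  fixes F :: "'b::topological_space \<Rightarrow> complex^'n"
  assumes "continuous_on S c" "continuous_on S F"
  shows "continuous_on S (\<lambda>x. c x *s F x)"
  unfolding vector_scalar_mult_def
  by (intro continuous_intros continuous_on_vec_lambda assms)

text \<open>The derivative becomes an integral of \<open>f\<close> alone, so its regularity in
  \<open>z\<close> follows from that of \<open>f\<close>. On the circle du = 2 pi i u ds, which
  cancels the constant and one of the two powers of u in the denominator.\<close>

lemma pd_Cauchy: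
  assumes r: "0 < r" and h: "\<And>w. w \<in> cball z r \<Longrightarrow> holo_at f w"
  shows "pd i f z = integral (cbox 0 1) (\<lambda>s. f (z + circ r s *s axis i 1) / circ r s)"
proof -
  let ?g = "\<lambda>t. f (z + t *s axis i 1)"
  have d: "?g field_differentiable (at t)" if "t \<in> cball 0 r" for t
    using holo_line[of f z t "axis i 1"] h[of "z + t *s axis i 1"] that norm_smult_axis[of t i]
    unfolding field_differentiable_def by (auto simp: dist_norm)
  have c: "continuous_on (cball 0 r) ?g"
    using d by (meson continuous_at_imp_continuous_on field_differentiable_imp_continuous_at)
  have ho: "?g holomorphic_on ball 0 r"
    using d by (auto simp: holomorphic_on_def field_differentiable_at_within)
  have "(?g has_field_derivative (1 / (2 * of_real pi * \<i>) * contour_integral(circlepath 0 r) (\<lambda>u. ?g u / (u-0)^2))) (at 0)"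
    by (rule Cauchy_derivative_integral_circlepath[OF c ho]) (use r in auto)
  then have "pd i f z = 1 / (2 * of_real pi * \<i>) * contour_integral(circlepath 0 r) (\<lambda>u. ?g u / (u-0)^2)"
    unfolding pd_def by (rule DERIV_imp_deriv)
  also have "\<dots> = integral (cbox 0 1) (\<lambda>s. f (z + circ r s *s axis i 1) / circ r s)"
    unfolding contour_integral_circlepath_circ using circ_nz[OF r]
    by (simp add: power2_eq_square)
  finally show ?thesis .
qed

lemma continuous_on_pd_param:
  fixes g :: "complex^'n \<Rightarrow> 'b::topological_space \<Rightarrow> complex"
  assumes U: "open U" and c: "continuous_on (U \<times> K) (\<lambda>(z, t). g z t)"
    and h: "\<And>z t. z \<in> U \<Longrightarrow> t \<in> K \<Longrightarrow> holo_at (\<lambda>z. g z t) z"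
  shows "continuous_on (U \<times> K) (\<lambda>(z, t). pd i (\<lambda>z. g z t) z)"
proof (rule continuous_on_locally)
  fix x assume "x \<in> U \<times> K"
  then obtain z0 t0 where x: "x = (z0, t0)" "z0 \<in> U" "t0 \<in> K" by auto
  obtain r' where r': "r' > 0" "cball z0 r' \<subseteq> U" using U x(2) open_contains_cball by blast
  \<comment> \<open>Half the radius: for a centre within \<open>r\<close> of \<open>z0\<close> the
    circle of radius \<open>r\<close> still lies in \<open>U\<close>.\<close>
  define r where "r = r' / 2"
  have r: "r > 0" using r' by (simp add: r_def)
  have sub: "cball z r \<subseteq> U" if "z \<in> ball z0 r" for z
  proof
    fix w assume "w \<in> cball z r"
    then have "dist z0 w \<le> r'" using that dist_triangle[of z0 w z] unfolding r_def by (simp add: dist_commute)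
    then show "w \<in> U" using r' by auto
  qed
  have in1: "z + circ r s *s axis i 1 \<in> U" if "z \<in> ball z0 r" for z s
    using sub[OF that] norm_circ[of r s] r by (intro subsetD[OF sub[OF that]]) (simp add: dist_norm norm_smult_axis)
  have "continuous_on ((ball z0 r \<times> K) \<times> cbox 0 1) (\<lambda>p. (\<lambda>(z, t). g z t)
       (fst (fst p) + circ r (snd p) *s axis i 1, snd (fst p)) / circ r (snd p))"
    by (intro continuous_intros continuous_on_compose2[OF c]) (use in1 circ_nz[OF r] in auto)
  then have "continuous_on ((ball z0 r \<times> K) \<times> cbox 0 1)
     (\<lambda>(p, s). g (fst p + circ r s *s axis i 1) (snd p) / circ r s)"
    by (simp add: split_beta)
  from integral_continuous_on_param[OF this]
  have "continuous_on (ball z0 r \<times> K) (\<lambda>p. integral (cbox 0 1) (\<lambda>s. g (fst p + circ r s *s axis i 1) (snd p) / circ r s))" .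
  then have "continuous_on (ball z0 r \<times> K) (\<lambda>(z, t). pd i (\<lambda>z. g z t) z)"
  proof (rule continuous_on_eq)
    fix p assume p: "p \<in> ball z0 r \<times> K"
    then have "pd i (\<lambda>z. g z (snd p)) (fst p) = integral (cbox 0 1) (\<lambda>s. g (fst p + circ r s *s axis i 1) (snd p) / circ r s)"
      by (intro pd_Cauchy[OF r] h subsetD[OF sub]) auto
    then show "integral (cbox 0 1) (\<lambda>s. g (fst p + circ r s *s axis i 1) (snd p) / circ r s) =
      (case p of (z, t) \<Rightarrow> pd i (\<lambda>z. g z t) z)" by (simp add: split_beta)
  qed
  then have "continuous_on (U \<times> K \<inter> ball z0 r \<times> UNIV) (\<lambda>(z, t). pd i (\<lambda>z. g z t) z)"
    by (rule continuous_on_subset) auto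
  then show "\<exists>T. open T \<and> x \<in> T \<and> continuous_on (U \<times> K \<inter> T) (\<lambda>(z, t). pd i (\<lambda>z. g z t) z)"
    using x r by (intro exI[of _ "ball z0 r \<times> UNIV"]) (auto intro: open_Times)
qed

text \<open>Differentiation under the integral sign needs the derivative to be jointly continuous.
  \<open>continuous_on_pd_param\<close> supplies this from joint continuity of \<open>g\<close>
  itself.\<close>

lemma
  fixes g :: "complex^'n \<Rightarrow> real \<Rightarrow> complex"
  assumes U: "open U" and c: "continuous_on (U \<times> cbox 0 1) (\<lambda>(z, t). g z t)"
    and h: "\<And>z t. z \<in> U \<Longrightarrow> t \<in> cbox 0 1 \<Longrightarrow> holo_at (\<lambda>z. g z t) z" and z0: "z0 \<in> U"
  shows holo_at_param_integral: "holo_at (\<lambda>z. integral (cbox 0 1) (g z)) z0"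
    and pd_param_integral: "pd i (\<lambda>z. integral (cbox 0 1) (g z)) z0 = integral (cbox 0 1) (\<lambda>t. pd i (\<lambda>z. g z t) z0)"
proof -
  obtain r where r: "r > 0" "ball z0 r \<subseteq> U" using U z0 open_contains_ball by blast
  let ?B = "ball z0 r"
  \<comment> \<open>\<open>leibniz_rule\<close> takes the derivative as a continuous family of
    bounded linear maps; \<open>fx z t\<close> is the map with the coefficients
    \<open>pd i\<close>.\<close>
  define fx :: "complex^'n \<Rightarrow> real \<Rightarrow> (complex^'n) \<Rightarrow>\<^sub>L complex" where
    "fx z t = (\<Sum>i\<in>UNIV. blinfun_mult_right (pd i (\<lambda>z. g z t) z) o\<^sub>L Blinfun (\<lambda>v. v $ i))" for z t
  have ap: "blinfun_apply (fx z t) v = (\<Sum>i\<in>UNIV. v $ i * pd i (\<lambda>z. g z t) z)" for z t v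
    by (simp add: fx_def blinfun.sum_left bounded_linear_Blinfun_apply bounded_linear_vec_nth mult.commute)
  have cpd: "continuous_on (U \<times> cbox 0 1) (\<lambda>x. pd i (\<lambda>z. g z (snd x)) (fst x))" for i
    using continuous_on_pd_param[OF U c h, of i] by (simp add: split_beta)
  have cfx: "continuous_on (U \<times> cbox 0 1) (\<lambda>(z, t). fx z t)"
    unfolding fx_def split_beta
    by (intro continuous_intros bounded_linear.continuous_on[OF bounded_linear_blinfun_mult_right]
        bounded_bilinear.continuous_on[OF bounded_bilinear_blinfun_compose] cpd)
  have slice: "continuous_on (cbox 0 1) (\<lambda>t. f z t)" if "continuous_on (U \<times> cbox 0 1) (\<lambda>(z, t). f z t)" "z \<in> U"
    for f :: "complex^'n \<Rightarrow> real \<Rightarrow> 'x::topological_space" and z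
    using continuous_on_compose2[OF that(1), of "cbox 0 1" "\<lambda>t. (z, t)"] that(2)
    by (simp add: continuous_on_Pair image_subset_iff)
  have "((\<lambda>x. integral (cbox 0 1) (g x)) has_derivative integral (cbox 0 1) (fx z0)) (at z0 within ?B)"
  proof (rule leibniz_rule)
    fix x t assume "x \<in> ?B" "t \<in> cbox (0::real) 1"
    then show "((\<lambda>x. g x t) has_derivative blinfun_apply (fx x t)) (at x within ?B)"
      using holo_at_deriv[OF h[OF subsetD[OF r(2)]], of x t]
      by (simp add: ap[abs_def] has_derivative_at_withinI)
  next
    fix x assume "x \<in> ?B"
    then show "g x integrable_on cbox 0 1"
      using r by (intro integrable_continuous slice[OF c]) auto
  next
    show "continuous_on (?B \<times> cbox 0 1) (\<lambda>(x, t). fx x t)"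
      by (rule continuous_on_subset[OF cfx]) (use r in auto)
  qed (use r in auto)
  then have D: "((\<lambda>x. integral (cbox 0 1) (g x)) has_derivative integral (cbox 0 1) (fx z0)) (at z0)"
    using r at_within_open[of z0 ?B] by auto
  have int: "(\<lambda>t. pd i (\<lambda>z. g z t) z0) integrable_on cbox 0 1" for i
    by (intro integrable_continuous slice[OF continuous_on_pd_param[OF U c h]] z0)
  have fxi: "fx z0 integrable_on cbox 0 1"
    by (intro integrable_continuous slice[OF cfx]) (use z0 in auto)
  have "blinfun_apply (integral (cbox 0 1) (fx z0)) v =
      (\<Sum>i\<in>UNIV. v $ i * integral (cbox 0 1) (\<lambda>t. pd i (\<lambda>z. g z t) z0))" for v
  proof -
    have "blinfun_apply (integral (cbox 0 1) (fx z0)) v = integral (cbox 0 1) (\<lambda>t. blinfun_apply (fx z0 t) v)"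
      using integral_linear[OF fxi, of "\<lambda>l. blinfun_apply l v"]
      by (simp add: blinfun.bounded_linear_left comp_def)
    also have "\<dots> = (\<Sum>i\<in>UNIV. v $ i * integral (cbox 0 1) (\<lambda>t. pd i (\<lambda>z. g z t) z0))"
      unfolding ap using int by (subst integral_sum) (auto intro!: integrable_on_mult_right)
    finally show ?thesis .
  qed
  then have "blinfun_apply (integral (cbox 0 1) (fx z0)) = (\<lambda>v. \<Sum>i\<in>UNIV. v $ i * integral (cbox 0 1) (\<lambda>t. pd i (\<lambda>z. g z t) z0))"
    by blast
  from holo_atI[OF D[unfolded this]]
  show "holo_at (\<lambda>z. integral (cbox 0 1) (g z)) z0"
    and "pd i (\<lambda>z. integral (cbox 0 1) (g z)) z0 = integral (cbox 0 1) (\<lambda>t. pd i (\<lambda>z. g z t) z0)" by auto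
qed

lemma pd_shift: "pd i (\<lambda>z. f (z + a)) z = pd i f (z + a)"
  by (simp add: pd_def add_ac)

lemma holo_at_shift: "holo_at f (z + a) \<Longrightarrow> holo_at (\<lambda>z. f (z + a)) z"
  by (rule holo_at_compose) (auto intro: holo_at_add holo_at_coord holo_at_const)

lemma holo_at_cmult: "holo_at f z \<Longrightarrow> holo_at (\<lambda>z. c * f z) z"
  and pd_cmult: "holo_at f z \<Longrightarrow> pd i (\<lambda>z. c * f z) z = c * pd i f z"
  using holo_at_mult[OF holo_at_const] pd_mult[OF holo_at_const] by (auto simp: pd_const)

text \<open>Cauchy's formula exhibits \<open>pd i f\<close> near \<open>z\<close> as a parameter
  integral of shifts of \<open>f\<close>. Differentiating under the integral shows that it is
  holomorphic again and computes its derivatives.\<close>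

lemma
  assumes cb: "cball z (2 * r) \<subseteq> S" and r: "0 < r" and h: "\<And>w. w \<in> S \<Longrightarrow> holo_at f w"
  shows holo_at_pd_aux: "holo_at (pd i f) z"
    and pd_pd_Cauchy: "pd j (pd i f) z = integral (cbox 0 1) (\<lambda>s. pd j f (z + circ r s *s axis i 1) / circ r s)"
proof -
  have sub: "cball w r \<subseteq> S" if "w \<in> ball z r" for w
  proof
    fix x assume "x \<in> cball w r"
    then have "dist z x \<le> 2 * r" using that dist_triangle[of z x w] by (simp add: dist_commute)
    then show "x \<in> S" using cb by auto
  qed
  have in1: "w + circ r s *s axis i 1 \<in> S" if "w \<in> ball z r" for w s
    using norm_circ[of r s] r by (intro subsetD[OF sub[OF that]]) (simp add: dist_norm norm_smult_axis)
  let ?g = "\<lambda>w s. f (w + circ r s *s axis i 1) / circ r s"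
  have cg: "continuous_on (ball z r \<times> cbox 0 1) (\<lambda>(w, s). ?g w s)"
    unfolding split_beta
    by (intro continuous_intros continuous_on_compose2[OF holo_at_continuous_on[OF h]])
      (use in1 circ_nz[OF r] in auto)
  have hg: "holo_at (\<lambda>w. ?g w s) w" "pd j (\<lambda>w. ?g w s) w = pd j f (w + circ r s *s axis i 1) / circ r s"
    if "w \<in> ball z r" for w s
  proof -
    note 1 = holo_at_shift[OF h[OF in1[OF that]], of s]
    show "holo_at (\<lambda>w. ?g w s) w"
      using holo_at_cmult[OF 1, of "inverse (circ r s)"] by (simp add: field_simps)
    show "pd j (\<lambda>w. ?g w s) w = pd j f (w + circ r s *s axis i 1) / circ r s"
      using pd_cmult[OF 1, of j "inverse (circ r s)"] by (simp add: field_simps pd_shift)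
  qed
  have eq: "eventually (\<lambda>w. integral (cbox 0 1) (?g w) = pd i f w) (nhds z)"
  proof (rule eventually_nhds_in_open[THEN eventually_mono])
    fix w assume "w \<in> ball z r"
    from subsetD[OF sub[OF this]] show "integral (cbox 0 1) (?g w) = pd i f w"
      by (intro pd_Cauchy[symmetric] r h)
  qed (use r in auto)
  have z0: "z \<in> ball z r" using r by simp
  have A: "holo_at (\<lambda>w. integral (cbox 0 1) (?g w)) z"
    by (rule holo_at_param_integral[OF _ cg hg(1) z0]) auto
  show "holo_at (pd i f) z"
    using holo_at_cong(1)[OF A eq] .
  have "pd j (pd i f) z = pd j (\<lambda>w. integral (cbox 0 1) (?g w)) z"
    by (rule holo_at_cong(2)[OF A eq])
  also have "\<dots> = integral (cbox 0 1) (\<lambda>s. pd j (\<lambda>w. ?g w s) z)"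
    by (rule pd_param_integral[OF _ cg hg(1) z0]) auto
  finally show "pd j (pd i f) z = integral (cbox 0 1) (\<lambda>s. pd j f (z + circ r s *s axis i 1) / circ r s)"
    using hg(2)[OF z0] by simp
qed

lemma
  assumes S: "open S" and h: "\<And>w. w \<in> S \<Longrightarrow> holo_at f w" and z: "z \<in> S"
  shows holo_at_pd: "holo_at (pd i f) z" and pd_commute: "pd j (pd i f) z = pd i (pd j f) z"
proof -
  have hp: "holo_at (pd k f) w" if w: "w \<in> S" for k w
  proof -
    obtain r where r: "r > 0" "cball w r \<subseteq> S" using S w open_contains_cball by blast
    then show ?thesis using holo_at_pd_aux[of w "r/2" S f] h by simp
  qed
  then show "holo_at (pd i f) z" using z .
  obtain r where r: "r > 0" "cball z r \<subseteq> S" using S z open_contains_cball by blast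
  \<comment> \<open>The Cauchy integral of \<open>pd i f\<close>, differentiated in direction
    \<open>j\<close>, is also the Cauchy integral for the \<open>i\<close>-th derivative of
    \<open>pd j f\<close>. This is the symmetry.\<close>
  have "pd j (pd i f) z = integral (cbox 0 1) (\<lambda>s. pd j f (z + circ (r/2) s *s axis i 1) / circ (r/2) s)"
    using pd_pd_Cauchy[of z "r/2" S f] r h by simp
  also have "\<dots> = pd i (pd j f) z"
  proof (rule pd_Cauchy[symmetric])
    fix w assume "w \<in> cball z (r/2)"
    then show "holo_at (pd j f) w" using r by (intro hp subsetD[OF r(2)]) auto
  qed (use r in auto)
  finally show "pd j (pd i f) z = pd i (pd j f) z" .
qed

text \<open>Integrate the derivative along the segment from \<open>p\<close> to \<open>z\<close>. In
  \<open>tangent_expand\<close> this writes a function as a constant plus products with one factor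
  vanishing at \<open>p\<close>, to which the Leibniz rule applies.\<close>

lemma Hadamard:
  assumes h: "\<And>z. z \<in> ball p r \<Longrightarrow> holo_at f z"
  obtains g where "\<And>i z. z \<in> ball p r \<Longrightarrow> holo_at (g i) z" "\<And>i. g i p = pd i f p"
    "\<And>z. z \<in> ball p r \<Longrightarrow> f z = f p + (\<Sum>i\<in>UNIV. (z $ i - p $ i) * g i z)"
proof
  let ?G = "\<lambda>i z t. pd i f (p + of_real t *s (z - p))"
  let ?g = "\<lambda>i z. integral (cbox 0 1) (?G i z)"
  have of_real_smult: "complex_of_real t *s x = t *\<^sub>R x" for t and x :: "complex^'a"
    unfolding vec_eq_iff vector_smult_component vector_scaleR_component by (simp add: scaleR_conv_of_real)
  have inb: "p + of_real t *s (z - p) \<in> ball p r" if "z \<in> ball p r" "t \<in> cbox 0 1" for z t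
  proof -
    have "norm (t *\<^sub>R (z - p)) \<le> norm (z - p)" using that(2) by (simp add: mult_left_le_one_le)
    then have "dist p (p + of_real t *s (z - p)) \<le> dist p z"
      by (simp only: of_real_smult dist_norm norm_minus_commute[of p] add_diff_cancel_left')
    then show ?thesis using that(1) by simp
  qed
  have hp: "holo_at (pd i f) z" if "z \<in> ball p r" for z i
    by (rule holo_at_pd[OF _ h that]) auto
  have cpd: "continuous_on (ball p r) (pd i f)" for i
    by (rule holo_at_continuous_on[OF hp])
  show "holo_at (?g i) z" if "z \<in> ball p r" for i z
  proof (rule holo_at_param_integral[OF _ _ _ that])
    show "continuous_on (ball p r \<times> cbox 0 1) (\<lambda>(z, t). ?G i z t)"
      unfolding split_beta
      by (intro continuous_on_compose2[OF cpd] continuous_intros) (use inb in auto)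
    show "holo_at (\<lambda>z. ?G i z t) w" if "w \<in> ball p r" "t \<in> cbox 0 1" for w t
    proof (rule holo_at_compose)
      show "holo_at (\<lambda>z. (p + of_real t *s (z - p)) $ k) w" for k
        by (simp only: vector_add_component vector_smult_component vector_minus_component)
          (intro holo_at_add holo_at_const holo_at_cmult holo_at_diff holo_at_coord)
    qed (rule hp[OF inb[OF that]])
  qed auto
  show "?g i p = pd i f p" for i by simp
  show "f z = f p + (\<Sum>i\<in>UNIV. (z $ i - p $ i) * ?g i z)" if z: "z \<in> ball p r" for z
  proof -
    have "((\<lambda>t. \<Sum>i\<in>UNIV. (z - p) $ i * pd i f (p + of_real t *s (z - p))) has_integral
       (f (p + of_real 1 *s (z - p)) - f (p + of_real 0 *s (z - p)))) {0..1}"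
    proof (rule fundamental_theorem_of_calculus)
      fix t :: real assume t: "t \<in> {0..1}"
      have "((\<lambda>t. f (p + t *s (z - p))) has_field_derivative
          (\<Sum>i\<in>UNIV. (z - p) $ i * pd i f (p + of_real t *s (z - p)))) (at (of_real t))"
        by (rule holo_line, rule h, rule inb) (use z t in auto)
      then show "((\<lambda>t. f (p + of_real t *s (z - p))) has_vector_derivative
          (\<Sum>i\<in>UNIV. (z - p) $ i * pd i f (p + of_real t *s (z - p)))) (at t within {0..1})"
        using has_vector_derivative_real_field has_vector_derivative_at_within by blast
    qed auto
    then have "f z - f p = integral (cbox 0 1) (\<lambda>t. \<Sum>i\<in>UNIV. (z - p) $ i * ?G i z t)"
      by (simp add: integral_unique of_real_smult)
    also have "\<dots> = (\<Sum>i\<in>UNIV. (z $ i - p $ i) * ?g i z)"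
    proof (subst integral_sum)
      have "continuous_on (cbox 0 1) (?G i z)" for i
        by (intro continuous_on_compose2[OF cpd] continuous_intros) (use inb[OF z] in auto)
      then show "(\<lambda>t. (z - p) $ i * ?G i z t) integrable_on cbox 0 1" for i
        by (intro integrable_on_mult_right integrable_continuous)
    qed auto
    finally show ?thesis by (simp add: algebra_simps)
  qed
qed

section \<open>Iterated partial derivatives and the identity theorem\<close>

text \<open>Words of directions instead of multi-indices: dropping the first letter undoes the last
  differentiation, which is what \<open>pdw_first_nonzero\<close> exploits, and there are only
  countably many words.\<close>

fun pdw :: "'n list \<Rightarrow> (complex^'n \<Rightarrow> complex) \<Rightarrow> complex^'n \<Rightarrow> complex" where
  "pdw [] f = f"
| "pdw (i # is) f = pd i (pdw is f)"

lemma holo_at_sum: "(\<And>i. i \<in> I \<Longrightarrow> holo_at (f i) z) \<Longrightarrow> holo_at (\<lambda>z. \<Sum>i\<in>I. f i z) z"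
  by (induction I rule: infinite_finite_induct) (auto intro: holo_at_add holo_at_const)

lemma pd_sum:
  assumes "\<And>i. i \<in> I \<Longrightarrow> holo_at (f i) z"
  shows "pd j (\<lambda>z. \<Sum>i\<in>I. f i z) z = (\<Sum>i\<in>I. pd j (f i) z)"
  using assms
proof (induction I rule: infinite_finite_induct)
  case (insert x F)
  then show ?case by (simp add: pd_add holo_at_sum)
qed (auto simp: pd_const)

lemma holo_at_pdw:
  assumes "open S" "\<And>w. w \<in> S \<Longrightarrow> holo_at f w" "z \<in> S"
  shows "holo_at (pdw ws f) z"
  using assms(3)
proof (induction ws arbitrary: z)
  case (Cons i ws)
  then show ?case using holo_at_pd[OF assms(1), of "pdw ws f"] by simp
qed (use assms in auto)

lemma pdw_append: "pdw (ws @ [i]) f = pdw ws (pd i f)"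
  by (induction ws) auto

lemma pd_cong_open:
  assumes "open S" "z \<in> S" "\<And>w. w \<in> S \<Longrightarrow> f w = g w" "holo_at f z"
  shows "pd i f z = pd i g z"
  using holo_at_cong(2)[OF assms(4), of g i] eventually_nhds_in_open[OF assms(1,2)] assms(3)
  by (metis (mono_tags, lifting) eventually_mono)

lemma pdw_sum:
  assumes S: "open S" and h: "\<And>i w. w \<in> S \<Longrightarrow> holo_at (f i) w" and z: "z \<in> S"
  shows "pdw ws (\<lambda>z. \<Sum>i\<in>I. c i * f i z) z = (\<Sum>i\<in>I. c i * pdw ws (f i) z)"
  using z
proof (induction ws arbitrary: z)
  case (Cons j ws)
  have H: "holo_at (pdw ws (f i)) w" if "w \<in> S" for i w using holo_at_pdw[OF S h that] .
  have "pdw (j # ws) (\<lambda>z. \<Sum>i\<in>I. c i * f i z) z = pd j (\<lambda>z. \<Sum>i\<in>I. c i * pdw ws (f i) z) z"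
  proof -
    have "holo_at (pdw ws (\<lambda>z. \<Sum>i\<in>I. c i * f i z)) z"
      by (rule holo_at_pdw[OF S _ Cons.prems]) (intro holo_at_sum holo_at_cmult h)
    then show ?thesis
      by (simp only: pdw.simps) (rule pd_cong_open[OF S Cons.prems Cons.IH])
  qed
  also have "\<dots> = (\<Sum>i\<in>I. c i * pd j (pdw ws (f i)) z)"
    by (subst pd_sum) (auto intro!: holo_at_cmult H Cons.prems simp: pd_cmult[OF H[OF Cons.prems]])
  finally show ?case by simp
qed auto

text \<open>The identity theorem on the line through \<open>q\<close> in direction \<open>v\<close>.
  Its Taylor coefficients at \<open>q\<close> are combinations of derivatives in the directions of
  \<open>I\<close>, because \<open>v\<close> has no other components.\<close>

lemma vanishing_on_slice:
  fixes q v :: "complex^'n"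
  assumes h: "\<And>z. z \<in> ball q r \<Longrightarrow> holo_at f z"
    and van: "\<And>ws. set ws \<subseteq> I \<Longrightarrow> pdw ws f q = 0"
    and v: "\<And>k. k \<notin> I \<Longrightarrow> v $ k = 0" "q + v \<in> ball q r"
  shows "f (q + v) = 0"
proof -
  let ?B = "ball q r"
  \<comment> \<open>Derivative in the constant direction \<open>v\<close>. The property
    \<open>P\<close> is inherited by \<open>Dv f\<close>, so all iterates of \<open>Dv\<close>
    vanish at \<open>q\<close>; these iterates are the derivatives along the line.\<close>
  define Dv where "Dv = (\<lambda>f::complex^'n \<Rightarrow> complex. \<lambda>z. \<Sum>i\<in>UNIV. v $ i * pd i f z)"
  define P where "P f \<longleftrightarrow> (\<forall>z\<in>?B. holo_at f z) \<and> (\<forall>ws. set ws \<subseteq> I \<longrightarrow> pdw ws f q = 0)" for f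
  have q: "q \<in> ?B" using v(2) by (metis dist_self mem_ball zero_le_dist le_less_trans centre_in_ball)
  have "P (Dv f)" if "P f" for f
    unfolding P_def
  proof (intro conjI ballI allI impI)
    have hf: "holo_at f z" if "z \<in> ?B" for z using \<open>P f\<close> that by (auto simp: P_def)
    have hp: "holo_at (pd i f) z" if "z \<in> ?B" for z i by (rule holo_at_pd[OF _ hf that]) auto
    show "holo_at (Dv f) z" if "z \<in> ?B" for z
      unfolding Dv_def by (intro holo_at_sum holo_at_cmult hp that)
    show "pdw ws (Dv f) q = 0" if ws: "set ws \<subseteq> I" for ws
    proof -
      have "pdw ws (Dv f) q = (\<Sum>i\<in>UNIV. v $ i * pdw ws (pd i f) q)"
        unfolding Dv_def by (rule pdw_sum[of ?B]) (use hp q in auto)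
      also have "\<dots> = 0"
      proof (intro sum.neutral ballI)
        fix i
        show "v $ i * pdw ws (pd i f) q = 0"
        proof (cases "i \<in> I")
          case True
          then have "set (ws @ [i]) \<subseteq> I" using ws by simp
          then have "pdw (ws @ [i]) f q = 0" using \<open>P f\<close> unfolding P_def by blast
          then show ?thesis by (simp add: pdw_append)
        qed (simp add: v)
      qed
      finally show ?thesis .
    qed
  qed
  then have Pn: "P ((Dv ^^ n) f)" for n
    by (induction n) (use h van in \<open>auto simp: P_def\<close>)
  \<comment> \<open>The disc of parameters must contain 1, the parameter of \<open>q + v\<close>.
    For \<open>v = 0\<close> any radius above 1 serves.\<close>
  define R where "R = (if v = 0 then 2 else r / norm v)"
  have R: "R > 1" using v(2) by (auto simp: R_def dist_norm)
  have inB: "q + t *s v \<in> ?B" if "t \<in> ball 0 R" for t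
  proof -
    have "norm (t *s v) = cmod t * norm v"
      by (simp add: norm_vec_def L2_set_def norm_mult power_mult_distrib flip: sum_distrib_left)
        (simp add: real_sqrt_mult)
    moreover have "cmod t * norm v < r"
      using that v(2) by (auto simp: R_def dist_norm field_simps split: if_splits)
    ultimately show ?thesis by (simp add: dist_norm)
  qed
  have dn: "((\<lambda>t. (Dv ^^ n) f (q + t *s v)) has_field_derivative (Dv ^^ Suc n) f (q + t *s v)) (at t)"
    if "t \<in> ball 0 R" for t n
    using holo_line[of "(Dv ^^ n) f" q t v] Pn[of n] inB[OF that] by (simp add: P_def Dv_def)
  have hd: "(deriv ^^ n) (\<lambda>t. f (q + t *s v)) t = (Dv ^^ n) f (q + t *s v)" if "t \<in> ball 0 R" for t n
    using that
  proof (induction n arbitrary: t)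
    case (Suc n)
    have "deriv ((deriv ^^ n) (\<lambda>t. f (q + t *s v))) t = deriv (\<lambda>t. (Dv ^^ n) f (q + t *s v)) t"
      by (rule deriv_cong_ev, rule eventually_nhds_in_open[THEN eventually_mono, of "ball 0 R"])
        (use Suc in auto)
    also have "\<dots> = (Dv ^^ Suc n) f (q + t *s v)" by (rule DERIV_imp_deriv[OF dn[OF Suc.prems]])
    finally show ?case by simp
  qed auto
  have "(\<lambda>t. f (q + t *s v)) holomorphic_on ball 0 R"
    unfolding holomorphic_on_open[OF open_ball]
  proof
    show "\<exists>f'. ((\<lambda>t. f (q + t *s v)) has_field_derivative f') (at t)" if "t \<in> ball 0 R" for t
      using dn[OF that, of 0] by (intro exI) simp
  qed
  moreover have "(deriv ^^ n) (\<lambda>t. f (q + t *s v)) 0 = 0" for n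
  proof -
    have "pdw [] ((Dv ^^ n) f) q = 0" using Pn[of n] unfolding P_def by (metis empty_set empty_subsetI)
    then show ?thesis using hd[of 0 n] R by simp
  qed
  ultimately have "f (q + 1 *s v) = 0"
    by (intro holomorphic_fun_eq_0_on_ball[of "\<lambda>t. f (q + t *s v)" 0 R 1]) (use R in auto)
  then show ?thesis by simp
qed

text \<open>Along the suffixes of the word, from \<open>f\<close> itself to the full derivative, the
  value at \<open>q\<close> changes from zero to non-zero at some letter. The derivative before that
  letter vanishes at \<open>q\<close> with non-zero differential, hence defines a smooth
  hypersurface there.\<close>

lemma pdw_first_nonzero:
  assumes "f q = 0" "pdw ws f q \<noteq> 0" "set ws \<subseteq> I"
  shows "\<exists>ws' i. set ws' \<subseteq> I \<and> i \<in> I \<and> pdw ws' f q = 0 \<and> pd i (pdw ws' f) q \<noteq> 0"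
  using assms(2,3)
proof (induction ws)
  case (Cons i ws)
  then show ?case by (cases "pdw ws f q = 0") auto
qed (use assms in auto)

section \<open>Zeros in two-dimensional slices and straightening\<close>

text \<open>If the zero at \<open>q\<close> were isolated in the slice, the maximum principle would bound \<open>1 / f\<close> near \<open>q\<close>.\<close>

lemma zero_in_slice_not_isolated:
  fixes q :: "complex^'n"
  assumes ab: "a \<noteq> b" and r: "0 < r" and h: "\<And>z. z \<in> ball q r \<Longrightarrow> holo_at f z" and f0: "f q = 0"
  shows "\<exists>z\<in>ball q r. z \<noteq> q \<and> (\<forall>k. k \<noteq> a \<and> k \<noteq> b \<longrightarrow> z $ k = q $ k) \<and> f z = 0"
proof (rule ccontr)
  assume "\<not> ?thesis"
  then have nz: "f z \<noteq> 0" if "z \<in> ball q r" "z \<noteq> q" "\<And>k. k \<noteq> a \<and> k \<noteq> b \<Longrightarrow> z $ k = q $ k" for z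
    using that by blast
  \<comment> \<open>Two displacements of size at most \<rho> stay inside the ball of radius
    \<open>r\<close>.\<close>
  define \<rho> where "\<rho> = r / 3"
  define P where "P x y = q + x *s axis a 1 + y *s axis b 1" for x y :: complex
  define \<phi> where "\<phi> x y = f (P x y)" for x y
  have \<rho>: "\<rho> > 0" using r by (simp add: \<rho>_def)
  have inB: "P x y \<in> ball q r" if "cmod x \<le> \<rho>" "cmod y \<le> \<rho>" for x y
  proof -
    have "norm (x *s axis a 1 + y *s axis b 1 :: complex^'n) \<le> \<rho> + \<rho>"
      by (rule order_trans[OF norm_triangle_ineq]) (use that in \<open>simp add: norm_smult_axis\<close>)
    moreover have "dist q (P x y) = norm (x *s axis a 1 + y *s axis b 1 :: complex^'n)"
      by (simp only: P_def dist_norm norm_minus_commute[of q] add.assoc add_diff_cancel_left')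
    ultimately show ?thesis using r by (simp add: \<rho>_def)
  qed
  have Pa: "P x y $ a = q $ a + x" and Pb: "P x y $ b = q $ b + y" for x y
    using ab by (simp_all add: P_def axis_def)
  have \<phi>nz: "\<phi> x y \<noteq> 0" if "cmod x \<le> \<rho>" "cmod y \<le> \<rho>" "x \<noteq> 0 \<or> y \<noteq> 0" for x y
    unfolding \<phi>_def
  proof (rule nz[OF inB])
    show "P x y \<noteq> q" using that(3) Pa[of x y] Pb[of x y] by (metis add_cancel_right_right)
  qed (use that in \<open>auto simp: P_def axis_def\<close>)
  have cf: "continuous_on (ball q r) f" by (rule holo_at_continuous_on[OF h])
  have cP: "continuous_on (cball 0 \<rho> \<times> cball 0 \<rho>) (\<lambda>(x, y). \<phi> x y)"
    unfolding \<phi>_def split_beta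
    by (rule continuous_on_compose2[OF cf]) (unfold P_def[abs_def], intro continuous_intros, use inB in \<open>auto simp: P_def\<close>)
  define K where "K = cball (0::complex) \<rho> \<times> sphere (0::complex) \<rho>"
  have "compact ((\<lambda>p. cmod (case p of (x, y) \<Rightarrow> \<phi> x y)) ` K)"
    by (rule compact_continuous_image, rule continuous_on_norm, rule continuous_on_subset[OF cP])
      (auto simp: K_def intro: compact_Times)
  moreover have Kne: "(0, of_real \<rho>) \<in> K" using \<rho> by (simp add: K_def)
  ultimately obtain p where p: "p \<in> K" "\<And>p'. p' \<in> K \<Longrightarrow> cmod (case p of (x, y) \<Rightarrow> \<phi> x y) \<le> cmod (case p' of (x, y) \<Rightarrow> \<phi> x y)"
    using compact_attains_inf[of "(\<lambda>p. cmod (case p of (x, y) \<Rightarrow> \<phi> x y)) ` K"] by blast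
  define m where "m = cmod (case p of (x, y) \<Rightarrow> \<phi> x y)"
  have m0: "m > 0" using p(1) \<rho> \<phi>nz[of "fst p" "snd p"] unfolding m_def K_def by (auto simp: split_beta)
  have m: "m \<le> cmod (\<phi> x y)" if "cmod x \<le> \<rho>" "cmod y = \<rho>" for x y
    using p(2)[of "(x, y)"] that by (simp add: m_def K_def)
  \<comment> \<open>For \<open>x\<close> different from 0 the function has no zero on the closed
    disc in \<open>y\<close>, so the maximum principle for its reciprocal moves the bound
    \<open>m\<close> from the boundary circle to the centre. Letting \<open>x\<close> tend to 0 then
    contradicts \<open>f q = 0\<close>.\<close>
  have bd: "m \<le> cmod (\<phi> x 0)" if x: "x \<noteq> 0" "cmod x \<le> \<rho>" for x
  proof -
    have hy: "(\<lambda>y. \<phi> x y) field_differentiable (at y)" if "cmod y \<le> \<rho>" for y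
      using holo_line[of f "q + x *s axis a 1" y "axis b 1"] h[OF inB[OF x(2) that]]
      unfolding \<phi>_def P_def field_differentiable_def by auto
    have hi: "(\<lambda>y. inverse (\<phi> x y)) field_differentiable (at w)" if "cmod w \<le> \<rho>" for w
      by (rule field_differentiable_inverse, rule hy[OF that], rule \<phi>nz) (use that x in auto)
    have "norm (inverse (\<phi> x 0)) \<le> inverse m"
    proof (rule maximum_modulus_frontier[where S = "ball 0 \<rho>" and f = "\<lambda>y. inverse (\<phi> x y)" and \<xi> = 0])
      show "(\<lambda>y. inverse (\<phi> x y)) holomorphic_on interior (ball 0 \<rho>)"
        using hi by (auto simp: holomorphic_on_def intro: field_differentiable_at_within)
      show "continuous_on (closure (ball 0 \<rho>)) (\<lambda>y. inverse (\<phi> x y))"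
        unfolding closure_ball[OF \<rho>]
        by (intro continuous_at_imp_continuous_on ballI field_differentiable_imp_continuous_at hi) auto
      show "norm (inverse (\<phi> x z)) \<le> inverse m" if "z \<in> frontier (ball 0 \<rho>)" for z
      proof -
        have "m \<le> cmod (\<phi> x z)" by (rule m[OF x(2)]) (use that \<rho> in auto)
        then show ?thesis using m0 by (simp only: norm_inverse) (rule le_imp_inverse_le)
      qed
    qed (use \<rho> in auto)
    then show ?thesis using m0 \<phi>nz[of x 0] x \<rho> by (simp add: norm_inverse)
  qed
  have "isCont (\<lambda>x. \<phi> x 0) 0"
    unfolding \<phi>_def
  proof (rule isCont_o2[where g = f])
    have "continuous_on UNIV (\<lambda>x. P x 0)" unfolding P_def by (intro continuous_intros)
    then show "isCont (\<lambda>x. P x 0) 0" by (simp add: continuous_on_eq_continuous_at)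
    show "isCont f (P 0 0)" by (rule holo_at_isCont[OF h[OF inB]]) (use \<rho> in auto)
  qed
  then have "(\<lambda>x. cmod (\<phi> x 0)) \<midarrow>0\<rightarrow> cmod (\<phi> 0 0)"
    by (intro tendsto_norm) (simp add: isCont_def)
  moreover have "eventually (\<lambda>x. m \<le> cmod (\<phi> x 0)) (at 0)"
    unfolding eventually_at using \<rho> bd by (intro exI[of _ \<rho>]) auto
  ultimately have "m \<le> cmod (\<phi> 0 0)"
    by (intro tendsto_lowerbound) auto
  then show False using m0 f0 by (simp add: \<phi>_def P_def)
qed

lemma isCont_nhds: "isCont f p \<Longrightarrow> filterlim f (nhds (f p)) (nhds p)"
  unfolding continuous_at tendsto_at_iff_tendsto_nhds .

definition subst_coord :: "'n \<Rightarrow> (complex^'n \<Rightarrow> complex) \<Rightarrow> complex^'n \<Rightarrow> complex^'n" where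
  "subst_coord j g z = (\<chi> k. if k = j then g z else z $ k)"

lemma subst_coord_nth: "subst_coord j g z $ k = (if k = j then g z else z $ k)"
  by (simp add: subst_coord_def)

text \<open>The inverse function theorem for the map that makes \<open>g\<close> the
  \<open>j\<close>-th coordinate. Its Jacobian is the identity except in row \<open>j\<close>, so
  \<open>G'\<close> inverts it explicitly where \<open>pd j g\<close> is not 0.\<close>

lemma straighten:
  fixes g :: "complex^'n \<Rightarrow> complex"
  assumes S: "open S" "p \<in> S" and h: "\<And>z. z \<in> S \<Longrightarrow> holo_at g z" and nz: "pd j g p \<noteq> 0"
  obtains U where "open U" "p \<in> U" "U \<subseteq> S" "inj_on (subst_coord j g) U" "open (subst_coord j g ` U)"
    "\<And>w k. w \<in> subst_coord j g ` U \<Longrightarrow> holo_at (\<lambda>w. inv_into U (subst_coord j g) w $ k) w"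
proof -
  let ?F = "subst_coord j g"
  have hF: "holo_at (\<lambda>z. ?F z $ k) z" if "z \<in> S" for z k
    by (cases "k = j") (simp_all add: subst_coord_nth h[OF that] holo_at_coord)
  define F' where "F' z v = (\<chi> k. if k = j then (\<Sum>i\<in>UNIV. v $ i * pd i g z) else v $ k)" for z v :: "complex^'n"
  have dF: "(?F has_derivative F' z) (at z)" if "z \<in> S" for z
  proof -
    have "F' z = (\<lambda>v. \<chi> k. \<Sum>i\<in>UNIV. v $ i * pd i (\<lambda>z. ?F z $ k) z)"
      by (auto simp: F'_def fun_eq_iff vec_eq_iff subst_coord_nth pd_coord if_distrib cong: if_cong)
    then show ?thesis using has_derivative_components[OF hF[OF that]] by simp
  qed
  define G' where "G' z w = (\<chi> k. if k = j then (w $ j - (\<Sum>i\<in>-{j}. w $ i * pd i g z)) / pd j g z else w $ k)"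
    for z w :: "complex^'n"
  have split: "(\<Sum>i\<in>UNIV. f i) = f j + (\<Sum>i\<in>-{j}. f i)" for f :: "'n \<Rightarrow> complex"
    by (subst sum.remove[of _ j]) (auto simp: Compl_eq_Diff_UNIV)
  have GF: "G' z (F' z v) = v" and FG: "F' z (G' z w) = w" if "pd j g z \<noteq> 0" for z v w
    using that by (auto simp: G'_def F'_def vec_eq_iff split)
  have linG: "bounded_linear (G' z)" for z
    unfolding linear_conv_bounded_linear[symmetric]
  proof (rule linearI)
    show "G' z (x + y) = G' z x + G' z y" for x y
      by (simp add: G'_def vec_eq_iff sum.distrib distrib_right add_divide_distrib diff_divide_distrib)
    show "G' z (r *\<^sub>R x) = r *\<^sub>R G' z x" for r x
    proof -
      have "(\<Sum>i\<in>-{j}. (r *\<^sub>R x) $ i * pd i g z) = of_real r * (\<Sum>i\<in>-{j}. x $ i * pd i g z)"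
        unfolding vector_scaleR_component sum_distrib_left by (rule sum.cong) (simp_all add: scaleR_conv_of_real)
      then have "((r *\<^sub>R x) $ j - (\<Sum>i\<in>-{j}. (r *\<^sub>R x) $ i * pd i g z)) / pd j g z =
          r *\<^sub>R ((x $ j - (\<Sum>i\<in>-{j}. x $ i * pd i g z)) / pd j g z)"
        unfolding vector_scaleR_component by (simp only: scaleR_conv_of_real right_diff_distrib times_divide_eq_right)
      then show ?thesis unfolding G'_def by (subst vec_eq_iff) (simp only: vec_lambda_beta vector_scaleR_component split: if_split, blast)
    qed
  qed
  have hp: "holo_at (pd i g) z" if "z \<in> S" for i z by (rule holo_at_pd[OF S(1) h that])
  have "eventually (\<lambda>z. z \<in> S \<and> pd j g z \<noteq> 0) (nhds p)"
  proof (intro eventually_conj eventually_nhds_in_open S)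
    have "isCont (pd j g) p" by (rule holo_at_isCont[OF hp[OF S(2)]])
    then have "filterlim (pd j g) (nhds (pd j g p)) (nhds p)" by (rule isCont_nhds)
    then show "eventually (\<lambda>z. pd j g z \<noteq> 0) (nhds p)"
      by (rule tendsto_imp_eventually_ne[OF _ nz])
  qed
  then obtain S' where S': "open S'" "p \<in> S'" "\<And>z. z \<in> S' \<Longrightarrow> z \<in> S" "\<And>z. z \<in> S' \<Longrightarrow> pd j g z \<noteq> 0"
    unfolding eventually_nhds by blast
  \<comment> \<open>The derivative varies only in its \<open>j\<close>-th component, so its change
    in operator norm is at most the sum of the changes of the partial derivatives of
    \<open>g\<close>.\<close>
  have "\<exists>d>0. \<forall>x. dist p x < d \<longrightarrow> onorm (\<lambda>v. F' x v - F' p v) < e" if e: "e > 0" for e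
  proof -
    let ?d = "\<lambda>x. \<Sum>i\<in>UNIV. cmod (pd i g x - pd i g p)"
    have "isCont ?d p" by (intro continuous_intros holo_at_isCont hp S(2))
    then have "filterlim ?d (nhds (?d p)) (nhds p)" by (rule isCont_nhds)
    then have "eventually (\<lambda>x. ?d x < e) (nhds p)" by (rule order_tendstoD(2)) (use e in simp)
    then obtain d where d: "d > 0" "\<And>x. dist x p < d \<Longrightarrow> ?d x < e"
      unfolding eventually_nhds_metric by blast
    have "onorm (\<lambda>v. F' x v - F' p v) < e" if x: "dist p x < d" for x
    proof -
      have "norm (F' x v - F' p v) \<le> ?d x * norm v" for v
      proof -
        have "F' x v - F' p v = axis j (\<Sum>i\<in>UNIV. v $ i * (pd i g x - pd i g p))"
          by (simp add: F'_def vec_eq_iff axis_def algebra_simps sum_subtractf)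
        then have "norm (F' x v - F' p v) = cmod (\<Sum>i\<in>UNIV. v $ i * (pd i g x - pd i g p))"
          by (simp add: norm_eq_sqrt_inner inner_axis_axis)
        also have "\<dots> \<le> (\<Sum>i\<in>UNIV. cmod (v $ i * (pd i g x - pd i g p)))" by (rule norm_sum)
        also have "\<dots> \<le> (\<Sum>i\<in>UNIV. cmod (pd i g x - pd i g p) * norm v)"
          by (intro sum_mono) (simp add: norm_mult mult.commute mult_right_mono norm_bound_component_le_cart component_le_norm_cart Finite_Cartesian_Product.norm_nth_le)
        finally show ?thesis by (simp add: sum_distrib_right)
      qed
      then have "onorm (\<lambda>v. F' x v - F' p v) \<le> ?d x" by (rule onorm_le)
      also have "\<dots> < e" using d(2)[of x] x by (simp add: dist_commute)
      finally show ?thesis .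
    qed
    then show ?thesis using d(1) by blast
  qed
  moreover have "G' p \<circ> F' p = id" using GF[OF S'(4)[OF S'(2)]] by (simp add: fun_eq_iff)
  ultimately obtain r where r: "r > 0" "ball p r \<subseteq> S'" "inj_on ?F (ball p r)"
    using has_derivative_locally_injective[OF S'(2,1) linG, of p F' ?F] dF S'(3) by blast
  let ?U = "ball p r"
  have cF: "continuous_on ?U ?F"
    using dF r(2) S'(3) by (auto intro!: continuous_at_imp_continuous_on has_derivative_continuous)
  have "holo_at (\<lambda>w. inv_into ?U ?F w $ k) (?F z)" if z: "z \<in> ?U" for z k
  proof -
    have z': "z \<in> S" "pd j g z \<noteq> 0" using z r(2) S'(3,4) by auto
    have "(inv_into ?U ?F has_derivative G' z) (at (?F z))"
      by (rule has_derivative_inverse_strong[OF _ z cF _ dF]) (use r(3) z' FG in auto)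
    then have "((\<lambda>w. inv_into ?U ?F w $ k) has_derivative (\<lambda>w. G' z w $ k)) (at (?F z))"
      by (rule bounded_linear.has_derivative[OF bounded_linear_vec_nth])
    moreover have "G' z (c *s v) $ k = c * G' z v $ k" for c v
    proof -
      have "(\<Sum>i\<in>-{j}. (c *s v) $ i * pd i g z) = c * (\<Sum>i\<in>-{j}. v $ i * pd i g z)"
        by (simp add: sum_distrib_left mult.assoc)
      then show ?thesis unfolding G'_def
        by (simp only: vec_lambda_beta vector_smult_component right_diff_distrib times_divide_eq_right split: if_split, blast)
    qed
    ultimately show ?thesis unfolding holo_at_def by (intro exI conjI) auto
  qed
  then have "holo_at (\<lambda>w. inv_into ?U ?F w $ k) w" if "w \<in> ?F ` ?U" for w k
    using that by blast
  moreover have "open (?F ` ?U)" by (rule invariance_of_domain[OF cF _ r(3)]) auto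
  moreover have "?U \<subseteq> S" using r S'(3) by auto
  ultimately show ?thesis using that[of ?U] r by simp
qed

lemma holo_components_continuous:
  assumes "\<And>z k. z \<in> S \<Longrightarrow> holo_at (\<lambda>z. F z $ k) z"
  shows "continuous_on S F"
  by (intro continuous_at_imp_continuous_on ballI has_derivative_continuous[OF has_derivative_components] assms)

lemma differentiable_along_line:
  fixes F :: "complex^'n \<Rightarrow> complex^'m"
  assumes "\<And>k. holo_at (\<lambda>z. F z $ k) (t *s v)"
  shows "(\<lambda>t. F (t *s v)) differentiable (at t)"
proof -
  have "((\<lambda>t. t *s v) has_derivative (\<lambda>t. t *s v)) (at t)"
    by (rule bounded_linear_imp_has_derivative[OF bounded_linear_smult])
  from diff_chain_at[OF this has_derivative_components[OF assms]]
  have "((\<lambda>t. F (t *s v)) has_derivative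
      (\<lambda>v. \<chi> k. \<Sum>i\<in>UNIV. v $ i * pd i (\<lambda>z. F z $ k) (t *s v')) \<circ> (\<lambda>t. t *s v')) (at t)"
    if "v' = v" for v' using that by (simp only: comp_def)
  then show ?thesis unfolding differentiable_def by blast
qed

section \<open>Analytic sets of dimension at most one in three-space\<close>

text \<open>A class of sets that contains the analytic sets in question with their singularities, is
  closed under countable unions and has null images in C^2. It replaces a decomposition into
  irreducible components.\<close>

definition thin :: "(complex^'n::finite) set \<Rightarrow> bool" where
  "thin X \<longleftrightarrow> (\<exists>(g :: nat \<Rightarrow> complex \<Rightarrow> complex^'n) Z. X \<subseteq> (\<Union>n. g n ` Z n) \<and> (\<forall>n. g n differentiable_on Z n))"

lemma thin_subset: "thin X \<Longrightarrow> Y \<subseteq> X \<Longrightarrow> thin Y"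
  unfolding thin_def by (meson subset_trans)

lemma thin_image:
  fixes g :: "complex \<Rightarrow> complex^'n::finite"
  shows "g differentiable_on Z \<Longrightarrow> X \<subseteq> g ` Z \<Longrightarrow> thin X"
  unfolding thin_def by (rule exI[of _ "\<lambda>_. g"], rule exI[of _ "\<lambda>_. Z"]) auto

lemma thin_UN:
  fixes X :: "'i \<Rightarrow> (complex^'n::finite) set"
  assumes I: "countable I" and X: "\<And>i. i \<in> I \<Longrightarrow> thin (X i)"
  shows "thin (\<Union>i\<in>I. X i)"
proof -
  define P where "P i g Z \<longleftrightarrow> X i \<subseteq> (\<Union>n. g n ` Z n) \<and> (\<forall>n. g n differentiable_on Z n)"
    for i and g :: "nat \<Rightarrow> complex \<Rightarrow> complex^'n" and Z
  have "\<exists>g. \<exists>Z. P i g Z" if "i \<in> I" for i using X[OF that] unfolding thin_def P_def .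
  then have "\<forall>i\<in>I. \<exists>g. \<exists>Z. P i g Z" ..
  from bchoice[OF this] obtain g where "\<forall>i\<in>I. \<exists>Z. P i (g i) Z" ..
  from bchoice[OF this] obtain Z where Z: "\<forall>i\<in>I. P i (g i) (Z i)" ..
  have gZ: "X i \<subseteq> (\<Union>n. g i n ` Z i n)" "g i n differentiable_on Z i n" if "i \<in> I" for i n
    using bspec[OF Z that] unfolding P_def by (rule conjunct1, simp)
  show ?thesis
  proof (cases "I = {}")
    case True
    then show ?thesis by (intro thin_image[of "\<lambda>_. 0" "{}"]) (auto simp: differentiable_on_def)
  next
    case False
    define e where "e = from_nat_into I"
    have e: "range e = I" using I False by (simp add: e_def range_from_nat_into)
    show ?thesis unfolding thin_def
    proof (intro exI conjI allI)
      let ?g = "\<lambda>m. g (e (fst (prod_decode m))) (snd (prod_decode m))"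
      let ?Z = "\<lambda>m. Z (e (fst (prod_decode m))) (snd (prod_decode m))"
      show "(\<Union>i\<in>I. X i) \<subseteq> (\<Union>m. ?g m ` ?Z m)"
      proof
        fix x assume "x \<in> (\<Union>i\<in>I. X i)"
        then obtain i where i: "i \<in> I" "x \<in> X i" by (rule UN_E)
        obtain n where n: "x \<in> g i n ` Z i n" using subsetD[OF gZ(1)[OF i(1)] i(2)] by (rule UN_E)
        obtain k where "i = e k" using i(1) unfolding e[symmetric] by (rule rangeE)
        then show "x \<in> (\<Union>m. ?g m ` ?Z m)"
          using n by (intro UN_I[of "prod_encode (k, n)"]) simp_all
      qed
      show "?g m differentiable_on ?Z m" for m using gZ(2)[of "e (fst (prod_decode m))"] e by (metis rangeI)
    qed
  qed
qed

text \<open>By the Lindelof property countably many of the neighbourhoods suffice.\<close>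

lemma thin_local:
  assumes "\<And>x. x \<in> X \<Longrightarrow> \<exists>W. open W \<and> x \<in> W \<and> thin (X \<inter> W)"
  shows "thin X"
proof -
  let ?F = "{W. open W \<and> thin (X \<inter> W)}"
  obtain F' where F': "F' \<subseteq> ?F" "countable F'" "\<Union>F' = \<Union>?F" using Lindelof[of ?F] by auto
  have "thin (\<Union>W\<in>F'. X \<inter> W)" by (rule thin_UN) (use F' in auto)
  moreover have "X \<subseteq> (\<Union>W\<in>F'. X \<inter> W)" using assms F'(3) by blast
  ultimately show ?thesis by (rule thin_subset)
qed

text \<open>Each piece is a differentiable image of a subset of a space of real dimension 2 in one
  of real dimension 4.\<close>

lemma thin_negligible:
  fixes \<pi> :: "complex^'n \<Rightarrow> complex^2"
  assumes "thin X" and d: "\<And>x. x \<in> X \<Longrightarrow> \<pi> differentiable (at x)"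
  shows "negligible (\<pi> ` X)"
proof -
  obtain g :: "nat \<Rightarrow> complex \<Rightarrow> complex^'n" and Z where gZ: "X \<subseteq> (\<Union>n. g n ` Z n)" "\<And>n. g n differentiable_on Z n"
    using assms unfolding thin_def by blast
  let ?Z = "\<lambda>n. {t \<in> Z n. g n t \<in> X}"
  have "negligible ((\<lambda>t. \<pi> (g n t)) ` ?Z n)" for n
  proof (rule negligible_differentiable_image_lowdim)
    show "(\<lambda>t. \<pi> (g n t)) differentiable_on ?Z n"
      unfolding differentiable_on_def
    proof
      fix t assume t: "t \<in> ?Z n"
      have "g n differentiable (at t within ?Z n)"
        using gZ(2)[of n] t unfolding differentiable_on_def by (auto intro: differentiable_within_subset)
      then show "(\<lambda>t. \<pi> (g n t)) differentiable (at t within ?Z n)"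
        using differentiable_chain_within[of "g n" t "?Z n" \<pi>] d t
        by (auto simp: comp_def intro: differentiable_at_withinI)
    qed
  qed auto
  then have "negligible (\<Union>n. (\<lambda>t. \<pi> (g n t)) ` ?Z n)" by (intro negligible_countable_Union) auto
  then show ?thesis by (rule negligible_subset) (use gZ(1) in blast)
qed

text \<open>\<open>isolated\<close> is the form in which dimension at most one enters: near each of
  its points, a single equation cuts \<open>V\<close> down to that point.\<close>

locale thin_analytic =
  fixes V :: "(complex^3) set"
  assumes zeros: "\<And>p. p \<in> V \<Longrightarrow> \<exists>W F. open W \<and> p \<in> W \<and> finite F \<and> (\<forall>f\<in>F. \<forall>z\<in>W. holo_at f z) \<and>
      V \<inter> W = {z \<in> W. \<forall>f\<in>F. f z = 0}"
    and isolated: "\<And>p. p \<in> V \<Longrightarrow> \<exists>W f. open W \<and> p \<in> W \<and> (\<forall>z\<in>W. holo_at f z) \<and> {z \<in> V \<inter> W. f z = 0} = {p}"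
begin

text \<open>If \<open>V\<close> contained the image of a two-dimensional slice, the isolating
  function pulled back to the slice would have an isolated zero, against
  \<open>zero_in_slice_not_isolated\<close>.\<close>

lemma no_surface:
  fixes \<Psi> :: "complex^3 \<Rightarrow> complex^3"
  assumes \<rho>: "0 < \<rho>" and h: "\<And>w k. w \<in> ball w0 \<rho> \<Longrightarrow> holo_at (\<lambda>w. \<Psi> w $ k) w"
    and inj: "inj_on \<Psi> (ball w0 \<rho>)" and ab: "a \<noteq> b"
    and sub: "\<And>w. w \<in> ball w0 \<rho> \<Longrightarrow> (\<And>k. k \<noteq> a \<Longrightarrow> k \<noteq> b \<Longrightarrow> w $ k = w0 $ k) \<Longrightarrow> \<Psi> w \<in> V"
  shows False
proof -
  have "\<Psi> w0 \<in> V" using sub[of w0] \<rho> by simp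
  from isolated[OF this] obtain W f where W0: "open W \<and> \<Psi> w0 \<in> W \<and> (\<forall>z\<in>W. holo_at f z) \<and>
      {z \<in> V \<inter> W. f z = 0} = {\<Psi> w0}" by (elim exE)
  then have W: "open W" "\<Psi> w0 \<in> W" "\<And>z. z \<in> W \<Longrightarrow> holo_at f z" "{z \<in> V \<inter> W. f z = 0} = {\<Psi> w0}"
    by simp_all
  have c: "continuous_on (ball w0 \<rho>) \<Psi>"
    by (rule holo_components_continuous[OF h])
  have "open (ball w0 \<rho> \<inter> \<Psi> -` W)" by (rule continuous_open_preimage[OF c _ W(1)]) auto
  moreover have "w0 \<in> ball w0 \<rho> \<inter> \<Psi> -` W" using W(2) \<rho> by simp
  ultimately obtain r where r: "r > 0" "ball w0 r \<subseteq> ball w0 \<rho> \<inter> \<Psi> -` W"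
    by (rule openE)
  have "\<exists>z\<in>ball w0 r. z \<noteq> w0 \<and> (\<forall>k. k \<noteq> a \<and> k \<noteq> b \<longrightarrow> z $ k = w0 $ k) \<and> f (\<Psi> z) = 0"
  proof (rule zero_in_slice_not_isolated[OF ab r(1), where f = "\<lambda>w. f (\<Psi> w)"])
    show "holo_at (\<lambda>w. f (\<Psi> w)) z" if "z \<in> ball w0 r" for z
      by (rule holo_at_compose[OF h W(3)]) (use that r in auto)
    show "f (\<Psi> w0) = 0" using equalityD2[OF W(4)] by simp
  qed
  then obtain z where z: "z \<in> ball w0 r" "z \<noteq> w0" "\<And>k. k \<noteq> a \<Longrightarrow> k \<noteq> b \<Longrightarrow> z $ k = w0 $ k" "f (\<Psi> z) = 0" by blast
  have zB: "z \<in> ball w0 \<rho>" "\<Psi> z \<in> W" using z(1) r by auto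
  then have "\<Psi> z \<in> {z \<in> V \<inter> W. f z = 0}" using z(4) sub[OF zB(1) z(3)] by simp
  then have "\<Psi> z = \<Psi> w0" unfolding W(4) by simp
  then show False using inj_onD[OF inj _ zB(1), of w0] z(2) \<rho> by simp
qed

text \<open>In the coordinates \<open>\<Phi>\<close> the set \<open>Y\<close> lies in the hyperplane
  where coordinate \<open>j\<close> is 0. If all tangential derivatives of the defining functions
  vanished at a point, \<open>V\<close> would contain a piece of this hyperplane, which
  \<open>no_surface\<close> excludes. So some tangential derivative supplies a second equation, and
  a second straightening leaves one free coordinate.\<close>

lemma thin_in_surface:
  fixes \<Phi> :: "complex^3 \<Rightarrow> complex^3" and F :: "(complex^3 \<Rightarrow> complex) set"
  assumes U: "open U" "inj_on \<Phi> U" "\<Phi> ` U = ball w0 \<rho>" "continuous_on U \<Phi>"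
    and \<Psi>: "\<And>w k. w \<in> ball w0 \<rho> \<Longrightarrow> holo_at (\<lambda>w. inv_into U \<Phi> w $ k) w"
    and F: "finite F" "\<And>f z. f \<in> F \<Longrightarrow> z \<in> U \<Longrightarrow> holo_at f z" "V \<inter> U = {z \<in> U. \<forall>f\<in>F. f z = 0}"
    and Y: "Y \<subseteq> V \<inter> U" "\<And>z. z \<in> Y \<Longrightarrow> \<Phi> z $ j = 0"
  shows "thin Y"
proof -
  let ?\<Psi> = "inv_into U \<Phi>"
  have \<Psi>U: "?\<Psi> w \<in> U" if "w \<in> ball w0 \<rho>" for w using that U(3) by (metis inv_into_into)
  have \<Psi>\<Phi>: "?\<Psi> (\<Phi> z) = z" if "z \<in> U" for z using that U(2) by simp
  have \<Phi>B: "\<Phi> z \<in> ball w0 \<rho>" if "z \<in> U" for z using that U(3) by blast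
  have inj\<Psi>: "inj_on ?\<Psi> (ball w0 \<rho>)" using U(3) by (metis inj_on_inv_into order_refl)
  define gf where "gf f w = f (?\<Psi> w)" for f :: "complex^3 \<Rightarrow> complex" and w
  have hgf: "holo_at (gf f) w" if "f \<in> F" "w \<in> ball w0 \<rho>" for f w
    unfolding gf_def by (rule holo_at_compose[OF \<Psi>]) (use that \<Psi>U F(2) in auto)
  define I where "I = - {j}"
  \<comment> \<open>One stratum for each equation, word and direction as in
    \<open>pdw_first_nonzero\<close>, with only directions tangent to the hyperplane; there are
    countably many.\<close>
  define Y' where "Y' = (\<lambda>(f, ws, i). {z \<in> Y. pdw ws (gf f) (\<Phi> z) = 0 \<and> pd i (pdw ws (gf f)) (\<Phi> z) \<noteq> 0})"
  have "Y \<subseteq> (\<Union>t\<in>F \<times> UNIV \<times> I. Y' t)"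
  proof
    fix z assume z: "z \<in> Y"
    then have zU: "z \<in> U" and zV: "z \<in> V" using Y by auto
    let ?w = "\<Phi> z"
    obtain r where r: "r > 0" "ball ?w r \<subseteq> ball w0 \<rho>"
      using openE[OF open_ball \<Phi>B[OF zU]] by blast
    have "\<exists>f\<in>F. \<exists>ws. set ws \<subseteq> I \<and> pdw ws (gf f) ?w \<noteq> 0"
    proof (rule ccontr)
      assume neg: "\<not> ?thesis"
      obtain a b where ab: "a \<noteq> b" "I = {a, b}"
      proof -
        have "card I = 2" by (simp add: I_def Compl_eq_Diff_UNIV card_Diff_singleton)
        then show ?thesis using that by (auto simp: card_2_iff)
      qed
      show False
      proof (rule no_surface[OF r(1) _ _ ab(1), of ?w ?\<Psi>])
        show "holo_at (\<lambda>w. ?\<Psi> w $ k) w" if "w \<in> ball ?w r" for w k using \<Psi> that r by blast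
        show "inj_on ?\<Psi> (ball ?w r)" by (rule inj_on_subset[OF inj\<Psi> r(2)])
        fix w assume w: "w \<in> ball ?w r" "\<And>k. k \<noteq> a \<Longrightarrow> k \<noteq> b \<Longrightarrow> w $ k = ?w $ k"
        have "f (?\<Psi> w) = 0" if f: "f \<in> F" for f
        proof -
          have "gf f (?w + (w - ?w)) = 0"
          proof (rule vanishing_on_slice[where I = I and r = r])
            show "holo_at (gf f) x" if "x \<in> ball ?w r" for x using hgf[OF f] r that by blast
            show "pdw ws (gf f) ?w = 0" if "set ws \<subseteq> I" for ws using neg that f by blast
            show "(w - ?w) $ k = 0" if "k \<notin> I" for k using w(2) that ab by auto
          qed (use w in auto)
          then show ?thesis by (simp add: gf_def)
        qed
        moreover have "?\<Psi> w \<in> U" using \<Psi>U w(1) r by blast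
        ultimately show "?\<Psi> w \<in> V" using F(3) by blast
      qed
    qed
    then obtain f ws where f: "f \<in> F" "set ws \<subseteq> I" "pdw ws (gf f) ?w \<noteq> 0" by blast
    have "gf f ?w = 0" using F(3) f(1) zU zV \<Psi>\<Phi>[OF zU] by (auto simp: gf_def)
    from pdw_first_nonzero[OF this f(3,2)] show "z \<in> (\<Union>t\<in>F \<times> UNIV \<times> I. Y' t)"
      using f(1) z unfolding Y'_def by force
  qed
  moreover have "thin (\<Union>t\<in>F \<times> UNIV \<times> I. Y' t)"
  proof (rule thin_UN)
    show "countable (F \<times> (UNIV :: 3 list set) \<times> I)" using F(1) by (simp add: countable_finite)
    fix t assume "t \<in> F \<times> (UNIV :: 3 list set) \<times> I"
    then obtain f ws i where t: "t = (f, ws, i)" "f \<in> F" "i \<in> I" by auto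
    define g where "g = pdw ws (gf f)"
    have hg: "holo_at g w" if "w \<in> ball w0 \<rho>" for w
      unfolding g_def by (rule holo_at_pdw[OF _ hgf[OF t(2)] that]) auto
    have "thin {z \<in> Y. g (\<Phi> z) = 0 \<and> pd i g (\<Phi> z) \<noteq> 0}" (is "thin ?Y")
    proof (rule thin_local)
      fix z1 assume z1: "z1 \<in> ?Y"
      then have z1U: "z1 \<in> U" using Y by auto
      obtain U2 where U2: "open U2" "\<Phi> z1 \<in> U2" "U2 \<subseteq> ball w0 \<rho>" "inj_on (subst_coord i g) U2"
        "open (subst_coord i g ` U2)"
        "\<And>w k. w \<in> subst_coord i g ` U2 \<Longrightarrow> holo_at (\<lambda>w. inv_into U2 (subst_coord i g) w $ k) w"
        by (rule straighten[OF open_ball \<Phi>B[OF z1U] hg, of i]) (use z1 in auto)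
      let ?\<Phi>2 = "subst_coord i g" and ?\<Psi>2 = "inv_into U2 (subst_coord i g)"
      obtain l :: 3 where l: "\<And>k. k = j \<or> k = i \<or> k = l" "l \<noteq> i" "l \<noteq> j"
      proof -
        have "i \<noteq> j" using t(3) by (auto simp: I_def)
        then have "\<exists>l::3. (\<forall>k. k = j \<or> k = i \<or> k = l) \<and> l \<noteq> i \<and> l \<noteq> j"
          using exhaust_3[of i] exhaust_3[of j] by (auto simp: forall_3)
        then show ?thesis using that by blast
      qed
      \<comment> \<open>After both straightenings the points of the stratum have coordinates
        \<open>i\<close> and \<open>j\<close> equal to 0. The two inverse maps along the remaining
        axis \<open>l\<close> therefore parametrise them.\<close>
      define \<gamma> where "\<gamma> t = ?\<Psi> (?\<Psi>2 (t *s axis l 1))" for t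
      define Z where "Z = {t. t *s axis l 1 \<in> ?\<Phi>2 ` U2}"
      have "\<gamma> differentiable_on Z"
        unfolding differentiable_on_def
      proof
        fix t assume t: "t \<in> Z"
        then have x: "t *s axis l 1 \<in> ?\<Phi>2 ` U2" by (simp add: Z_def)
        have y: "?\<Psi>2 (t *s axis l 1) \<in> ball w0 \<rho>" using U2(3) inv_into_into[OF x] by blast
        have "holo_at (\<lambda>w. ?\<Psi> (?\<Psi>2 w) $ k) (t *s axis l 1)" for k
          by (rule holo_at_compose[where f = "\<lambda>w. ?\<Psi> w $ k" and F = ?\<Psi>2, OF U2(6)[OF x] \<Psi>[OF y]])
        then have "\<gamma> differentiable (at t)"
          unfolding \<gamma>_def by (rule differentiable_along_line)
        then show "\<gamma> differentiable (at t within Z)" by (rule differentiable_at_withinI)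
      qed
      moreover have "?Y \<inter> (U \<inter> \<Phi> -` U2) \<subseteq> \<gamma> ` Z"
      proof
        fix z assume z: "z \<in> ?Y \<inter> (U \<inter> \<Phi> -` U2)"
        define t where "t = ?\<Phi>2 (\<Phi> z) $ l"
        have "?\<Phi>2 (\<Phi> z) $ k = (t *s axis l 1 :: complex^3) $ k" for k
          using l(1)[of k] l(2,3) z Y(2)[of z] by (auto simp: t_def subst_coord_nth axis_def)
        then have e: "?\<Phi>2 (\<Phi> z) = t *s axis l 1" by (simp add: vec_eq_iff)
        then have "z = \<gamma> t" using z U2(4) \<Psi>\<Phi> by (simp add: \<gamma>_def flip: e)
        moreover have "t \<in> Z" using e z by (auto simp: Z_def intro!: image_eqI[of _ _ "\<Phi> z"])
        ultimately show "z \<in> \<gamma> ` Z" by blast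
      qed
      ultimately have "thin (?Y \<inter> (U \<inter> \<Phi> -` U2))" by (rule thin_image)
      moreover have "open (U \<inter> \<Phi> -` U2)" by (rule continuous_open_preimage[OF U(4,1) U2(1)])
      ultimately show "\<exists>W. open W \<and> z1 \<in> W \<and> thin (?Y \<inter> W)" using z1U U2(2) by blast
    qed
    then show "thin (Y' t)" by (simp add: Y'_def t g_def)
  qed
  ultimately show ?thesis by (rule thin_subset[rotated])
qed

text \<open>The same stratification one dimension higher. Where all derivatives of the equations
  vanish, \<open>V\<close> would contain a ball; everywhere else the point lies on a smooth
  hypersurface \<open>g = 0\<close>, which is straightened and handed to
  \<open>thin_in_surface\<close>.\<close>

lemma thin_V: "thin V"
proof (rule thin_local)
  fix p assume p: "p \<in> V"
  obtain W F where W: "open W" "p \<in> W" "finite F" "\<And>f z. f \<in> F \<Longrightarrow> z \<in> W \<Longrightarrow> holo_at f z"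
      "V \<inter> W = {z \<in> W. \<forall>f\<in>F. f z = 0}"
    using zeros[OF p] by blast
  define Y where "Y = (\<lambda>(f, ws, j). {z \<in> V \<inter> W. pdw ws f z = 0 \<and> pd j (pdw ws f) z \<noteq> 0})"
  have "V \<inter> W \<subseteq> (\<Union>t\<in>F \<times> UNIV \<times> UNIV. Y t)"
  proof
    fix q assume q: "q \<in> V \<inter> W"
    obtain r where r: "r > 0" "ball q r \<subseteq> W" using q W(1) open_contains_ball by blast
    have "\<exists>f\<in>F. \<exists>ws. pdw ws f q \<noteq> 0"
    proof (rule ccontr)
      assume neg: "\<not> ?thesis"
      show False
      proof (rule no_surface[OF r(1), of q "\<lambda>w. w" 1 2])
        fix w assume w: "w \<in> ball q r"
        have "f w = 0" if "f \<in> F" for f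
        proof -
          have "f (q + (w - q)) = 0"
          proof (rule vanishing_on_slice[where I = UNIV])
            show "holo_at f z" if "z \<in> ball q r" for z using W(4) \<open>f \<in> F\<close> r(2) that by blast
            show "pdw ws f q = 0" for ws using neg \<open>f \<in> F\<close> by blast
          qed (use w in auto)
          then show ?thesis by simp
        qed
        then show "w \<in> V" using W(5) w r by blast
      qed (auto intro: holo_at_coord)
    qed
    then obtain f ws where f: "f \<in> F" "pdw ws f q \<noteq> 0" by blast
    have "f q = 0" using W(5) q f by auto
    from pdw_first_nonzero[OF this f(2), of UNIV] show "q \<in> (\<Union>t\<in>F \<times> UNIV \<times> UNIV. Y t)"
      using f(1) q unfolding Y_def by force
  qed
  moreover have "thin (\<Union>t\<in>F \<times> UNIV \<times> UNIV. Y t)"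
  proof (rule thin_UN)
    show "countable (F \<times> (UNIV :: 3 list set) \<times> (UNIV :: 3 set))" using W(3) by (simp add: countable_finite)
    fix t assume "t \<in> F \<times> (UNIV :: 3 list set) \<times> (UNIV :: 3 set)"
    then obtain f ws j where t: "t = (f, ws, j)" "f \<in> F" by auto
    define g where "g = pdw ws f"
    have hg: "holo_at g w" if "w \<in> W" for w
      unfolding g_def by (rule holo_at_pdw[OF W(1) W(4)[OF t(2)] that])
    have "thin {z \<in> V \<inter> W. g z = 0 \<and> pd j g z \<noteq> 0}" (is "thin ?Y")
    proof (rule thin_local)
      fix q assume q: "q \<in> ?Y"
      let ?\<Phi> = "subst_coord j g"
      obtain U where U: "open U" "q \<in> U" "U \<subseteq> W" "inj_on ?\<Phi> U" "open (?\<Phi> ` U)"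
        "\<And>w k. w \<in> ?\<Phi> ` U \<Longrightarrow> holo_at (\<lambda>w. inv_into U ?\<Phi> w $ k) w"
        using straighten[OF W(1) _ hg, of q j] q by auto
      obtain \<rho> where \<rho>: "\<rho> > 0" "ball (?\<Phi> q) \<rho> \<subseteq> ?\<Phi> ` U" using U(2,5) open_contains_ball by blast
      have c: "continuous_on U ?\<Phi>"
      proof -
        have "holo_at (\<lambda>z. ?\<Phi> z $ k) z" if "z \<in> U" for z k
          using that U(3) by (cases "k = j") (auto simp: subst_coord_nth hg holo_at_coord)
        then show ?thesis by (rule holo_components_continuous)
      qed
      define U' where "U' = U \<inter> ?\<Phi> -` ball (?\<Phi> q) \<rho>"
      have oU': "open U'" unfolding U'_def by (rule continuous_open_preimage[OF c U(1)]) auto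
      have im: "?\<Phi> ` U' = ball (?\<Phi> q) \<rho>" unfolding U'_def using \<rho>(2) by blast
      have inj': "inj_on ?\<Phi> U'" using U(4) by (rule inj_on_subset) (auto simp: U'_def)
      have inv: "inv_into U' ?\<Phi> w = inv_into U ?\<Phi> w" if "w \<in> ball (?\<Phi> q) \<rho>" for w
      proof -
        obtain z where "z \<in> U'" "w = ?\<Phi> z" using \<open>?\<Phi> ` U' = ball (?\<Phi> q) \<rho>\<close> \<open>w \<in> _\<close> by blast
        then show ?thesis using inj' U(4) by (simp add: U'_def)
      qed
      have "thin (?Y \<inter> U')"
      proof (rule thin_in_surface[OF oU' inj' im])
        show "continuous_on U' ?\<Phi>" by (rule continuous_on_subset[OF c]) (auto simp: U'_def)
        show "holo_at (\<lambda>w. inv_into U' ?\<Phi> w $ k) w" if w: "w \<in> ball (?\<Phi> q) \<rho>" for w k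
        proof (rule holo_at_cong(1)[OF U(6)[OF subsetD[OF \<rho>(2) w]]])
          show "eventually (\<lambda>w. inv_into U ?\<Phi> w $ k = inv_into U' ?\<Phi> w $ k) (nhds w)"
            by (rule eventually_nhds_in_open[THEN eventually_mono, OF _ w]) (auto simp: inv)
        qed
        show "holo_at f' z" if "f' \<in> F" "z \<in> U'" for f' z using W(4) that U(3) by (auto simp: U'_def)
        show "V \<inter> U' = {z \<in> U'. \<forall>f\<in>F. f z = 0}" using W(5) U(3) unfolding U'_def by blast
        show "?\<Phi> z $ j = 0" if "z \<in> ?Y \<inter> U'" for z using that by (simp add: subst_coord_nth)
      qed (use W(3) in auto)
      then show "\<exists>W. open W \<and> q \<in> W \<and> thin (?Y \<inter> W)"
        using oU' U(2) \<rho>(1) by (intro exI[of _ U']) (auto simp: U'_def)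
    qed
    then show "thin (Y t)" by (simp add: Y_def t g_def)
  qed
  ultimately have "thin (V \<inter> W)" by (rule thin_subset[rotated])
  then show "\<exists>W. open W \<and> p \<in> W \<and> thin (V \<inter> W)" using W by blast
qed

end

section \<open>Hartogs extension across a thin set\<close>

text \<open>Almost every complex line through \<open>s\<close> meets the thin set at most in \<open>s\<close>. Along a fixed such
  direction the Cauchy integral over a small circle extends \<open>h\<close>; it agrees with \<open>h\<close> on every line of
  that direction which misses the thin set, hence on a dense set.\<close>

lemma thin_direction:
  fixes V :: "(complex^3) set"
  assumes "thin V"
  obtains a b where "\<And>\<tau>. \<tau> \<noteq> 0 \<Longrightarrow> s + \<tau> *s vector [a, b, 1] \<notin> V"
proof -
  let ?X = "{z \<in> V. z $ 3 \<noteq> s $ 3}"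
  \<comment> \<open>The direction of the line from \<open>s\<close> to \<open>z\<close>, scaled to
    have third component 1. A value \<open>c\<close> missed by this map is a direction whose line
    through \<open>s\<close> avoids \<open>V\<close> except possibly at \<open>s\<close>.\<close>
  define \<pi> :: "complex^3 \<Rightarrow> complex^2" where
    "\<pi> z = (\<chi> k. (if k = 1 then z $ 1 - s $ 1 else z $ 2 - s $ 2) * inverse (z $ 3 - s $ 3))" for z
  have "negligible (\<pi> ` ?X)"
  proof (rule thin_negligible)
    show "thin ?X" by (rule thin_subset[OF assms]) auto
    fix x assume x: "x \<in> ?X"
    have "holo_at (\<lambda>z. \<pi> z $ k) x" for k
      using x by (cases "k = 1") (auto simp: \<pi>_def intro!: holo_at_mult holo_at_inverse holo_at_diff holo_at_coord holo_at_const)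
    from has_derivative_components[OF this] show "\<pi> differentiable (at x)"
      unfolding differentiable_def by blast
  qed
  then obtain c where c: "c \<notin> \<pi> ` ?X" using open_not_negligible[of UNIV] negligible_subset[of "\<pi> ` ?X" UNIV] by auto
  have "s + \<tau> *s vector [c $ 1, c $ 2, 1] \<notin> V" if "\<tau> \<noteq> 0" for \<tau>
  proof
    assume V: "s + \<tau> *s vector [c $ 1, c $ 2, 1] \<in> V"
    have "\<pi> (s + \<tau> *s vector [c $ 1, c $ 2, 1]) = c"
      using that by (simp add: \<pi>_def vec_eq_iff forall_2 vector_3)
    moreover have "s + \<tau> *s vector [c $ 1, c $ 2, 1] \<in> ?X" using V that by (simp add: vector_3)
    then have "\<pi> (s + \<tau> *s vector [c $ 1, c $ 2, 1]) \<in> \<pi> ` ?X" by (rule imageI)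
    ultimately show False using c by simp
  qed
  then show ?thesis using that by blast
qed

text \<open>One neighbourhood \<open>W\<close> is found before any function is given, because
  several functions are later extended together. Density of the complement of \<open>S\<close> is
  delivered with it, in order to carry identities over to \<open>S\<close>.\<close>

theorem Hartogs_thin:
  fixes \<Omega> S V :: "(complex^3) set"
  assumes \<Omega>: "open \<Omega>" "s \<in> \<Omega>" and S: "open (\<Omega> - S)" "S \<inter> \<Omega> \<subseteq> V" and V: "thin V"
  obtains W where "open W" "s \<in> W" "W \<subseteq> \<Omega>"
    "\<And>O'. open O' \<Longrightarrow> O' \<subseteq> W \<Longrightarrow> O' \<noteq> {} \<Longrightarrow> O' - S \<noteq> {}"
    "\<And>h. (\<And>z. z \<in> \<Omega> - S \<Longrightarrow> holo_at h z) \<Longrightarrow>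
       \<exists>h'. (\<forall>z\<in>W. holo_at h' z) \<and> (\<forall>z\<in>W - S. h' z = h z)"
proof -
  obtain a b where ab: "\<And>\<tau>. \<tau> \<noteq> 0 \<Longrightarrow> s + \<tau> *s vector [a, b, 1] \<notin> V"
    using thin_direction[OF V] by blast
  define d :: "complex^3" where "d = vector [a, b, 1]"
  have d3: "d $ 3 = 1" by (simp add: d_def vector_3)
  \<comment> \<open>Projection along \<open>d\<close>: its fibres are the lines in direction
    \<open>d\<close>, so a line avoids \<open>V\<close> when its image lies outside the image of
    \<open>V\<close>, a null set.\<close>
  define \<pi> :: "complex^3 \<Rightarrow> complex^2" where
    "\<pi> z = (\<chi> k. if k = 1 then z $ 1 - a * z $ 3 else z $ 2 - b * z $ 3)" for z
  have \<pi>d: "\<pi> (z + \<tau> *s d) = \<pi> z" for z \<tau>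
    by (simp add: \<pi>_def d_def vec_eq_iff forall_2 vector_3 algebra_simps)
  have negV: "negligible (\<pi> ` V)"
  proof (rule thin_negligible[OF V])
    fix x
    have "holo_at (\<lambda>z. \<pi> z $ k) x" for k
      by (cases "k = 1") (auto simp: \<pi>_def intro!: holo_at_cmult holo_at_diff holo_at_coord)
    from has_derivative_components[OF this] show "\<pi> differentiable (at x)"
      unfolding differentiable_def by blast
  qed
  have dense: "\<exists>z\<in>O'. \<pi> z \<notin> \<pi> ` V" if O': "open O'" "O' \<noteq> {}" for O'
  proof -
    obtain z0 where z0: "z0 \<in> O'" using O' by blast
    \<comment> \<open>The affine section of the projection through \<open>z0\<close>. If all of
      \<open>O'\<close> projected into the image of \<open>V\<close>, the non-empty open preimage of
      \<open>O'\<close> in C^2 would be a null set.\<close>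
    define \<sigma> :: "complex^2 \<Rightarrow> complex^3" where "\<sigma> y = vector [y $ 1 + a * z0 $ 3, y $ 2 + b * z0 $ 3, z0 $ 3]" for y
    have \<sigma>\<pi>: "\<pi> (\<sigma> y) = y" for y by (simp add: \<sigma>_def \<pi>_def vec_eq_iff forall_2 vector_3)
    have "holo_at (\<lambda>y. \<sigma> y $ k) y" for k y
      using exhaust_3[of k] by (auto simp: \<sigma>_def vector_3 intro!: holo_at_add holo_at_const holo_at_coord)
    then have "continuous_on UNIV \<sigma>" by (rule holo_components_continuous)
    then have "open (\<sigma> -` O')" using O'(1) by (rule open_vimage[rotated])
    moreover have "\<pi> z0 \<in> \<sigma> -` O'"
    proof -
      have "\<sigma> (\<pi> z0) = z0" by (simp add: \<sigma>_def \<pi>_def vec_eq_iff forall_3 vector_3)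
      then show ?thesis using z0 by simp
    qed
    ultimately have "\<not> negligible (\<sigma> -` O')" using open_not_negligible by blast
    then have "\<not> \<sigma> -` O' \<subseteq> \<pi> ` V" using negligible_subset[OF negV] by blast
    then obtain y where "\<sigma> y \<in> O'" "y \<notin> \<pi> ` V" by blast
    then show ?thesis using \<sigma>\<pi> by metis
  qed
  obtain R where R: "R > 0" "ball s R \<subseteq> \<Omega>" using \<Omega> openE by blast
  \<comment> \<open>The disc of radius \<open>r\<close> in direction \<open>d\<close> around
    \<open>s\<close> stays inside the ball of radius \<open>R\<close>.\<close>
  define r where "r = R / (2 * (norm d + 1))"
  have r: "r > 0" "r * norm d < R"
  proof -
    have nd: "norm d + 1 > 0" using norm_ge_zero[of d] by linarith
    then show "r > 0" using R by (simp add: r_def)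
    then have "r * norm d \<le> r * (norm d + 1)" by simp
    also have "\<dots> = R / 2" using nd by (simp add: r_def field_simps)
    finally show "r * norm d < R" using R by simp
  qed
  have nsd: "norm (c *s d) = cmod c * norm d" for c
    by (simp add: norm_vec_def L2_set_def norm_mult power_mult_distrib flip: sum_distrib_left)
      (simp add: real_sqrt_mult)
  have cont_line: "continuous_on X (\<lambda>\<zeta>. s + \<zeta> *s d)" for X by (intro continuous_intros)
  have disc: "(\<lambda>\<zeta>. s + \<zeta> *s d) ` cball 0 r \<subseteq> \<Omega>"
  proof
    fix z assume "z \<in> (\<lambda>\<zeta>. s + \<zeta> *s d) ` cball 0 r"
    then obtain \<zeta> where \<zeta>: "z = s + \<zeta> *s d" "\<zeta> \<in> cball 0 r" by (rule imageE)
    have "dist s z = cmod \<zeta> * norm d" by (simp add: \<zeta>(1) dist_norm nsd)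
    also have "\<dots> \<le> r * norm d" using \<zeta>(2) by (simp add: mult_right_mono)
    finally show "z \<in> \<Omega>" using r(2) R(2) by auto
  qed
  have circle: "(\<lambda>\<zeta>. s + \<zeta> *s d) ` sphere 0 r \<subseteq> \<Omega> - S"
  proof
    fix z assume z: "z \<in> (\<lambda>\<zeta>. s + \<zeta> *s d) ` sphere 0 r"
    then have "z \<in> \<Omega>" using disc sphere_cball[of 0 r] by blast
    moreover have "z \<notin> V" using z ab r(1) by (auto simp: d_def)
    ultimately show "z \<in> \<Omega> - S" using S(2) by blast
  qed
  obtain e1 where e1: "e1 > 0" "(\<Union>x\<in>(\<lambda>\<zeta>. s + \<zeta> *s d) ` cball 0 r. ball x e1) \<subseteq> \<Omega>"
    by (rule compact_subset_open_imp_ball_epsilon_subset[OF compact_continuous_image[OF cont_line compact_cball] \<Omega>(1) disc])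
  obtain e2 where e2: "e2 > 0" "(\<Union>x\<in>(\<lambda>\<zeta>. s + \<zeta> *s d) ` sphere 0 r. ball x e2) \<subseteq> \<Omega> - S"
    by (rule compact_subset_open_imp_ball_epsilon_subset[OF compact_continuous_image[OF cont_line compact_sphere] S(1) circle])
  \<comment> \<open>Replacing \<open>s\<close> by a point of \<open>W\<close> moves each point of
    the disc by less than \<open>e1\<close> and each point of the circle by less than
    \<open>e2\<close>. The bound by \<open>r\<close> keeps the parameter of the point itself inside
    the circle.\<close>
  define \<epsilon> where "\<epsilon> = min r (min e1 e2 / (1 + norm d))"
  have nd: "1 + norm d > 0" using norm_ge_zero[of d] by linarith
  have \<epsilon>: "\<epsilon> > 0" "\<epsilon> \<le> r" "\<epsilon> * (1 + norm d) \<le> e1" "\<epsilon> * (1 + norm d) \<le> e2"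
  proof -
    show "\<epsilon> > 0" "\<epsilon> \<le> r" using r e1 e2 nd by (auto simp: \<epsilon>_def)
    have "\<epsilon> * (1 + norm d) \<le> min e1 e2 / (1 + norm d) * (1 + norm d)"
      by (rule mult_right_mono) (use nd in \<open>auto simp: \<epsilon>_def\<close>)
    also have "\<dots> = min e1 e2" using nd by simp
    finally show "\<epsilon> * (1 + norm d) \<le> e1" "\<epsilon> * (1 + norm d) \<le> e2" by simp_all
  qed
  define W where "W = ball s \<epsilon>"
  \<comment> \<open>The line through \<open>z\<close> in direction \<open>d\<close>, with \<zeta>
    measuring the third coordinate from that of \<open>s\<close>. So \<open>z\<close> has the
    parameter \<open>z $ 3 - s $ 3\<close>, and the circle of integration in \<zeta> is the same for
    all \<open>z\<close>.\<close>
  define L where "L z \<zeta> = z + (\<zeta> - (z $ 3 - s $ 3)) *s d" for z \<zeta>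
  have z3: "cmod (z $ 3 - s $ 3) < \<epsilon>" if "z \<in> W" for z
    using that Finite_Cartesian_Product.norm_nth_le[of "z - s" 3] by (simp add: W_def dist_norm norm_minus_commute)
  have close: "dist (s + \<zeta> *s d) (L z \<zeta>) < \<epsilon> * (1 + norm d)" if z: "z \<in> W" for z \<zeta>
  proof -
    have "L z \<zeta> - (s + \<zeta> *s d) = (z - s) - (z $ 3 - s $ 3) *s d"
      by (simp add: L_def vec_eq_iff algebra_simps)
    then have "dist (s + \<zeta> *s d) (L z \<zeta>) \<le> norm (z - s) + cmod (z $ 3 - s $ 3) * norm d"
      unfolding dist_norm norm_minus_commute[of _ "L z \<zeta>"] nsd[symmetric] by (metis norm_triangle_ineq4)
    also have "\<dots> < \<epsilon> + \<epsilon> * norm d"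
    proof (rule add_less_le_mono)
      show "norm (z - s) < \<epsilon>" using z by (simp add: W_def dist_norm norm_minus_commute)
      show "cmod (z $ 3 - s $ 3) * norm d \<le> \<epsilon> * norm d" using z3[OF z] by (simp add: mult_right_mono)
    qed
    finally show ?thesis by (simp add: algebra_simps)
  qed
  have L1: "L z \<zeta> \<in> \<Omega>" if "z \<in> W" "cmod \<zeta> \<le> r" for z \<zeta>
  proof -
    have "L z \<zeta> \<in> ball (s + \<zeta> *s d) e1" using close[OF that(1), of \<zeta>] \<epsilon>(3) by simp
    then show ?thesis using e1(2) that(2) by fastforce
  qed
  have L2: "L z \<zeta> \<in> \<Omega> - S" if "z \<in> W" "cmod \<zeta> = r" for z \<zeta>
  proof -
    have "L z \<zeta> \<in> ball (s + \<zeta> *s d) e2" using close[OF that(1), of \<zeta>] \<epsilon>(4) by simp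
    moreover have "s + \<zeta> *s d \<in> (\<lambda>\<zeta>. s + \<zeta> *s d) ` sphere 0 r" by (rule imageI) (simp add: that)
    ultimately have "L z \<zeta> \<in> (\<Union>x\<in>(\<lambda>\<zeta>. s + \<zeta> *s d) ` sphere 0 r. ball x e2)" by (rule UN_I[rotated])
    then show ?thesis by (rule subsetD[OF e2(2)])
  qed
  have L0: "L z (z $ 3 - s $ 3) = z" for z by (simp add: L_def)
  have W\<Omega>: "W \<subseteq> \<Omega>"
  proof
    fix z assume z: "z \<in> W"
    have "cmod (z $ 3 - s $ 3) \<le> r" using z3[OF z] \<epsilon>(2) by simp
    from L1[OF z this] show "z \<in> \<Omega>" by (simp only: L0)
  qed
  have hL: "holo_at (\<lambda>z. L z \<zeta> $ k) z" for \<zeta> k z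
    unfolding L_def vector_add_component vector_smult_component
    by (intro holo_at_add holo_at_mult holo_at_diff holo_at_coord holo_at_const)
  have dS: "O' - S \<noteq> {}" if "open O'" "O' \<subseteq> W" "O' \<noteq> {}" for O'
    using dense[OF that(1,3)] S(2) that(2) W\<Omega> by blast
  have "\<exists>h'. (\<forall>z\<in>W. holo_at h' z) \<and> (\<forall>z\<in>W - S. h' z = h z)" if h: "\<And>z. z \<in> \<Omega> - S \<Longrightarrow> holo_at h z" for h
  proof -
    \<comment> \<open>Cauchy's integrand for \<open>h\<close> on this line. The factor
      \<open>circ r t\<close> comes from d\<zeta>; the constant 2 pi i has been cancelled.\<close>
    define g where "g z t = h (L z (circ r t)) * circ r t * inverse (circ r t - (z $ 3 - s $ 3))" for z t
    define h' where "h' z = integral (cbox 0 1) (g z)" for z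
    have nz: "circ r t - (z $ 3 - s $ 3) \<noteq> 0" if "z \<in> W" for z t
      using z3[OF that] \<epsilon>(2) norm_circ[of r t] r(1) by (metis eq_iff_diff_eq_0 not_less less_imp_le)
    have Lc: "L z (circ r t) \<in> \<Omega> - S" if "z \<in> W" for z t by (rule L2[OF that]) (use norm_circ[of r t] r(1) in simp)
    have hh': "holo_at h' z" if "z \<in> W" for z
      unfolding h'_def
    proof (rule holo_at_param_integral[OF _ _ _ that])
      show "open W" by (simp add: W_def)
      have cL: "continuous_on (W \<times> cbox 0 1) (\<lambda>p. L (fst p) (circ r (snd p)))"
        unfolding L_def by (intro continuous_intros)
      have cL': "continuous_on (W \<times> cbox 0 1) (\<lambda>p. h (L (fst p) (circ r (snd p))))"
      proof (rule continuous_on_compose2[of "\<Omega> - S" h, OF _ cL])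
        show "continuous_on (\<Omega> - S) h" by (rule holo_at_continuous_on[OF h])
      qed (use Lc in auto)
      show "continuous_on (W \<times> cbox 0 1) (\<lambda>(z, t). g z t)"
        unfolding g_def split_beta
        by (intro continuous_intros cL') (use nz in auto)
      show "holo_at (\<lambda>z. g z t) z" if "z \<in> W" for z t
        unfolding g_def
        by (intro holo_at_mult holo_at_const holo_at_inverse nz that holo_at_diff holo_at_coord
            holo_at_compose[where f = h and F = "\<lambda>z. L z (circ r t)"] hL h Lc)
    qed
    have eq: "h' z = h z" if z: "z \<in> W" "\<pi> z \<notin> \<pi> ` V" for z
    proof -
      let ?w = "z $ 3 - s $ 3"
      let ?u = "\<lambda>\<zeta>. h (L z \<zeta>)"
      have LS: "L z \<zeta> \<in> \<Omega> - S" if "cmod \<zeta> \<le> r" for \<zeta>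
      proof -
        have "\<pi> (L z \<zeta>) = \<pi> z" by (simp only: L_def \<pi>d)
        then have "L z \<zeta> \<notin> V" using z(2) by (metis imageI)
        then show ?thesis using L1[OF z(1) that] S(2) by blast
      qed
      have Leq: "L z = (\<lambda>\<zeta>. (z - ?w *s d) + \<zeta> *s d)" by (rule ext) (simp add: L_def vec_eq_iff algebra_simps)
      have du: "?u field_differentiable (at \<zeta>)" if "cmod \<zeta> \<le> r" for \<zeta>
      proof -
        have "holo_at h (z - ?w *s d + \<zeta> *s d)" using h[OF LS[OF that]] by (simp only: Leq)
        from holo_line[OF this] show ?thesis unfolding field_differentiable_def Leq by (rule exI)
      qed
      have "((\<lambda>\<zeta>. ?u \<zeta> / (\<zeta> - ?w)) has_contour_integral (2 * of_real pi * \<i> * ?u ?w)) (circlepath 0 r)"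
      proof (rule Cauchy_integral_circlepath[where f = ?u and w = ?w])
        show "continuous_on (cball 0 r) ?u"
          by (intro continuous_at_imp_continuous_on ballI field_differentiable_imp_continuous_at du) simp
        show "?u holomorphic_on ball 0 r"
          unfolding holomorphic_on_def by (auto intro!: field_differentiable_at_within du)
        show "cmod (?w - 0) < r" using z3[OF z(1)] \<epsilon>(2) by simp
      qed
      from contour_integral_unique[OF this]
      have "integral {0..1} (\<lambda>t. ?u (circ r t) / (circ r t - ?w) * circ r t) = h z"
        unfolding contour_integral_circlepath_circ by (simp add: L0)
      moreover have "g z = (\<lambda>t. ?u (circ r t) / (circ r t - ?w) * circ r t)"
        by (rule ext) (simp add: g_def divide_inverse mult_ac)
      ultimately show ?thesis by (simp add: h'_def)
    qed
    \<comment> \<open>Both functions are continuous off \<open>S\<close>. If they differed at a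
      point they would differ on an open set, and this would contain a point whose line avoids
      \<open>V\<close>.\<close>
    have "h' z = h z" if z: "z \<in> W - S" for z
    proof (rule ccontr)
      assume ne: "h' z \<noteq> h z"
      let ?O = "W \<inter> (\<Omega> - S)"
      have oO: "open ?O" using S(1) by (auto simp: W_def)
      have zO: "z \<in> ?O" using z W\<Omega> by blast
      have "continuous_on ?O (\<lambda>z. h' z - h z)"
        by (intro continuous_intros holo_at_continuous_on) (use hh' h in auto)
      then have "open (?O \<inter> (\<lambda>z. h' z - h z) -` (- {0}))"
        by (rule continuous_open_preimage[OF _ oO]) auto
      moreover have "z \<in> ?O \<inter> (\<lambda>z. h' z - h z) -` (- {0})" using zO ne by simp
      ultimately obtain w where "w \<in> ?O" "h' w \<noteq> h w" "\<pi> w \<notin> \<pi> ` V" using dense by fastforce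
      then show False using eq by blast
    qed
    then show ?thesis using hh' by blast
  qed
  then show ?thesis using that[of W] \<epsilon>(1) W\<Omega> dS by (simp add: W_def)
qed

section \<open>Germs of holomorphic functions and maps on a manifold\<close>

text \<open>Germs at \<open>p\<close> are treated as statements that hold eventually in this filter,
  so that neighbourhoods rarely have to be named.\<close>

abbreviation nh :: "('a, 'n::finite) atlas \<Rightarrow> 'a \<Rightarrow> 'a filter" where
  "nh A p \<equiv> nhdsin (mtop A) p"

lemma pointsE:
  assumes "p \<in> points A"
  obtains U \<kappa> where "(U, \<kappa>) \<in> A" "p \<in> U"
  using assms unfolding points_def by blast

lemma chart_subset_points: "(U, \<kappa>) \<in> A \<Longrightarrow> U \<subseteq> points A"
  unfolding points_def by blast

context
  fixes A :: "('a, 'n::finite) atlas"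
  assumes cA: "compatible_charts A"
begin

lemma chart_inv:
  assumes "(U, \<kappa>) \<in> A"
  shows "inj_on \<kappa> U" "z \<in> \<kappa> ` U \<Longrightarrow> inv_into U \<kappa> z \<in> U" "z \<in> \<kappa> ` U \<Longrightarrow> \<kappa> (inv_into U \<kappa> z) = z"
    "p \<in> U \<Longrightarrow> inv_into U \<kappa> (\<kappa> p) = p"
proof -
  show i: "inj_on \<kappa> U" by (rule compatible_chartsD(1)[OF cA assms assms])
  show "z \<in> \<kappa> ` U \<Longrightarrow> inv_into U \<kappa> z \<in> U" by (rule inv_into_into)
  show "z \<in> \<kappa> ` U \<Longrightarrow> \<kappa> (inv_into U \<kappa> z) = z" by (rule f_inv_into_f)
  show "p \<in> U \<Longrightarrow> inv_into U \<kappa> (\<kappa> p) = p" by (rule inv_into_f_f[OF i])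
qed

lemma open_chart_image:
  assumes "openin (mtop A) W" "(U, \<kappa>) \<in> A"
  shows "open (\<kappa> ` (U \<inter> W))"
  using assms unfolding openin_mtop[OF cA] by (auto simp: Int_commute)

lemma continuous_on_transition:
  assumes "(U, \<kappa>) \<in> A" "(V, \<eta>) \<in> A"
  shows "continuous_on (\<kappa> ` (U \<inter> V)) (\<lambda>z. \<eta> (inv_into U \<kappa> z))"
  by (rule holo_components_continuous) (rule compatible_chartsD(3)[OF cA assms, unfolded holo_Cn_iff, rule_format])

lemma open_chart_preimage:
  assumes U: "(U, \<kappa>) \<in> A" and O: "open Q"
  shows "openin (mtop A) (U \<inter> \<kappa> -` Q)"
  unfolding openin_mtop[OF cA]
proof (intro conjI ballI)
  show "U \<inter> \<kappa> -` Q \<subseteq> points A" using chart_subset_points[OF U] by blast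
  fix c assume "c \<in> A"
  then obtain V \<eta> where V: "c = (V, \<eta>)" "(V, \<eta>) \<in> A" by (cases c) auto
  have "\<eta> ` (U \<inter> \<kappa> -` Q \<inter> V) = \<eta> ` (V \<inter> U) \<inter> (\<lambda>z. \<kappa> (inv_into V \<eta> z)) -` Q"
    using chart_inv(4)[OF V(2)] by (auto intro!: imageI)
  moreover have "open (\<eta> ` (V \<inter> U) \<inter> (\<lambda>z. \<kappa> (inv_into V \<eta> z)) -` Q)"
    by (rule continuous_open_preimage[OF continuous_on_transition[OF V(2) U] compatible_chartsD(2)[OF cA V(2) U] O])
  ultimately show "case c of (V, \<eta>) \<Rightarrow> open (\<eta> ` (U \<inter> \<kappa> -` Q \<inter> V))"
    unfolding V(1) prod.case by (simp only:)
qed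

lemma openin_chart: "(U, \<kappa>) \<in> A \<Longrightarrow> openin (mtop A) U"
  using open_chart_preimage[of U \<kappa> UNIV] by simp

lemma open_chart: "(U, \<kappa>) \<in> A \<Longrightarrow> open (\<kappa> ` U)"
  using compatible_chartsD(2)[OF cA, of U \<kappa> U \<kappa>] by simp

lemma nh_self: "eventually P (nh A p) \<Longrightarrow> p \<in> points A \<Longrightarrow> P p"
  unfolding eventually_nhdsin topspace_mtop[OF cA] by blast

lemma nh_open: "openin (mtop A) W \<Longrightarrow> p \<in> W \<Longrightarrow> eventually (\<lambda>q. q \<in> W) (nh A p)"
  unfolding eventually_nhdsin by blast

lemma nh_chart: "(U, \<kappa>) \<in> A \<Longrightarrow> p \<in> U \<Longrightarrow> eventually (\<lambda>q. q \<in> U) (nh A p)"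
  by (rule nh_open[OF openin_chart])

lemma nh_points: "p \<in> points A \<Longrightarrow> eventually (\<lambda>q. q \<in> points A) (nh A p)"
  using nh_open[of "points A" p] openin_topspace[of "mtop A"] unfolding topspace_mtop[OF cA] by blast

lemma eventually_nhE:
  assumes "eventually P (nh A p)" "p \<in> points A"
  obtains W where "openin (mtop A) W" "p \<in> W" "\<And>q. q \<in> W \<Longrightarrow> P q"
  using assms unfolding eventually_nhdsin topspace_mtop[OF cA] by blast

lemma eventually_eventually_nh: "eventually P (nh A p) \<Longrightarrow> eventually (\<lambda>q. eventually P (nh A q)) (nh A p)"
  unfolding eventually_nhdsin by blast

text \<open>A chart is a homeomorphism onto an open set, so neighbourhoods of \<open>p\<close> can
  be computed in any one chart.\<close>

lemma eventually_nh_iff: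
  assumes U: "(U, \<kappa>) \<in> A" and p: "p \<in> U"
  shows "eventually P (nh A p) \<longleftrightarrow> eventually (\<lambda>z. P (inv_into U \<kappa> z)) (nhds (\<kappa> p))"
proof
  assume "eventually P (nh A p)"
  then obtain W where W: "openin (mtop A) W" "p \<in> W" "\<And>q. q \<in> W \<Longrightarrow> P q"
    using eventually_nhE[of P p] chart_subset_points[OF U] p by blast
  show "eventually (\<lambda>z. P (inv_into U \<kappa> z)) (nhds (\<kappa> p))"
    unfolding eventually_nhds
  proof (intro exI conjI ballI)
    show "open (\<kappa> ` (U \<inter> W))" by (rule open_chart_image[OF W(1) U])
    show "\<kappa> p \<in> \<kappa> ` (U \<inter> W)" using p W(2) by blast
    fix z assume "z \<in> \<kappa> ` (U \<inter> W)"
    then show "P (inv_into U \<kappa> z)" using W(3) chart_inv(4)[OF U] by auto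
  qed
next
  assume "eventually (\<lambda>z. P (inv_into U \<kappa> z)) (nhds (\<kappa> p))"
  then obtain Q where Q: "open Q" "\<kappa> p \<in> Q" "\<And>z. z \<in> Q \<Longrightarrow> P (inv_into U \<kappa> z)"
    unfolding eventually_nhds by blast
  have "P q" if "q \<in> U \<inter> \<kappa> -` Q" for q
    using Q(3)[of "\<kappa> q"] that chart_inv(4)[OF U] by auto
  then show "eventually P (nh A p)"
    unfolding eventually_nhdsin using open_chart_preimage[OF U Q(1)] Q(2) p by blast
qed

lemma nhds_chart: "(U, \<kappa>) \<in> A \<Longrightarrow> p \<in> U \<Longrightarrow> eventually (\<lambda>z. z \<in> \<kappa> ` U) (nhds (\<kappa> p))"
  by (rule eventually_nhds_in_open[OF open_chart]) auto

lemma holo_near_points: "holo_near A p f \<Longrightarrow> p \<in> points A"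
  unfolding holo_near_def using openin_subset topspace_mtop[OF cA] by blast

lemma eventually_holo_near: "holo_near A p f \<Longrightarrow> eventually (\<lambda>q. holo_near A q f) (nh A p)"
  unfolding holo_near_def eventually_nhdsin by blast

text \<open>\<open>holo_fun\<close> quantifies over all charts; since transition functions are
  holomorphic, a single chart decides.\<close>

lemma holo_near_iff:
  assumes U: "(U, \<kappa>) \<in> A" and p: "p \<in> U"
  shows "holo_near A p f \<longleftrightarrow> eventually (holo_at (\<lambda>z. f (inv_into U \<kappa> z))) (nhds (\<kappa> p))"
proof
  assume "holo_near A p f"
  then obtain W where W: "openin (mtop A) W" "p \<in> W" "holo_fun A W f" unfolding holo_near_def by blast
  then have h: "holo_Cn (\<lambda>z. f (inv_into U \<kappa> z)) (\<kappa> ` (U \<inter> W))" using U unfolding holo_fun_def by blast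
  have "\<kappa> p \<in> \<kappa> ` (U \<inter> W)" using p W(2) by blast
  then show "eventually (holo_at (\<lambda>z. f (inv_into U \<kappa> z))) (nhds (\<kappa> p))"
    unfolding eventually_nhds using open_chart_image[OF W(1) U] h unfolding holo_Cn_iff by blast
next
  assume "eventually (holo_at (\<lambda>z. f (inv_into U \<kappa> z))) (nhds (\<kappa> p))"
  then obtain Q where Q: "open Q" "\<kappa> p \<in> Q" "\<And>z. z \<in> Q \<Longrightarrow> holo_at (\<lambda>z. f (inv_into U \<kappa> z)) z"
    unfolding eventually_nhds by blast
  let ?W = "U \<inter> \<kappa> -` Q"
  have "holo_Cn (\<lambda>z. f (inv_into V \<eta> z)) (\<eta> ` (V \<inter> ?W))" if V: "(V, \<eta>) \<in> A" for V \<eta>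
    unfolding holo_Cn_iff
  proof
    fix z assume z: "z \<in> \<eta> ` (V \<inter> ?W)"
    let ?T = "\<lambda>z. \<kappa> (inv_into V \<eta> z)"
    have zV: "z \<in> \<eta> ` (V \<inter> U)" and TQ: "?T z \<in> Q" using z chart_inv(4)[OF V] by auto
    have hT: "holo_at (\<lambda>z. ?T z $ i) z" for i
      using compatible_chartsD(3)[OF cA V U, of i] zV unfolding holo_Cn_iff by blast
    have "holo_at (\<lambda>z. f (inv_into U \<kappa> (?T z))) z"
      by (rule holo_at_compose[where F = ?T, OF hT Q(3)[OF TQ]])
    moreover have "eventually (\<lambda>w. f (inv_into U \<kappa> (?T w)) = f (inv_into V \<eta> w)) (nhds z)"
      using eventually_nhds_in_open[OF compatible_chartsD(2)[OF cA V U] zV]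
    proof eventually_elim
      case (elim w)
      then have "inv_into V \<eta> w \<in> U" using chart_inv(4)[OF V] by auto
      then show ?case using chart_inv(4)[OF U] by simp
    qed
    ultimately show "holo_at (\<lambda>z. f (inv_into V \<eta> z)) z" by (rule holo_at_cong(1))
  qed
  then have "holo_fun A ?W f" unfolding holo_fun_def by blast
  then show "holo_near A p f" unfolding holo_near_def using open_chart_preimage[OF U Q(1)] p Q(2) by blast
qed

lemma holo_near_cong:
  assumes "eventually (\<lambda>q. f q = g q) (nh A p)" "holo_near A p f"
  shows "holo_near A p g"
proof -
  obtain U \<kappa> where U: "(U, \<kappa>) \<in> A" "p \<in> U" using pointsE[OF holo_near_points[OF assms(2)]] by blast
  from eventually_eventually[THEN iffD2, OF assms(1)[unfolded eventually_nh_iff[OF U]]]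
    assms(2)[unfolded holo_near_iff[OF U]]
  show ?thesis unfolding holo_near_iff[OF U]
    by eventually_elim (rule holo_at_cong(1))
qed

lemma holo_near_const: "p \<in> points A \<Longrightarrow> holo_near A p (\<lambda>q. c)"
  by (erule pointsE) (simp add: holo_near_iff always_eventually holo_at_const)

lemma holo_near_chart_fun:
  assumes U: "(U, \<kappa>) \<in> A" "p \<in> U" and g: "eventually (holo_at g) (nhds (\<kappa> p))"
  shows "holo_near A p (\<lambda>q. g (\<kappa> q))"
  unfolding holo_near_iff[OF U]
  using g eventually_eventually[THEN iffD2, OF nhds_chart[OF U]]
proof eventually_elim
  case (elim z)
  show ?case
    by (rule holo_at_cong(1)[OF elim(1)], rule eventually_mono[OF elim(2)]) (simp add: chart_inv(3)[OF U(1)])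
qed

lemma holo_near_coord: "(U, \<kappa>) \<in> A \<Longrightarrow> p \<in> U \<Longrightarrow> holo_near A p (\<lambda>q. \<kappa> q $ i)"
  by (rule holo_near_chart_fun, assumption+) (intro always_eventually allI holo_at_coord)

lemma holo_near_add: "holo_near A p (\<lambda>q. f q + g q)"
  and holo_near_mult: "holo_near A p (\<lambda>q. f q * g q)"
  and holo_near_diff: "holo_near A p (\<lambda>q. f q - g q)"
  if f: "holo_near A p f" and g: "holo_near A p g"
proof -
  obtain U \<kappa> where U: "(U, \<kappa>) \<in> A" "p \<in> U" using pointsE[OF holo_near_points[OF f]] by blast
  note * = f[unfolded holo_near_iff[OF U]] g[unfolded holo_near_iff[OF U]]
  show "holo_near A p (\<lambda>q. f q + g q)" "holo_near A p (\<lambda>q. f q * g q)" "holo_near A p (\<lambda>q. f q - g q)"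
    unfolding holo_near_iff[OF U]
    by (rule eventually_elim2[OF *], erule (1) holo_at_add)
      (rule eventually_elim2[OF *], erule (1) holo_at_mult, rule eventually_elim2[OF *], erule (1) holo_at_diff)
qed

lemma holo_near_cmult: "holo_near A p f \<Longrightarrow> holo_near A p (\<lambda>q. c * f q)"
  by (rule holo_near_mult) (auto intro: holo_near_const holo_near_points)

lemma holo_near_uminus: "holo_near A p f \<Longrightarrow> holo_near A p (\<lambda>q. - f q)"
  using holo_near_cmult[of p f "- 1"] by simp

lemma holo_near_sum: "p \<in> points A \<Longrightarrow> (\<And>i. i \<in> I \<Longrightarrow> holo_near A p (f i)) \<Longrightarrow> holo_near A p (\<lambda>q. \<Sum>i\<in>I. f i q)"
  by (induction I rule: infinite_finite_induct) (auto intro: holo_near_const holo_near_add)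

lemma holo_near_tendsto:
  assumes "holo_near A p f"
  shows "filterlim f (nhds (f p)) (nh A p)"
proof -
  obtain U \<kappa> where U: "(U, \<kappa>) \<in> A" "p \<in> U" using pointsE[OF holo_near_points[OF assms]] by blast
  have "holo_at (\<lambda>z. f (inv_into U \<kappa> z)) (\<kappa> p)"
    using assms unfolding holo_near_iff[OF U] by (rule eventually_nhds_x_imp_x)
  from isCont_nhds[OF holo_at_isCont[OF this]] show ?thesis
    unfolding filterlim_iff eventually_nh_iff[OF U] chart_inv(4)[OF U] by simp
qed

lemma holo_near_eventually_in:
  assumes "holo_near A p f" "open Q" "f p \<in> Q"
  shows "eventually (\<lambda>q. f q \<in> Q) (nh A p)"
  using topological_tendstoD[OF holo_near_tendsto[OF assms(1)] assms(2,3)] .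

lemma holo_near_nonzero: "holo_near A p f \<Longrightarrow> f p \<noteq> 0 \<Longrightarrow> eventually (\<lambda>q. f q \<noteq> 0) (nh A p)"
  using holo_near_eventually_in[of p f "- {0}"] by (simp add: open_Compl)

lemma holo_near_frequently_zero:
  assumes "holo_near A p f" "frequently (\<lambda>q. f q = 0) (nh A p)"
  shows "f p = 0"
  using holo_near_nonzero[OF assms(1)] assms(2) unfolding frequently_def by blast

lemma holo_near_outer:
  assumes f: "holo_near A p f" and \<phi>: "open Q" "\<phi> holomorphic_on Q" "f p \<in> Q"
  shows "holo_near A p (\<lambda>q. \<phi> (f q))"
proof -
  obtain U \<kappa> where U: "(U, \<kappa>) \<in> A" "p \<in> U" using pointsE[OF holo_near_points[OF f]] by blast
  from holo_near_eventually_in[OF f \<phi>(1,3), unfolded eventually_nh_iff[OF U]] f[unfolded holo_near_iff[OF U]]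
  show ?thesis unfolding holo_near_iff[OF U]
  proof eventually_elim
    case (elim z)
    have "\<phi> field_differentiable (at (f (inv_into U \<kappa> z)))"
      using \<phi>(2) elim(1) holomorphic_on_imp_differentiable_at[OF _ \<phi>(1)] by blast
    then show ?case by (rule holo_at_outer[OF elim(2)])
  qed
qed

lemma holo_near_inverse: "holo_near A p f \<Longrightarrow> f p \<noteq> 0 \<Longrightarrow> holo_near A p (\<lambda>q. inverse (f q))"
  by (rule holo_near_outer[of _ _ "- {0}"]) (auto intro!: holomorphic_intros)

lemma holo_near_divide: "holo_near A p f \<Longrightarrow> holo_near A p g \<Longrightarrow> g p \<noteq> 0 \<Longrightarrow> holo_near A p (\<lambda>q. f q / g q)"
  unfolding divide_inverse by (intro holo_near_mult holo_near_inverse)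

end

text \<open>Dividing by \<open>f p\<close> moves the value at \<open>p\<close> to 1, away from the
  cut of \<open>csqrt\<close>. The identity for the square holds at every \<open>q\<close>, even
  where the root is not holomorphic, which saves a neighbourhood later.\<close>

lemma holo_near_sqrt:
  assumes cA: "compatible_charts A" and f: "holo_near A p f" and nz: "f p \<noteq> 0"
  shows "\<exists>r. holo_near A p r \<and> (\<forall>q. (r q)\<^sup>2 = f q)"
proof (intro exI conjI allI)
  let ?r = "\<lambda>q. csqrt (f p) * csqrt (inverse (f p) * f q)"
  have 1: "holo_near A p (\<lambda>q. inverse (f p) * f q)" by (rule holo_near_cmult[OF cA f])
  have "holo_near A p (\<lambda>q. csqrt (inverse (f p) * f q))"
  proof (rule holo_near_outer[OF cA 1, of "- \<real>\<^sub>\<le>\<^sub>0"])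
    show "open (- \<real>\<^sub>\<le>\<^sub>0 :: complex set)" by (simp add: open_Compl)
    show "csqrt holomorphic_on - \<real>\<^sub>\<le>\<^sub>0" by (rule holomorphic_on_csqrt)
    show "inverse (f p) * f p \<in> - \<real>\<^sub>\<le>\<^sub>0" using nz by simp
  qed
  then show "holo_near A p ?r" by (rule holo_near_cmult[OF cA])
  show "(?r q)\<^sup>2 = f q" for q using nz by (simp add: power_mult_distrib)
qed

text \<open>Holomorphy of a map at a point, as continuity together with pullback of holomorphic
  germs. No charts occur, so composition is immediate; \<open>hmap_chartI\<close> and
  \<open>holo_map_iff\<close> connect it with coordinates.\<close>

definition hmap :: "('a, 'n::finite) atlas \<Rightarrow> ('b, 'm::finite) atlas \<Rightarrow> 'a \<Rightarrow> ('a \<Rightarrow> 'b) \<Rightarrow> bool" where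
  "hmap A B x F \<longleftrightarrow> x \<in> points A \<and> F x \<in> points B \<and> filterlim F (nh B (F x)) (nh A x) \<and>
     (\<forall>f. holo_near B (F x) f \<longrightarrow> holo_near A x (\<lambda>q. f (F q)))"

lemma hmapD:
  assumes "hmap A B x F"
  shows "x \<in> points A" "F x \<in> points B" "filterlim F (nh B (F x)) (nh A x)"
    "holo_near B (F x) f \<Longrightarrow> holo_near A x (\<lambda>q. f (F q))"
  using assms unfolding hmap_def by auto

lemma hmap_eventually: "hmap A B x F \<Longrightarrow> eventually P (nh B (F x)) \<Longrightarrow> eventually (\<lambda>q. P (F q)) (nh A x)"
  using hmapD(3)[of A B x F] unfolding filterlim_iff by blast

lemma hmap_compose:
  assumes "hmap A B x F" "hmap B C (F x) G"
  shows "hmap A C x (\<lambda>q. G (F q))"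
  unfolding hmap_def
  using hmapD[OF assms(1)] hmapD[OF assms(2)] filterlim_compose[OF hmapD(3)[OF assms(2)] hmapD(3)[OF assms(1)]]
  by blast

lemma hmap_id: "x \<in> points A \<Longrightarrow> hmap A A x (\<lambda>q. q)"
  unfolding hmap_def by (simp add: filterlim_ident)

lemma hmap_cong:
  assumes cA: "compatible_charts A" and F: "hmap A B x F" and eq: "eventually (\<lambda>q. F q = G q) (nh A x)"
  shows "hmap A B x G"
proof -
  have x: "F x = G x" by (rule nh_self[OF cA eq hmapD(1)[OF F]])
  have "filterlim G (nh B (F x)) (nh A x)"
    by (rule filterlim_cong[THEN iffD1, OF refl refl eq hmapD(3)[OF F]])
  moreover have "holo_near A x (\<lambda>q. f (G q))" if "holo_near B (F x) f" for f
    by (rule holo_near_cong[OF cA _ hmapD(4)[OF F that]], rule eventually_mono[OF eq]) simp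
  ultimately show ?thesis using hmapD(1,2)[OF F] unfolding hmap_def x by blast
qed

lemma hmap_chartI:
  fixes A :: "('a, 'n::finite) atlas" and B :: "('b, 'm::finite) atlas"
  assumes cA: "compatible_charts A" and cB: "compatible_charts B" and x: "x \<in> points A"
    and V: "(V, \<eta>) \<in> B" and ev: "eventually (\<lambda>q. F q \<in> V) (nh A x)"
    and h: "\<And>i. holo_near A x (\<lambda>q. \<eta> (F q) $ i)"
  shows "hmap A B x F"
proof -
  have FV: "F x \<in> V" by (rule nh_self[OF cA ev x])
  obtain U \<kappa> where U: "(U, \<kappa>) \<in> A" "x \<in> U" using pointsE[OF x] by blast
  have lim: "filterlim (\<lambda>q. \<eta> (F q)) (nhds (\<eta> (F x))) (nh A x)"
    by (rule vec_tendstoI) (rule holo_near_tendsto[OF cA h])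
  have "filterlim F (nh B (F x)) (nh A x)"
    unfolding filterlim_iff
  proof (intro allI impI)
    fix P assume "eventually P (nh B (F x))"
    then have "eventually (\<lambda>z. P (inv_into V \<eta> z)) (nhds (\<eta> (F x)))"
      unfolding eventually_nh_iff[OF cB V FV] .
    then have "eventually (\<lambda>q. P (inv_into V \<eta> (\<eta> (F q)))) (nh A x)"
      using lim unfolding filterlim_iff by blast
    with ev show "eventually (\<lambda>q. P (F q)) (nh A x)"
      by eventually_elim (simp add: chart_inv(4)[OF cB V])
  qed
  moreover have "holo_near A x (\<lambda>q. f (F q))" if f: "holo_near B (F x) f" for f
  proof -
    have "eventually (\<lambda>q. holo_at (\<lambda>z. f (inv_into V \<eta> z)) (\<eta> (F q))) (nh A x)"
      using lim f[unfolded holo_near_iff[OF cB V FV]] unfolding filterlim_iff by blast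
    then have 1: "eventually (\<lambda>z. holo_at (\<lambda>z. f (inv_into V \<eta> z)) (\<eta> (F (inv_into U \<kappa> z)))) (nhds (\<kappa> x))"
      unfolding eventually_nh_iff[OF cA U] .
    have 2: "eventually (\<lambda>z. \<forall>i\<in>UNIV. holo_at (\<lambda>z. \<eta> (F (inv_into U \<kappa> z)) $ i) z) (nhds (\<kappa> x))"
      using h unfolding holo_near_iff[OF cA U] by (intro eventually_ball_finite ballI) auto
    have "holo_near A x (\<lambda>q. f (inv_into V \<eta> (\<eta> (F q))))"
      unfolding holo_near_iff[OF cA U] using 1 2
    proof eventually_elim
      case (elim z)
      show ?case
        by (rule holo_at_compose[where F = "\<lambda>z. \<eta> (F (inv_into U \<kappa> z))" and f = "\<lambda>z. f (inv_into V \<eta> z)"])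
          (use elim in auto)
    qed
    then show ?thesis
    proof (rule holo_near_cong[OF cA, rotated])
      show "eventually (\<lambda>q. f (inv_into V \<eta> (\<eta> (F q))) = f (F q)) (nh A x)"
        using ev by eventually_elim (simp add: chart_inv(4)[OF cB V])
    qed
  qed
  moreover have "F x \<in> points B" using FV chart_subset_points[OF V] by blast
  ultimately show ?thesis using x unfolding hmap_def by blast
qed

lemma hmap_coord:
  assumes "compatible_charts B" "hmap A B x F" "(V, \<eta>) \<in> B" "F x \<in> V"
  shows "eventually (\<lambda>q. F q \<in> V) (nh A x)" "holo_near A x (\<lambda>q. \<eta> (F q) $ i)"
  using hmap_eventually[OF assms(2) nh_chart[OF assms(1,3,4)]]
    hmapD(4)[OF assms(2) holo_near_coord[OF assms(1,3,4)]] by auto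

lemma holo_map_iff:
  assumes cA: "compatible_charts A" and cB: "compatible_charts B"
  shows "holo_map A B F \<longleftrightarrow> (\<forall>x\<in>points A. hmap A B x F)"
proof
  assume F: "holo_map A B F"
  then have cF: "continuous_map (mtop A) (mtop B) F" unfolding holo_map_def by blast
  show "\<forall>x\<in>points A. hmap A B x F"
  proof
    fix x assume x: "x \<in> points A"
    have "F x \<in> points B" using cF x topspace_mtop[OF cA] topspace_mtop[OF cB]
      unfolding continuous_map_def by auto
    then obtain V \<eta> where V: "(V, \<eta>) \<in> B" "F x \<in> V" by (rule pointsE)
    obtain U \<kappa> where U: "(U, \<kappa>) \<in> A" "x \<in> U" using pointsE[OF x] by blast
    have o: "openin (mtop A) {q \<in> points A. F q \<in> V}"
      using openin_continuous_map_preimage[OF cF openin_chart[OF cB V(1)]] unfolding topspace_mtop[OF cA] .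
    have ev: "eventually (\<lambda>q. F q \<in> V) (nh A x)"
      by (rule eventually_mono[OF nh_open[OF cA o]]) (use x V in auto)
    show "hmap A B x F"
    proof (rule hmap_chartI[OF cA cB x V(1) ev])
      fix i
      have "holo_Cn (\<lambda>z. \<eta> (F (inv_into U \<kappa> z)) $ i) (\<kappa> ` (U \<inter> F -` V))"
        using F U(1) V(1) unfolding holo_map_def by blast
      moreover have "eventually (\<lambda>z. z \<in> \<kappa> ` (U \<inter> F -` V)) (nhds (\<kappa> x))"
      proof (rule eventually_nhds_in_open)
        have "U \<inter> F -` V = U \<inter> {q \<in> points A. F q \<in> V}" using chart_subset_points[OF U(1)] by blast
        then show "open (\<kappa> ` (U \<inter> F -` V))" using open_chart_image[OF cA o U(1)] by simp
      qed (use U V in auto)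
      ultimately show "holo_near A x (\<lambda>q. \<eta> (F q) $ i)"
        unfolding holo_near_iff[OF cA U] holo_Cn_iff by (auto elim: eventually_mono)
    qed
  qed
next
  assume F: "\<forall>x\<in>points A. hmap A B x F"
  show "holo_map A B F"
    unfolding holo_map_def
  proof (intro conjI)
    show "continuous_map (mtop A) (mtop B) F"
      unfolding continuous_map_def topspace_mtop[OF cA] topspace_mtop[OF cB]
    proof (intro conjI allI impI)
      show "F \<in> points A \<rightarrow> points B" by (rule Pi_I) (rule hmapD(2)[OF F[rule_format]])
      fix W assume W: "openin (mtop B) W"
      show "openin (mtop A) {x \<in> points A. F x \<in> W}"
      proof (subst openin_subopen, intro ballI)
        fix x assume x: "x \<in> {x \<in> points A. F x \<in> W}"
        then have "eventually (\<lambda>q. F q \<in> W) (nh A x)"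
          using hmap_eventually[OF F[rule_format, of x] nh_open[OF cB W]] by simp
        with nh_points[OF cA, of x] x have "eventually (\<lambda>q. q \<in> {x \<in> points A. F x \<in> W}) (nh A x)"
          by (auto elim: eventually_elim2)
        then obtain T where T: "openin (mtop A) T" "x \<in> T" "\<And>q. q \<in> T \<Longrightarrow> q \<in> {x \<in> points A. F x \<in> W}"
          by (rule eventually_nhE[OF cA]) (use x in auto)
        then show "\<exists>T. openin (mtop A) T \<and> x \<in> T \<and> T \<subseteq> {x \<in> points A. F x \<in> W}" by blast
      qed
    qed
    have "holo_Cn (\<lambda>z. \<eta> (F (inv_into U \<kappa> z)) $ i) (\<kappa> ` (U \<inter> F -` V))"
      if U: "(U, \<kappa>) \<in> A" and V: "(V, \<eta>) \<in> B" for U \<kappa> V \<eta> i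
      unfolding holo_Cn_iff
    proof
      fix z assume "z \<in> \<kappa> ` (U \<inter> F -` V)"
      then obtain q where q: "z = \<kappa> q" "q \<in> U" "F q \<in> V" by blast
      have "hmap A B q F" using F chart_subset_points[OF U] q(2) by blast
      from hmap_coord(2)[OF cB this V q(3), of i]
      show "holo_at (\<lambda>z. \<eta> (F (inv_into U \<kappa> z)) $ i) z"
        unfolding holo_near_iff[OF cA U q(2)] q(1) by (rule eventually_nhds_x_imp_x)
    qed
    then show "\<forall>(U, \<kappa>)\<in>A. \<forall>(V, \<eta>)\<in>B. \<forall>i. holo_Cn (\<lambda>z. \<eta> (F (inv_into U \<kappa> z)) $ i) (\<kappa> ` (U \<inter> F -` V))"
      by blast
  qed
qed

section \<open>Tangent vectors as derivations\<close>

abbreviation dv :: "('a, 'n::finite) atlas \<Rightarrow> ('a, 'n) chart \<Rightarrow> 'n \<Rightarrow> 'a \<Rightarrow> 'a tvec" where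
  "dv A c i p \<equiv> chart_vec A c (axis i 1) p"

lemma tv_add: "v \<in> tangent_space A p \<Longrightarrow> holo_near A p f \<Longrightarrow> holo_near A p g \<Longrightarrow> v (\<lambda>q. f q + g q) = v f + v g"
  and tv_cmult: "v \<in> tangent_space A p \<Longrightarrow> holo_near A p f \<Longrightarrow> v (\<lambda>q. c * f q) = c * v f"
  and tv_mult: "v \<in> tangent_space A p \<Longrightarrow> holo_near A p f \<Longrightarrow> holo_near A p g \<Longrightarrow>
    v (\<lambda>q. f q * g q) = f p * v g + g p * v f"
  and tv_not_holo: "v \<in> tangent_space A p \<Longrightarrow> \<not> holo_near A p f \<Longrightarrow> v f = 0"
  unfolding tangent_space_def mem_Collect_eq by (blast, blast, blast, blast)

context
  fixes A :: "('a, 'n::finite) atlas" and v :: "'a tvec" and p :: 'a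
  assumes cA: "compatible_charts A" and v: "v \<in> tangent_space A p"
begin

lemma tv_const: "p \<in> points A \<Longrightarrow> v (\<lambda>q. c) = 0"
proof -
  assume p: "p \<in> points A"
  have "v (\<lambda>q. 1 * 1) = 1 * v (\<lambda>q. 1) + 1 * v (\<lambda>q. 1)"
    by (rule tv_mult[OF v holo_near_const[OF cA p] holo_near_const[OF cA p]])
  then have "v (\<lambda>q. 1) = 0" by simp
  then show ?thesis using tv_cmult[OF v holo_near_const[OF cA p, of 1], of c] by simp
qed

lemma tv_diff: "holo_near A p f \<Longrightarrow> holo_near A p g \<Longrightarrow> v (\<lambda>q. f q - g q) = v f - v g"
  using tv_add[OF v _ holo_near_cmult[OF cA], of f g "- 1"] tv_cmult[OF v, of g "- 1"] by simp

lemma tv_sum: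
  assumes "p \<in> points A" "\<And>i. i \<in> I \<Longrightarrow> holo_near A p (f i)"
  shows "v (\<lambda>q. \<Sum>i\<in>I. f i q) = (\<Sum>i\<in>I. v (f i))"
  using assms(2)
proof (induction I rule: infinite_finite_induct)
  case (insert x F)
  have "v (\<lambda>q. f x q + (\<Sum>i\<in>F. f i q)) = v (f x) + v (\<lambda>q. \<Sum>i\<in>F. f i q)"
    by (rule tv_add[OF v]) (auto intro!: holo_near_sum[OF cA assms(1)] insert.prems)
  then show ?case using insert by simp
qed (simp_all add: tv_const[OF assms(1)])

text \<open>A derivation depends on germs only: apply the Leibniz rule to the product of \<open>f - g\<close> and the
  indicator function of a neighbourhood on which it vanishes.\<close>

lemma tv_cong:
  assumes eq: "eventually (\<lambda>q. f q = g q) (nh A p)" and p: "p \<in> points A"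
  shows "v f = v g"
proof (cases "holo_near A p f")
  case True
  have g: "holo_near A p g" by (rule holo_near_cong[OF cA eq True])
  obtain W where W: "openin (mtop A) W" "p \<in> W" "\<And>q. q \<in> W \<Longrightarrow> f q = g q"
    using eventually_nhE[OF cA eq p] by blast
  define h :: "'a \<Rightarrow> complex" where "h q = (if q \<in> W then 1 else 0)" for q
  have h: "holo_near A p h"
    by (rule holo_near_cong[OF cA _ holo_near_const[OF cA p, of 1]], rule eventually_mono[OF nh_open[OF cA W(1,2)]])
      (simp add: h_def)
  have "v (\<lambda>q. h q * (f q - g q)) = h p * v (\<lambda>q. f q - g q) + (f p - g p) * v h"
    by (rule tv_mult[OF v h holo_near_diff[OF cA True g]])
  moreover have "(\<lambda>q. h q * (f q - g q)) = (\<lambda>q. 0)" using W(3) by (auto simp: h_def)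
  ultimately show ?thesis using tv_const[OF p, of 0] W(2,3) tv_diff[OF True g] by (simp add: h_def)
next
  case False
  have "\<not> holo_near A p g"
    using holo_near_cong[OF cA eventually_mono[OF eq], of g f] False by auto
  then show ?thesis using False tv_not_holo[OF v] by simp
qed

end

context
  fixes A :: "('a, 'n::finite) atlas" and U \<kappa>
  assumes cA: "compatible_charts A" and U: "(U, \<kappa>) \<in> A"
begin

lemma chart_vec_eval:
  assumes p: "p \<in> U" and f: "holo_near A p f"
  shows "chart_vec A (U, \<kappa>) x p f = (\<Sum>i\<in>UNIV. x $ i * pd i (\<lambda>z. f (inv_into U \<kappa> z)) (\<kappa> p))"
proof -
  have "holo_at (\<lambda>z. f (inv_into U \<kappa> z)) (\<kappa> p)"
    using f unfolding holo_near_iff[OF cA U p] by (rule eventually_nhds_x_imp_x)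
  then have "((\<lambda>t. f (inv_into U \<kappa> (\<kappa> p + t *s x))) has_field_derivative
      (\<Sum>i\<in>UNIV. x $ i * pd i (\<lambda>z. f (inv_into U \<kappa> z)) (\<kappa> p + 0 *s x))) (at 0)"
    by (intro holo_line) simp
  then show ?thesis using f by (simp add: chart_vec_def DERIV_imp_deriv)
qed

lemma chart_vec_tangent:
  assumes p: "p \<in> U"
  shows "chart_vec A (U, \<kappa>) x p \<in> tangent_space A p"
proof -
  have pp: "p \<in> points A" using p chart_subset_points[OF U] by blast
  let ?v = "chart_vec A (U, \<kappa>) x p"
  have ha: "holo_at (\<lambda>z. f (inv_into U \<kappa> z)) (\<kappa> p)" if "holo_near A p f" for f
    using that unfolding holo_near_iff[OF cA U p] by (rule eventually_nhds_x_imp_x)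
  have "?v f = 0" if "\<not> holo_near A p f" for f using that by (simp add: chart_vec_def)
  moreover have "?v (\<lambda>q. f q + g q) = ?v f + ?v g \<and> ?v (\<lambda>q. c * f q) = c * ?v f \<and>
      ?v (\<lambda>q. f q * g q) = f p * ?v g + g p * ?v f" if f: "holo_near A p f" and g: "holo_near A p g" for f g c
    by (simp add: chart_vec_eval[OF p] f g holo_near_add[OF cA f g] holo_near_cmult[OF cA] holo_near_mult[OF cA f g]
        pd_add[OF ha[OF f] ha[OF g]] pd_mult[OF ha[OF f] ha[OF g]] pd_cmult[OF ha[OF f]] chart_inv(4)[OF cA U p]
        sum.distrib sum_distrib_left algebra_simps)
  ultimately show ?thesis unfolding tangent_space_def by blast
qed

lemma chart_vec_coord:
  assumes p: "p \<in> U"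
  shows "chart_vec A (U, \<kappa>) x p (\<lambda>q. \<kappa> q $ i) = x $ i"
proof -
  have "pd j (\<lambda>z. \<kappa> (inv_into U \<kappa> z) $ i) (\<kappa> p) = (if j = i then 1 else 0)" for j
  proof -
    have "eventually (\<lambda>z. z $ i = \<kappa> (inv_into U \<kappa> z) $ i) (nhds (\<kappa> p))"
      using nhds_chart[OF cA U p] by eventually_elim (simp add: chart_inv(3)[OF cA U])
    from holo_at_cong(2)[OF holo_at_coord this, of j] show ?thesis by (simp add: pd_coord)
  qed
  note pd = this
  show ?thesis
    by (simp only: chart_vec_eval[OF p holo_near_coord[OF cA U p]] pd) (simp add: if_distrib cong: if_cong)
qed

text \<open>By Hadamard's lemma \<open>f\<close> is near \<open>p\<close> a constant plus terms
  \<open>(\<kappa> q $ i - \<kappa> p $ i) * g i (\<kappa> q)\<close>. The first factor vanishes at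
  \<open>p\<close>, so the Leibniz rule leaves the \<open>i\<close>-th coordinate of
  \<open>v\<close> times the value of \<open>g i\<close>, which is a partial derivative of
  \<open>f\<close>.\<close>

lemma tangent_expand:
  assumes p: "p \<in> U" and v: "v \<in> tangent_space A p"
  shows "v = chart_vec A (U, \<kappa>) (\<chi> i. v (\<lambda>q. \<kappa> q $ i)) p"
proof
  fix f
  have pp: "p \<in> points A" using p chart_subset_points[OF U] by blast
  show "v f = chart_vec A (U, \<kappa>) (\<chi> i. v (\<lambda>q. \<kappa> q $ i)) p f"
  proof (cases "holo_near A p f")
    case True
    let ?f = "\<lambda>z. f (inv_into U \<kappa> z)"
    let ?z = "\<kappa> p"
    have "eventually (\<lambda>z. holo_at ?f z \<and> z \<in> \<kappa> ` U) (nhds ?z)"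
      using True[unfolded holo_near_iff[OF cA U p]] nhds_chart[OF cA U p] by (rule eventually_conj)
    then obtain r where r: "r > 0" "\<And>z. z \<in> ball ?z r \<Longrightarrow> holo_at ?f z \<and> z \<in> \<kappa> ` U"
      unfolding eventually_nhds_metric by (auto simp: dist_commute)
    obtain g where g: "\<And>i z. z \<in> ball ?z r \<Longrightarrow> holo_at (g i) z" "\<And>i. g i ?z = pd i ?f ?z"
      "\<And>z. z \<in> ball ?z r \<Longrightarrow> ?f z = ?f ?z + (\<Sum>i\<in>UNIV. (z $ i - ?z $ i) * g i z)"
      using Hadamard[of ?z r ?f] r(2) by blast
    have evb: "eventually (\<lambda>z. z \<in> ball ?z r) (nhds ?z)" using r(1) by (intro eventually_nhds_in_open) auto
    have hg: "holo_near A p (\<lambda>q. g i (\<kappa> q))" for i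
      by (rule holo_near_chart_fun[OF cA U p], rule eventually_mono[OF evb]) (rule g(1))
    have hc: "holo_near A p (\<lambda>q. \<kappa> q $ i - ?z $ i)" for i
      by (intro holo_near_diff[OF cA] holo_near_coord[OF cA U p] holo_near_const[OF cA pp])
    have hm: "holo_near A p (\<lambda>q. (\<kappa> q $ i - ?z $ i) * g i (\<kappa> q))" for i
      by (rule holo_near_mult[OF cA hc hg])
    have "eventually (\<lambda>q. f q = f p + (\<Sum>i\<in>UNIV. (\<kappa> q $ i - ?z $ i) * g i (\<kappa> q))) (nh A p)"
      unfolding eventually_nh_iff[OF cA U p]
      using evb nhds_chart[OF cA U p]
    proof eventually_elim
      case (elim z)
      then show ?case using g(3)[OF elim(1)] by (simp add: chart_inv[OF cA U] p)
    qed
    then have "v f = v (\<lambda>q. f p + (\<Sum>i\<in>UNIV. (\<kappa> q $ i - ?z $ i) * g i (\<kappa> q)))"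
      by (rule tv_cong[OF cA v _ pp])
    also have "\<dots> = v (\<lambda>q. f p) + v (\<lambda>q. \<Sum>i\<in>UNIV. (\<kappa> q $ i - ?z $ i) * g i (\<kappa> q))"
      by (rule tv_add[OF v]) (intro holo_near_const[OF cA pp] holo_near_sum[OF cA pp] hm)+
    also have "\<dots> = (\<Sum>i\<in>UNIV. v (\<lambda>q. (\<kappa> q $ i - ?z $ i) * g i (\<kappa> q)))"
      by (simp add: tv_const[OF cA v pp] tv_sum[OF cA v pp] hm)
    also have "\<dots> = (\<Sum>i\<in>UNIV. v (\<lambda>q. \<kappa> q $ i) * pd i ?f ?z)"
    proof (rule sum.cong[OF refl])
      fix i
      have "v (\<lambda>q. (\<kappa> q $ i - ?z $ i) * g i (\<kappa> q)) = (\<kappa> p $ i - ?z $ i) * v (\<lambda>q. g i (\<kappa> q)) + g i (\<kappa> p) * v (\<lambda>q. \<kappa> q $ i - ?z $ i)"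
        by (rule tv_mult[OF v hc hg])
      then show "v (\<lambda>q. (\<kappa> q $ i - ?z $ i) * g i (\<kappa> q)) = v (\<lambda>q. \<kappa> q $ i) * pd i ?f ?z"
        by (simp add: tv_diff[OF cA v holo_near_coord[OF cA U p] holo_near_const[OF cA pp]] tv_const[OF cA v pp] g(2))
    qed
    finally show ?thesis by (simp add: chart_vec_eval[OF p True])
  next
    case False
    then show ?thesis using tv_not_holo[OF v] by (simp add: chart_vec_def)
  qed
qed

lemma tangent_apply:
  assumes p: "p \<in> U" and v: "v \<in> tangent_space A p" and f: "holo_near A p f"
  shows "v f = (\<Sum>i\<in>UNIV. v (\<lambda>q. \<kappa> q $ i) * dv A (U, \<kappa>) i p f)"
proof -
  have "v f = chart_vec A (U, \<kappa>) (\<chi> i. v (\<lambda>q. \<kappa> q $ i)) p f"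
    using tangent_expand[OF p v] by (rule fun_cong)
  then show ?thesis
    by (simp add: chart_vec_eval[OF p f] axis_def if_distrib if_distribR cong: if_cong)
qed

lemma eventually_chart_vec:
  assumes p: "p \<in> U" and f: "holo_near A p f"
  shows "eventually (\<lambda>q. chart_vec A (U, \<kappa>) x q f = (\<Sum>i\<in>UNIV. x $ i * pd i (\<lambda>z. f (inv_into U \<kappa> z)) (\<kappa> q))) (nh A p)"
  using nh_chart[OF cA U p] eventually_holo_near[OF cA f] by eventually_elim (rule chart_vec_eval)

lemma eventually_holo_at_pd:
  assumes p: "p \<in> U" and f: "holo_near A p f"
  shows "eventually (holo_at (pd i (\<lambda>z. f (inv_into U \<kappa> z)))) (nhds (\<kappa> p))"
proof -
  obtain S where S: "open S" "\<kappa> p \<in> S" "\<And>z. z \<in> S \<Longrightarrow> holo_at (\<lambda>z. f (inv_into U \<kappa> z)) z"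
    using f unfolding holo_near_iff[OF cA U p] eventually_nhds by blast
  show ?thesis
    by (rule eventually_mono[OF eventually_nhds_in_open[OF S(1,2)]]) (rule holo_at_pd[OF S(1,3)])
qed

lemma holo_near_chart_vec:
  assumes p: "p \<in> U" and f: "holo_near A p f"
  shows "holo_near A p (\<lambda>q. chart_vec A (U, \<kappa>) x q f)"
proof (rule holo_near_cong[OF cA])
  show "eventually (\<lambda>q. (\<Sum>i\<in>UNIV. x $ i * pd i (\<lambda>z. f (inv_into U \<kappa> z)) (\<kappa> q)) = chart_vec A (U, \<kappa>) x q f) (nh A p)"
    by (rule eventually_mono[OF eventually_chart_vec[OF assms, of x]]) simp
  have pp: "p \<in> points A" using p chart_subset_points[OF U] by blast
  show "holo_near A p (\<lambda>q. \<Sum>i\<in>UNIV. x $ i * pd i (\<lambda>z. f (inv_into U \<kappa> z)) (\<kappa> q))"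
    by (intro holo_near_sum[OF cA pp] holo_near_cmult[OF cA] holo_near_chart_fun[OF cA U p] eventually_holo_at_pd assms)
qed

lemma dv_commute:
  assumes p: "p \<in> U" and f: "holo_near A p f"
  shows "dv A (U, \<kappa>) i p (\<lambda>q. dv A (U, \<kappa>) j q f) = dv A (U, \<kappa>) j p (\<lambda>q. dv A (U, \<kappa>) i q f)"
proof -
  let ?f = "\<lambda>z. f (inv_into U \<kappa> z)"
  have pp: "p \<in> points A" using p chart_subset_points[OF U] by blast
  obtain S where S: "open S" "\<kappa> p \<in> S" "\<And>z. z \<in> S \<Longrightarrow> holo_at ?f z"
    using f unfolding holo_near_iff[OF cA U p] eventually_nhds by blast
  have sx: "(\<Sum>k\<in>UNIV. axis i 1 $ k * a k) = (a i :: complex)" for a and i :: 'n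
    by (simp add: axis_def if_distrib if_distribR cong: if_cong)
  have "dv A (U, \<kappa>) i p (\<lambda>q. dv A (U, \<kappa>) j q f) = pd i (pd j ?f) (\<kappa> p)" for i j
  proof -
    have hp: "holo_near A p (\<lambda>q. pd j ?f (\<kappa> q))"
      by (rule holo_near_chart_fun[OF cA U p eventually_holo_at_pd[OF assms]])
    have "dv A (U, \<kappa>) i p (\<lambda>q. dv A (U, \<kappa>) j q f) = dv A (U, \<kappa>) i p (\<lambda>q. pd j ?f (\<kappa> q))"
      by (rule tv_cong[OF cA chart_vec_tangent[OF p] _ pp], rule eventually_mono[OF eventually_chart_vec[OF assms, of "axis j 1"]])
        (simp only: sx)
    also have "\<dots> = pd i (\<lambda>z. pd j ?f (\<kappa> (inv_into U \<kappa> z))) (\<kappa> p)"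
      by (simp only: chart_vec_eval[OF p hp] sx)
    also have "\<dots> = pd i (pd j ?f) (\<kappa> p)"
    proof (rule holo_at_cong(2))
      show "holo_at (pd j ?f) (\<kappa> p)" by (rule holo_at_pd[OF S(1,3,2)])
      show "eventually (\<lambda>w. pd j ?f w = pd j ?f (\<kappa> (inv_into U \<kappa> w))) (nhds (\<kappa> p))"
        using nhds_chart[OF cA U p] by eventually_elim (simp add: chart_inv(3)[OF cA U])
    qed
    finally show ?thesis .
  qed
  then show ?thesis using pd_commute[OF S(1,3,2)] by simp
qed

end

lemma pushforward_apply: "holo_near B (F p) f \<Longrightarrow> pushforward B F p v f = v (\<lambda>q. f (F q))"
  by (simp add: pushforward_def)

lemma pushforward_tangent:
  assumes cB: "compatible_charts B" and F: "hmap A B p F" and v: "v \<in> tangent_space A p"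
  shows "pushforward B F p v \<in> tangent_space B (F p)"
proof -
  note h = hmapD(4)[OF F]
  have "pushforward B F p v f = 0" if "\<not> holo_near B (F p) f" for f
    using that by (simp add: pushforward_def)
  moreover have "pushforward B F p v (\<lambda>q. f q + g q) = pushforward B F p v f + pushforward B F p v g \<and>
      pushforward B F p v (\<lambda>q. c * f q) = c * pushforward B F p v f \<and>
      pushforward B F p v (\<lambda>q. f q * g q) = f (F p) * pushforward B F p v g + g (F p) * pushforward B F p v f"
    if f: "holo_near B (F p) f" and g: "holo_near B (F p) g" for f g c
    by (simp only: pushforward_apply f g holo_near_add[OF cB f g] holo_near_cmult[OF cB f] holo_near_mult[OF cB f g]
        tv_add[OF v h[OF f] h[OF g]] tv_cmult[OF v h[OF f]] tv_mult[OF v h[OF f] h[OF g]])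
  ultimately show ?thesis unfolding tangent_space_def by blast
qed

lemma tangent_chain:
  assumes cB: "compatible_charts B" and F: "hmap A B p F" and v: "v \<in> tangent_space A p"
    and V: "(V, \<eta>) \<in> B" "F p \<in> V" and f: "holo_near B (F p) f"
  shows "v (\<lambda>q. f (F q)) = (\<Sum>k\<in>UNIV. v (\<lambda>q. \<eta> (F q) $ k) * dv B (V, \<eta>) k (F p) f)"
  using tangent_apply[OF cB V pushforward_tangent[OF cB F v] f]
  by (simp only: pushforward_apply f holo_near_coord[OF cB V])

section \<open>Open submanifolds and products\<close>

context
  fixes A :: "('a, 'n::finite) atlas" and W :: "'a set"
  assumes cA: "compatible_charts A" and W: "openin (mtop A) W"
begin

lemma open_sub_subset: "W \<subseteq> points A"
  using openin_subset[OF W] unfolding topspace_mtop[OF cA] .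

lemma nh_open_sub:
  assumes p: "p \<in> W"
  shows "nh (open_sub A W) p = nh A p"
proof (rule filter_eqI)
  fix P
  have pt: "p \<in> points A" "p \<in> points (open_sub A W)" using p open_sub_subset by (auto simp: points_open_sub)
  show "eventually P (nh (open_sub A W) p) \<longleftrightarrow> eventually P (nh A p)"
  proof
    assume "eventually P (nh (open_sub A W) p)"
    then show "eventually P (nh A p)"
      using pt unfolding eventually_nhdsin topspace_mtop[OF cA] topspace_mtop[OF compatible_open_sub[OF cA W]]
        openin_open_sub[OF cA W] by blast
  next
    assume "eventually P (nh A p)"
    then obtain V where V: "openin (mtop A) V" "p \<in> V" "\<forall>x\<in>V. P x"
      using pt unfolding eventually_nhdsin topspace_mtop[OF cA] by blast
    have "openin (mtop A) (V \<inter> W)" using V(1) W by (rule openin_Int)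
    then show "eventually P (nh (open_sub A W) p)"
      using V p unfolding eventually_nhdsin openin_open_sub[OF cA W] by blast
  qed
qed

lemma holo_near_open_sub:
  assumes p: "p \<in> W"
  shows "holo_near (open_sub A W) p f \<longleftrightarrow> holo_near A p f"
proof
  assume "holo_near (open_sub A W) p f"
  then show "holo_near A p f"
    unfolding holo_near_def openin_open_sub[OF cA W] using holo_fun_open_sub[OF cA W] by blast
next
  assume "holo_near A p f"
  then obtain V where V: "openin (mtop A) V" "p \<in> V" "holo_fun A V f"
    unfolding holo_near_def by blast
  have VW: "openin (mtop A) (V \<inter> W)" using V(1) W by (rule openin_Int)
  have "holo_fun A (V \<inter> W) f"
    using V(3) unfolding holo_fun_def holo_Cn_iff by fast
  then have "holo_fun (open_sub A W) (V \<inter> W) f"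
    using holo_fun_open_sub[OF cA W VW] by blast
  then show "holo_near (open_sub A W) p f"
    unfolding holo_near_def openin_open_sub[OF cA W] using VW V(2) p by blast
qed

lemma hmap_open_sub_dom:
  assumes "x \<in> W"
  shows "hmap (open_sub A W) B x F \<longleftrightarrow> hmap A B x F"
  unfolding hmap_def nh_open_sub[OF assms] holo_near_open_sub[OF assms] points_open_sub using assms by simp

lemma hmap_open_sub_cod: "hmap B (open_sub A W) x F \<longleftrightarrow> hmap B A x F \<and> F x \<in> W"
proof (cases "F x \<in> W")
  case True
  then show ?thesis unfolding hmap_def nh_open_sub[OF True] holo_near_open_sub[OF True] points_open_sub by simp
next
  case False
  then show ?thesis unfolding hmap_def points_open_sub by simp
qed

lemma chart_open_sub: "(U, \<kappa>) \<in> A \<Longrightarrow> (U \<inter> W, \<kappa>) \<in> open_sub A W"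
  unfolding open_sub_def by force

text \<open>Both sides are tangent vectors of the larger manifold with the same coordinates, so
  \<open>tangent_expand\<close> identifies them.\<close>

lemma chart_vec_open_sub:
  assumes U: "(U, \<kappa>) \<in> A" and p: "p \<in> U" "p \<in> W"
  shows "chart_vec (open_sub A W) (U \<inter> W, \<kappa>) x p = chart_vec A (U, \<kappa>) x p"
proof -
  let ?v = "chart_vec (open_sub A W) (U \<inter> W, \<kappa>) x p"
  note cs = compatible_open_sub[OF cA W]
  have pU: "p \<in> U \<inter> W" using p by blast
  have "?v \<in> tangent_space A p"
    using chart_vec_tangent[OF cs chart_open_sub[OF U] pU] unfolding tangent_space_open_sub[OF cA W p(2)] .
  from tangent_expand[OF cA U p(1) this]
  show ?thesis by (simp add: chart_vec_coord[OF cs chart_open_sub[OF U] pU])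
qed

end

section \<open>Products of atlases\<close>

definition pl :: "complex^('n::finite + 'm::finite) \<Rightarrow> complex^'n" where "pl z = (\<chi> i. z $ Inl i)"
definition pr :: "complex^('n::finite + 'm::finite) \<Rightarrow> complex^'m" where "pr z = (\<chi> i. z $ Inr i)"
definition pc :: "('a \<Rightarrow> complex^'n::finite) \<Rightarrow> ('b \<Rightarrow> complex^'m::finite) \<Rightarrow> 'a \<times> 'b \<Rightarrow> complex^('n + 'm)" where
  "pc \<kappa> \<eta> = (\<lambda>(p, q). \<chi> i. case i of Inl j \<Rightarrow> \<kappa> p $ j | Inr j \<Rightarrow> \<eta> q $ j)"

lemma pl_nth: "pl z $ i = z $ Inl i"
  by (simp add: pl_def)

lemma pr_nth: "pr z $ j = z $ Inr j"
  by (simp add: pr_def)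

lemma pl_pc: "pl (pc \<kappa> \<eta> (p, q)) = \<kappa> p" and pr_pc: "pr (pc \<kappa> \<eta> (p, q)) = \<eta> q"
  by (simp_all add: vec_eq_iff pl_def pr_def pc_def)

lemma pc_eq_iff: "pc \<kappa> \<eta> (p, q) = z \<longleftrightarrow> \<kappa> p = pl z \<and> \<eta> q = pr z"
proof
  assume "\<kappa> p = pl z \<and> \<eta> q = pr z"
  then have "pc \<kappa> \<eta> (p, q) $ i = z $ i" for i
    by (cases i) (simp_all add: pc_def pl_def pr_def)
  then show "pc \<kappa> \<eta> (p, q) = z" by (simp add: vec_eq_iff)
qed (auto simp: pl_pc pr_pc)

lemma pc_coord: "pc \<kappa> \<eta> x $ Inl i = \<kappa> (fst x) $ i" "pc \<kappa> \<eta> x $ Inr j = \<eta> (snd x) $ j"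
  by (simp_all add: pc_def split_beta)

lemma continuous_pl: "continuous_on S pl"
  by (rule holo_components_continuous) (simp add: pl_nth holo_at_coord)

lemma continuous_pr: "continuous_on S pr"
  by (rule holo_components_continuous) (simp add: pr_nth holo_at_coord)

lemma image_pc: "pc \<kappa> \<eta> ` (U \<times> V) = pl -` (\<kappa> ` U) \<inter> pr -` (\<eta> ` V)"
proof (intro equalityI subsetI)
  fix z assume "z \<in> pl -` (\<kappa> ` U) \<inter> pr -` (\<eta> ` V)"
  then obtain p q where "p \<in> U" "q \<in> V" "pl z = \<kappa> p" "pr z = \<eta> q" by blast
  then have "pc \<kappa> \<eta> (p, q) = z" "(p, q) \<in> U \<times> V" by (simp_all add: pc_eq_iff)
  then show "z \<in> pc \<kappa> \<eta> ` (U \<times> V)" by blast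
qed (auto simp: pl_pc pr_pc)

context
  fixes A :: "('a, 'n::finite) atlas" and B :: "('b, 'm::finite) atlas"
  assumes cA: "compatible_charts A" and cB: "compatible_charts B"
begin

lemma prod_atlas_eq: "prod_atlas A B = {(U \<times> V, pc \<kappa> \<eta>) | U \<kappa> V \<eta>. (U, \<kappa>) \<in> A \<and> (V, \<eta>) \<in> B}"
  unfolding prod_atlas_def pc_def ..

lemma points_prod_atlas: "points (prod_atlas A B) = points A \<times> points B"
proof (intro equalityI subsetI)
  fix x assume "x \<in> points (prod_atlas A B)"
  then obtain U \<kappa> V \<eta> where "(U, \<kappa>) \<in> A" "(V, \<eta>) \<in> B" "x \<in> U \<times> V"
    unfolding points_def prod_atlas_eq by blast
  then show "x \<in> points A \<times> points B"
    using chart_subset_points[of U \<kappa> A] chart_subset_points[of V \<eta> B] by auto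
next
  fix x assume "x \<in> points A \<times> points B"
  then obtain p q where x: "x = (p, q)" "p \<in> points A" "q \<in> points B" by blast
  obtain U \<kappa> where U: "(U, \<kappa>) \<in> A" "p \<in> U" using pointsE[OF x(2)] by blast
  obtain V \<eta> where V: "(V, \<eta>) \<in> B" "q \<in> V" using pointsE[OF x(3)] by blast
  have "(U \<times> V, pc \<kappa> \<eta>) \<in> prod_atlas A B" using U V unfolding prod_atlas_eq by blast
  from chart_subset_points[OF this] show "x \<in> points (prod_atlas A B)" using U V x by blast
qed

lemma inv_into_pc:
  assumes U: "(U, \<kappa>) \<in> A" and V: "(V, \<eta>) \<in> B" and z: "z \<in> pc \<kappa> \<eta> ` (U \<times> V)"
  shows "inv_into (U \<times> V) (pc \<kappa> \<eta>) z = (inv_into U \<kappa> (pl z), inv_into V \<eta> (pr z))"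
    and "inj_on (pc \<kappa> \<eta>) (U \<times> V)"
proof -
  show inj: "inj_on (pc \<kappa> \<eta>) (U \<times> V)"
  proof (rule inj_onI)
    fix x y assume xy: "x \<in> U \<times> V" "y \<in> U \<times> V" "pc \<kappa> \<eta> x = pc \<kappa> \<eta> y"
    obtain p q p' q' where [simp]: "x = (p, q)" "y = (p', q')" by (cases x, cases y)
    have "\<kappa> p = \<kappa> p'" "\<eta> q = \<eta> q'" using xy(3) by (simp_all add: pc_eq_iff pl_pc pr_pc)
    then show "x = y" using xy(1,2) inj_onD[OF chart_inv(1)[OF cA U]] inj_onD[OF chart_inv(1)[OF cB V]] by simp
  qed
  obtain p q where "p \<in> U" "q \<in> V" "z = pc \<kappa> \<eta> (p, q)" using z by blast
  then show "inv_into (U \<times> V) (pc \<kappa> \<eta>) z = (inv_into U \<kappa> (pl z), inv_into V \<eta> (pr z))"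
    using inv_into_f_f[OF inj, of "(p, q)"] by (simp add: pl_pc pr_pc chart_inv(4)[OF cA U] chart_inv(4)[OF cB V])
qed

lemma compatible_prod_atlas: "compatible_charts (prod_atlas A B)"
proof -
  have 1: "inj_on (pc \<kappa> \<eta>) (U \<times> V)" if "(U, \<kappa>) \<in> A" "(V, \<eta>) \<in> B" for U \<kappa> V \<eta>
    using inv_into_pc(2)[OF that, of "pc \<kappa> \<eta> x" for x] by (cases "U \<times> V = {}") auto
  have img: "pc \<kappa> \<eta> ` ((U \<times> V) \<inter> (U' \<times> V')) = pl -` (\<kappa> ` (U \<inter> U')) \<inter> pr -` (\<eta> ` (V \<inter> V'))" for \<kappa> \<eta> U V U' V'
    unfolding Times_Int_Times image_pc ..
  have 2: "open (pc \<kappa> \<eta> ` ((U \<times> V) \<inter> (U' \<times> V')))"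
    if "(U, \<kappa>) \<in> A" "(V, \<eta>) \<in> B" "(U', \<kappa>') \<in> A" "(V', \<eta>') \<in> B" for U \<kappa> V \<eta> U' \<kappa>' V' \<eta>'
    unfolding img
    by (intro open_Int open_vimage continuous_pl continuous_pr compatible_chartsD(2)[OF cA that(1,3)]
        compatible_chartsD(2)[OF cB that(2,4)])
  have 3: "holo_Cn (\<lambda>z. pc \<kappa>' \<eta>' (inv_into (U \<times> V) (pc \<kappa> \<eta>) z) $ i) (pc \<kappa> \<eta> ` ((U \<times> V) \<inter> (U' \<times> V')))"
    if c: "(U, \<kappa>) \<in> A" "(V, \<eta>) \<in> B" "(U', \<kappa>') \<in> A" "(V', \<eta>') \<in> B" for U \<kappa> V \<eta> U' \<kappa>' V' \<eta>' i
    unfolding holo_Cn_iff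
  proof
    fix z assume z: "z \<in> pc \<kappa> \<eta> ` ((U \<times> V) \<inter> (U' \<times> V'))"
    then have "z \<in> pl -` (\<kappa> ` (U \<inter> U')) \<inter> pr -` (\<eta> ` (V \<inter> V'))" unfolding img .
    then have zl: "pl z \<in> \<kappa> ` (U \<inter> U')" and zr: "pr z \<in> \<eta> ` (V \<inter> V')" by simp_all
    have hl: "holo_at (\<lambda>z. pl z $ k) z" for k unfolding pl_nth by (rule holo_at_coord)
    have hr: "holo_at (\<lambda>z. pr z $ l) z" for l unfolding pr_nth by (rule holo_at_coord)
    let ?F = "\<lambda>z. pc \<kappa>' \<eta>' (inv_into U \<kappa> (pl z), inv_into V \<eta> (pr z)) $ i"
    have "holo_at ?F z"
    proof (cases i)
      case (Inl j)
      have "holo_at (\<lambda>w. \<kappa>' (inv_into U \<kappa> w) $ j) (pl z)"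
        using compatible_chartsD(3)[OF cA c(1,3)] zl unfolding holo_Cn_iff by blast
      from holo_at_compose[where F = pl, OF hl this] show ?thesis by (simp add: Inl pc_coord)
    next
      case (Inr j)
      have "holo_at (\<lambda>w. \<eta>' (inv_into V \<eta> w) $ j) (pr z)"
        using compatible_chartsD(3)[OF cB c(2,4)] zr unfolding holo_Cn_iff by blast
      from holo_at_compose[where F = pr, OF hr this] show ?thesis by (simp add: Inr pc_coord)
    qed
    moreover have "eventually (\<lambda>w. ?F w = pc \<kappa>' \<eta>' (inv_into (U \<times> V) (pc \<kappa> \<eta>) w) $ i) (nhds z)"
    proof (rule eventually_mono[OF eventually_nhds_in_open[OF 2[OF c] z]])
      fix w assume "w \<in> pc \<kappa> \<eta> ` ((U \<times> V) \<inter> (U' \<times> V'))"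
      then have "w \<in> pc \<kappa> \<eta> ` (U \<times> V)" by blast
      from inv_into_pc(1)[OF c(1,2) this] show "?F w = pc \<kappa>' \<eta>' (inv_into (U \<times> V) (pc \<kappa> \<eta>) w) $ i" by simp
    qed
    ultimately show "holo_at (\<lambda>z. pc \<kappa>' \<eta>' (inv_into (U \<times> V) (pc \<kappa> \<eta>) z) $ i) z" by (rule holo_at_cong(1))
  qed
  show ?thesis
    unfolding compatible_charts_def
  proof (intro conjI ballI)
    fix c assume "c \<in> prod_atlas A B"
    then obtain U \<kappa> V \<eta> where c: "c = (U \<times> V, pc \<kappa> \<eta>)" "(U, \<kappa>) \<in> A" "(V, \<eta>) \<in> B" unfolding prod_atlas_eq by blast
    show "case c of (U, \<kappa>) \<Rightarrow> inj_on \<kappa> U" using 1[OF c(2,3)] c(1) by simp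
    have "open (pc \<kappa> \<eta> ` (U \<times> V \<inter> fst d)) \<and> (\<forall>i. holo_Cn (\<lambda>z. snd d (inv_into (U \<times> V) (pc \<kappa> \<eta>) z) $ i) (pc \<kappa> \<eta> ` (U \<times> V \<inter> fst d)))"
      if "d \<in> prod_atlas A B" for d
    proof -
      obtain U' \<kappa>' V' \<eta>' where d: "d = (U' \<times> V', pc \<kappa>' \<eta>')" "(U', \<kappa>') \<in> A" "(V', \<eta>') \<in> B"
        using \<open>d \<in> _\<close> unfolding prod_atlas_eq by blast
      show ?thesis unfolding d(1) fst_conv snd_conv using 2[OF c(2,3) d(2,3)] 3[OF c(2,3) d(2,3)] by blast
    qed
    then show "case c of (U, \<kappa>) \<Rightarrow> \<forall>(V, \<eta>)\<in>prod_atlas A B. open (\<kappa> ` (U \<inter> V)) \<and>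
        (\<forall>i. holo_Cn (\<lambda>z. \<eta> (inv_into U \<kappa> z) $ i) (\<kappa> ` (U \<inter> V)))"
      unfolding c(1) by (simp add: split_beta)
  qed
qed

lemma hmap_prod_proj:
  assumes x: "x \<in> points A \<times> points B"
  shows "hmap (prod_atlas A B) A x fst" "hmap (prod_atlas A B) B x snd"
proof -
  obtain p q where pq: "x = (p, q)" "p \<in> points A" "q \<in> points B" using x by blast
  obtain U \<kappa> where U: "(U, \<kappa>) \<in> A" "p \<in> U" using pointsE[OF pq(2)] by blast
  obtain V \<eta> where V: "(V, \<eta>) \<in> B" "q \<in> V" using pointsE[OF pq(3)] by blast
  have c: "(U \<times> V, pc \<kappa> \<eta>) \<in> prod_atlas A B" using U V unfolding prod_atlas_eq by blast
  have xU: "x \<in> U \<times> V" using pq U V by blast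
  have xp: "x \<in> points (prod_atlas A B)" using x unfolding points_prod_atlas .
  note cP = compatible_prod_atlas
  note ev = nh_chart[OF cP c xU]
  show "hmap (prod_atlas A B) A x fst"
  proof (rule hmap_chartI[OF cP cA xp U(1)])
    show "eventually (\<lambda>q. fst q \<in> U) (nh (prod_atlas A B) x)" using ev by eventually_elim auto
    show "holo_near (prod_atlas A B) x (\<lambda>q. \<kappa> (fst q) $ i)" for i
      using holo_near_coord[OF cP c xU, of "Inl i"] by (simp add: pc_coord)
  qed
  show "hmap (prod_atlas A B) B x snd"
  proof (rule hmap_chartI[OF cP cB xp V(1)])
    show "eventually (\<lambda>q. snd q \<in> V) (nh (prod_atlas A B) x)" using ev by eventually_elim auto
    show "holo_near (prod_atlas A B) x (\<lambda>q. \<eta> (snd q) $ i)" for i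
      using holo_near_coord[OF cP c xU, of "Inr i"] by (simp add: pc_coord)
  qed
qed

lemma hmap_pair:
  assumes cX: "compatible_charts X" and F: "hmap X A x F" and G: "hmap X B x G"
  shows "hmap X (prod_atlas A B) x (\<lambda>q. (F q, G q))"
proof -
  obtain U \<kappa> where U: "(U, \<kappa>) \<in> A" "F x \<in> U" using pointsE[OF hmapD(2)[OF F]] by blast
  obtain V \<eta> where V: "(V, \<eta>) \<in> B" "G x \<in> V" using pointsE[OF hmapD(2)[OF G]] by blast
  have c: "(U \<times> V, pc \<kappa> \<eta>) \<in> prod_atlas A B" using U V unfolding prod_atlas_eq by blast
  show ?thesis
  proof (rule hmap_chartI[OF cX compatible_prod_atlas hmapD(1)[OF F] c])
    show "eventually (\<lambda>q. (F q, G q) \<in> U \<times> V) (nh X x)"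
      using hmap_coord(1)[OF cA F U] hmap_coord(1)[OF cB G V] by eventually_elim blast
    show "holo_near X x (\<lambda>q. pc \<kappa> \<eta> (F q, G q) $ i)" for i
      using hmap_coord(2)[OF cA F U] hmap_coord(2)[OF cB G V] by (cases i) (simp_all add: pc_coord)
  qed
qed

end

section \<open>The group and its atlas\<close>

lemma G_mat_nth [simp]:
  "G_mat g h $ 1 $ 1 = g\<^sup>2" "G_mat g h $ 1 $ 2 = 0" "G_mat g h $ 1 $ 3 = 0"
  "G_mat g h $ 2 $ 1 = 0" "G_mat g h $ 2 $ 2 = g" "G_mat g h $ 2 $ 3 = 0"
  "G_mat g h $ 3 $ 1 = 0" "G_mat g h $ 3 $ 2 = h" "G_mat g h $ 3 $ 3 = inverse g"
  by (simp_all add: G_mat_def)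

lemma mat3_eq_iff: "(m :: 'a^3^3) = m' \<longleftrightarrow> (\<forall>i j. m $ i $ j = m' $ i $ j)"
  by (simp add: vec_eq_iff)

lemma G_mat_mult: "g \<noteq> 0 \<Longrightarrow> g' \<noteq> 0 \<Longrightarrow> G_mat g h ** G_mat g' h' = G_mat (g * g') (h * g' + h' / g)"
  unfolding mat3_eq_iff by (simp add: forall_3 matrix_matrix_mult_def sum_3 power_mult_distrib divide_inverse)

lemma G_mat_one: "G_mat 1 0 = mat 1"
  unfolding mat3_eq_iff by (simp add: forall_3 mat_def)

lemma matrix_inv_inverse:
  assumes "invertible m"
  shows "m ** matrix_inv m = mat 1" "matrix_inv m ** m = mat 1"
proof -
  have "m ** matrix_inv m = mat 1 \<and> matrix_inv m ** m = mat 1"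
    unfolding matrix_inv_def by (rule someI_ex[OF assms[unfolded invertible_def]])
  then show "m ** matrix_inv m = mat 1" "matrix_inv m ** m = mat 1" by simp_all
qed

lemma G_mat_inv: "g \<noteq> 0 \<Longrightarrow> matrix_inv (G_mat g h) = G_mat (inverse g) (- h)"
proof -
  assume g: "g \<noteq> 0"
  have 1: "G_mat g h ** G_mat (inverse g) (- h) = mat 1" "G_mat (inverse g) (- h) ** G_mat g h = mat 1"
    using g by (simp_all add: G_mat_mult G_mat_one[symmetric] divide_inverse)
  then have "matrix_inv (G_mat g h) ** G_mat g h = mat 1" by (intro matrix_inv_inverse) (auto simp: invertible_def)
  then have "(matrix_inv (G_mat g h) ** G_mat g h) ** G_mat (inverse g) (- h) = G_mat (inverse g) (- h)" by simp
  then show ?thesis unfolding matrix_mul_assoc[symmetric] 1 by simp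
qed

lemma det_G_mat: "g \<noteq> 0 \<Longrightarrow> det (G_mat g h) = g\<^sup>2"
  by (simp add: det_3)

lemma G_group_iff: "k \<in> G_group \<longleftrightarrow> k $ 2 $ 2 \<noteq> 0 \<and> k = G_mat (k $ 2 $ 2) (k $ 3 $ 2)"
  unfolding G_group_def by auto

lemma G_mat_in: "g \<noteq> 0 \<Longrightarrow> G_mat g h \<in> G_group"
  unfolding G_group_def by blast

lemma G_group_cases:
  assumes "k \<in> G_group"
  obtains g h where "g \<noteq> 0" "k = G_mat g h"
  using assms unfolding G_group_def by blast

text \<open>These are polynomial equations in the entries, and the last one also keeps limits away
  from g = 0. In \<open>AD_trans\<close> they are carried to \<open>S\<close> one by one.\<close>

lemma G_groupI:
  assumes "k $ 1 $ 2 = 0" "k $ 1 $ 3 = 0" "k $ 2 $ 1 = 0" "k $ 2 $ 3 = 0" "k $ 3 $ 1 = 0"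
    "k $ 1 $ 1 = (k $ 2 $ 2)\<^sup>2" "k $ 2 $ 2 * k $ 3 $ 3 = 1"
  shows "k \<in> G_group"
proof -
  have nz: "k $ 2 $ 2 \<noteq> 0" using assms(7) by auto
  have "k $ 3 $ 3 = inverse (k $ 2 $ 2)" using inverse_unique[OF assms(7)] by simp
  then have "k = G_mat (k $ 2 $ 2) (k $ 3 $ 2)"
    using assms(1-6) by (simp add: mat3_eq_iff forall_3)
  then show ?thesis using nz unfolding G_group_iff by blast
qed

lemma G_mat_mult_nth:
  "(G_mat g h ** m) $ 1 $ j = g\<^sup>2 * m $ 1 $ j" "(G_mat g h ** m) $ 2 $ j = g * m $ 2 $ j"
  "(G_mat g h ** m) $ 3 $ j = h * m $ 2 $ j + inverse g * m $ 3 $ j"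
  by (simp_all add: matrix_matrix_mult_def sum_3)

abbreviation gc :: "complex^3^3 \<Rightarrow> complex^2" where
  "gc \<equiv> \<lambda>k. vector [k $ 2 $ 2, k $ 3 $ 2]"

lemma image_gc: "gc ` G_group = {z. z $ 1 \<noteq> 0}"
proof (intro equalityI subsetI)
  fix z :: "complex^2" assume z: "z \<in> {z. z $ 1 \<noteq> 0}"
  have "gc (G_mat (z $ 1) (z $ 2)) = z" by (simp add: vec_eq_iff forall_2)
  then show "z \<in> gc ` G_group" using imageI[OF G_mat_in[of "z $ 1" "z $ 2"], of gc] z by simp
qed (auto simp: G_group_def)

lemma inj_gc: "inj_on gc G_group"
proof (rule inj_onI)
  fix k l assume kl: "k \<in> G_group" "l \<in> G_group" "gc k = gc l"
  have "k $ 2 $ 2 = l $ 2 $ 2" "k $ 3 $ 2 = l $ 3 $ 2"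
    using arg_cong[OF kl(3), of "\<lambda>z. z $ 1"] arg_cong[OF kl(3), of "\<lambda>z. z $ 2"] by simp_all
  with kl(1,2) show "k = l" unfolding G_group_iff by metis
qed

lemma open_vec_nonzero: "open {z :: complex^'n. z $ i \<noteq> 0}"
proof -
  have "open ((\<lambda>z :: complex^'n. z $ i) -` (- {0}))"
    by (intro open_vimage continuous_intros)
  then show ?thesis by (simp add: vimage_def)
qed

lemma compatible_G_atlas: "compatible_charts G_atlas"
proof -
  have "holo_Cn (\<lambda>z. gc (inv_into G_group gc z) $ i) (gc ` G_group)" for i
    unfolding holo_Cn_iff
  proof
    fix z assume z: "z \<in> gc ` G_group"
    have "open (gc ` G_group)" unfolding image_gc by (rule open_vec_nonzero)
    then have "eventually (\<lambda>w. w $ i = gc (inv_into G_group gc w) $ i) (nhds z)"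
      by (rule eventually_mono[OF eventually_nhds_in_open[OF _ z]]) (rule arg_cong[where f = "\<lambda>w. w $ i"], rule f_inv_into_f[symmetric])
    then show "holo_at (\<lambda>z. gc (inv_into G_group gc z) $ i) z" by (rule holo_at_cong(1)[OF holo_at_coord])
  qed
  moreover have "open (gc ` G_group)" unfolding image_gc by (rule open_vec_nonzero)
  ultimately show ?thesis unfolding compatible_charts_def G_atlas_def using inj_gc by simp
qed

lemma points_G_atlas: "points G_atlas = G_group"
  by (simp add: points_def G_atlas_def)

lemma chart_G_atlas: "(G_group, gc) \<in> G_atlas"
  by (simp add: G_atlas_def)

lemma holo_near_G:
  assumes "k \<in> G_group"
  shows "holo_near G_atlas k (\<lambda>k. k $ 2 $ 2)" "holo_near G_atlas k (\<lambda>k. k $ 3 $ 2)"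
  using holo_near_coord[OF compatible_G_atlas chart_G_atlas assms, of 1]
    holo_near_coord[OF compatible_G_atlas chart_G_atlas assms, of 2] by simp_all

lemma hmap_GI:
  assumes cX: "compatible_charts X" and x: "x \<in> points X" and ev: "eventually (\<lambda>q. F q \<in> G_group) (nh X x)"
    and h: "holo_near X x (\<lambda>q. F q $ 2 $ 2)" "holo_near X x (\<lambda>q. F q $ 3 $ 2)"
  shows "hmap X G_atlas x F"
proof (rule hmap_chartI[OF cX compatible_G_atlas x chart_G_atlas ev])
  show "holo_near X x (\<lambda>q. gc (F q) $ i)" for i
    using h exhaust_2[of i] by auto
qed

section \<open>Frames and the frame bundle\<close>

text \<open>Frames in coordinates: the base point and the matrix with respect to the coordinate
  basis determine the frame, and \<open>mt\<close> reads the matrix off again.\<close>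

definition fr :: "('a, 'n::finite) atlas \<Rightarrow> ('a, 'n) chart \<Rightarrow> 'a \<Rightarrow> complex^'n^'n \<Rightarrow> ('a, 'n) frame" where
  "fr A c p m = (p, restrict (\<lambda>v. m *v (\<chi> i. v (\<lambda>q. snd c q $ i))) (tangent_space A p))"

definition mt :: "('a, 'n::finite) atlas \<Rightarrow> ('a, 'n) chart \<Rightarrow> ('a, 'n) frame \<Rightarrow> complex^'n^'n" where
  "mt A c e = (\<chi> i j. snd e (dv A c j (fst e)) $ i)"

text \<open>The matrix \<open>m\<close> of a frame in the chart \<open>c\<close> becomes \<open>m ** jac A c c' p\<close> in the chart \<open>c'\<close>.\<close>

definition jac :: "('a, 'n::finite) atlas \<Rightarrow> ('a, 'n) chart \<Rightarrow> ('a, 'n) chart \<Rightarrow> 'a \<Rightarrow> complex^'n^'n" where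
  "jac A c c' p = (\<chi> i j. dv A c' j p (\<lambda>q. snd c q $ i))"

lemma fst_fr [simp]: "fst (fr A c p m) = p"
  by (simp add: fr_def)

text \<open>The right action composes a frame with the inverse matrix. On matrices of frames it is
  therefore a left multiplication, which is the source of the inverses in all later formulas for the
  action.\<close>

lemma frame_act_fr: "frame_act A k (fr A c p m) = fr A c p (matrix_inv k ** m)"
  unfolding frame_act_def fr_def
  by (simp add: matrix_vector_mul_assoc cong: restrict_cong)

context
  fixes A :: "('a, 'n::finite) atlas"
  assumes cA: "compatible_charts A"
begin

lemma chart_vec_add:
  assumes U: "(U, \<kappa>) \<in> A" "p \<in> U"
  shows "chart_vec A (U, \<kappa>) (x + y) p = (\<lambda>f. chart_vec A (U, \<kappa>) x p f + chart_vec A (U, \<kappa>) y p f)"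
    and "chart_vec A (U, \<kappa>) (c *s x) p = (\<lambda>f. c * chart_vec A (U, \<kappa>) x p f)"
proof -
  have nh: "chart_vec A (U, \<kappa>) x p f = 0" if "\<not> holo_near A p f" for x f using that by (simp add: chart_vec_def)
  show "chart_vec A (U, \<kappa>) (x + y) p = (\<lambda>f. chart_vec A (U, \<kappa>) x p f + chart_vec A (U, \<kappa>) y p f)"
  proof
    fix f show "chart_vec A (U, \<kappa>) (x + y) p f = chart_vec A (U, \<kappa>) x p f + chart_vec A (U, \<kappa>) y p f"
      by (cases "holo_near A p f") (simp_all add: nh chart_vec_eval[OF cA U] distrib_right sum.distrib)
  qed
  show "chart_vec A (U, \<kappa>) (c *s x) p = (\<lambda>f. c * chart_vec A (U, \<kappa>) x p f)"
  proof
    fix f show "chart_vec A (U, \<kappa>) (c *s x) p f = c * chart_vec A (U, \<kappa>) x p f"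
      by (cases "holo_near A p f") (simp_all add: nh chart_vec_eval[OF cA U] sum_distrib_left mult.assoc)
  qed
qed

lemma tangent_space_add:
  assumes "p \<in> points A" "v \<in> tangent_space A p" "w \<in> tangent_space A p"
  shows "(\<lambda>f. v f + w f) \<in> tangent_space A p" "(\<lambda>f. c * v f) \<in> tangent_space A p"
proof -
  obtain U \<kappa> where U: "(U, \<kappa>) \<in> A" "p \<in> U" using pointsE[OF assms(1)] by blast
  obtain x y where xy: "v = chart_vec A (U, \<kappa>) x p" "w = chart_vec A (U, \<kappa>) y p"
    using tangent_expand[OF cA U assms(2)] tangent_expand[OF cA U assms(3)] by blast
  show "(\<lambda>f. v f + w f) \<in> tangent_space A p" "(\<lambda>f. c * v f) \<in> tangent_space A p"
    unfolding xy chart_vec_add[OF U, symmetric] by (rule chart_vec_tangent[OF cA U])+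
qed

lemma tlinear_expand:
  assumes U: "(U, \<kappa>) \<in> A" "p \<in> U" and \<alpha>: "tlinear_on (tangent_space A p) \<alpha>"
  shows "\<alpha> (chart_vec A (U, \<kappa>) x p) = (\<Sum>i\<in>UNIV. x $ i * \<alpha> (dv A (U, \<kappa>) i p))"
proof -
  note t = chart_vec_tangent[OF cA U]
  have add: "\<alpha> (chart_vec A (U, \<kappa>) (x + y) p) = \<alpha> (chart_vec A (U, \<kappa>) x p) + \<alpha> (chart_vec A (U, \<kappa>) y p)" for x y
    using \<alpha> t unfolding tlinear_on_def chart_vec_add[OF U] by blast
  have sc: "\<alpha> (chart_vec A (U, \<kappa>) (c *s x) p) = c * \<alpha> (chart_vec A (U, \<kappa>) x p)" for c x
    using \<alpha> t unfolding tlinear_on_def chart_vec_add[OF U] by blast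
  have "\<alpha> (chart_vec A (U, \<kappa>) (\<Sum>i\<in>I. x $ i *s axis i 1) p) = (\<Sum>i\<in>I. x $ i * \<alpha> (dv A (U, \<kappa>) i p))" for I
  proof (induction I rule: infinite_finite_induct)
    case (insert i I)
    then show ?case by (simp add: add sc)
  qed (use sc[of 0 0] in simp_all)
  from this[of UNIV] show ?thesis by (simp add: vec_expand[symmetric])
qed

lemma tangent_coords_inject:
  assumes U: "(U, \<kappa>) \<in> A" "p \<in> U" and "v \<in> tangent_space A p" "w \<in> tangent_space A p"
    and "(\<chi> i. v (\<lambda>q. \<kappa> q $ i)) = (\<chi> i. w (\<lambda>q. \<kappa> q $ i))"
  shows "v = w"
  using tangent_expand[OF cA U assms(3)] tangent_expand[OF cA U assms(4)] assms(5) by simp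

lemma mt_fr:
  assumes U: "(U, \<kappa>) \<in> A" "p \<in> U" and V: "(V, \<eta>) \<in> A" "p \<in> V"
  shows "mt A (V, \<eta>) (fr A (U, \<kappa>) p m) = m ** jac A (U, \<kappa>) (V, \<eta>) p"
  unfolding mt_def fr_def jac_def
  by (simp add: vec_eq_iff chart_vec_tangent[OF cA V] matrix_vector_mult_def matrix_matrix_mult_def)

lemma jac_self: "(U, \<kappa>) \<in> A \<Longrightarrow> p \<in> U \<Longrightarrow> jac A (U, \<kappa>) (U, \<kappa>) p = mat 1"
  by (simp add: jac_def mat_def vec_eq_iff chart_vec_coord[OF cA] axis_def)

lemma mt_fr_self: "(U, \<kappa>) \<in> A \<Longrightarrow> p \<in> U \<Longrightarrow> mt A (U, \<kappa>) (fr A (U, \<kappa>) p m) = m"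
  by (simp add: mt_fr jac_self)

lemma frame_apply:
  assumes U: "(U, \<kappa>) \<in> A" "fst e \<in> U" and e: "e \<in> frames A" and v: "v \<in> tangent_space A (fst e)"
  shows "snd e v = mt A (U, \<kappa>) e *v (\<chi> i. v (\<lambda>q. \<kappa> q $ i))"
proof -
  let ?x = "\<chi> i. v (\<lambda>q. \<kappa> q $ i)"
  have "snd e v $ r = (mt A (U, \<kappa>) e *v ?x) $ r" for r
  proof -
    have l: "tlinear_on (tangent_space A (fst e)) (\<lambda>v. snd e v $ r)" using e unfolding frames_def by auto
    have "snd e v $ r = snd e (chart_vec A (U, \<kappa>) ?x (fst e)) $ r" using tangent_expand[OF cA U v] by simp
    also have "\<dots> = (\<Sum>i\<in>UNIV. ?x $ i * snd e (dv A (U, \<kappa>) i (fst e)) $ r)" by (rule tlinear_expand[OF U l])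
    finally show ?thesis by (simp add: matrix_vector_mult_def mt_def mult.commute)
  qed
  then show ?thesis by (simp add: vec_eq_iff)
qed

lemma fr_mt:
  assumes U: "(U, \<kappa>) \<in> A" "fst e \<in> U" and e: "e \<in> frames A"
  shows "fr A (U, \<kappa>) (fst e) (mt A (U, \<kappa>) e) = e"
proof -
  have "restrict (\<lambda>v. mt A (U, \<kappa>) e *v (\<chi> i. v (\<lambda>q. \<kappa> q $ i))) (tangent_space A (fst e)) = snd e"
  proof (rule extensionalityI[of _ "tangent_space A (fst e)"])
    show "snd e \<in> extensional (tangent_space A (fst e))" using e unfolding frames_def by auto
  qed (simp_all add: frame_apply[OF assms])
  then show ?thesis by (simp add: fr_def prod_eq_iff)
qed

lemma fr_in_frames:
  assumes U: "(U, \<kappa>) \<in> A" "p \<in> U" and m: "det m \<noteq> 0"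
  shows "fr A (U, \<kappa>) p m \<in> frames A"
proof -
  let ?T = "tangent_space A p"
  let ?x = "\<lambda>v. \<chi> i. v (\<lambda>q. \<kappa> q $ i)"
  let ?u = "restrict (\<lambda>v. m *v ?x v) ?T"
  have p: "p \<in> points A" using U chart_subset_points by blast
  have im: "invertible m" using m by (simp add: invertible_det_nz)
  have inj: "inj ((*v) m)" using im matrix_left_invertible_injective[of m] unfolding invertible_def by blast
  have "tlinear_on ?T (\<lambda>v. ?u v $ i)" for i
    unfolding tlinear_on_def
  proof (intro ballI allI conjI)
    fix v w c assume vw: "v \<in> ?T" "w \<in> ?T"
    show "?u (\<lambda>f. v f + w f) $ i = ?u v $ i + ?u w $ i"
      using vw tangent_space_add(1)[OF p vw] by (simp add: matrix_vector_mult_def distrib_left sum.distrib)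
    show "?u (\<lambda>f. c * v f) $ i = c * ?u v $ i"
      using vw tangent_space_add(2)[OF p vw] by (simp add: matrix_vector_mult_def sum_distrib_left mult_ac)
  qed
  moreover have "bij_betw ?u ?T UNIV"
  proof (rule bij_betwI')
    fix v w assume vw: "v \<in> ?T" "w \<in> ?T"
    show "?u v = ?u w \<longleftrightarrow> v = w"
      using vw injD[OF inj, of "?x v" "?x w"] tangent_coords_inject[OF U vw] by auto
  next
    fix y :: "complex^'n"
    let ?v = "chart_vec A (U, \<kappa>) (matrix_inv m *v y) p"
    have v: "?v \<in> ?T" by (rule chart_vec_tangent[OF cA U])
    have "?x ?v = matrix_inv m *v y" by (simp add: vec_eq_iff chart_vec_coord[OF cA U])
    then have "?u ?v = m *v (matrix_inv m *v y)" using v by simp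
    also have "\<dots> = y" using matrix_inv_inverse(1)[OF im] by (simp add: matrix_vector_mul_assoc)
    finally show "\<exists>v\<in>?T. y = ?u v" using v by metis
  qed simp
  ultimately show ?thesis using p unfolding frames_def fr_def by simp
qed

lemma det_mt_nonzero:
  assumes U: "(U, \<kappa>) \<in> A" "fst e \<in> U" and e: "e \<in> frames A"
  shows "det (mt A (U, \<kappa>) e) \<noteq> 0"
proof -
  let ?c = "\<lambda>x. chart_vec A (U, \<kappa>) x (fst e)"
  have t: "?c x \<in> tangent_space A (fst e)" for x by (rule chart_vec_tangent[OF cA U])
  have cx: "(\<chi> i. ?c x (\<lambda>q. \<kappa> q $ i)) = x" for x by (simp add: vec_eq_iff chart_vec_coord[OF cA U])
  have "inj ((*v) (mt A (U, \<kappa>) e))"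
  proof (rule injI)
    fix x y assume "mt A (U, \<kappa>) e *v x = mt A (U, \<kappa>) e *v y"
    then have "snd e (?c x) = snd e (?c y)"
      by (simp only: frame_apply[OF assms t] cx)
    moreover have "inj_on (snd e) (tangent_space A (fst e))" using e unfolding frames_def bij_betw_def by auto
    ultimately have "?c x = ?c y" using t by (meson inj_onD)
    then show "x = y" using cx by metis
  qed
  then have "invertible (mt A (U, \<kappa>) e)"
    unfolding invertible_left_inverse matrix_left_invertible_injective .
  then show ?thesis by (simp add: invertible_det_nz)
qed

lemma holo_near_jac:
  assumes "(U, \<kappa>) \<in> A" "p \<in> U" "(V, \<eta>) \<in> A" "p \<in> V"
  shows "holo_near A p (\<lambda>p. jac A (U, \<kappa>) (V, \<eta>) p $ i $ j)"
  unfolding jac_def vec_lambda_beta snd_conv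
  by (rule holo_near_chart_vec[OF cA assms(3,4) holo_near_coord[OF cA assms(1,2)]])

subsection \<open>The atlas of the frame bundle\<close>

definition fdom :: "'a set \<Rightarrow> ('a, 'n) frame set" where
  "fdom U = {(p, u) \<in> frames A. p \<in> U}"

definition fc :: "('a, 'n) chart \<Rightarrow> ('a, 'n) frame \<Rightarrow> complex^('n + 'n \<times> 'n)" where
  "fc c = (\<lambda>(p, u). \<chi> k. case k of Inl i \<Rightarrow> snd c p $ i | Inr (i, j) \<Rightarrow> u (dv A c j p) $ i)"

definition fm :: "complex^('n + 'n \<times> 'n) \<Rightarrow> complex^'n^'n" where
  "fm z = (\<chi> i j. z $ Inr (i, j))"

lemma fdom_iff: "e \<in> fdom U \<longleftrightarrow> e \<in> frames A \<and> fst e \<in> U"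
  unfolding fdom_def by (cases e) auto

lemma frame_bundle_eq: "frame_bundle A = {(fdom U, fc (U, \<kappa>)) | U \<kappa>. (U, \<kappa>) \<in> A}"
  unfolding frame_bundle_def fdom_def fc_def snd_conv ..

lemma fc_coord: "fc c e $ Inl i = snd c (fst e) $ i" "fc c e $ Inr (i, j) = mt A c e $ i $ j"
  by (simp_all add: fc_def mt_def split_beta)

lemma pl_fc: "pl (fc c e) = snd c (fst e)" and fm_fc: "fm (fc c e) = mt A c e"
  by (simp_all add: vec_eq_iff pl_def fm_def fc_coord)

lemma fc_eqI: "snd c (fst e) = pl z \<Longrightarrow> mt A c e = fm z \<Longrightarrow> fc c e = z"
proof -
  assume a: "snd c (fst e) = pl z" "mt A c e = fm z"
  have "fc c e $ k = z $ k" for k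
  proof (cases k)
    case (Inl i)
    then show ?thesis using a(1) by (simp add: fc_coord pl_def)
  next
    case (Inr ij)
    then show ?thesis using a(2) by (cases ij) (simp add: fc_coord fm_def)
  qed
  then show ?thesis by (simp add: vec_eq_iff)
qed

lemma inj_fc: "(U, \<kappa>) \<in> A \<Longrightarrow> inj_on (fc (U, \<kappa>)) (fdom U)"
proof (rule inj_onI)
  fix e e' assume U: "(U, \<kappa>) \<in> A" and e: "e \<in> fdom U" "e' \<in> fdom U" "fc (U, \<kappa>) e = fc (U, \<kappa>) e'"
  have "\<kappa> (fst e) = \<kappa> (fst e')" "mt A (U, \<kappa>) e = mt A (U, \<kappa>) e'"
    using arg_cong[OF e(3), of pl] arg_cong[OF e(3), of fm] by (simp_all add: pl_fc fm_fc)
  moreover then have "fst e = fst e'" using e inj_onD[OF chart_inv(1)[OF cA U]] by (simp add: fdom_iff)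
  moreover have "fr A (U, \<kappa>) (fst e) (mt A (U, \<kappa>) e) = e" "fr A (U, \<kappa>) (fst e') (mt A (U, \<kappa>) e') = e'"
    using e by (simp_all add: fdom_iff fr_mt[OF U])
  ultimately show "e = e'" by metis
qed

text \<open>In coordinates the frames over \<open>U'\<close> are the pairs of a point and a matrix
  with non-zero determinant, which makes the chart image open when the image of \<open>U'\<close>
  is.\<close>

lemma image_fc:
  assumes U: "(U, \<kappa>) \<in> A" and "U' \<subseteq> U"
  shows "fc (U, \<kappa>) ` fdom U' = pl -` (\<kappa> ` U') \<inter> (\<lambda>z. det (fm z)) -` (- {0})"
proof (intro equalityI subsetI)
  fix z assume "z \<in> fc (U, \<kappa>) ` fdom U'"
  then obtain e where "e \<in> frames A" "fst e \<in> U'" "z = fc (U, \<kappa>) e" by (auto simp: fdom_iff)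
  then show "z \<in> pl -` (\<kappa> ` U') \<inter> (\<lambda>z. det (fm z)) -` (- {0})"
    using assms(2) det_mt_nonzero[OF U, of e] by (auto simp: pl_fc fm_fc)
next
  fix z assume "z \<in> pl -` (\<kappa> ` U') \<inter> (\<lambda>z. det (fm z)) -` (- {0})"
  then obtain p where p: "p \<in> U'" "pl z = \<kappa> p" "det (fm z) \<noteq> 0" by auto
  have pU: "p \<in> U" using p assms by blast
  have "fc (U, \<kappa>) (fr A (U, \<kappa>) p (fm z)) = z" by (rule fc_eqI) (simp_all add: p(2) mt_fr_self[OF U pU])
  moreover have "fr A (U, \<kappa>) p (fm z) \<in> fdom U'" using fr_in_frames[OF U pU p(3)] p(1) by (simp add: fdom_iff)
  ultimately show "z \<in> fc (U, \<kappa>) ` fdom U'" by (metis imageI)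
qed

lemma inv_into_fc:
  assumes U: "(U, \<kappa>) \<in> A" and z: "z \<in> fc (U, \<kappa>) ` fdom U"
  shows "inv_into (fdom U) (fc (U, \<kappa>)) z = fr A (U, \<kappa>) (inv_into U \<kappa> (pl z)) (fm z)"
proof -
  obtain e where e: "e \<in> fdom U" "z = fc (U, \<kappa>) e" using z by blast
  then show ?thesis
    using fr_mt[OF U, of e] by (simp add: inv_into_f_f[OF inj_fc[OF U]] pl_fc fm_fc fdom_iff chart_inv(4)[OF cA U])
qed

lemma compatible_frame_bundle: "compatible_charts (frame_bundle A)"
proof -
  have img: "fc (U, \<kappa>) ` (fdom U \<inter> fdom V) = pl -` (\<kappa> ` (U \<inter> V)) \<inter> (\<lambda>z. det (fm z)) -` (- {0})"
    if "(U, \<kappa>) \<in> A" for U \<kappa> V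
  proof -
    have "fdom U \<inter> fdom V = fdom (U \<inter> V)" by (auto simp: fdom_iff)
    then show ?thesis using image_fc[OF that, of "U \<inter> V"] by simp
  qed
  have cdet: "continuous_on UNIV (\<lambda>z. det (fm z))"
    unfolding det_def fm_def vec_lambda_beta by (intro continuous_intros)
  have 2: "open (fc (U, \<kappa>) ` (fdom U \<inter> fdom V))" if "(U, \<kappa>) \<in> A" "(V, \<eta>) \<in> A" for U \<kappa> V \<eta>
    unfolding img[OF that(1)]
    by (intro open_Int open_vimage continuous_pl cdet compatible_chartsD(2)[OF cA that]) (simp add: open_Compl)
  have 3: "holo_Cn (\<lambda>z. fc (V, \<eta>) (inv_into (fdom U) (fc (U, \<kappa>)) z) $ k) (fc (U, \<kappa>) ` (fdom U \<inter> fdom V))"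
    if U: "(U, \<kappa>) \<in> A" and V: "(V, \<eta>) \<in> A" for U \<kappa> V \<eta> k
    unfolding holo_Cn_iff
  proof
    fix z assume z: "z \<in> fc (U, \<kappa>) ` (fdom U \<inter> fdom V)"
    then have zl: "pl z \<in> \<kappa> ` (U \<inter> V)" unfolding img[OF U] by blast
    have hl: "holo_at (\<lambda>z. pl z $ k) z" for k unfolding pl_nth by (rule holo_at_coord)
    let ?F = "\<lambda>z. fc (V, \<eta>) (fr A (U, \<kappa>) (inv_into U \<kappa> (pl z)) (fm z)) $ k"
    let ?H = "\<lambda>z. case k of Inl i \<Rightarrow> \<eta> (inv_into U \<kappa> (pl z)) $ i
        | Inr (i, j) \<Rightarrow> (\<Sum>l\<in>UNIV. z $ Inr (i, l) * jac A (U, \<kappa>) (V, \<eta>) (inv_into U \<kappa> (pl z)) $ l $ j)"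
    have "holo_at ?H z"
    proof (cases k)
      case (Inl i)
      have "holo_at (\<lambda>w. \<eta> (inv_into U \<kappa> w) $ i) (pl z)"
        using compatible_chartsD(3)[OF cA U V] zl unfolding holo_Cn_iff by blast
      from holo_at_compose[where F = pl, OF hl this] show ?thesis by (simp add: Inl)
    next
      case (Inr ij)
      obtain i j where ij: "ij = (i, j)" by (cases ij)
      obtain p where p: "p \<in> U" "p \<in> V" "pl z = \<kappa> p" using zl by blast
      have "holo_at (\<lambda>w. jac A (U, \<kappa>) (V, \<eta>) (inv_into U \<kappa> w) $ l $ j) (pl z)" for l
        using holo_near_jac[OF U p(1) V p(2), of l j] unfolding holo_near_iff[OF cA U p(1)] p(3)
        by (rule eventually_nhds_x_imp_x)
      then have "holo_at (\<lambda>z. jac A (U, \<kappa>) (V, \<eta>) (inv_into U \<kappa> (pl z)) $ l $ j) z" for l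
        by (rule holo_at_compose[where F = pl, OF hl])
      then show ?thesis
        unfolding Inr ij sum.case prod.case by (intro holo_at_sum holo_at_mult holo_at_coord)
    qed
    moreover have "eventually (\<lambda>w. ?H w = fc (V, \<eta>) (inv_into (fdom U) (fc (U, \<kappa>)) w) $ k) (nhds z)"
    proof (rule eventually_mono[OF eventually_nhds_in_open[OF 2[OF U V] z]])
      fix w assume w: "w \<in> fc (U, \<kappa>) ` (fdom U \<inter> fdom V)"
      then have i: "inv_into (fdom U) (fc (U, \<kappa>)) w = fr A (U, \<kappa>) (inv_into U \<kappa> (pl w)) (fm w)"
        by (intro inv_into_fc[OF U]) blast
      obtain p where p: "p \<in> U" "p \<in> V" "pl w = \<kappa> p" using w unfolding img[OF U] by blast
      have ip: "inv_into U \<kappa> (pl w) = p" using p chart_inv(4)[OF cA U] by simp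
      show "?H w = fc (V, \<eta>) (inv_into (fdom U) (fc (U, \<kappa>)) w) $ k"
        unfolding i ip
        by (cases k) (auto simp: fc_coord mt_fr[OF U p(1) V p(2)] matrix_matrix_mult_def fm_def split: prod.split)
    qed
    ultimately show "holo_at (\<lambda>z. fc (V, \<eta>) (inv_into (fdom U) (fc (U, \<kappa>)) z) $ k) z" by (rule holo_at_cong(1))
  qed
  show ?thesis
    unfolding compatible_charts_def
  proof (intro conjI ballI)
    fix c assume "c \<in> frame_bundle A"
    then obtain U \<kappa> where c: "c = (fdom U, fc (U, \<kappa>))" "(U, \<kappa>) \<in> A" unfolding frame_bundle_eq by blast
    show "case c of (U, \<kappa>) \<Rightarrow> inj_on \<kappa> U" using inj_fc[OF c(2)] c(1) by simp
    have "open (fc (U, \<kappa>) ` (fdom U \<inter> fst d)) \<and> (\<forall>i. holo_Cn (\<lambda>z. snd d (inv_into (fdom U) (fc (U, \<kappa>)) z) $ i) (fc (U, \<kappa>) ` (fdom U \<inter> fst d)))"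
      if "d \<in> frame_bundle A" for d
    proof -
      obtain V \<eta> where d: "d = (fdom V, fc (V, \<eta>))" "(V, \<eta>) \<in> A" using \<open>d \<in> _\<close> unfolding frame_bundle_eq by blast
      show ?thesis unfolding d(1) fst_conv snd_conv using 2[OF c(2) d(2)] 3[OF c(2) d(2)] by blast
    qed
    then show "case c of (U, \<kappa>) \<Rightarrow> \<forall>(V, \<eta>)\<in>frame_bundle A. open (\<kappa> ` (U \<inter> V)) \<and>
        (\<forall>i. holo_Cn (\<lambda>z. \<eta> (inv_into U \<kappa> z) $ i) (\<kappa> ` (U \<inter> V)))"
      unfolding c(1) by (simp add: split_beta)
  qed
qed

lemma chart_frame_bundle: "(U, \<kappa>) \<in> A \<Longrightarrow> (fdom U, fc (U, \<kappa>)) \<in> frame_bundle A"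
  unfolding frame_bundle_eq by blast

lemma points_frame_bundle: "points (frame_bundle A) = frames A"
proof (intro equalityI subsetI)
  fix e assume "e \<in> points (frame_bundle A)"
  then obtain U \<kappa> where "(U, \<kappa>) \<in> A" "e \<in> fdom U" unfolding points_def frame_bundle_eq by blast
  then show "e \<in> frames A" by (simp add: fdom_iff)
next
  fix e assume e: "e \<in> frames A"
  then have "fst e \<in> points A" unfolding frames_def by auto
  then obtain U \<kappa> where U: "(U, \<kappa>) \<in> A" "fst e \<in> U" by (rule pointsE)
  then show "e \<in> points (frame_bundle A)"
    using chart_subset_points[OF chart_frame_bundle[OF U(1)]] e by (auto simp: fdom_iff)
qed

lemma holo_near_mt:
  assumes e: "e \<in> frames A" and U: "(U, \<kappa>) \<in> A" "fst e \<in> U"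
  shows "holo_near (frame_bundle A) e (\<lambda>e. mt A (U, \<kappa>) e $ i $ j)"
  using holo_near_coord[OF compatible_frame_bundle chart_frame_bundle[OF U(1)], of e "Inr (i, j)"] e U(2)
  by (simp add: fc_coord fdom_iff)

lemma hmap_frame_fst:
  assumes e: "e \<in> frames A"
  shows "hmap (frame_bundle A) A e fst"
proof -
  have "fst e \<in> points A" using e unfolding frames_def by auto
  then obtain U \<kappa> where U: "(U, \<kappa>) \<in> A" "fst e \<in> U" by (rule pointsE)
  have eU: "e \<in> fdom U" using e U by (simp add: fdom_iff)
  note c = compatible_frame_bundle chart_frame_bundle[OF U(1)]
  show ?thesis
  proof (rule hmap_chartI[OF c(1) cA _ U(1)])
    show "e \<in> points (frame_bundle A)" using e by (simp add: points_frame_bundle)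
    show "eventually (\<lambda>q. fst q \<in> U) (nh (frame_bundle A) e)"
      by (rule eventually_mono[OF nh_chart[OF c eU]]) (simp add: fdom_iff)
    show "holo_near (frame_bundle A) e (\<lambda>q. \<kappa> (fst q) $ i)" for i
      using holo_near_coord[OF c eU, of "Inl i"] by (simp add: fc_coord)
  qed
qed

lemma hmap_frameI:
  assumes cX: "compatible_charts X" and F: "hmap X A x (\<lambda>q. fst (F q))"
    and ev: "eventually (\<lambda>q. F q \<in> frames A) (nh X x)"
    and U: "(U, \<kappa>) \<in> A" "fst (F x) \<in> U" and h: "\<And>i j. holo_near X x (\<lambda>q. mt A (U, \<kappa>) (F q) $ i $ j)"
  shows "hmap X (frame_bundle A) x F"
proof (rule hmap_chartI[OF cX compatible_frame_bundle hmapD(1)[OF F] chart_frame_bundle[OF U(1)]])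
  show "eventually (\<lambda>q. F q \<in> fdom U) (nh X x)"
    using ev hmap_coord(1)[OF cA F U] by eventually_elim (simp add: fdom_iff)
  fix k show "holo_near X x (\<lambda>q. fc (U, \<kappa>) (F q) $ k)"
  proof (cases k)
    case (Inl i)
    then show ?thesis using hmap_coord(2)[OF cA F U] by (simp add: fc_coord)
  next
    case (Inr ij)
    then show ?thesis using h by (cases ij) (simp add: fc_coord)
  qed
qed

end

lemma holo_funI:
  assumes cA: "compatible_charts A" and W: "\<And>p. p \<in> W \<Longrightarrow> holo_near A p f"
  shows "holo_fun A W f"
proof -
  have "holo_at (\<lambda>z. f (inv_into U \<kappa> z)) (\<kappa> p)" if U: "(U, \<kappa>) \<in> A" and p: "p \<in> U" "p \<in> W" for U \<kappa> p
    using W[OF p(2)] unfolding holo_near_iff[OF cA U p(1)] by (rule eventually_nhds_x_imp_x)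
  then show ?thesis unfolding holo_fun_def holo_Cn_iff by auto
qed

section \<open>Gluing charts\<close>

text \<open>A manifold structure on a union of sets \<open>D i\<close>, each identified by
  \<open>\<tau> i\<close> with an open part of a known manifold \<open>P\<close>. The bijection
  \<open>jj\<close> renames coordinates: \<open>P\<close> will be a product with index type
  \<open>3 + 2\<close>, whereas the total space of a \<open>gstruct\<close> has index type
  5.\<close>

locale glue =
  fixes P :: "('x, 'n::finite) atlas" and I :: "'i set" and D :: "'i \<Rightarrow> 'e set" and \<tau> :: "'i \<Rightarrow> 'e \<Rightarrow> 'x"
    and C :: "'i \<Rightarrow> ('x, 'n) chart" and jj :: "'m::finite \<Rightarrow> 'n"
  assumes cP: "compatible_charts P" and jj: "bij jj"
    and inj: "\<And>i. i \<in> I \<Longrightarrow> inj_on (\<tau> i) (D i)"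
    and C: "\<And>i. i \<in> I \<Longrightarrow> C i \<in> P" "\<And>i e. i \<in> I \<Longrightarrow> e \<in> D i \<Longrightarrow> \<tau> i e \<in> fst (C i)"
    and op: "\<And>i j. i \<in> I \<Longrightarrow> j \<in> I \<Longrightarrow> openin (mtop P) (\<tau> i ` (D i \<inter> D j))"
    and tr: "\<And>i j e. i \<in> I \<Longrightarrow> j \<in> I \<Longrightarrow> e \<in> D i \<Longrightarrow> e \<in> D j \<Longrightarrow>
      hmap P P (\<tau> i e) (\<lambda>x. \<tau> j (inv_into (D i) (\<tau> i) x))"
begin

definition chi :: "'i \<Rightarrow> 'e \<Rightarrow> complex^'m" where
  "chi i e = (\<chi> k. snd (C i) (\<tau> i e) $ jj k)"

definition atlas :: "('e, 'm) atlas" where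
  "atlas = (\<lambda>i. (D i, chi i)) ` I"

text \<open>Undoes the renaming of coordinates by \<open>jj\<close>.\<close>

definition ux :: "complex^'m \<Rightarrow> complex^'n" where
  "ux w = (\<chi> k. w $ inv jj k)"

lemma C': "i \<in> I \<Longrightarrow> (fst (C i), snd (C i)) \<in> P"
  using C(1) by simp

lemma ux_chi: "ux (chi i e) = snd (C i) (\<tau> i e)"
  using jj by (simp add: ux_def chi_def vec_eq_iff bij_is_surj surj_f_inv_f)

lemma chi_eqI: "snd (C i) (\<tau> i e) = ux z \<Longrightarrow> chi i e = z"
  using jj by (simp add: ux_def chi_def vec_eq_iff bij_is_inj inv_f_f)

lemma \<sigma>_\<tau>: "i \<in> I \<Longrightarrow> e \<in> D i \<Longrightarrow> inv_into (D i) (\<tau> i) (\<tau> i e) = e"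
  by (rule inv_into_f_f[OF inj])

lemma inj_chi: "i \<in> I \<Longrightarrow> inj_on (chi i) (D i)"
proof (rule inj_onI)
  fix e e' assume i: "i \<in> I" and e: "e \<in> D i" "e' \<in> D i" "chi i e = chi i e'"
  then have "snd (C i) (\<tau> i e) = snd (C i) (\<tau> i e')" using ux_chi by metis
  then have "\<tau> i e = \<tau> i e'" using inj_onD[OF chart_inv(1)[OF cP C'[OF i]]] C(2)[OF i] e by blast
  then show "e = e'" using inj_onD[OF inj[OF i]] e by blast
qed

lemma image_chi:
  assumes "i \<in> I"
  shows "chi i ` T = ux -` (snd (C i) ` (\<tau> i ` T))"
proof (intro equalityI subsetI)
  fix z assume "z \<in> ux -` (snd (C i) ` (\<tau> i ` T))"
  then obtain e where e: "e \<in> T" "ux z = snd (C i) (\<tau> i e)" by blast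
  then have "chi i e = z" by (intro chi_eqI) simp
  then show "z \<in> chi i ` T" using e(1) by blast
qed (auto simp: ux_chi)

lemma holo_ux: "holo_at (\<lambda>w. ux w $ k) w"
  unfolding ux_def vec_lambda_beta by (rule holo_at_coord)

lemma open_image_chi:
  assumes "i \<in> I" "j \<in> I"
  shows "open (chi i ` (D i \<inter> D j))"
proof -
  have "fst (C i) \<inter> \<tau> i ` (D i \<inter> D j) = \<tau> i ` (D i \<inter> D j)" using C(2)[OF assms(1)] by blast
  then have "open (snd (C i) ` (\<tau> i ` (D i \<inter> D j)))"
    using open_chart_image[OF cP op[OF assms] C'[OF assms(1)]] by simp
  moreover have "continuous_on UNIV ux" by (rule holo_components_continuous) (rule holo_ux)
  ultimately show ?thesis unfolding image_chi[OF assms(1)] by (rule open_vimage)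
qed

lemma inv_into_chi:
  assumes i: "i \<in> I" and z: "z \<in> chi i ` D i"
  shows "inv_into (D i) (chi i) z = inv_into (D i) (\<tau> i) (inv_into (fst (C i)) (snd (C i)) (ux z))"
proof -
  obtain e where e: "e \<in> D i" "z = chi i e" using z by blast
  then show ?thesis
    by (simp add: inv_into_f_f[OF inj_chi[OF i]] ux_chi chart_inv(4)[OF cP C'[OF i] C(2)[OF i]] \<sigma>_\<tau>[OF i])
qed

lemma compatible_atlas: "compatible_charts atlas"
proof -
  have 3: "holo_Cn (\<lambda>z. chi j (inv_into (D i) (chi i) z) $ k) (chi i ` (D i \<inter> D j))"
    if i: "i \<in> I" and j: "j \<in> I" for i j k
    unfolding holo_Cn_iff
  proof
    fix z assume z: "z \<in> chi i ` (D i \<inter> D j)"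
    then obtain e where e: "e \<in> D i" "e \<in> D j" "z = chi i e" by blast
    have x: "\<tau> i e \<in> fst (C i)" by (rule C(2)[OF i e(1)])
    have "\<tau> j (inv_into (D i) (\<tau> i) (\<tau> i e)) \<in> fst (C j)" using C(2)[OF j e(2)] by (simp add: \<sigma>_\<tau>[OF i e(1)])
    from hmap_coord(2)[OF cP tr[OF i j e(1,2)] C'[OF j] this, of "jj k"]
    have "holo_at (\<lambda>w. snd (C j) (\<tau> j (inv_into (D i) (\<tau> i) (inv_into (fst (C i)) (snd (C i)) w))) $ jj k) (snd (C i) (\<tau> i e))"
      unfolding holo_near_iff[OF cP C'[OF i] x] by (rule eventually_nhds_x_imp_x)
    then have "holo_at (\<lambda>w. snd (C j) (\<tau> j (inv_into (D i) (\<tau> i) (inv_into (fst (C i)) (snd (C i)) w))) $ jj k) (ux z)"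
      by (simp only: e(3) ux_chi)
    from holo_at_compose[where F = ux, OF holo_ux this]
    have "holo_at (\<lambda>z. chi j (inv_into (D i) (\<tau> i) (inv_into (fst (C i)) (snd (C i)) (ux z))) $ k) z"
      by (simp add: chi_def)
    then show "holo_at (\<lambda>z. chi j (inv_into (D i) (chi i) z) $ k) z"
    proof (rule holo_at_cong(1))
      show "eventually (\<lambda>w. chi j (inv_into (D i) (\<tau> i) (inv_into (fst (C i)) (snd (C i)) (ux w))) $ k =
          chi j (inv_into (D i) (chi i) w) $ k) (nhds z)"
      proof (rule eventually_mono[OF eventually_nhds_in_open[OF open_image_chi[OF i j] z]])
        fix w assume "w \<in> chi i ` (D i \<inter> D j)"
        then have "w \<in> chi i ` D i" by blast
        from inv_into_chi[OF i this]
        show "chi j (inv_into (D i) (\<tau> i) (inv_into (fst (C i)) (snd (C i)) (ux w))) $ k =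
          chi j (inv_into (D i) (chi i) w) $ k" by simp
      qed
    qed
  qed
  show ?thesis
    unfolding compatible_charts_def atlas_def
    using inj_chi open_image_chi 3 by simp
qed

lemma chart_atlas: "i \<in> I \<Longrightarrow> (D i, chi i) \<in> atlas"
  unfolding atlas_def by blast

lemma points_atlas: "points atlas = (\<Union>i\<in>I. D i)"
  unfolding points_def atlas_def by simp

lemma hmap_\<tau>:
  assumes i: "i \<in> I" and e: "e \<in> D i"
  shows "hmap atlas P e (\<tau> i)"
proof (rule hmap_chartI[OF compatible_atlas cP _ C'[OF i]])
  show "e \<in> points atlas" using i e by (auto simp: points_atlas)
  show "eventually (\<lambda>q. \<tau> i q \<in> fst (C i)) (nh atlas e)"
    by (rule eventually_mono[OF nh_chart[OF compatible_atlas chart_atlas[OF i] e]]) (rule C(2)[OF i])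
  have "snd (C i) (\<tau> i q) $ k = chi i q $ inv jj k" for q k
    using jj by (simp add: chi_def bij_is_surj surj_f_inv_f)
  then show "holo_near atlas e (\<lambda>q. snd (C i) (\<tau> i q) $ k)" for k
    using holo_near_coord[OF compatible_atlas chart_atlas[OF i] e, of "inv jj k"] by simp
qed

lemma hmap_\<sigma>:
  assumes i: "i \<in> I" and e: "e \<in> D i"
  shows "hmap P atlas (\<tau> i e) (inv_into (D i) (\<tau> i))"
proof (rule hmap_chartI[OF cP compatible_atlas _ chart_atlas[OF i]])
  have x: "\<tau> i e \<in> fst (C i)" by (rule C(2)[OF i e])
  show "\<tau> i e \<in> points P" using x chart_subset_points[OF C'[OF i]] by blast
  have "openin (mtop P) (\<tau> i ` D i)" using op[OF i i] by simp
  then have ev: "eventually (\<lambda>x. x \<in> \<tau> i ` D i) (nh P (\<tau> i e))"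
    by (rule nh_open[OF cP]) (use e in blast)
  then show "eventually (\<lambda>x. inv_into (D i) (\<tau> i) x \<in> D i) (nh P (\<tau> i e))"
    by eventually_elim (rule inv_into_into)
  fix k
  show "holo_near P (\<tau> i e) (\<lambda>x. chi i (inv_into (D i) (\<tau> i) x) $ k)"
  proof (rule holo_near_cong[OF cP _ holo_near_coord[OF cP C'[OF i] x, of "jj k"]])
    show "eventually (\<lambda>x. snd (C i) x $ jj k = chi i (inv_into (D i) (\<tau> i) x) $ k) (nh P (\<tau> i e))"
      using ev by eventually_elim (simp add: chi_def f_inv_into_f)
  qed
qed

end

section \<open>Second countability\<close>

text \<open>The preimages of a countable base under countably many charts form a base as soon as
  these charts cover the manifold.\<close>

lemma second_countable_mtop:
  fixes A :: "('a, 'n::finite) atlas"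
  assumes cA: "compatible_charts A" and A': "A' \<subseteq> A" "countable A'" "points A \<subseteq> points A'"
  shows "second_countable (mtop A)"
proof -
  obtain \<B> :: "(complex^'n) set set" where \<B>: "countable \<B>" "topological_basis \<B>"
    using ex_countable_basis by blast
  let ?B = "(\<lambda>(c, Q). fst c \<inter> snd c -` Q) ` (A' \<times> \<B>)"
  show ?thesis
    unfolding second_countable_def
  proof (intro exI[of _ ?B] conjI ballI allI impI)
    show "countable ?B" using A'(2) \<B>(1) by blast
    fix V assume "V \<in> ?B"
    then obtain U \<kappa> Q where V: "V = U \<inter> \<kappa> -` Q" "(U, \<kappa>) \<in> A'" "Q \<in> \<B>" by auto
    show "openin (mtop A) V"
      unfolding V(1) by (rule open_chart_preimage[OF cA]) (use V A' \<B> topological_basis_open in auto)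
  next
    fix V x assume "openin (mtop A) V \<and> x \<in> V"
    then have V: "openin (mtop A) V" "x \<in> V" by auto
    have "x \<in> points A" using openin_subset[OF V(1)] V(2) unfolding topspace_mtop[OF cA] by blast
    then have "x \<in> points A'" using A'(3) by blast
    then obtain U \<kappa> where U: "(U, \<kappa>) \<in> A'" "x \<in> U" by (rule pointsE)
    have UA: "(U, \<kappa>) \<in> A" using U A' by blast
    have "\<kappa> x \<in> \<kappa> ` (U \<inter> V)" using U V by blast
    then obtain Q where Q: "Q \<in> \<B>" "\<kappa> x \<in> Q" "Q \<subseteq> \<kappa> ` (U \<inter> V)"
      using topological_basisE[OF \<B>(2) open_chart_image[OF cA V(1) UA]] by blast
    have "U \<inter> \<kappa> -` Q \<subseteq> V"
    proof
      fix y assume y: "y \<in> U \<inter> \<kappa> -` Q"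
      then obtain y' where "y' \<in> U" "y' \<in> V" "\<kappa> y = \<kappa> y'" using Q(3) by blast
      then show "y \<in> V" using inj_onD[OF chart_inv(1)[OF cA UA]] y by blast
    qed
    moreover have "U \<inter> \<kappa> -` Q \<in> ?B"
      by (rule image_eqI[where x = "((U, \<kappa>), Q)"]) (use U Q in auto)
    moreover have "x \<in> U \<inter> \<kappa> -` Q" using U Q by simp
    ultimately show "\<exists>V'\<in>?B. x \<in> V' \<and> V' \<subseteq> V" by (intro bexI conjI)
  qed
qed

section \<open>Exterior derivatives\<close>

text \<open>If \<open>\<omega> = \<Sum>k. F k * d (f k)\<close> then \<open>d \<omega> = \<Sum>k. d (F k) \<and> d (f k)\<close>, in whatever chart
  \<^const>\<open>ext_deriv\<close> is computed.\<close>

lemma ext_deriv_form: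
  fixes A :: "('a, 'n::finite) atlas"
  assumes cA: "compatible_charts A" and e: "e \<in> points A"
    and F: "\<And>k. k \<in> I \<Longrightarrow> holo_near A e (F k)" and f: "\<And>k. k \<in> I \<Longrightarrow> holo_near A e (f k)"
    and \<omega>: "eventually (\<lambda>q. \<forall>v\<in>tangent_space A q. \<omega> q v = (\<Sum>k\<in>I. F k q * v (f k))) (nh A e)"
    and v: "v \<in> tangent_space A e" and w: "w \<in> tangent_space A e"
  shows "ext_deriv A \<omega> e v w = (\<Sum>k\<in>I. v (F k) * w (f k) - w (F k) * v (f k))"
proof -
  \<comment> \<open>The chart that \<open>ext_deriv\<close> itself selects. Nothing is known about
    it except that it contains \<open>e\<close>.\<close>
  define c where "c = (SOME c. c \<in> A \<and> e \<in> fst c)"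
  have "\<exists>c. c \<in> A \<and> e \<in> fst c" using pointsE[OF e] by (metis fst_conv)
  then have "c \<in> A \<and> e \<in> fst c" unfolding c_def by (rule someI_ex)
  moreover obtain Y y where c: "c = (Y, y)" by (cases c)
  ultimately have Y: "(Y, y) \<in> A" "e \<in> Y" by auto
  let ?D = "\<lambda>i q. dv A (Y, y) i q"
  have t: "?D i q \<in> tangent_space A q" if "q \<in> Y" for i q by (rule chart_vec_tangent[OF cA Y(1) that])
  have hD: "holo_near A e (\<lambda>q. ?D j q (f k))" if "k \<in> I" for j k by (rule holo_near_chart_vec[OF cA Y f[OF that]])
  have D\<omega>: "?D i e (\<lambda>q. \<omega> q (?D j q)) = (\<Sum>k\<in>I. F k e * ?D i e (\<lambda>q. ?D j q (f k)) + ?D j e (f k) * ?D i e (F k))" for i j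
  proof -
    have "?D i e (\<lambda>q. \<omega> q (?D j q)) = ?D i e (\<lambda>q. \<Sum>k\<in>I. F k q * ?D j q (f k))"
    proof (rule tv_cong[OF cA t[OF Y(2)] _ e])
      show "eventually (\<lambda>q. \<omega> q (?D j q) = (\<Sum>k\<in>I. F k q * ?D j q (f k))) (nh A e)"
        using \<omega> nh_chart[OF cA Y] by eventually_elim (use t in blast)
    qed
    also have "\<dots> = (\<Sum>k\<in>I. ?D i e (\<lambda>q. F k q * ?D j q (f k)))"
      by (rule tv_sum[OF cA t[OF Y(2)] e]) (rule holo_near_mult[OF cA F hD])
    also have "\<dots> = (\<Sum>k\<in>I. F k e * ?D i e (\<lambda>q. ?D j q (f k)) + ?D j e (f k) * ?D i e (F k))"
      by (rule sum.cong[OF refl]) (rule tv_mult[OF t[OF Y(2)] F hD])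
    finally show ?thesis .
  qed
  have anti: "?D i e (\<lambda>q. \<omega> q (?D j q)) - ?D j e (\<lambda>q. \<omega> q (?D i q)) =
      (\<Sum>k\<in>I. ?D i e (F k) * ?D j e (f k) - ?D j e (F k) * ?D i e (f k))" for i j
    unfolding D\<omega> sum_subtractf[symmetric]
  proof (rule sum.cong[OF refl])
    fix k assume "k \<in> I"
    show "F k e * ?D i e (\<lambda>q. ?D j q (f k)) + ?D j e (f k) * ?D i e (F k) -
         (F k e * ?D j e (\<lambda>q. ?D i q (f k)) + ?D i e (f k) * ?D j e (F k)) =
         ?D i e (F k) * ?D j e (f k) - ?D j e (F k) * ?D i e (f k)"
      \<comment> \<open>The second derivatives of \<open>f k\<close> are symmetric and cancel; only
        derivatives of the coefficients \<open>F k\<close> survive.\<close>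
      unfolding dv_commute[OF cA Y f[OF \<open>k \<in> I\<close>], of i j] by (simp add: algebra_simps)
  qed
  let ?v = "\<lambda>i. v (\<lambda>q. y q $ i)" and ?w = "\<lambda>i. w (\<lambda>q. y q $ i)"
  have "ext_deriv A \<omega> e v w = (\<Sum>i\<in>UNIV. \<Sum>j\<in>UNIV. ?v i * ?w j *
      (?D i e (\<lambda>q. \<omega> q (?D j q)) - ?D j e (\<lambda>q. \<omega> q (?D i q))))"
    unfolding ext_deriv_def c_def[symmetric] c Let_def prod.case ..
  also have "\<dots> = (\<Sum>i\<in>UNIV. \<Sum>j\<in>UNIV. \<Sum>k\<in>I. ?v i * ?w j * (?D i e (F k) * ?D j e (f k) - ?D j e (F k) * ?D i e (f k)))"
    unfolding anti sum_distrib_left ..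
  also have "\<dots> = (\<Sum>k\<in>I. \<Sum>i\<in>UNIV. \<Sum>j\<in>UNIV. ?v i * ?w j * (?D i e (F k) * ?D j e (f k) - ?D j e (F k) * ?D i e (f k)))"
    by (subst (2) sum.swap, subst sum.swap) (rule refl)
  also have "\<dots> = (\<Sum>k\<in>I. v (F k) * w (f k) - w (F k) * v (f k))"
  proof (rule sum.cong[OF refl])
    fix k assume k: "k \<in> I"
    have "v (F k) * w (f k) - w (F k) * v (f k) =
        (\<Sum>i\<in>UNIV. ?v i * ?D i e (F k)) * (\<Sum>j\<in>UNIV. ?w j * ?D j e (f k)) -
        (\<Sum>j\<in>UNIV. ?w j * ?D j e (F k)) * (\<Sum>i\<in>UNIV. ?v i * ?D i e (f k))"
      by (simp only: tangent_apply[OF cA Y v F[OF k]] tangent_apply[OF cA Y w f[OF k]]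
          tangent_apply[OF cA Y w F[OF k]] tangent_apply[OF cA Y v f[OF k]])
    also have "\<dots> = (\<Sum>i\<in>UNIV. \<Sum>j\<in>UNIV. ?v i * ?w j * (?D i e (F k) * ?D j e (f k) - ?D j e (F k) * ?D i e (f k)))"
    proof -
      have "(\<Sum>j\<in>UNIV. ?w j * ?D j e (F k)) * (\<Sum>i\<in>UNIV. ?v i * ?D i e (f k)) =
        (\<Sum>i\<in>UNIV. ?v i * ?D i e (f k)) * (\<Sum>j\<in>UNIV. ?w j * ?D j e (F k))" by (rule mult.commute)
      then show ?thesis
        by (simp add: sum_product sum_subtractf right_diff_distrib mult_ac)
    qed
    finally show "(\<Sum>i\<in>UNIV. \<Sum>j\<in>UNIV. ?v i * ?w j * (?D i e (F k) * ?D j e (f k) - ?D j e (F k) * ?D i e (f k))) =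
       v (F k) * w (f k) - w (F k) * v (f k)" by simp
  qed
  finally show ?thesis .
qed

section \<open>The exponential map of the group\<close>

lemma \<gg>_mat_nth [simp]:
  "\<gg>_mat a b $ 1 $ 1 = 2 * a" "\<gg>_mat a b $ 1 $ 2 = 0" "\<gg>_mat a b $ 1 $ 3 = 0"
  "\<gg>_mat a b $ 2 $ 1 = 0" "\<gg>_mat a b $ 2 $ 2 = a" "\<gg>_mat a b $ 2 $ 3 = 0"
  "\<gg>_mat a b $ 3 $ 1 = 0" "\<gg>_mat a b $ 3 $ 2 = b" "\<gg>_mat a b $ 3 $ 3 = - a"
  by (simp_all add: \<gg>_mat_def)

text \<open>This is b sinh(a) / a, the entry in row 3 and column 2 of the exponential, with its
  value at the removable singularity a = 0.\<close>

definition exp_h :: "complex \<Rightarrow> complex \<Rightarrow> complex" where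
  "exp_h a b = (if a = 0 then b else b * ((exp a - exp (- a)) / (2 * a)))"

text \<open>The entry below the diagonal is b times the divided difference of the k-th power
  function at a and -a. For a = 0 the matrix has square zero and only the first power
  contributes.\<close>

lemma mat_power_\<gg>:
  "mat_power (\<gg>_mat a b) k =
    vector [vector [(2 * a) ^ k, 0, 0], vector [0, a ^ k, 0],
      vector [0, b * (if a = 0 then (if k = 1 then 1 else 0) else (a ^ k - (- a) ^ k) / (2 * a)), (- a) ^ k]]"
proof (induction k)
  case 0
  show ?case unfolding mat3_eq_iff by (simp add: forall_3 mat_def)
next
  case (Suc k)
  have "a \<noteq> 0 \<Longrightarrow> b * a ^ k + - a * (b * ((a ^ k - (- a) ^ k) / (2 * a))) = b * ((a ^ Suc k - (- a) ^ Suc k) / (2 * a))"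
    by (simp add: field_simps)
  then show ?case
    unfolding mat_power.simps Suc.IH mat3_eq_iff
    by (simp add: forall_3 matrix_matrix_mult_def sum_3)
qed

lemma exp_sums: "(\<lambda>k. (1 / fact k) *\<^sub>R (x ^ k)) sums exp (x :: complex)"
  using exp_converges[of x] by (simp add: inverse_eq_divide)

lemma mat_exp_\<gg>: "mat_exp (\<gg>_mat a b) = G_mat (exp a) (exp_h a b)"
proof -
  let ?c = "\<lambda>k. b * (if a = 0 then (if k = 1 then 1 else 0) else (a ^ k - (- a) ^ k) / (2 * a))"
  have h: "(\<lambda>k. (1 / fact k) *\<^sub>R ?c k) sums exp_h a b"
  proof (cases "a = 0")
    case True
    have "(\<lambda>k. (1 / fact k) *\<^sub>R ?c k) sums (\<Sum>k\<in>{1}. (1 / fact k) *\<^sub>R ?c k)"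
      by (rule sums_finite) (use True in auto)
    then show ?thesis using True by (simp add: exp_h_def)
  next
    case False
    have "(\<lambda>k. (b / (2 * a)) * ((1 / fact k) *\<^sub>R (a ^ k) - (1 / fact k) *\<^sub>R ((- a) ^ k))) sums ((b / (2 * a)) * (exp a - exp (- a)))"
      by (intro sums_mult sums_diff exp_sums)
    moreover have "(b / (2 * a)) * ((1 / fact k) *\<^sub>R (a ^ k) - (1 / fact k) *\<^sub>R ((- a) ^ k)) = (1 / fact k) *\<^sub>R ?c k" for k
      using False by (simp add: scaleR_conv_of_real field_simps)
    ultimately show ?thesis using False by (simp add: exp_h_def)
  qed
  have "(\<lambda>k. (1 / fact k) *\<^sub>R mat_power (\<gg>_mat a b) k $ i $ j) sums (G_mat (exp a) (exp_h a b) $ i $ j)" for i j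
  proof -
    have e2: "(\<lambda>k. (1 / fact k) *\<^sub>R ((2 * a) ^ k)) sums (exp a)\<^sup>2"
      using exp_sums[of "2 * a"] by (simp add: exp_double)
    have em: "(\<lambda>k. (1 / fact k) *\<^sub>R ((- a) ^ k)) sums inverse (exp a)"
      using exp_sums[of "- a"] by (simp add: exp_minus)
    show ?thesis
      unfolding mat_power_\<gg> using exhaust_3[of i] exhaust_3[of j] e2 em h exp_sums[of a]
      by (elim disjE) (simp_all only: vector_3 G_mat_nth scaleR_zero_right sums_zero)
  qed
  then have "(\<lambda>n. (\<Sum>k<n. (1 / fact k) *\<^sub>R mat_power (\<gg>_mat a b) k) $ i $ j) \<longlonglongrightarrow> G_mat (exp a) (exp_h a b) $ i $ j" for i j
    unfolding sums_def by simp
  then have "(\<lambda>n. \<Sum>k<n. (1 / fact k) *\<^sub>R mat_power (\<gg>_mat a b) k) \<longlonglongrightarrow> G_mat (exp a) (exp_h a b)"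
    by (intro vec_tendstoI)
  then show ?thesis unfolding mat_exp_def sums_def[symmetric] by (simp add: sums_iff)
qed

lemma scale_\<gg>: "(\<chi> i. t *s \<gg>_mat a b $ i) = \<gg>_mat (t * a) (t * b)"
  unfolding mat3_eq_iff by (simp add: forall_3)

lemma exp_h_deriv: "((\<lambda>t. exp_h (t * a) (t * b)) has_field_derivative b) (at 0)"
proof (cases "a = 0")
  case True
  then show ?thesis by (auto simp: exp_h_def intro!: derivative_eq_intros)
next
  case False
  have "((\<lambda>t. b * ((exp (t * a) - exp (- (t * a))) / (2 * a))) has_field_derivative b) (at 0)"
    using False by (auto intro!: derivative_eq_intros simp: field_simps)
  moreover have "(\<lambda>t. exp_h (t * a) (t * b)) = (\<lambda>t. b * ((exp (t * a) - exp (- (t * a))) / (2 * a)))"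
    using False by (auto simp: exp_h_def fun_eq_iff)
  ultimately show ?thesis by simp
qed

section \<open>The torsion equations of a coframe\<close>

text \<open>A coframe is given by its matrix \<open>\<eta>\<close> with respect to a chart \<open>c\<close>; \<open>curl M c \<eta> i a b\<close> is the
  coefficient of \<open>dz\<^sup>a \<and> dz\<^sup>b\<close> in \<open>d \<eta>\<^sup>i\<close>, and \<open>dwedge M c \<eta> i j\<close> that of
  \<open>dz\<^sup>1 \<and> dz\<^sup>2 \<and> dz\<^sup>3\<close> in \<open>d \<eta>\<^sup>i \<and> \<eta>\<^sup>j\<close>.\<close>

definition curl :: "('a, 3) atlas \<Rightarrow> ('a, 3) chart \<Rightarrow> ('a \<Rightarrow> complex^3^3) \<Rightarrow> 3 \<Rightarrow> 3 \<Rightarrow> 3 \<Rightarrow> 'a \<Rightarrow> complex" where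
  "curl M c \<eta> i a b p = dv M c a p (\<lambda>q. \<eta> q $ i $ b) - dv M c b p (\<lambda>q. \<eta> q $ i $ a)"

definition dwedge :: "('a, 3) atlas \<Rightarrow> ('a, 3) chart \<Rightarrow> ('a \<Rightarrow> complex^3^3) \<Rightarrow> 3 \<Rightarrow> 3 \<Rightarrow> 'a \<Rightarrow> complex" where
  "dwedge M c \<eta> i j p = curl M c \<eta> i 2 3 p * \<eta> p $ j $ 1 + curl M c \<eta> i 3 1 p * \<eta> p $ j $ 2 + curl M c \<eta> i 1 2 p * \<eta> p $ j $ 3"

text \<open>The structure equations with \<phi>, \<mu> and K eliminated. Wedging the second with
  eta^2 leaves minus the volume form. The first wedged with eta^2 is -2 times the second wedged with
  eta^1, both being multiples of \<phi> \<and> eta^1 \<and> eta^2. The third wedged with eta^2 and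
  the second wedged with eta^3 are both \<phi> \<and> eta^3 \<and> eta^2.\<close>

definition adapted :: "('a, 3) atlas \<Rightarrow> ('a, 3) chart \<Rightarrow> ('a \<Rightarrow> complex^3^3) \<Rightarrow> 'a \<Rightarrow> bool" where
  "adapted M c \<eta> p \<longleftrightarrow> dwedge M c \<eta> 2 2 p = - det (\<eta> p) \<and>
     dwedge M c \<eta> 1 2 p = - 2 * dwedge M c \<eta> 2 1 p \<and> dwedge M c \<eta> 3 2 p = dwedge M c \<eta> 2 3 p"

lemma holo_near_curl:
  assumes cA: "compatible_charts A" and U: "(U, \<kappa>) \<in> A" "p \<in> U"
    and m: "\<And>i j. holo_near A p (\<lambda>q. m q $ i $ j)"
  shows "holo_near A p (curl A (U, \<kappa>) m i a b)"
  unfolding curl_def[abs_def] by (rule holo_near_diff[OF cA]; rule holo_near_chart_vec[OF cA U(1,2) m])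

lemma holo_near_dwedge:
  assumes cA: "compatible_charts A" and U: "(U, \<kappa>) \<in> A" "p \<in> U"
    and m: "\<And>i j. holo_near A p (\<lambda>q. m q $ i $ j)"
  shows "holo_near A p (dwedge A (U, \<kappa>) m i j)"
  unfolding dwedge_def[abs_def]
  by (intro holo_near_add[OF cA] holo_near_mult[OF cA] holo_near_curl[OF assms] m)

definition cov :: "complex^3^3 \<Rightarrow> 3 \<Rightarrow> complex^3 \<Rightarrow> complex" where
  "cov m i x = m $ i $ 1 * x $ 1 + m $ i $ 2 * x $ 2 + m $ i $ 3 * x $ 3"

definition w2 :: "('x \<Rightarrow> complex) \<Rightarrow> ('x \<Rightarrow> complex) \<Rightarrow> 'x \<Rightarrow> 'x \<Rightarrow> complex" where
  "w2 f g x y = f x * g y - f y * g x"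

definition dcov :: "('a, 3) atlas \<Rightarrow> ('a, 3) chart \<Rightarrow> ('a \<Rightarrow> complex^3^3) \<Rightarrow> 3 \<Rightarrow> 'a \<Rightarrow> complex^3 \<Rightarrow> complex^3 \<Rightarrow> complex" where
  "dcov M c \<eta> i p x y = (\<Sum>a\<in>UNIV. \<Sum>b\<in>UNIV. x $ a * y $ b * curl M c \<eta> i a b p)"

lemma curl_antisym: "curl M c \<eta> i a b p = - curl M c \<eta> i b a p"
  by (simp add: curl_def)

lemma curl_same: "curl M c \<eta> i a a p = 0"
  by (simp add: curl_def)

lemma dcov_curl:
  "dcov M c \<eta> i p x y = curl M c \<eta> i 2 3 p * (x $ 2 * y $ 3 - x $ 3 * y $ 2) +
     curl M c \<eta> i 3 1 p * (x $ 3 * y $ 1 - x $ 1 * y $ 3) + curl M c \<eta> i 1 2 p * (x $ 1 * y $ 2 - x $ 2 * y $ 1)"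
  unfolding dcov_def sum_3 curl_same
  by (simp add: curl_antisym[of M c \<eta> i 2 1 p] curl_antisym[of M c \<eta> i 3 2 p] curl_antisym[of M c \<eta> i 1 3 p] algebra_simps)

text \<open>Cramer's rule for 2-forms: in the basis of wedge products of the rows, each coefficient
  is the wedge of the form with the complementary row, up to the determinant.\<close>

lemma cramer_form:
  fixes m11 m12 m13 m21 m22 m23 m31 m32 m33 c1 c2 c3 x1 x2 x3 y1 y2 y3 :: complex
  shows "(m11 * m22 * m33 + m12 * m23 * m31 + m13 * m21 * m32 - m11 * m23 * m32 - m12 * m21 * m33 - m13 * m22 * m31) *
     (c1 * (x2 * y3 - x3 * y2) + c2 * (x3 * y1 - x1 * y3) + c3 * (x1 * y2 - x2 * y1)) =
   (c1 * m31 + c2 * m32 + c3 * m33) * ((m11 * x1 + m12 * x2 + m13 * x3) * (m21 * y1 + m22 * y2 + m23 * y3) - (m11 * y1 + m12 * y2 + m13 * y3) * (m21 * x1 + m22 * x2 + m23 * x3)) +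
   (c1 * m11 + c2 * m12 + c3 * m13) * ((m21 * x1 + m22 * x2 + m23 * x3) * (m31 * y1 + m32 * y2 + m33 * y3) - (m21 * y1 + m22 * y2 + m23 * y3) * (m31 * x1 + m32 * x2 + m33 * x3)) +
   (c1 * m21 + c2 * m22 + c3 * m23) * ((m31 * x1 + m32 * x2 + m33 * x3) * (m11 * y1 + m12 * y2 + m13 * y3) - (m31 * y1 + m32 * y2 + m33 * y3) * (m11 * x1 + m12 * x2 + m13 * x3))"
  by algebra

lemma dcov_expand:
  "det (\<eta> p) * dcov M c \<eta> i p x y =
    dwedge M c \<eta> i 3 p * w2 (cov (\<eta> p) 1) (cov (\<eta> p) 2) x y +
    dwedge M c \<eta> i 1 p * w2 (cov (\<eta> p) 2) (cov (\<eta> p) 3) x y +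
    dwedge M c \<eta> i 2 p * w2 (cov (\<eta> p) 3) (cov (\<eta> p) 1) x y"
  unfolding dcov_curl det_3 dwedge_def w2_def cov_def by (rule cramer_form)

text \<open>The coefficients of \<phi> in the coframe, found by comparing \<open>dcov_expand\<close>
  with the structure equations. Nine coefficients are compared for six unknowns in \<phi>, \<mu> and
  K; the three equations of \<open>adapted\<close> are the compatibility conditions.\<close>

definition sol_a :: "('a, 3) atlas \<Rightarrow> ('a, 3) chart \<Rightarrow> ('a \<Rightarrow> complex^3^3) \<Rightarrow> 'a \<Rightarrow> complex^3" where
  "sol_a M c \<eta> p = vector [- dwedge M c \<eta> 2 3 p / det (\<eta> p), dwedge M c \<eta> 1 3 p / (2 * det (\<eta> p)), dwedge M c \<eta> 2 1 p / det (\<eta> p)]"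

text \<open>The coefficients of \<mu>. It occurs only wedged with the second row, so its second
  coefficient is free and set to 0; the subtracted term in the third is the second coefficient of
  \<phi>.\<close>

definition sol_b :: "('a, 3) atlas \<Rightarrow> ('a, 3) chart \<Rightarrow> ('a \<Rightarrow> complex^3^3) \<Rightarrow> 'a \<Rightarrow> complex^3" where
  "sol_b M c \<eta> p = vector [- dwedge M c \<eta> 3 3 p / det (\<eta> p), 0, dwedge M c \<eta> 3 1 p / det (\<eta> p) - dwedge M c \<eta> 1 3 p / (2 * det (\<eta> p))]"

definition comb :: "complex^3 \<Rightarrow> complex^3^3 \<Rightarrow> complex^3 \<Rightarrow> complex" where
  "comb s m x = s $ 1 * cov m 1 x + s $ 2 * cov m 2 x + s $ 3 * cov m 3 x"

definition sol_K :: "('a, 3) atlas \<Rightarrow> ('a, 3) chart \<Rightarrow> ('a \<Rightarrow> complex^3^3) \<Rightarrow> 'a \<Rightarrow> complex" where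
  "sol_K M c \<eta> p = dwedge M c \<eta> 1 1 p / det (\<eta> p)"

lemma adapted_structure_equations:
  assumes "adapted M c \<eta> p" and d: "det (\<eta> p) \<noteq> 0"
  defines "\<phi> \<equiv> comb (sol_a M c \<eta> p) (\<eta> p)" and "\<mu> \<equiv> comb (sol_b M c \<eta> p) (\<eta> p)" and "K \<equiv> sol_K M c \<eta> p"
    and "E \<equiv> cov (\<eta> p)"
  shows "dcov M c \<eta> 1 p x y = - 2 * w2 \<phi> (E 1) x y + K * w2 (E 2) (E 3) x y"
    and "dcov M c \<eta> 2 p x y = - w2 \<phi> (E 2) x y + w2 (E 1) (E 3) x y"
    and "dcov M c \<eta> 3 p x y = - w2 \<mu> (E 2) x y + w2 \<phi> (E 3) x y"
proof -
  let ?d = "det (\<eta> p)"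
  have ex: "dcov M c \<eta> i p x y = (dwedge M c \<eta> i 3 p / ?d) * w2 (E 1) (E 2) x y +
      (dwedge M c \<eta> i 1 p / ?d) * w2 (E 2) (E 3) x y + (dwedge M c \<eta> i 2 p / ?d) * w2 (E 3) (E 1) x y" for i
    using dcov_expand[of \<eta> p M c i x y] d unfolding E_def by (simp add: field_simps)
  have a: "dwedge M c \<eta> 2 2 p / ?d = - 1" "dwedge M c \<eta> 1 2 p / ?d = - 2 * (dwedge M c \<eta> 2 1 p / ?d)"
    "dwedge M c \<eta> 3 2 p / ?d = dwedge M c \<eta> 2 3 p / ?d"
    using assms(1) d unfolding adapted_def by simp_all
  have s: "sol_a M c \<eta> p $ 1 = - (dwedge M c \<eta> 2 3 p / ?d)" "sol_a M c \<eta> p $ 2 = (dwedge M c \<eta> 1 3 p / ?d) / 2"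
    "sol_a M c \<eta> p $ 3 = dwedge M c \<eta> 2 1 p / ?d" "sol_b M c \<eta> p $ 1 = - (dwedge M c \<eta> 3 3 p / ?d)" "sol_b M c \<eta> p $ 2 = 0"
    "sol_b M c \<eta> p $ 3 = dwedge M c \<eta> 3 1 p / ?d - (dwedge M c \<eta> 1 3 p / ?d) / 2"
    by (simp_all add: sol_a_def sol_b_def)
  show "dcov M c \<eta> 1 p x y = - 2 * w2 \<phi> (E 1) x y + K * w2 (E 2) (E 3) x y"
    unfolding ex a \<phi>_def comb_def s K_def sol_K_def w2_def E_def[symmetric] by (simp add: algebra_simps)
  show "dcov M c \<eta> 2 p x y = - w2 \<phi> (E 2) x y + w2 (E 1) (E 3) x y"
    unfolding ex a \<phi>_def comb_def s w2_def E_def[symmetric] by (simp add: algebra_simps)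
  show "dcov M c \<eta> 3 p x y = - w2 \<mu> (E 2) x y + w2 \<phi> (E 3) x y"
    unfolding ex a \<phi>_def \<mu>_def comb_def s w2_def E_def[symmetric] by (simp add: algebra_simps)
qed

text \<open>Only the values \<open>f a\<close> and \<open>u a\<close> of the two connection forms on
  coordinate vectors matter; they cancel when the wedge products are expanded.\<close>

lemma adapted_if_structure_equations:
  fixes \<phi> \<mu> :: "complex^3 \<Rightarrow> complex"
  assumes 1: "\<And>a b. curl M c \<eta> 1 a b p = - 2 * (f a * \<eta> p $ 1 $ b - f b * \<eta> p $ 1 $ a) + K * (\<eta> p $ 2 $ a * \<eta> p $ 3 $ b - \<eta> p $ 2 $ b * \<eta> p $ 3 $ a)"
    and 2: "\<And>a b. curl M c \<eta> 2 a b p = - (f a * \<eta> p $ 2 $ b - f b * \<eta> p $ 2 $ a) + (\<eta> p $ 1 $ a * \<eta> p $ 3 $ b - \<eta> p $ 1 $ b * \<eta> p $ 3 $ a)"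
    and 3: "\<And>a b. curl M c \<eta> 3 a b p = - (u a * \<eta> p $ 2 $ b - u b * \<eta> p $ 2 $ a) + (f a * \<eta> p $ 3 $ b - f b * \<eta> p $ 3 $ a)"
  shows "adapted M c \<eta> p"
  unfolding adapted_def dwedge_def 1 2 3 det_3 by (simp add: algebra_simps)

section \<open>Matrices of holomorphic functions\<close>

text \<open>The adjugate divided by the determinant. Unlike the choice made in
  \<open>matrix_inv\<close>, this formula shows that the inverse of a holomorphic matrix is
  holomorphic.\<close>

definition inv3 :: "complex^3^3 \<Rightarrow> complex^3^3" where
  "inv3 m = (\<chi> i j. vector [
     vector [m $ 2 $ 2 * m $ 3 $ 3 - m $ 2 $ 3 * m $ 3 $ 2, m $ 1 $ 3 * m $ 3 $ 2 - m $ 1 $ 2 * m $ 3 $ 3, m $ 1 $ 2 * m $ 2 $ 3 - m $ 1 $ 3 * m $ 2 $ 2],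
     vector [m $ 2 $ 3 * m $ 3 $ 1 - m $ 2 $ 1 * m $ 3 $ 3, m $ 1 $ 1 * m $ 3 $ 3 - m $ 1 $ 3 * m $ 3 $ 1, m $ 1 $ 3 * m $ 2 $ 1 - m $ 1 $ 1 * m $ 2 $ 3],
     vector [m $ 2 $ 1 * m $ 3 $ 2 - m $ 2 $ 2 * m $ 3 $ 1, m $ 1 $ 2 * m $ 3 $ 1 - m $ 1 $ 1 * m $ 3 $ 2, m $ 1 $ 1 * m $ 2 $ 2 - m $ 1 $ 2 * m $ 2 $ 1]]
     $ i $ j * inverse (det m))"

lemma inv3_inverse:
  assumes d: "det m \<noteq> 0"
  shows "m ** inv3 m = mat 1" "inv3 m ** m = mat 1"
proof -
  have 1: "m ** inv3 m = mat 1"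
  proof -
    have "(\<Sum>k\<in>UNIV. m $ i $ k * (inv3 m $ k $ j)) = (if i = j then det m * inverse (det m) else 0)" for i j
      using exhaust_3[of i] exhaust_3[of j]
      by (elim disjE) (simp_all add: inv3_def sum_3 det_3 algebra_simps)
    then show ?thesis using d unfolding mat3_eq_iff by (simp add: matrix_matrix_mult_def mat_def)
  qed
  then show "m ** inv3 m = mat 1" .
  then show "inv3 m ** m = mat 1" unfolding matrix_left_right_inverse .
qed

context
  fixes A :: "('a, 'n::finite) atlas" and p :: 'a
  assumes cA: "compatible_charts A" and p: "p \<in> points A"
begin

lemma holo_near_det3:
  assumes "\<And>i j. holo_near A p (\<lambda>q. m q $ i $ j)"
  shows "holo_near A p (\<lambda>q. det (m q :: complex^3^3))"
  unfolding det_3 by (intro holo_near_add[OF cA] holo_near_diff[OF cA] holo_near_mult[OF cA] assms)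

lemma holo_near_mat_mult:
  assumes "\<And>i j. holo_near A p (\<lambda>q. m q $ i $ j)" "\<And>i j. holo_near A p (\<lambda>q. m' q $ i $ j)"
  shows "holo_near A p (\<lambda>q. (m q ** m' q) $ i $ j)"
  unfolding matrix_matrix_mult_def vec_lambda_beta
  by (intro holo_near_sum[OF cA p] holo_near_mult[OF cA] assms)

lemma holo_near_inv3:
  assumes m: "\<And>i j. holo_near A p (\<lambda>q. m q $ i $ j)" and d: "det (m p) \<noteq> 0"
  shows "holo_near A p (\<lambda>q. inv3 (m q) $ i $ j)"
proof -
  have id: "holo_near A p (\<lambda>q. inverse (det (m q)))" by (rule holo_near_inverse[OF cA holo_near_det3[OF m] d])
  show ?thesis
    unfolding inv3_def vec_lambda_beta using exhaust_3[of i] exhaust_3[of j]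
    by (elim disjE) (simp_all only: vector_3, (intro holo_near_mult[OF cA _ id] holo_near_diff[OF cA] holo_near_mult[OF cA] m)+)
qed

end

lemma G_mult_in: "k \<in> G_group \<Longrightarrow> l \<in> G_group \<Longrightarrow> k ** l \<in> G_group"
  by (erule G_group_cases, erule G_group_cases) (simp add: G_mat_mult G_mat_in)

lemma G_inv_in: "k \<in> G_group \<Longrightarrow> matrix_inv k \<in> G_group"
  by (erule G_group_cases) (simp add: G_mat_inv G_mat_in)

lemma G_inv_mult: "k \<in> G_group \<Longrightarrow> matrix_inv k ** k = mat 1" "k \<in> G_group \<Longrightarrow> k ** matrix_inv k = mat 1"
  by (erule G_group_cases, simp add: G_mat_inv G_mat_mult G_mat_one[symmetric] divide_inverse)+

lemma G_inv_inv: "k \<in> G_group \<Longrightarrow> matrix_inv (matrix_inv k) = k"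
  by (erule G_group_cases) (simp add: G_mat_inv)

lemma G_inv_prod: "k \<in> G_group \<Longrightarrow> l \<in> G_group \<Longrightarrow> matrix_inv (k ** l) = matrix_inv l ** matrix_inv k"
  by (erule G_group_cases, erule G_group_cases) (simp add: G_mat_inv G_mat_mult divide_inverse algebra_simps)

lemma G_one_in: "mat 1 \<in> G_group"
  using G_mat_in[of 1 0] by (simp add: G_mat_one)

lemma G_det: "k \<in> G_group \<Longrightarrow> det k \<noteq> 0"
  by (erule G_group_cases) (simp add: det_G_mat)

lemma G_nth:
  assumes "k \<in> G_group"
  shows "k $ 1 $ 1 = (k $ 2 $ 2)\<^sup>2" "k $ 1 $ 2 = 0" "k $ 1 $ 3 = 0" "k $ 2 $ 1 = 0" "k $ 2 $ 3 = 0"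
    "k $ 3 $ 1 = 0" "k $ 3 $ 3 = inverse (k $ 2 $ 2)" "k $ 2 $ 2 \<noteq> 0"
proof -
  obtain g h where "g \<noteq> 0" "k = G_mat g h" using assms by (rule G_group_cases)
  then show "k $ 1 $ 1 = (k $ 2 $ 2)\<^sup>2" "k $ 1 $ 2 = 0" "k $ 1 $ 3 = 0" "k $ 2 $ 1 = 0" "k $ 2 $ 3 = 0"
    "k $ 3 $ 1 = 0" "k $ 3 $ 3 = inverse (k $ 2 $ 2)" "k $ 2 $ 2 \<noteq> 0" by simp_all
qed

lemma hmap_G_mult:
  assumes cX: "compatible_charts X" and F: "hmap X G_atlas x F" and H: "hmap X G_atlas x H"
  shows "hmap X G_atlas x (\<lambda>q. F q ** H q)"
proof -
  have x: "x \<in> points X" by (rule hmapD(1)[OF F])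
  have ev: "eventually (\<lambda>q. F q \<in> G_group) (nh X x)" "eventually (\<lambda>q. H q \<in> G_group) (nh X x)"
    using hmap_eventually[OF F nh_points[OF compatible_G_atlas hmapD(2)[OF F]]]
      hmap_eventually[OF H nh_points[OF compatible_G_atlas hmapD(2)[OF H]]] by (simp_all add: points_G_atlas)
  have FG: "F x \<in> G_group" "H x \<in> G_group" using hmapD(2)[OF F] hmapD(2)[OF H] by (simp_all add: points_G_atlas)
  note hF = hmapD(4)[OF F holo_near_G(1)[OF FG(1)]] hmapD(4)[OF F holo_near_G(2)[OF FG(1)]]
  note hH = hmapD(4)[OF H holo_near_G(1)[OF FG(2)]] hmapD(4)[OF H holo_near_G(2)[OF FG(2)]]
  show ?thesis
  proof (rule hmap_GI[OF cX x])
    show "eventually (\<lambda>q. F q ** H q \<in> G_group) (nh X x)"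
      using ev by eventually_elim (rule G_mult_in)
    have "holo_near X x (\<lambda>q. F q $ 2 $ 2 * H q $ 2 $ 2)" by (rule holo_near_mult[OF cX hF(1) hH(1)])
    then show "holo_near X x (\<lambda>q. (F q ** H q) $ 2 $ 2)"
    proof (rule holo_near_cong[OF cX, rotated])
      show "eventually (\<lambda>q. F q $ 2 $ 2 * H q $ 2 $ 2 = (F q ** H q) $ 2 $ 2) (nh X x)"
        using ev by eventually_elim (simp add: matrix_matrix_mult_def sum_3 G_nth)
    qed
    have "holo_near X x (\<lambda>q. F q $ 3 $ 2 * H q $ 2 $ 2 + inverse (F q $ 2 $ 2) * H q $ 3 $ 2)"
      by (intro holo_near_add[OF cX] holo_near_mult[OF cX] holo_near_inverse[OF cX] hF hH G_nth(8)[OF FG(1)])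
    then show "holo_near X x (\<lambda>q. (F q ** H q) $ 3 $ 2)"
    proof (rule holo_near_cong[OF cX, rotated])
      show "eventually (\<lambda>q. F q $ 3 $ 2 * H q $ 2 $ 2 + inverse (F q $ 2 $ 2) * H q $ 3 $ 2 = (F q ** H q) $ 3 $ 2) (nh X x)"
        using ev by eventually_elim (simp add: matrix_matrix_mult_def sum_3 G_nth)
    qed
  qed
qed

lemma hmap_G_inv:
  assumes cX: "compatible_charts X" and F: "hmap X G_atlas x F"
  shows "hmap X G_atlas x (\<lambda>q. matrix_inv (F q))"
proof -
  have x: "x \<in> points X" by (rule hmapD(1)[OF F])
  have ev: "eventually (\<lambda>q. F q \<in> G_group) (nh X x)"
    using hmap_eventually[OF F nh_points[OF compatible_G_atlas hmapD(2)[OF F]]] by (simp add: points_G_atlas)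
  have FG: "F x \<in> G_group" using hmapD(2)[OF F] by (simp add: points_G_atlas)
  note hF = hmapD(4)[OF F holo_near_G(1)[OF FG]] hmapD(4)[OF F holo_near_G(2)[OF FG]]
  have e: "matrix_inv k $ 2 $ 2 = inverse (k $ 2 $ 2)" "matrix_inv k $ 3 $ 2 = - (k $ 3 $ 2)" if "k \<in> G_group" for k
    by (rule G_group_cases[OF that], simp add: G_mat_inv)+
  show ?thesis
  proof (rule hmap_GI[OF cX x])
    show "eventually (\<lambda>q. matrix_inv (F q) \<in> G_group) (nh X x)"
      using ev by eventually_elim (rule G_inv_in)
    show "holo_near X x (\<lambda>q. matrix_inv (F q) $ 2 $ 2)"
    proof (rule holo_near_cong[OF cX _ holo_near_inverse[OF cX hF(1) G_nth(8)[OF FG]]])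
      show "eventually (\<lambda>q. inverse (F q $ 2 $ 2) = matrix_inv (F q) $ 2 $ 2) (nh X x)"
        using ev by eventually_elim (simp add: e)
    qed
    show "holo_near X x (\<lambda>q. matrix_inv (F q) $ 3 $ 2)"
    proof (rule holo_near_cong[OF cX _ holo_near_uminus[OF cX hF(2)]])
      show "eventually (\<lambda>q. - (F q $ 3 $ 2) = matrix_inv (F q) $ 3 $ 2) (nh X x)"
        using ev by eventually_elim (simp add: e)
    qed
  qed
qed

section \<open>Holomorphic one-forms\<close>

lemma holo_one_form_apply:
  assumes cA: "compatible_charts A" and W: "W \<subseteq> points A" and f: "\<And>p. p \<in> W \<Longrightarrow> holo_near A p f"
  shows "holo_one_form A W (\<lambda>e v. v f)"
  unfolding holo_one_form_def
proof (intro conjI ballI)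
  show "tlinear_on (tangent_space A p) (\<lambda>v. v f)" for p unfolding tlinear_on_def by simp
  fix c assume "c \<in> A"
  then obtain U \<kappa> where c: "c = (U, \<kappa>)" "(U, \<kappa>) \<in> A" by (cases c) auto
  have "holo_fun A (U \<inter> W) (\<lambda>q. dv A (U, \<kappa>) i q f)" for i
    by (rule holo_funI[OF cA]) (use holo_near_chart_vec[OF cA c(2)] f in blast)
  then show "case c of (U, \<kappa>) \<Rightarrow> \<forall>i. holo_fun A (U \<inter> W) (\<lambda>q. dv A (U, \<kappa>) i q f)"
    unfolding c(1) by simp
qed

lemma holo_funD:
  assumes cA: "compatible_charts A" and W: "openin (mtop A) W" and f: "holo_fun A W f" "p \<in> W"
  shows "holo_near A p f"
  using W f unfolding holo_near_def by blast

context
  fixes A :: "('a, 'n::finite) atlas" and W :: "'a set"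
  assumes cA: "compatible_charts A" and W: "openin (mtop A) W"
begin

lemma holo_one_form_near:
  assumes "holo_one_form A W \<alpha>" "(U, \<kappa>) \<in> A" "p \<in> U" "p \<in> W"
  shows "holo_near A p (\<lambda>q. \<alpha> q (dv A (U, \<kappa>) i q))"
proof (rule holo_funD[OF cA])
  show "openin (mtop A) (U \<inter> W)" using openin_chart[OF cA assms(2)] W by (rule openin_Int)
  show "holo_fun A (U \<inter> W) (\<lambda>q. \<alpha> q (dv A (U, \<kappa>) i q))" using assms(1,2) unfolding holo_one_form_def by blast
qed (use assms in blast)

lemma holo_one_formI:
  assumes "\<And>p. p \<in> W \<Longrightarrow> tlinear_on (tangent_space A p) (\<alpha> p)"
    and "\<And>U \<kappa> p i. (U, \<kappa>) \<in> A \<Longrightarrow> p \<in> U \<Longrightarrow> p \<in> W \<Longrightarrow> holo_near A p (\<lambda>q. \<alpha> q (dv A (U, \<kappa>) i q))"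
  shows "holo_one_form A W \<alpha>"
  unfolding holo_one_form_def
proof (intro conjI ballI)
  fix c assume "c \<in> A"
  then obtain U \<kappa> where c: "c = (U, \<kappa>)" "(U, \<kappa>) \<in> A" by (cases c) auto
  have "holo_fun A (U \<inter> W) (\<lambda>q. \<alpha> q (dv A (U, \<kappa>) i q))" for i
    by (rule holo_funI[OF cA]) (use assms(2)[OF c(2)] in blast)
  then show "case c of (U, \<kappa>) \<Rightarrow> \<forall>i. holo_fun A (U \<inter> W) (\<lambda>q. \<alpha> q (dv A (U, \<kappa>) i q))"
    unfolding c(1) by simp
qed (rule assms(1))

lemma holo_one_form_add:
  assumes a: "holo_one_form A W \<alpha>" and b: "holo_one_form A W \<beta>"
  shows "holo_one_form A W (\<lambda>e v. \<alpha> e v + \<beta> e v)"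
proof (rule holo_one_formI)
  fix p assume p: "p \<in> W"
  have "tlinear_on (tangent_space A p) (\<alpha> p)" using a p unfolding holo_one_form_def by blast
  moreover have "tlinear_on (tangent_space A p) (\<beta> p)" using b p unfolding holo_one_form_def by blast
  ultimately show "tlinear_on (tangent_space A p) (\<lambda>v. \<alpha> p v + \<beta> p v)" unfolding tlinear_on_def by (simp add: distrib_left)
qed (intro holo_near_add[OF cA] holo_one_form_near[OF a] holo_one_form_near[OF b])

lemma holo_one_form_scale:
  assumes F: "\<And>p. p \<in> W \<Longrightarrow> holo_near A p F" and a: "holo_one_form A W \<alpha>"
  shows "holo_one_form A W (\<lambda>e v. F e * \<alpha> e v)"
proof (rule holo_one_formI)
  fix p assume p: "p \<in> W"
  have "tlinear_on (tangent_space A p) (\<alpha> p)" using a p unfolding holo_one_form_def by blast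
  then show "tlinear_on (tangent_space A p) (\<lambda>v. F p * \<alpha> p v)"
    unfolding tlinear_on_def by (simp add: distrib_left mult.left_commute)
qed (intro holo_near_mult[OF cA] F holo_one_form_near[OF a])

end

lemma tv_inverse:
  assumes cA: "compatible_charts A" and v: "v \<in> tangent_space A p" and f: "holo_near A p f" "f p \<noteq> 0"
  shows "v (\<lambda>q. inverse (f q)) = - v f / (f p)\<^sup>2"
proof -
  have p: "p \<in> points A" by (rule holo_near_points[OF cA f(1)])
  have "v (\<lambda>q. f q * inverse (f q)) = v (\<lambda>q. 1)"
    by (rule tv_cong[OF cA v _ p], rule eventually_mono[OF holo_near_nonzero[OF cA f]]) simp
  then have "f p * v (\<lambda>q. inverse (f q)) + inverse (f p) * v f = 0"
    using tv_mult[OF v f(1) holo_near_inverse[OF cA f]] tv_const[OF cA v p] by simp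
  then have "v (\<lambda>q. inverse (f q)) = - (inverse (f p) * v f) * inverse (f p)"
    using f(2) by (simp add: field_simps eq_neg_iff_add_eq_0)
  then show ?thesis by (simp add: power2_eq_square divide_inverse mult_ac)
qed

lemma open_sub_Int_points: "open_sub A W = open_sub A (W \<inter> points A)"
proof -
  have "(U \<inter> W, \<kappa>) = (U \<inter> (W \<inter> points A), \<kappa>)" if "(U, \<kappa>) \<in> A" for U \<kappa>
    using chart_subset_points[OF that] by auto
  then show ?thesis unfolding open_sub_def by (intro image_cong) auto
qed

section \<open>The structure defined by a family of adapted coframes\<close>

text \<open>The orbits of these coframes under left multiplication by \<open>G_group\<close> will
  form the total space of a conservation law on all of \<open>M\<close>. Everything about
  \<open>S\<close> and about the given law is hidden behind these assumptions.\<close>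

locale adapted_family =
  fixes M :: "('a, 3) atlas" and AD :: "(('a, 3) chart \<times> 'a set \<times> ('a \<Rightarrow> complex^3^3)) set"
  assumes M: "complex_manifold M"
    and chart: "\<And>c W \<eta>. (c, W, \<eta>) \<in> AD \<Longrightarrow> c \<in> M" "\<And>c W \<eta>. (c, W, \<eta>) \<in> AD \<Longrightarrow> W \<subseteq> fst c"
      "\<And>c W \<eta>. (c, W, \<eta>) \<in> AD \<Longrightarrow> openin (mtop M) W"
    and holo: "\<And>c W \<eta> p i j. (c, W, \<eta>) \<in> AD \<Longrightarrow> p \<in> W \<Longrightarrow> holo_near M p (\<lambda>q. \<eta> q $ i $ j)"
    and nondeg: "\<And>c W \<eta> p. (c, W, \<eta>) \<in> AD \<Longrightarrow> p \<in> W \<Longrightarrow> det (\<eta> p) \<noteq> 0"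
    and adapted: "\<And>c W \<eta> p. (c, W, \<eta>) \<in> AD \<Longrightarrow> p \<in> W \<Longrightarrow> adapted M c \<eta> p"
    and trans: "\<And>c W \<eta> c' W' \<eta>' p. (c, W, \<eta>) \<in> AD \<Longrightarrow> (c', W', \<eta>') \<in> AD \<Longrightarrow> p \<in> W \<Longrightarrow> p \<in> W' \<Longrightarrow>
      \<exists>k\<in>G_group. \<eta> p ** jac M c c' p = k ** \<eta>' p"
    and cover: "\<And>p. p \<in> points M \<Longrightarrow> \<exists>c W \<eta>. (c, W, \<eta>) \<in> AD \<and> p \<in> W"
begin

abbreviation "dc \<equiv> \<lambda>d :: ('a, 3) chart \<times> 'a set \<times> ('a \<Rightarrow> complex^3^3). fst d"
abbreviation "dW \<equiv> \<lambda>d :: ('a, 3) chart \<times> 'a set \<times> ('a \<Rightarrow> complex^3^3). fst (snd d)"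
abbreviation "d\<eta> \<equiv> \<lambda>d :: ('a, 3) chart \<times> 'a set \<times> ('a \<Rightarrow> complex^3^3). snd (snd d)"

text \<open>\<open>sg d\<close> parametrises the frames over \<open>dW d\<close> by point and group
  element, \<open>tT d\<close> recovers the group element of a frame, and \<open>tau d\<close> is
  the resulting identification of \<open>Dm d\<close> with \<open>dW d\<close> times the
  group.\<close>

definition sg where "sg d = (\<lambda>(p, k). fr M (dc d) p (k ** d\<eta> d p))"
definition tT where "tT d e = mt M (dc d) e ** inv3 (d\<eta> d (fst e))"
definition Dm where "Dm d = sg d ` (dW d \<times> G_group)"
definition tau where "tau d e = (fst e, tT d e)"
definition Cd where "Cd d = (fst (dc d) \<times> G_group, pc (snd (dc d)) gc)"
text \<open>Any bijection will do: it only renames three base coordinates and two group coordinates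
  as five.\<close>

definition j5 :: "5 \<Rightarrow> 3 + 2" where "j5 = (SOME f. bij f)"

lemma cM: "compatible_charts M"
  using M unfolding complex_manifold_def by blast

lemma AD:
  assumes "d \<in> AD"
  shows "(fst (dc d), snd (dc d)) \<in> M" "dW d \<subseteq> fst (dc d)" "openin (mtop M) (dW d)"
    "p \<in> dW d \<Longrightarrow> holo_near M p (\<lambda>q. d\<eta> d q $ i $ j)" "p \<in> dW d \<Longrightarrow> det (d\<eta> d p) \<noteq> 0"
    "p \<in> dW d \<Longrightarrow> adapted M (dc d) (d\<eta> d) p" "dW d \<subseteq> points M"
proof -
  have d: "(dc d, dW d, d\<eta> d) \<in> AD" using assms by simp
  show "(fst (dc d), snd (dc d)) \<in> M" using chart(1)[OF d] by simp
  show "dW d \<subseteq> fst (dc d)" "openin (mtop M) (dW d)" by (rule chart[OF d])+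
  then show "dW d \<subseteq> points M" using chart_subset_points[OF \<open>(fst (dc d), snd (dc d)) \<in> M\<close>] by blast
  show "p \<in> dW d \<Longrightarrow> holo_near M p (\<lambda>q. d\<eta> d q $ i $ j)" by (rule holo[OF d])
  show "p \<in> dW d \<Longrightarrow> det (d\<eta> d p) \<noteq> 0" by (rule nondeg[OF d])
  show "p \<in> dW d \<Longrightarrow> adapted M (dc d) (d\<eta> d) p" by (rule adapted[OF d])
qed

lemma bij_j5: "bij j5"
proof -
  have "\<exists>f :: 5 \<Rightarrow> 3 + 2. bij f"
    using finite_same_card_bij[of "UNIV :: 5 set" "UNIV :: (3 + 2) set"] by simp
  then show ?thesis unfolding j5_def by (rule someI_ex)
qed

lemma fst_sg [simp]: "fst (sg d (p, k)) = p"
  by (simp add: sg_def)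

lemma mt_sg: "d \<in> AD \<Longrightarrow> p \<in> dW d \<Longrightarrow> mt M (dc d) (sg d (p, k)) = k ** d\<eta> d p"
  using mt_fr_self[OF cM AD(1), of d p] AD(2)[of d] by (auto simp: sg_def)

lemma tau_sg: "d \<in> AD \<Longrightarrow> p \<in> dW d \<Longrightarrow> tau d (sg d (p, k)) = (p, k)"
  by (simp add: tau_def tT_def mt_sg matrix_mul_assoc[symmetric] inv3_inverse(1)[OF AD(5)])

lemma sg_frames: "d \<in> AD \<Longrightarrow> p \<in> dW d \<Longrightarrow> k \<in> G_group \<Longrightarrow> sg d (p, k) \<in> frames M"
  using fr_in_frames[OF cM AD(1)[of d], of p "k ** d\<eta> d p"] AD(2)[of d] AD(5)[of d p] G_det[of k]
  by (auto simp: sg_def det_mul)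

lemma DmE:
  assumes "e \<in> Dm d" "d \<in> AD"
  shows "fst e \<in> dW d" "tT d e \<in> G_group" "e = sg d (fst e, tT d e)" "e \<in> frames M"
    "mt M (dc d) e = tT d e ** d\<eta> d (fst e)"
proof -
  obtain p k where pk: "p \<in> dW d" "k \<in> G_group" "e = sg d (p, k)" using assms(1) unfolding Dm_def by blast
  have "tau d e = (p, k)" unfolding pk(3) by (rule tau_sg[OF assms(2) pk(1)])
  then have *: "fst e = p" "tT d e = k" by (simp_all add: tau_def)
  show "fst e \<in> dW d" "tT d e \<in> G_group" "e = sg d (fst e, tT d e)" using * pk by simp_all
  show "e \<in> frames M" unfolding pk(3) by (rule sg_frames[OF assms(2) pk(1,2)])
  show "mt M (dc d) e = tT d e ** d\<eta> d (fst e)" unfolding * unfolding pk(3) by (rule mt_sg[OF assms(2) pk(1)])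
qed

lemma DmI: "d \<in> AD \<Longrightarrow> p \<in> dW d \<Longrightarrow> k \<in> G_group \<Longrightarrow> sg d (p, k) \<in> Dm d"
  unfolding Dm_def by blast

text \<open>Changing the coframe multiplies the group element from the right by a function of the
  point alone. Written with \<open>inv3\<close>, this function is visibly holomorphic.\<close>

lemma transition:
  assumes d: "d \<in> AD" "d' \<in> AD" and p: "p \<in> dW d" "p \<in> dW d'"
  defines "T \<equiv> \<lambda>p. d\<eta> d p ** jac M (dc d) (dc d') p ** inv3 (d\<eta> d' p)"
  shows "T p \<in> G_group" "sg d (p, k) = sg d' (p, k ** T p)"
proof -
  obtain g where g: "g \<in> G_group" "d\<eta> d p ** jac M (dc d) (dc d') p = g ** d\<eta> d' p"
    using trans[of "dc d" "dW d" "d\<eta> d" "dc d'" "dW d'" "d\<eta> d'" p] d p by auto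
  have T: "T p = g"
    unfolding T_def g(2) by (simp add: matrix_mul_assoc[symmetric] inv3_inverse(1)[OF AD(5)[OF d(2) p(2)]])
  then show "T p \<in> G_group" using g by simp
  have U: "(fst (dc d), snd (dc d)) \<in> M" "p \<in> fst (dc d)" and V: "(fst (dc d'), snd (dc d')) \<in> M" "p \<in> fst (dc d')"
    using AD(1,2)[OF d(1)] AD(1,2)[OF d(2)] p by auto
  have c: "fr M (dc d) p m = fr M (dc d') p (m ** jac M (dc d) (dc d') p)" if "det m \<noteq> 0" for m
    using fr_mt[OF cM V(1), of "fr M (dc d) p m"] fr_in_frames[OF cM U that] mt_fr[OF cM U V, of m] V(2) by simp
  show "sg d (p, k) = sg d' (p, k ** T p)"
  \<comment> \<open>\<open>fr_mt\<close> speaks of frames and so requires an invertible matrix. For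
    singular \<open>k\<close> the change of chart is checked on tangent vectors directly.\<close>
  proof (cases "det k = 0")
    case True
    have "fr M (dc d) p m = fr M (dc d') p (m ** jac M (dc d) (dc d') p)" for m
    proof -
      have "m *v (\<chi> i. v (\<lambda>q. snd (dc d) q $ i)) = (m ** jac M (dc d) (dc d') p) *v (\<chi> i. v (\<lambda>q. snd (dc d') q $ i))"
        if v: "v \<in> tangent_space M p" for v
      proof -
        have "v (\<lambda>q. snd (dc d) q $ i) = (\<Sum>j\<in>UNIV. v (\<lambda>q. snd (dc d') q $ j) * jac M (dc d) (dc d') p $ i $ j)" for i
          using tangent_apply[OF cM V v holo_near_coord[OF cM U, of i]] by (simp add: jac_def)
        then have "(\<chi> i. v (\<lambda>q. snd (dc d) q $ i)) = jac M (dc d) (dc d') p *v (\<chi> i. v (\<lambda>q. snd (dc d') q $ i))"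
          by (simp add: vec_eq_iff matrix_vector_mult_def mult.commute)
        then show ?thesis by (simp add: matrix_vector_mul_assoc)
      qed
      then show ?thesis unfolding fr_def by (simp cong: restrict_cong)
    qed
    then show ?thesis by (simp add: sg_def T matrix_mul_assoc[symmetric] g(2))
  next
    case False
    then have "det (k ** d\<eta> d p) \<noteq> 0" using AD(5)[OF d(1) p(1)] by (simp add: det_mul)
    from c[OF this] show ?thesis by (simp add: sg_def T matrix_mul_assoc[symmetric] g(2))
  qed
qed

text \<open>Two coframes define the same orbit over a common point. Hence \<open>Dm d\<close>
  consists of all points of the total space over \<open>dW d\<close>, as \<open>Dm_iff\<close>
  records.\<close>

lemma Dm_overlap:
  assumes d: "d \<in> AD" "d' \<in> AD" and e: "e \<in> Dm d" "fst e \<in> dW d'"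
  shows "e \<in> Dm d'"
proof -
  note E = DmE[OF e(1) d(1)] and T = transition[OF d DmE(1)[OF e(1) d(1)] e(2)]
  show ?thesis
    by (subst E(3), subst T(2), rule DmI[OF d(2) e(2) G_mult_in[OF E(2) T(1)]])
qed

abbreviation "PG \<equiv> prod_atlas M G_atlas"

lemma cPG: "compatible_charts PG"
  by (rule compatible_prod_atlas[OF cM compatible_G_atlas])

lemma tau_image:
  assumes d: "d \<in> AD" "d' \<in> AD"
  shows "tau d ` (Dm d \<inter> Dm d') = (dW d \<inter> dW d') \<times> G_group"
proof (intro equalityI subsetI)
  fix x assume "x \<in> tau d ` (Dm d \<inter> Dm d')"
  then obtain e where "e \<in> Dm d" "e \<in> Dm d'" "x = tau d e" by blast
  then show "x \<in> (dW d \<inter> dW d') \<times> G_group"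
    using DmE(1,2)[of e d] DmE(1)[of e d'] d by (simp add: tau_def)
next
  fix x assume "x \<in> (dW d \<inter> dW d') \<times> G_group"
  then obtain p k where pk: "x = (p, k)" "p \<in> dW d" "p \<in> dW d'" "k \<in> G_group" by blast
  have "sg d (p, k) \<in> Dm d" by (rule DmI[OF d(1) pk(2,4)])
  moreover then have "sg d (p, k) \<in> Dm d'" using Dm_overlap[OF d] pk(3) by simp
  moreover have "tau d (sg d (p, k)) = x" using tau_sg[OF d(1) pk(2)] pk(1) by simp
  ultimately show "x \<in> tau d ` (Dm d \<inter> Dm d')" by blast
qed

lemma inj_tau: "d \<in> AD \<Longrightarrow> inj_on (tau d) (Dm d)"
  by (rule inj_onI) (metis DmE(3) tau_def)

lemma inv_tau:
  assumes d: "d \<in> AD" "p \<in> dW d" "k \<in> G_group"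
  shows "inv_into (Dm d) (tau d) (p, k) = sg d (p, k)"
  using inv_into_f_f[OF inj_tau[OF d(1)] DmI[OF d]] unfolding tau_sg[OF d(1,2)] .

lemma Cd: "d \<in> AD \<Longrightarrow> Cd d \<in> PG"
  unfolding Cd_def prod_atlas_eq[OF cM compatible_G_atlas] using AD(1) chart_G_atlas by blast

lemma openin_PG:
  assumes W: "openin (mtop M) W"
  shows "openin (mtop PG) (W \<times> G_group)"
proof (subst openin_subopen, intro ballI)
  fix x assume x: "x \<in> W \<times> G_group"
  have sub: "W \<subseteq> points M" using open_sub_subset[OF cM W] .
  have xp: "x \<in> points M \<times> points G_atlas" using x sub by (auto simp: points_G_atlas)
  have "fst x \<in> W" using x by auto
  then have 1: "eventually (\<lambda>y. fst y \<in> W) (nh PG x)"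
    using hmap_eventually[OF hmap_prod_proj(1)[OF cM compatible_G_atlas xp] nh_open[OF cM W]] by blast
  have xPG: "x \<in> points PG" using xp unfolding points_prod_atlas[OF cM compatible_G_atlas] .
  have "eventually (\<lambda>y. y \<in> W \<times> G_group) (nh PG x)"
    using 1 nh_points[OF cPG xPG, unfolded points_prod_atlas[OF cM compatible_G_atlas] points_G_atlas]
    by eventually_elim auto
  then obtain T where "openin (mtop PG) T" "x \<in> T" "\<And>y. y \<in> T \<Longrightarrow> y \<in> W \<times> G_group"
    using eventually_nhE[OF cPG _ xPG] by blast
  then show "\<exists>T. openin (mtop PG) T \<and> x \<in> T \<and> T \<subseteq> W \<times> G_group" by blast
qed

lemma hmap_transition:
  assumes d: "d \<in> AD" "d' \<in> AD" and e: "e \<in> Dm d" "e \<in> Dm d'"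
  shows "hmap PG PG (tau d e) (\<lambda>x. tau d' (inv_into (Dm d) (tau d) x))"
proof -
  define T where "T p = d\<eta> d p ** jac M (dc d) (dc d') p ** inv3 (d\<eta> d' p)" for p
  let ?x = "tau d e"
  let ?W = "dW d \<inter> dW d'"
  have W: "openin (mtop M) ?W" using AD(3)[OF d(1)] AD(3)[OF d(2)] by (rule openin_Int)
  have xW: "?x \<in> ?W \<times> G_group" using tau_image[OF d] e by blast
  have p: "fst ?x \<in> dW d" "fst ?x \<in> dW d'" "fst ?x \<in> points M" using xW AD(7)[OF d(1)] by auto
  have xp: "?x \<in> points M \<times> points G_atlas" using xW AD(7)[OF d(1)] by (auto simp: points_G_atlas)
  note h1 = hmap_prod_proj(1)[OF cM compatible_G_atlas xp] and h2 = hmap_prod_proj(2)[OF cM compatible_G_atlas xp]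
  have hT: "hmap M G_atlas (fst ?x) T"
  proof (rule hmap_GI[OF cM p(3)])
    show "eventually (\<lambda>q. T q \<in> G_group) (nh M (fst ?x))"
      by (rule eventually_mono[OF nh_open[OF cM W]]) (use xW transition(1)[OF d] in \<open>auto simp: T_def\<close>)
    have hTT: "holo_near M (fst ?x) (\<lambda>q. T q $ i $ j)" for i j
    proof -
      have j: "holo_near M (fst ?x) (\<lambda>q. jac M (dc d) (dc d') q $ i $ j)" for i j
        using holo_near_jac[OF cM AD(1)[OF d(1)] subsetD[OF AD(2)[OF d(1)] p(1)] AD(1)[OF d(2)] subsetD[OF AD(2)[OF d(2)] p(2)]] by simp
      show ?thesis unfolding T_def
        by (intro holo_near_mat_mult[OF cM p(3)] holo_near_inv3[OF cM p(3)] j AD(4)[OF d(1) p(1)] AD(4)[OF d(2) p(2)] AD(5)[OF d(2) p(2)])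
    qed
    show "holo_near M (fst ?x) (\<lambda>q. T q $ 2 $ 2)" "holo_near M (fst ?x) (\<lambda>q. T q $ 3 $ 2)" by (rule hTT)+
  qed
  have "hmap PG PG ?x (\<lambda>x. (fst x, snd x ** T (fst x)))"
    by (rule hmap_pair[OF cM compatible_G_atlas cPG h1 hmap_G_mult[OF cPG h2 hmap_compose[OF h1 hT]]])
  then show ?thesis
  proof (rule hmap_cong[OF cPG])
    show "eventually (\<lambda>x. (fst x, snd x ** T (fst x)) = tau d' (inv_into (Dm d) (tau d) x)) (nh PG ?x)"
    proof (rule eventually_mono[OF nh_open[OF cPG openin_PG[OF W] xW]])
      fix x assume "x \<in> ?W \<times> G_group"
      then obtain p k where x: "x = (p, k)" "p \<in> dW d" "p \<in> dW d'" "k \<in> G_group" by blast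
      have "inv_into (Dm d) (tau d) x = sg d' (p, k ** T p)"
        unfolding x(1) inv_tau[OF d(1) x(2,4)] T_def by (rule transition(2)[OF d x(2,3)])
      then show "(fst x, snd x ** T (fst x)) = tau d' (inv_into (Dm d) (tau d) x)"
        using tau_sg[OF d(2) x(3)] x(1) by simp
    qed
  qed
qed

sublocale G: glue PG AD Dm tau Cd j5
proof
  show "compatible_charts PG" by (rule cPG)
  show "bij j5" by (rule bij_j5)
  show "inj_on (tau d) (Dm d)" if "d \<in> AD" for d by (rule inj_tau[OF that])
  show "Cd d \<in> PG" if "d \<in> AD" for d by (rule Cd[OF that])
  show "tau d e \<in> fst (Cd d)" if "d \<in> AD" "e \<in> Dm d" for d e
    using DmE(1,2)[OF that(2,1)] AD(2)[OF that(1)] by (auto simp: tau_def Cd_def)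
  show "openin (mtop PG) (tau d ` (Dm d \<inter> Dm d'))" if "d \<in> AD" "d' \<in> AD" for d d'
    unfolding tau_image[OF that] by (rule openin_PG) (rule openin_Int[OF AD(3)[OF that(1)] AD(3)[OF that(2)]])
  show "hmap PG PG (tau d e) (\<lambda>x. tau d' (inv_into (Dm d) (tau d) x))"
    if "d \<in> AD" "d' \<in> AD" "e \<in> Dm d" "e \<in> Dm d'" for d d' e
    by (rule hmap_transition[OF that])
qed

abbreviation "EA \<equiv> G.atlas"

text \<open>The total space lies inside the frame bundle, so the bundle map to frames is the
  inclusion and the action is that on frames.\<close>

definition EE :: "('a, ('a, 3) frame) gstruct" where
  "EE = \<lparr>total = EA, proj = fst, act = (\<lambda>e k. frame_act M k e), to_frame = (\<lambda>e. e)\<rparr>"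

lemmas cEA = G.compatible_atlas

lemma EA_E:
  assumes "e \<in> points EA"
  obtains d where "d \<in> AD" "e \<in> Dm d"
  using assms unfolding G.points_atlas by blast

lemma EA_I: "d \<in> AD \<Longrightarrow> e \<in> Dm d \<Longrightarrow> e \<in> points EA"
  unfolding G.points_atlas by blast

lemma Dm_iff: "d \<in> AD \<Longrightarrow> e \<in> points EA \<Longrightarrow> e \<in> Dm d \<longleftrightarrow> fst e \<in> dW d"
  using Dm_overlap EA_E DmE(1) by metis

lemma fst_points: "e \<in> points EA \<Longrightarrow> fst e \<in> points M"
  by (erule EA_E) (use AD(7) DmE(1) in blast)

lemma tau_points: "d \<in> AD \<Longrightarrow> e \<in> Dm d \<Longrightarrow> tau d e \<in> points M \<times> points G_atlas"
  using DmE(1,2)[of e d] AD(7)[of d] by (auto simp: tau_def points_G_atlas)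

lemma hmap_fst: "e \<in> points EA \<Longrightarrow> hmap EA M e fst"
proof (erule EA_E)
  fix d assume d: "d \<in> AD" "e \<in> Dm d"
  have "hmap EA M e (\<lambda>q. fst (tau d q))"
    by (rule hmap_compose[OF G.hmap_\<tau>[OF d] hmap_prod_proj(1)[OF cM compatible_G_atlas tau_points[OF d]]])
  then show ?thesis by (simp add: tau_def)
qed

lemma hmap_tT: "d \<in> AD \<Longrightarrow> e \<in> Dm d \<Longrightarrow> hmap EA G_atlas e (tT d)"
proof -
  assume d: "d \<in> AD" "e \<in> Dm d"
  have "hmap EA G_atlas e (\<lambda>q. snd (tau d q))"
    by (rule hmap_compose[OF G.hmap_\<tau>[OF d] hmap_prod_proj(2)[OF cM compatible_G_atlas tau_points[OF d]]])
  then show ?thesis by (simp add: tau_def)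
qed

lemma hmap_sg:
  assumes cX: "compatible_charts X" and d: "d \<in> AD" and F: "hmap X M x F" "F x \<in> dW d" and H: "hmap X G_atlas x H"
  shows "hmap X EA x (\<lambda>q. sg d (F q, H q))"
proof -
  have HG: "H x \<in> G_group" using hmapD(2)[OF H] by (simp add: points_G_atlas)
  let ?e = "sg d (F x, H x)"
  have e: "?e \<in> Dm d" by (rule DmI[OF d F(2) HG])
  have te: "tau d ?e = (F x, H x)" by (rule tau_sg[OF d F(2)])
  have "hmap X EA x (\<lambda>q. inv_into (Dm d) (tau d) (F q, H q))"
    by (rule hmap_compose[OF hmap_pair[OF cM compatible_G_atlas cX F(1) H]]) (use G.hmap_\<sigma>[OF d e] te in simp)
  then show ?thesis
  proof (rule hmap_cong[OF cX])
    show "eventually (\<lambda>q. inv_into (Dm d) (tau d) (F q, H q) = sg d (F q, H q)) (nh X x)"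
      using hmap_eventually[OF F(1) nh_open[OF cM AD(3)[OF d] F(2)]]
        hmap_eventually[OF H nh_points[OF compatible_G_atlas hmapD(2)[OF H]]]
      by eventually_elim (simp add: inv_tau[OF d] points_G_atlas)
  qed
qed

lemma act_sg: "frame_act M k (sg d (p, l)) = sg d (p, matrix_inv k ** l)"
  by (simp add: sg_def frame_act_fr matrix_mul_assoc)

lemma act_Dm: "d \<in> AD \<Longrightarrow> e \<in> Dm d \<Longrightarrow> frame_act M k e = sg d (fst e, matrix_inv k ** tT d e)"
  using act_sg[of k d "fst e" "tT d e"] DmE(3)[of e d] by simp

lemma Dm_open: "d \<in> AD \<Longrightarrow> openin (mtop EA) (Dm d)"
  by (rule openin_chart[OF cEA G.chart_atlas])

lemma complex_manifold_EA: "complex_manifold EA"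
  unfolding complex_manifold_def
proof (intro conjI)
  show "compatible_charts EA" by (rule cEA)
  show "Hausdorff_space (mtop EA)"
    unfolding Hausdorff_space_def topspace_mtop[OF cEA]
  proof (intro allI impI)
    fix e e' assume "e \<in> points EA \<and> e' \<in> points EA \<and> e \<noteq> e'"
    then have e: "e \<in> points EA" "e' \<in> points EA" "e \<noteq> e'" by auto
    show "\<exists>U V. openin (mtop EA) U \<and> openin (mtop EA) V \<and> e \<in> U \<and> e' \<in> V \<and> disjnt U V"
    \<comment> \<open>Points of one fibre lie in a common chart and are separated there; points of
      different fibres are separated by sets pulled back from \<open>M\<close>.\<close>
    proof (cases "fst e = fst e'")
      case True
      obtain d where d: "d \<in> AD" "e \<in> Dm d" using e(1) by (rule EA_E)
      then have d': "e' \<in> Dm d" using Dm_iff[OF d(1) e(2)] DmE(1)[OF d(2,1)] True by simp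
      have "G.chi d e \<noteq> G.chi d e'" using inj_onD[OF G.inj_chi[OF d(1)] _ d(2) d'] e(3) by blast
      from hausdorff[OF this] obtain Q Q' where Q: "open Q" "open Q'" "G.chi d e \<in> Q" "G.chi d e' \<in> Q'" "Q \<inter> Q' = {}"
        by (elim exE conjE) (rule that)
      have "openin (mtop EA) (Dm d \<inter> G.chi d -` Q)" "openin (mtop EA) (Dm d \<inter> G.chi d -` Q')"
        by (rule open_chart_preimage[OF cEA G.chart_atlas[OF d(1)] Q(1)])
          (rule open_chart_preimage[OF cEA G.chart_atlas[OF d(1)] Q(2)])
      moreover have "disjnt (Dm d \<inter> G.chi d -` Q) (Dm d \<inter> G.chi d -` Q')"
        using Q(5) unfolding disjnt_def by blast
      ultimately show ?thesis using d(2) d' Q(3,4) by blast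
    next
      case False
      have "Hausdorff_space (mtop M)" using M unfolding complex_manifold_def by blast
      then obtain U V where UV: "openin (mtop M) U" "openin (mtop M) V" "fst e \<in> U" "fst e' \<in> V" "disjnt U V"
        using False fst_points[OF e(1)] fst_points[OF e(2)] unfolding Hausdorff_space_def topspace_mtop[OF cM] by blast
      have "holo_map EA M fst" unfolding holo_map_iff[OF cEA cM] using hmap_fst by blast
      then have c: "continuous_map (mtop EA) (mtop M) fst" unfolding holo_map_def by blast
      let ?P = "\<lambda>U. {x \<in> topspace (mtop EA). fst x \<in> U}"
      have "openin (mtop EA) (?P U)" "openin (mtop EA) (?P V)"
        using openin_continuous_map_preimage[OF c UV(1)] openin_continuous_map_preimage[OF c UV(2)] .
      moreover have "disjnt (?P U) (?P V)" using UV(5) unfolding disjnt_def by blast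
      moreover have "e \<in> ?P U" "e' \<in> ?P V" using e UV(3,4) unfolding topspace_mtop[OF cEA] by auto
      ultimately show ?thesis by blast
    qed
  qed
  show "second_countable (mtop EA)"
  proof -
    \<comment> \<open>Countably many of the sets \<open>dW d\<close> already cover \<open>M\<close>,
      and the charts over them meet the hypothesis of \<open>second_countable_mtop\<close>.\<close>
    have "second_countable (mtop M)" using M unfolding complex_manifold_def by blast
    then have L: "Lindelof_space (mtop M)" by (rule second_countable_imp_Lindelof_space)
    have U: "\<Union> (dW ` AD) = topspace (mtop M)"
      unfolding topspace_mtop[OF cM] using AD(7) cover by force
    have "\<forall>U\<in>dW ` AD. openin (mtop M) U" using AD(3) by blast
    from L[unfolded Lindelof_space_def, THEN spec, THEN mp, OF conjI[OF this U]]
    obtain \<V> where V: "countable \<V>" "\<V> \<subseteq> dW ` AD" "\<Union>\<V> = topspace (mtop M)"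
      by (elim exE conjE) (rule that)
    then obtain AD' where AD': "countable AD'" "AD' \<subseteq> AD" "\<V> = dW ` AD'"
      by (meson countable_subset_image)
    show ?thesis
    proof (rule second_countable_mtop[OF cEA, of "(\<lambda>d. (Dm d, G.chi d)) ` AD'"])
      show "(\<lambda>d. (Dm d, G.chi d)) ` AD' \<subseteq> EA" using AD'(2) G.chart_atlas by blast
      show "countable ((\<lambda>d. (Dm d, G.chi d)) ` AD')" using AD'(1) by blast
      show "points EA \<subseteq> points ((\<lambda>d. (Dm d, G.chi d)) ` AD')"
      proof
        fix e assume e: "e \<in> points EA"
        have "fst e \<in> \<Union>\<V>" using fst_points[OF e] V(3) topspace_mtop[OF cM] by simp
        then obtain d where d: "d \<in> AD'" "fst e \<in> dW d" using AD'(3) by blast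
        then have "e \<in> Dm d" using Dm_iff[OF _ e] AD'(2) by blast
        then show "e \<in> points ((\<lambda>d. (Dm d, G.chi d)) ` AD')" using d(1) unfolding points_def by blast
      qed
    qed
  qed
qed

lemma hmap_act:
  assumes "x \<in> points EA \<times> G_group"
  shows "hmap (prod_atlas EA G_atlas) EA x (\<lambda>(e, k). frame_act M k e)"
proof -
  obtain e k where x: "x = (e, k)" "e \<in> points EA" "k \<in> G_group" using assms by blast
  obtain d where d: "d \<in> AD" "e \<in> Dm d" using x(2) by (rule EA_E)
  let ?X = "prod_atlas EA G_atlas"
  have cX: "compatible_charts ?X" by (rule compatible_prod_atlas[OF cEA compatible_G_atlas])
  have xp: "x \<in> points EA \<times> points G_atlas" using x by (simp add: points_G_atlas)
  note h1 = hmap_prod_proj(1)[OF cEA compatible_G_atlas xp] and h2 = hmap_prod_proj(2)[OF cEA compatible_G_atlas xp]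
  have fx: "fst x = e" using x by simp
  have 1: "hmap ?X M x (\<lambda>q. fst (fst q))"
    by (rule hmap_compose[OF h1]) (use hmap_fst x fx in simp)
  have 2: "hmap ?X G_atlas x (\<lambda>q. tT d (fst q))"
    by (rule hmap_compose[OF h1]) (use hmap_tT[OF d] fx in simp)
  have "hmap ?X EA x (\<lambda>q. sg d (fst (fst q), matrix_inv (snd q) ** tT d (fst q)))"
    by (rule hmap_sg[OF cX d(1) 1 _ hmap_G_mult[OF cX hmap_G_inv[OF cX h2] 2]]) (use DmE(1)[OF d(2,1)] fx in simp)
  then show ?thesis
  proof (rule hmap_cong[OF cX])
    have "eventually (\<lambda>q. fst q \<in> Dm d) (nh ?X x)"
      using hmap_eventually[OF h1 nh_open[OF cEA Dm_open[OF d(1)]]] fx d(2) by simp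
    then show "eventually (\<lambda>q. sg d (fst (fst q), matrix_inv (snd q) ** tT d (fst q)) =
        (case q of (e, k) \<Rightarrow> frame_act M k e)) (nh ?X x)"
      by eventually_elim (simp add: split_beta act_Dm[OF d(1)])
  qed
qed

text \<open>The group element is inverted because the action multiplies it from the left by an
  inverse. With this choice right multiplication of \<open>k\<close> by \<open>l\<close> becomes the
  action of \<open>l\<close>.\<close>

lemma local_triviality:
  assumes d: "d \<in> AD"
  defines "\<psi> \<equiv> \<lambda>x. sg d (fst x, matrix_inv (snd x))"
  shows "biholo (prod_atlas (open_sub M (dW d)) G_atlas) (open_sub EA (fst -` dW d)) \<psi>"
proof -
  let ?W = "dW d"
  have cW: "compatible_charts (open_sub M ?W)" by (rule compatible_open_sub[OF cM AD(3)[OF d]])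
  let ?Q = "prod_atlas (open_sub M ?W) G_atlas"
  have cQ: "compatible_charts ?Q" by (rule compatible_prod_atlas[OF cW compatible_G_atlas])
  have pQ: "points ?Q = ?W \<times> G_group"
    using AD(7)[OF d] by (auto simp: points_prod_atlas[OF cW compatible_G_atlas] points_open_sub points_G_atlas)
  have "fst -` ?W \<inter> points EA = Dm d" using Dm_iff[OF d] EA_I[OF d] by blast
  then have os: "open_sub EA (fst -` ?W) = open_sub EA (Dm d)" by (subst open_sub_Int_points) simp
  have cD: "compatible_charts (open_sub EA (Dm d))" by (rule compatible_open_sub[OF cEA Dm_open[OF d]])
  have pD: "points (open_sub EA (Dm d)) = Dm d" using EA_I[OF d] by (auto simp: points_open_sub)
  have \<psi>D: "\<psi> x \<in> Dm d" if "x \<in> ?W \<times> G_group" for x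
    using that DmI[OF d] G_inv_in by (auto simp: \<psi>_def)
  define \<theta> where "\<theta> e = (fst e, matrix_inv (tT d e))" for e
  have \<theta>W: "\<theta> e \<in> ?W \<times> G_group" "\<psi> (\<theta> e) = e" if "e \<in> Dm d" for e
    using DmE[OF that d] G_inv_in G_inv_inv by (auto simp: \<theta>_def \<psi>_def)
  have \<theta>\<psi>: "\<theta> (\<psi> x) = x" if "x \<in> ?W \<times> G_group" for x
    using that tau_sg[OF d, of "fst x" "matrix_inv (snd x)"] G_inv_inv by (auto simp: \<theta>_def \<psi>_def tau_def)
  have bij: "bij_betw \<psi> (?W \<times> G_group) (Dm d)"
  proof (rule bij_betw_byWitness[where f' = \<theta>])
    show "\<forall>x\<in>?W \<times> G_group. \<theta> (\<psi> x) = x" by (intro ballI \<theta>\<psi>)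
    show "\<forall>e\<in>Dm d. \<psi> (\<theta> e) = e" by (intro ballI \<theta>W(2))
    show "\<psi> ` (?W \<times> G_group) \<subseteq> Dm d" by (intro image_subsetI \<psi>D)
    show "\<theta> ` Dm d \<subseteq> ?W \<times> G_group" by (intro image_subsetI \<theta>W(1))
  qed
  have h\<psi>: "holo_map ?Q (open_sub EA (Dm d)) \<psi>"
    unfolding holo_map_iff[OF cQ cD] pQ
  proof
    fix x assume x: "x \<in> ?W \<times> G_group"
    then have xp: "x \<in> points (open_sub M ?W) \<times> points G_atlas"
      using AD(7)[OF d] by (auto simp: points_open_sub points_G_atlas)
    have fW: "fst x \<in> ?W" using x by auto
    have i: "hmap (open_sub M ?W) M (fst x) (\<lambda>q. q)"
      unfolding hmap_open_sub_dom[OF cM AD(3)[OF d] fW] by (rule hmap_id) (use fW AD(7)[OF d] in blast)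
    have 1: "hmap ?Q M x fst" by (rule hmap_compose[OF hmap_prod_proj(1)[OF cW compatible_G_atlas xp] i])
    have 2: "hmap ?Q G_atlas x (\<lambda>x. matrix_inv (snd x))"
      by (rule hmap_G_inv[OF cQ hmap_prod_proj(2)[OF cW compatible_G_atlas xp]])
    show "hmap ?Q (open_sub EA (Dm d)) x \<psi>"
      unfolding hmap_open_sub_cod[OF cEA Dm_open[OF d]] using hmap_sg[OF cQ d 1 fW 2] \<psi>D[OF x] by (simp add: \<psi>_def)
  qed
  have h\<theta>: "hmap (open_sub EA (Dm d)) ?Q e \<theta>" if e: "e \<in> Dm d" for e
  proof -
    have 1: "hmap (open_sub EA (Dm d)) (open_sub M ?W) e fst"
      unfolding hmap_open_sub_cod[OF cM AD(3)[OF d]] hmap_open_sub_dom[OF cEA Dm_open[OF d] e]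
      using hmap_fst[OF EA_I[OF d e]] DmE(1)[OF e d] by blast
    have 2: "hmap (open_sub EA (Dm d)) G_atlas e (\<lambda>e. matrix_inv (tT d e))"
      unfolding hmap_open_sub_dom[OF cEA Dm_open[OF d] e] by (rule hmap_G_inv[OF cEA hmap_tT[OF d e]])
    show ?thesis unfolding \<theta>_def by (rule hmap_pair[OF cW compatible_G_atlas cD 1 2])
  qed
  have inv: "inv_into (?W \<times> G_group) \<psi> e = \<theta> e" if "e \<in> Dm d" for e
    using inv_into_f_f[OF bij_betw_imp_inj_on[OF bij] \<theta>W(1)[OF that]] \<theta>W(2)[OF that] by simp
  have hi: "holo_map (open_sub EA (Dm d)) ?Q (inv_into (?W \<times> G_group) \<psi>)"
    unfolding holo_map_iff[OF cD cQ] pD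
  proof
    fix e assume e: "e \<in> Dm d"
    show "hmap (open_sub EA (Dm d)) ?Q e (inv_into (?W \<times> G_group) \<psi>)"
    proof (rule hmap_cong[OF cD h\<theta>[OF e]])
      show "eventually (\<lambda>q. \<theta> q = inv_into (?W \<times> G_group) \<psi> q) (nh (open_sub EA (Dm d)) e)"
        unfolding nh_open_sub[OF cEA Dm_open[OF d] e]
        by (rule eventually_mono[OF nh_open[OF cEA Dm_open[OF d] e]]) (simp add: inv)
    qed
  qed
  show ?thesis unfolding biholo_def os pQ pD using bij h\<psi> hi by blast
qed

lemma principal_EE: "principal_G_bundle M EE"
proof -
  have 1: "holo_map EA M fst" unfolding holo_map_iff[OF cEA cM] using hmap_fst by blast
  have 2: "holo_map (prod_atlas EA G_atlas) EA (\<lambda>(e, k). frame_act M k e)"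
    unfolding holo_map_iff[OF compatible_prod_atlas[OF cEA compatible_G_atlas] cEA]
      points_prod_atlas[OF cEA compatible_G_atlas] points_G_atlas using hmap_act by blast
  have 3: "frame_act M (mat 1) e = e" if "e \<in> points EA" for e
  proof -
    obtain d where d: "d \<in> AD" "e \<in> Dm d" using \<open>e \<in> points EA\<close> by (rule EA_E)
    have "matrix_inv (mat 1 :: complex^3^3) = mat 1"
      using G_mat_inv[of 1 0] by (simp add: G_mat_one)
    then show ?thesis using act_Dm[OF d, of "mat 1"] DmE(3)[OF d(2,1)] by simp
  qed
  have 4: "frame_act M (k ** l) e = frame_act M l (frame_act M k e)"
    if "e \<in> points EA" "k \<in> G_group" "l \<in> G_group" for e k l
  proof -
    obtain d where d: "d \<in> AD" "e \<in> Dm d" using \<open>e \<in> points EA\<close> by (rule EA_E)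
    show ?thesis unfolding act_Dm[OF d] act_sg G_inv_prod[OF that(2,3)] by (simp add: matrix_mul_assoc)
  qed
  have 5: "fst (frame_act M k e) = fst e" for k e by (simp add: frame_act_def split_beta)
  have 6: "\<exists>U \<psi>. openin (mtop M) U \<and> m \<in> U \<and>
        biholo (prod_atlas (open_sub M U) G_atlas) (open_sub EA (fst -` U)) \<psi> \<and>
        (\<forall>p\<in>U. \<forall>k\<in>G_group. fst (\<psi> (p, k)) = p \<and>
           (\<forall>l\<in>G_group. \<psi> (p, k ** l) = frame_act M l (\<psi> (p, k))))" if m: "m \<in> points M" for m
  proof -
    obtain c W \<eta> where c: "(c, W, \<eta>) \<in> AD" "m \<in> W" using cover[OF m] by blast
    define d where "d = (c, W, \<eta>)"
    have d: "d \<in> AD" "m \<in> dW d" using c by (simp_all add: d_def)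
    show ?thesis
    proof (intro exI conjI ballI)
      show "openin (mtop M) (dW d)" by (rule AD(3)[OF d(1)])
      show "biholo (prod_atlas (open_sub M (dW d)) G_atlas) (open_sub EA (fst -` dW d)) (\<lambda>x. sg d (fst x, matrix_inv (snd x)))"
        by (rule local_triviality[OF d(1)])
    qed (simp_all add: d(2) act_sg G_inv_prod)
  qed
  show ?thesis
    unfolding principal_G_bundle_def EE_def gstruct.simps
    by (intro conjI ballI complex_manifold_EA 1 2 3 4 5 6)
qed

lemma frames_EA: "e \<in> points EA \<Longrightarrow> e \<in> frames M"
  by (erule EA_E) (rule DmE(4))

lemma G_structure_EE: "G_structure M EE"
proof -
  have "hmap EA (frame_bundle M) e (\<lambda>e. e)" if e: "e \<in> points EA" for e
  proof -
    obtain d where d: "d \<in> AD" "e \<in> Dm d" using e by (rule EA_E)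
    have W: "fst e \<in> dW d" by (rule DmE(1)[OF d(2,1)])
    have TG: "tT d e \<in> G_group" by (rule DmE(2)[OF d(2,1)])
    note hT = hmapD(4)[OF hmap_tT[OF d] holo_near_G(1)[OF TG]] hmapD(4)[OF hmap_tT[OF d] holo_near_G(2)[OF TG]]
    show ?thesis
    proof (rule hmap_frameI[OF cM cEA hmap_fst[OF e] _ AD(1)[OF d(1)]])
      show "eventually (\<lambda>q. q \<in> frames M) (nh EA e)"
        by (rule eventually_mono[OF nh_points[OF cEA e]]) (rule frames_EA)
      show "fst e \<in> fst (dc d)" using W AD(2)[OF d(1)] by blast
      fix i j
      have g: "holo_near EA e (\<lambda>q. tT d q $ i $ j)" for i j
      proof -
        have "holo_near EA e (\<lambda>q. G_mat (tT d q $ 2 $ 2) (tT d q $ 3 $ 2) $ i $ j)"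
          using exhaust_3[of i] exhaust_3[of j]
          by (elim disjE) (simp_all add: hT holo_near_const[OF cEA e] power2_eq_square holo_near_mult[OF cEA]
              holo_near_inverse[OF cEA] G_nth(8)[OF TG])
        then show ?thesis
        proof (rule holo_near_cong[OF cEA, rotated])
          show "eventually (\<lambda>q. G_mat (tT d q $ 2 $ 2) (tT d q $ 3 $ 2) $ i $ j = tT d q $ i $ j) (nh EA e)"
          proof (rule eventually_mono[OF nh_open[OF cEA Dm_open[OF d(1)] d(2)]])
            fix q assume "q \<in> Dm d"
            then have "tT d q = G_mat (tT d q $ 2 $ 2) (tT d q $ 3 $ 2)"
              using DmE(2)[OF _ d(1)] unfolding G_group_iff by blast
            then show "G_mat (tT d q $ 2 $ 2) (tT d q $ 3 $ 2) $ i $ j = tT d q $ i $ j" by metis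
          qed
        qed
      qed
      have "holo_near EA e (\<lambda>q. (tT d q ** d\<eta> d (fst q)) $ i $ j)"
        by (intro holo_near_mat_mult[OF cEA e] g hmapD(4)[OF hmap_fst[OF e]] AD(4)[OF d(1) W])
      then show "holo_near EA e (\<lambda>q. mt M (fst (dc d), snd (dc d)) q $ i $ j)"
      proof (rule holo_near_cong[OF cEA, rotated])
        show "eventually (\<lambda>q. (tT d q ** d\<eta> d (fst q)) $ i $ j = mt M (fst (dc d), snd (dc d)) q $ i $ j) (nh EA e)"
          by (rule eventually_mono[OF nh_open[OF cEA Dm_open[OF d(1)] d(2)]]) (simp add: DmE(5)[OF _ d(1)])
      qed
    qed
  qed
  then have "holo_map EA (frame_bundle M) (\<lambda>e. e)"
    unfolding holo_map_iff[OF cEA compatible_frame_bundle[OF cM]] by blast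
  then show ?thesis
    unfolding G_structure_def using principal_EE by (simp add: EE_def)
qed

end

lemma cov_sum: "cov m i x = (\<Sum>k\<in>UNIV. m $ i $ k * x $ k)"
  by (simp add: cov_def sum_3)

text \<open>The effect of multiplying a coframe by \<open>G_mat a b\<close> on the structure equations, evaluated on two
  vectors \<open>v\<close> and \<open>w\<close>: \<open>va\<close> is the derivative of \<open>a\<close> along \<open>v\<close>, \<open>e1v\<close> the first coframe form on \<open>v\<close>,
  \<open>D1\<close> its exterior derivative, and \<open>ia\<close> stands for \<open>1 / a\<close>.\<close>

context
  fixes a ia b va wa vb wb fv fw uv uw e1v e1w e2v e2w e3v e3w K0 D1 D2 D3 \<phi>v \<phi>w \<mu>v \<mu>w :: complex
  assumes ia: "a * ia = 1"
    and D1: "D1 = - 2 * (fv * e1w - fw * e1v) + K0 * (e2v * e3w - e2w * e3v)"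
    and D2: "D2 = - (fv * e2w - fw * e2v) + (e1v * e3w - e1w * e3v)"
    and D3: "D3 = - (uv * e2w - uw * e2v) + (fv * e3w - fw * e3v)"
    and \<phi>: "\<phi>v = fv + - ia * va + a * b * e1v" "\<phi>w = fw + - ia * wa + a * b * e1w"
    and \<mu>: "\<mu>v = - ia * vb + 2 * b * ia * fv + ia * ia * uv + - (b * ia * ia) * va + b * b * e1v"
      "\<mu>w = - ia * wb + 2 * b * ia * fw + ia * ia * uw + - (b * ia * ia) * wa + b * b * e1w"
begin

lemma structure_eq1:
  "a * a * D1 + (a * va + a * va) * e1w - (a * wa + a * wa) * e1v =
    - (2 * \<phi>v * (a * a * e1w) - 2 * \<phi>w * (a * a * e1v)) +
    a * a * K0 * (a * e2v * (b * e2w + ia * e3w) - a * e2w * (b * e2v + ia * e3v))"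
  unfolding D1 \<phi> using ia by algebra

lemma structure_eq2:
  "a * D2 + va * e2w - wa * e2v = - (\<phi>v * (a * e2w) - \<phi>w * (a * e2v)) +
    (a * a * e1v * (b * e2w + ia * e3w) - a * a * e1w * (b * e2v + ia * e3v))"
  unfolding D2 \<phi> using ia by algebra

lemma structure_eq3:
  "(b * D2 + vb * e2w - wb * e2v) + (ia * D3 + - (va * (ia * ia)) * e3w - - (wa * (ia * ia)) * e3v) =
    - ((\<mu>v * (a * e2w) - \<mu>w * (a * e2v)) + (- \<phi>v * (b * e2w + ia * e3w) - - \<phi>w * (b * e2v + ia * e3v)))"
  unfolding D2 D3 \<phi> \<mu> using ia by algebra

end

section \<open>The pseudoconnection and the structure equations on the total space\<close>

context adapted_family
begin

context
  fixes d assumes d: "d \<in> AD"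
begin

definition xv where "xv v = (\<chi> j. v (\<lambda>q :: ('a, 3) frame. snd (dc d) (fst q) $ j))"
definition aa where "aa e = tT d e $ 2 $ 2"
definition bb where "bb e = tT d e $ 3 $ 2"

definition \<phi>0 where "\<phi>0 e v = comb (sol_a M (dc d) (d\<eta> d) (fst e)) (d\<eta> d (fst e)) (xv v)"
definition \<mu>0 where "\<mu>0 e v = comb (sol_b M (dc d) (d\<eta> d) (fst e)) (d\<eta> d (fst e)) (xv v)"

text \<open>With k = \<open>G_mat (aa e) (bb e)\<close> the soldering form is k times the coframe,
  so a connection \<Gamma> of the coframe becomes k \<Gamma> k^-1 - dk k^-1. The first two terms are
  its entry in row 2 and column 2. The shear does not preserve the torsion term
  \<open>\<omega>\<^sup>1 \<and> \<omega>\<^sup>3\<close>; the last term, a b eta^1, corrects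
  this.\<close>

definition phi where
  "phi e v = \<phi>0 e v + - inverse (aa e) * v aa + aa e * bb e * cov (d\<eta> d (fst e)) 1 (xv v)"
text \<open>The entry in row 3 and column 2 of k \<Gamma> k^-1 - dk k^-1. The last term, b^2 eta^1,
  balances in the third equation the correction made in \<open>phi\<close>.\<close>

definition mu where
  "mu e v = - inverse (aa e) * v bb + 2 * bb e * inverse (aa e) * \<phi>0 e v + inverse (aa e) * inverse (aa e) * \<mu>0 e v +
     - (bb e * inverse (aa e) * inverse (aa e)) * v aa + bb e * bb e * cov (d\<eta> d (fst e)) 1 (xv v)"
text \<open>The second and third soldering forms have the same wedge product as the rows of the
  coframe, while the first form is scaled by a^2; so is the torsion coefficient.\<close>

definition KK where "KK e = aa e * aa e * sol_K M (dc d) (d\<eta> d) (fst e)"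

lemma xv_nth: "xv v $ j = v (\<lambda>q. snd (dc d) (fst q) $ j)"
  by (simp add: xv_def)

lemma holo_near_sol:
  assumes p: "p \<in> dW d"
  shows "holo_near M p (\<lambda>p. sol_a M (dc d) (d\<eta> d) p $ i)" "holo_near M p (\<lambda>p. sol_b M (dc d) (d\<eta> d) p $ i)"
    "holo_near M p (sol_K M (dc d) (d\<eta> d))"
proof -
  have dw: "holo_near M p (dwedge M (dc d) (d\<eta> d) i j)" for i j
    using holo_near_dwedge[OF cM AD(1)[OF d] subsetD[OF AD(2)[OF d] p] AD(4)[OF d p]] by simp
  have pp: "p \<in> points M" using AD(7)[OF d] p by blast
  have det: "holo_near M p (\<lambda>p. det (d\<eta> d p))" by (rule holo_near_det3[OF cM pp AD(4)[OF d p]])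
  note D = holo_near_divide[OF cM dw det AD(5)[OF d p]]
  have D2: "holo_near M p (\<lambda>p. dwedge M (dc d) (d\<eta> d) k j p / (2 * det (d\<eta> d p)))" for k j
    by (rule holo_near_divide[OF cM dw holo_near_cmult[OF cM det]]) (simp add: AD(5)[OF d p])
  have m: "- x / y = - (x / y)" for x y :: complex by simp
  show "holo_near M p (\<lambda>p. sol_a M (dc d) (d\<eta> d) p $ i)"
    unfolding sol_a_def using exhaust_3[of i]
    by (elim disjE) (simp_all only: vector_3 m D D2 holo_near_uminus[OF cM D])
  show "holo_near M p (\<lambda>p. sol_b M (dc d) (d\<eta> d) p $ i)"
    unfolding sol_b_def using exhaust_3[of i]
    by (elim disjE) (simp_all only: vector_3 m D D2 holo_near_uminus[OF cM D] holo_near_const[OF cM pp] holo_near_diff[OF cM D D2])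
  show "holo_near M p (sol_K M (dc d) (d\<eta> d))" unfolding sol_K_def[abs_def] by (rule D)
qed

context
  fixes e assumes e: "e \<in> Dm d"
begin

lemma eA: "e \<in> points EA"
  by (rule EA_I[OF d e])

lemma TG: "tT d e \<in> G_group"
  by (rule DmE(2)[OF e d])

lemma aa_nz: "aa e \<noteq> 0"
  unfolding aa_def by (rule G_nth(8)[OF TG])

lemma holo_aa: "holo_near EA e aa" and holo_bb: "holo_near EA e bb"
  unfolding aa_def[abs_def] bb_def[abs_def]
  by (rule hmapD(4)[OF hmap_tT[OF d e] holo_near_G(1)[OF TG]], rule hmapD(4)[OF hmap_tT[OF d e] holo_near_G(2)[OF TG]])

lemma holo_fst: "holo_near M (fst e) f \<Longrightarrow> holo_near EA e (\<lambda>q. f (fst q))"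
  by (rule hmapD(4)[OF hmap_fst[OF eA]])

lemma eW: "fst e \<in> dW d"
  by (rule DmE(1)[OF e d])

lemma holo_z: "holo_near EA e (\<lambda>q. snd (dc d) (fst q) $ j)"
  by (rule holo_fst[OF holo_near_coord[OF cM AD(1)[OF d] subsetD[OF AD(2)[OF d] eW]]])

lemma holo_\<eta>: "holo_near EA e (\<lambda>q. d\<eta> d (fst q) $ i $ j)"
  by (rule holo_fst[OF AD(4)[OF d eW]])

lemma holo_inv_aa: "holo_near EA e (\<lambda>q. inverse (aa q))"
  by (rule holo_near_inverse[OF cEA holo_aa aa_nz])

text \<open>At the frame k times eta, the soldering form is k applied to the coframe, and it sees
  \<open>v\<close> only through the coordinates \<open>xv v\<close> of its projection to the
  base.\<close>

lemma soldering_eval: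
  assumes v: "v \<in> tangent_space EA e"
  shows "soldering M EE e v $ 1 = aa e * aa e * cov (d\<eta> d (fst e)) 1 (xv v)"
    "soldering M EE e v $ 2 = aa e * cov (d\<eta> d (fst e)) 2 (xv v)"
    "soldering M EE e v $ 3 = bb e * cov (d\<eta> d (fst e)) 2 (xv v) + inverse (aa e) * cov (d\<eta> d (fst e)) 3 (xv v)"
proof -
  have U: "(fst (dc d), snd (dc d)) \<in> M" "fst e \<in> fst (dc d)" using AD(1,2)[OF d] eW by auto
  have t: "pushforward M fst e v \<in> tangent_space M (fst e)" by (rule pushforward_tangent[OF cM hmap_fst[OF eA] v])
  have "soldering M EE e v = mt M (dc d) e *v (\<chi> i. pushforward M fst e v (\<lambda>q. snd (dc d) q $ i))"
    unfolding soldering_def EE_def gstruct.simps using frame_apply[OF cM U DmE(4)[OF e d] t] by simp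
  also have "(\<chi> i. pushforward M fst e v (\<lambda>q. snd (dc d) q $ i)) = xv v"
    by (simp add: vec_eq_iff xv_nth pushforward_apply holo_near_coord[OF cM U])
  finally have s: "soldering M EE e v = tT d e *v (d\<eta> d (fst e) *v xv v)"
    by (simp add: DmE(5)[OF e d] matrix_vector_mul_assoc)
  have c: "(d\<eta> d (fst e) *v xv v) $ i = cov (d\<eta> d (fst e)) i (xv v)" for i
    by (simp add: matrix_vector_mult_def cov_sum)
  have s': "soldering M EE e v $ i = (\<Sum>k\<in>UNIV. tT d e $ i $ k * cov (d\<eta> d (fst e)) k (xv v))" for i
    unfolding s by (subst matrix_vector_mult_def) (simp add: c)
  show "soldering M EE e v $ 1 = aa e * aa e * cov (d\<eta> d (fst e)) 1 (xv v)"
    "soldering M EE e v $ 2 = aa e * cov (d\<eta> d (fst e)) 2 (xv v)"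
    "soldering M EE e v $ 3 = bb e * cov (d\<eta> d (fst e)) 2 (xv v) + inverse (aa e) * cov (d\<eta> d (fst e)) 3 (xv v)"
    unfolding s' sum_3 aa_def bb_def by (simp_all add: G_nth[OF TG] power2_eq_square)
qed

lemma tv_\<eta>:
  assumes v: "v \<in> tangent_space EA e"
  shows "v (\<lambda>q. d\<eta> d (fst q) $ i $ b) = (\<Sum>a\<in>UNIV. xv v $ a * dv M (dc d) a (fst e) (\<lambda>q. d\<eta> d q $ i $ b))"
  using tangent_chain[OF cM hmap_fst[OF eA] v AD(1)[OF d] subsetD[OF AD(2)[OF d] eW] AD(4)[OF d eW, of i b]]
  by (simp add: xv_nth)

lemma dcov_tv:
  assumes v: "v \<in> tangent_space EA e" and w: "w \<in> tangent_space EA e"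
  shows "(\<Sum>b\<in>UNIV. v (\<lambda>q. d\<eta> d (fst q) $ i $ b) * xv w $ b - w (\<lambda>q. d\<eta> d (fst q) $ i $ b) * xv v $ b) =
    dcov M (dc d) (d\<eta> d) i (fst e) (xv v) (xv w)"
  unfolding tv_\<eta>[OF v] tv_\<eta>[OF w] dcov_def curl_def sum_3 by (simp add: algebra_simps)

lemma form_piece:
  assumes v: "v \<in> tangent_space EA e" and w: "w \<in> tangent_space EA e" and F: "holo_near EA e F"
  shows "(\<Sum>b\<in>UNIV. v (\<lambda>q. F q * d\<eta> d (fst q) $ i $ b) * w (\<lambda>q. snd (dc d) (fst q) $ b) -
      w (\<lambda>q. F q * d\<eta> d (fst q) $ i $ b) * v (\<lambda>q. snd (dc d) (fst q) $ b)) =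
    F e * dcov M (dc d) (d\<eta> d) i (fst e) (xv v) (xv w) + v F * cov (d\<eta> d (fst e)) i (xv w) - w F * cov (d\<eta> d (fst e)) i (xv v)"
  unfolding tv_mult[OF v F holo_\<eta>] tv_mult[OF w F holo_\<eta>] dcov_tv[OF v w, symmetric] cov_sum xv_nth sum_3
  by (simp add: algebra_simps)

text \<open>Each component is a combination of differentials of base coordinates with holomorphic
  coefficients, so \<open>ext_deriv_form\<close> applies. The Leibniz rule then separates
  derivatives of the group coordinates from the exterior derivative of the coframe.\<close>

lemma ext_deriv_soldering:
  assumes v: "v \<in> tangent_space EA e" and w: "w \<in> tangent_space EA e"
  shows "ext_deriv EA (\<lambda>e v. soldering M EE e v $ 1) e v w =
      aa e * aa e * dcov M (dc d) (d\<eta> d) 1 (fst e) (xv v) (xv w) +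
      (aa e * v aa + aa e * v aa) * cov (d\<eta> d (fst e)) 1 (xv w) - (aa e * w aa + aa e * w aa) * cov (d\<eta> d (fst e)) 1 (xv v)"
    "ext_deriv EA (\<lambda>e v. soldering M EE e v $ 2) e v w =
      aa e * dcov M (dc d) (d\<eta> d) 2 (fst e) (xv v) (xv w) +
      v aa * cov (d\<eta> d (fst e)) 2 (xv w) - w aa * cov (d\<eta> d (fst e)) 2 (xv v)"
    "ext_deriv EA (\<lambda>e v. soldering M EE e v $ 3) e v w =
      (bb e * dcov M (dc d) (d\<eta> d) 2 (fst e) (xv v) (xv w) +
      v bb * cov (d\<eta> d (fst e)) 2 (xv w) - w bb * cov (d\<eta> d (fst e)) 2 (xv v)) +
      (inverse (aa e) * dcov M (dc d) (d\<eta> d) 3 (fst e) (xv v) (xv w) +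
      - (v aa * (inverse (aa e) * inverse (aa e))) * cov (d\<eta> d (fst e)) 3 (xv w) - - (w aa * (inverse (aa e) * inverse (aa e))) * cov (d\<eta> d (fst e)) 3 (xv v))"
proof -
  let ?f = "\<lambda>b q. snd (dc d) (fst q) $ b"
  let ?\<eta> = "\<lambda>i b q. d\<eta> d (fst q) $ i $ b"
  have evD: "eventually (\<lambda>q. q \<in> Dm d) (nh EA e)" by (rule nh_open[OF cEA Dm_open[OF d] e])
  have haa2: "holo_near EA e (\<lambda>q. aa q * aa q)" by (rule holo_near_mult[OF cEA holo_aa holo_aa])
  have "ext_deriv EA (\<lambda>e v. soldering M EE e v $ 1) e v w =
      (\<Sum>b\<in>UNIV. v (\<lambda>q. aa q * aa q * ?\<eta> 1 b q) * w (?f b) - w (\<lambda>q. aa q * aa q * ?\<eta> 1 b q) * v (?f b))"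
  proof (rule ext_deriv_form[OF cEA eA _ _ _ v w])
    show "holo_near EA e (\<lambda>q. aa q * aa q * ?\<eta> 1 b q)" for b by (rule holo_near_mult[OF cEA haa2 holo_\<eta>])
    show "holo_near EA e (?f b)" for b by (rule holo_z)
    show "eventually (\<lambda>q. \<forall>v\<in>tangent_space EA q. soldering M EE q v $ 1 = (\<Sum>b\<in>UNIV. aa q * aa q * ?\<eta> 1 b q * v (?f b))) (nh EA e)"
      using evD
    proof eventually_elim
      case (elim q)
      show ?case
        by (intro ballI) (simp add: adapted_family.soldering_eval[OF adapted_family_axioms d elim] cov_sum xv_nth sum_distrib_left mult.assoc)
    qed
  qed
  then show "ext_deriv EA (\<lambda>e v. soldering M EE e v $ 1) e v w =
      aa e * aa e * dcov M (dc d) (d\<eta> d) 1 (fst e) (xv v) (xv w) +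
      (aa e * v aa + aa e * v aa) * cov (d\<eta> d (fst e)) 1 (xv w) - (aa e * w aa + aa e * w aa) * cov (d\<eta> d (fst e)) 1 (xv v)"
    unfolding form_piece[OF v w haa2] tv_mult[OF v holo_aa holo_aa] tv_mult[OF w holo_aa holo_aa] .
  have "ext_deriv EA (\<lambda>e v. soldering M EE e v $ 2) e v w =
      (\<Sum>b\<in>UNIV. v (\<lambda>q. aa q * ?\<eta> 2 b q) * w (?f b) - w (\<lambda>q. aa q * ?\<eta> 2 b q) * v (?f b))"
  proof (rule ext_deriv_form[OF cEA eA _ _ _ v w])
    show "holo_near EA e (\<lambda>q. aa q * ?\<eta> 2 b q)" for b by (rule holo_near_mult[OF cEA holo_aa holo_\<eta>])
    show "holo_near EA e (?f b)" for b by (rule holo_z)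
    show "eventually (\<lambda>q. \<forall>v\<in>tangent_space EA q. soldering M EE q v $ 2 = (\<Sum>b\<in>UNIV. aa q * ?\<eta> 2 b q * v (?f b))) (nh EA e)"
      using evD
    proof eventually_elim
      case (elim q)
      show ?case
        by (intro ballI) (simp add: adapted_family.soldering_eval[OF adapted_family_axioms d elim] cov_sum xv_nth sum_distrib_left mult.assoc)
    qed
  qed
  then show "ext_deriv EA (\<lambda>e v. soldering M EE e v $ 2) e v w =
      aa e * dcov M (dc d) (d\<eta> d) 2 (fst e) (xv v) (xv w) +
      v aa * cov (d\<eta> d (fst e)) 2 (xv w) - w aa * cov (d\<eta> d (fst e)) 2 (xv v)"
    unfolding form_piece[OF v w holo_aa] .
  note h2 = holo_near_mult[OF cEA holo_bb holo_\<eta>] and h3 = holo_near_mult[OF cEA holo_inv_aa holo_\<eta>]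
  have "ext_deriv EA (\<lambda>e v. soldering M EE e v $ 3) e v w =
      (\<Sum>b\<in>UNIV. v (\<lambda>q. bb q * ?\<eta> 2 b q + inverse (aa q) * ?\<eta> 3 b q) * w (?f b) -
        w (\<lambda>q. bb q * ?\<eta> 2 b q + inverse (aa q) * ?\<eta> 3 b q) * v (?f b))"
  proof (rule ext_deriv_form[OF cEA eA _ _ _ v w])
    show "holo_near EA e (\<lambda>q. bb q * ?\<eta> 2 b q + inverse (aa q) * ?\<eta> 3 b q)" for b by (rule holo_near_add[OF cEA h2 h3])
    show "holo_near EA e (?f b)" for b by (rule holo_z)
    show "eventually (\<lambda>q. \<forall>v\<in>tangent_space EA q. soldering M EE q v $ 3 =
        (\<Sum>b\<in>UNIV. (bb q * ?\<eta> 2 b q + inverse (aa q) * ?\<eta> 3 b q) * v (?f b))) (nh EA e)"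
      using evD
    proof eventually_elim
      case (elim q)
      show ?case
        by (intro ballI) (simp add: adapted_family.soldering_eval[OF adapted_family_axioms d elim] cov_sum xv_nth
            sum_distrib_left mult.assoc distrib_right sum.distrib)
    qed
  qed
  also have "\<dots> = (\<Sum>b\<in>UNIV. v (\<lambda>q. bb q * ?\<eta> 2 b q) * w (?f b) - w (\<lambda>q. bb q * ?\<eta> 2 b q) * v (?f b)) +
      (\<Sum>b\<in>UNIV. v (\<lambda>q. inverse (aa q) * ?\<eta> 3 b q) * w (?f b) - w (\<lambda>q. inverse (aa q) * ?\<eta> 3 b q) * v (?f b))"
    unfolding tv_add[OF v h2 h3] tv_add[OF w h2 h3] sum.distrib[symmetric]
    by (rule sum.cong[OF refl]) (simp add: algebra_simps)
  finally show "ext_deriv EA (\<lambda>e v. soldering M EE e v $ 3) e v w =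
      (bb e * dcov M (dc d) (d\<eta> d) 2 (fst e) (xv v) (xv w) +
      v bb * cov (d\<eta> d (fst e)) 2 (xv w) - w bb * cov (d\<eta> d (fst e)) 2 (xv v)) +
      (inverse (aa e) * dcov M (dc d) (d\<eta> d) 3 (fst e) (xv v) (xv w) +
      - (v aa * (inverse (aa e) * inverse (aa e))) * cov (d\<eta> d (fst e)) 3 (xv w) - - (w aa * (inverse (aa e) * inverse (aa e))) * cov (d\<eta> d (fst e)) 3 (xv v))"
    unfolding form_piece[OF v w holo_bb] form_piece[OF v w holo_inv_aa] tv_inverse[OF cEA v holo_aa aa_nz] tv_inverse[OF cEA w holo_aa aa_nz]
    by (simp add: power2_eq_square divide_inverse)
qed

lemma structure_equations:
  assumes v: "v \<in> tangent_space EA e" and w: "w \<in> tangent_space EA e"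
  shows "ext_deriv EA (\<lambda>e v. soldering M EE e v $ 1) e v w =
      - wedge (\<lambda>e v. 2 * phi e v) (\<lambda>e v. soldering M EE e v $ 1) e v w +
      KK e * wedge (\<lambda>e v. soldering M EE e v $ 2) (\<lambda>e v. soldering M EE e v $ 3) e v w"
    "ext_deriv EA (\<lambda>e v. soldering M EE e v $ 2) e v w =
      - wedge phi (\<lambda>e v. soldering M EE e v $ 2) e v w +
      wedge (\<lambda>e v. soldering M EE e v $ 1) (\<lambda>e v. soldering M EE e v $ 3) e v w"
    "ext_deriv EA (\<lambda>e v. soldering M EE e v $ 3) e v w =
      - (wedge mu (\<lambda>e v. soldering M EE e v $ 2) e v w + wedge (\<lambda>e v. - phi e v) (\<lambda>e v. soldering M EE e v $ 3) e v w)"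
proof -
  note SE = adapted_structure_equations[OF AD(6)[OF d eW] AD(5)[OF d eW], unfolded w2_def, of "xv v" "xv w", folded \<phi>0_def \<mu>0_def]
  have ia: "aa e * inverse (aa e) = 1" using aa_nz by simp
  note ev = ext_deriv_soldering[OF v w] soldering_eval[OF v] soldering_eval[OF w]
  show "ext_deriv EA (\<lambda>e v. soldering M EE e v $ 1) e v w =
      - wedge (\<lambda>e v. 2 * phi e v) (\<lambda>e v. soldering M EE e v $ 1) e v w +
      KK e * wedge (\<lambda>e v. soldering M EE e v $ 2) (\<lambda>e v. soldering M EE e v $ 3) e v w"
    unfolding wedge_def ev KK_def by (rule structure_eq1[OF ia SE phi_def phi_def mu_def mu_def])
  show "ext_deriv EA (\<lambda>e v. soldering M EE e v $ 2) e v w =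
      - wedge phi (\<lambda>e v. soldering M EE e v $ 2) e v w +
      wedge (\<lambda>e v. soldering M EE e v $ 1) (\<lambda>e v. soldering M EE e v $ 3) e v w"
    unfolding wedge_def ev by (rule structure_eq2[OF ia SE phi_def phi_def mu_def mu_def])
  show "ext_deriv EA (\<lambda>e v. soldering M EE e v $ 3) e v w =
      - (wedge mu (\<lambda>e v. soldering M EE e v $ 2) e v w + wedge (\<lambda>e v. - phi e v) (\<lambda>e v. soldering M EE e v $ 3) e v w)"
    unfolding wedge_def ev by (rule structure_eq3[OF ia SE phi_def phi_def mu_def mu_def])
qed

text \<open>The flow multiplies the group coordinate from the left by the inverse of the exponential
  and fixes the base point. The minus signs that result are undone by the term - dk k^-1 in
  \<open>phi\<close> and \<open>mu\<close>.\<close>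

lemma fundamental_eval:
  shows "xv (fundamental EE (\<gg>_mat \<alpha> \<beta>) e) = 0" "fundamental EE (\<gg>_mat \<alpha> \<beta>) e aa = - \<alpha> * aa e"
    "fundamental EE (\<gg>_mat \<alpha> \<beta>) e bb = - \<beta> * aa e + \<alpha> * bb e"
proof -
  let ?a = "\<lambda>t. frame_act M (mat_exp (\<chi> i. t *s \<gg>_mat \<alpha> \<beta> $ i)) e"
  have act: "?a t = sg d (fst e, G_mat (inverse (exp (t * \<alpha>))) (- exp_h (t * \<alpha>) (t * \<beta>)) ** tT d e)" for t
    unfolding scale_\<gg> mat_exp_\<gg> act_Dm[OF d e] by (simp add: G_mat_inv)
  have tTa: "tT d (?a t) = G_mat (inverse (exp (t * \<alpha>))) (- exp_h (t * \<alpha>) (t * \<beta>)) ** tT d e" for t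
    using tau_sg[OF d eW, of "G_mat (inverse (exp (t * \<alpha>))) (- exp_h (t * \<alpha>) (t * \<beta>)) ** tT d e"]
    unfolding act by (simp add: tau_def)
  have fa: "fst (?a t) = fst e" for t unfolding act by simp
  have aat: "aa (?a t) = inverse (exp (t * \<alpha>)) * aa e" for t
    unfolding aa_def tTa by (simp add: matrix_matrix_mult_def sum_3)
  have bbt: "bb (?a t) = - exp_h (t * \<alpha>) (t * \<beta>) * aa e + exp (t * \<alpha>) * bb e" for t
    unfolding aa_def bb_def tTa by (simp add: matrix_matrix_mult_def sum_3 G_nth[OF TG])
  have fund: "fundamental EE X e f = deriv (\<lambda>t. f (frame_act M (mat_exp (\<chi> i. t *s X $ i)) e)) 0" if "holo_near EA e f" for X f
    using that by (simp add: fundamental_def EE_def)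
  show "xv (fundamental EE (\<gg>_mat \<alpha> \<beta>) e) = 0"
    unfolding xv_def fund[OF holo_z] fa by (simp add: vec_eq_iff)
  show "fundamental EE (\<gg>_mat \<alpha> \<beta>) e aa = - \<alpha> * aa e"
    unfolding fund[OF holo_aa] aat
    by (rule DERIV_imp_deriv) (auto intro!: derivative_eq_intros)
  show "fundamental EE (\<gg>_mat \<alpha> \<beta>) e bb = - \<beta> * aa e + \<alpha> * bb e"
    unfolding fund[OF holo_bb] bbt
  proof (rule DERIV_imp_deriv)
    have "((\<lambda>t. exp (t * \<alpha>)) has_field_derivative \<alpha>) (at 0)" by (auto intro!: derivative_eq_intros)
    then show "((\<lambda>t. - exp_h (t * \<alpha>) (t * \<beta>) * aa e + exp (t * \<alpha>) * bb e) has_field_derivative (- \<beta> * aa e + \<alpha> * bb e)) (at 0)"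
      by (intro DERIV_add DERIV_cmult_right DERIV_minus exp_h_deriv)
  qed
qed

lemma pseudoconnection:
  "phi e (fundamental EE (\<gg>_mat \<alpha> \<beta>) e) = \<alpha>" "mu e (fundamental EE (\<gg>_mat \<alpha> \<beta>) e) = \<beta>"
proof -
  have c0: "cov m i 0 = 0" "comb s m 0 = 0" for m i s by (simp_all add: cov_def comb_def)
  show "phi e (fundamental EE (\<gg>_mat \<alpha> \<beta>) e) = \<alpha>"
    unfolding phi_def \<phi>0_def fundamental_eval c0 using aa_nz by simp
  show "mu e (fundamental EE (\<gg>_mat \<alpha> \<beta>) e) = \<beta>"
    unfolding mu_def \<phi>0_def \<mu>0_def fundamental_eval c0 using aa_nz by (simp add: field_simps)
qed

end

lemma holo_forms:
  shows "holo_one_form EA (Dm d) phi" "holo_one_form EA (Dm d) mu" "holo_fun EA (Dm d) KK"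
proof -
  note O = Dm_open[OF d]
  have sub: "Dm d \<subseteq> points EA" using EA_I[OF d] by blast
  have haa: "holo_near EA p aa" and hbb: "holo_near EA p bb" and hia: "holo_near EA p (\<lambda>q. inverse (aa q))"
    if "p \<in> Dm d" for p
    using holo_aa[OF that] holo_bb[OF that] holo_inv_aa[OF that] by auto
  have vz: "holo_one_form EA (Dm d) (\<lambda>e v. xv v $ j)" for j
    unfolding xv_nth by (rule holo_one_form_apply[OF cEA sub holo_z])
  have va: "holo_one_form EA (Dm d) (\<lambda>e v. v aa)" by (rule holo_one_form_apply[OF cEA sub haa])
  have vb: "holo_one_form EA (Dm d) (\<lambda>e v. v bb)" by (rule holo_one_form_apply[OF cEA sub hbb])
  note I = holo_one_form_add[OF cEA O] holo_one_form_scale[OF cEA O]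
  have c: "holo_one_form EA (Dm d) (\<lambda>e v. cov (d\<eta> d (fst e)) i (xv v))" for i
    unfolding cov_def by (intro I vz holo_\<eta>)
  have s: "holo_near EA p (\<lambda>q. sol_a M (dc d) (d\<eta> d) (fst q) $ i)" "holo_near EA p (\<lambda>q. sol_b M (dc d) (d\<eta> d) (fst q) $ i)"
    "holo_near EA p (\<lambda>q. sol_K M (dc d) (d\<eta> d) (fst q))" if "p \<in> Dm d" for p i
    by (rule holo_fst[OF that], rule holo_near_sol[OF eW[OF that]])+
  have f0: "holo_one_form EA (Dm d) \<phi>0"
    unfolding \<phi>0_def[abs_def] comb_def by (intro I c s)
  have u0: "holo_one_form EA (Dm d) \<mu>0"
    unfolding \<mu>0_def[abs_def] comb_def by (intro I c s)
  show "holo_one_form EA (Dm d) phi"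
    unfolding phi_def[abs_def]
    by (intro I c f0 va holo_near_mult[OF cEA] holo_near_uminus[OF cEA] haa hbb hia)
  have c2: "holo_near EA p (\<lambda>q. 2 * bb q)" if "p \<in> Dm d" for p by (rule holo_near_cmult[OF cEA hbb[OF that]])
  show "holo_one_form EA (Dm d) mu"
    unfolding mu_def[abs_def]
    by (intro I c f0 u0 va vb c2 holo_near_mult[OF cEA] holo_near_uminus[OF cEA] haa hbb hia)
  show "holo_fun EA (Dm d) KK"
    unfolding KK_def[abs_def] by (rule holo_funI[OF cEA]) (intro holo_near_mult[OF cEA] haa s)
qed

end

theorem scalar_conservation_law_EE: "scalar_conservation_law M EE"
  unfolding scalar_conservation_law_def
proof (intro conjI ballI)
  show "G_structure M EE" by (rule G_structure_EE)
  have tE: "total EE = EA" by (simp add: EE_def)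
  fix e0 assume "e0 \<in> points (total EE)"
  then obtain d where d: "d \<in> AD" "e0 \<in> Dm d" unfolding tE by (rule EA_E)
  show "\<exists>W \<phi> \<mu> K.
        openin (mtop (total EE)) W \<and> e0 \<in> W \<and>
        holo_one_form (total EE) W \<phi> \<and> holo_one_form (total EE) W \<mu> \<and> holo_fun (total EE) W K \<and>
        (let \<Gamma> = (\<lambda>e v. \<gg>_mat (\<phi> e v) (\<mu> e v));
             \<omega> = (\<lambda>i e v. soldering M EE e v $ i)
         in (\<forall>e\<in>W. \<forall>a b. \<Gamma> e (fundamental EE (\<gg>_mat a b) e) = \<gg>_mat a b) \<and>
            (\<forall>e\<in>W. \<forall>v\<in>tangent_space (total EE) e. \<forall>w\<in>tangent_space (total EE) e.
               (\<chi> i. ext_deriv (total EE) (\<omega> i) e v w) =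
               - (\<chi> i. \<Sum>j\<in>UNIV. wedge (\<lambda>e v. \<Gamma> e v $ i $ j) (\<omega> j) e v w)
               + vector [K e * wedge (\<omega> 2) (\<omega> 3) e v w, wedge (\<omega> 1) (\<omega> 3) e v w, 0]))"
    unfolding tE Let_def
  proof (intro exI conjI ballI allI)
    show "openin (mtop EA) (Dm d)" by (rule Dm_open[OF d(1)])
    show "e0 \<in> Dm d" by (rule d(2))
    show "holo_one_form EA (Dm d) (phi d)" "holo_one_form EA (Dm d) (mu d)" "holo_fun EA (Dm d) (KK d)"
      by (rule holo_forms[OF d(1)])+
    show "\<gg>_mat (phi d e (fundamental EE (\<gg>_mat a b) e)) (mu d e (fundamental EE (\<gg>_mat a b) e)) = \<gg>_mat a b"
      if "e \<in> Dm d" for e a b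
      by (simp add: pseudoconnection[OF d(1) that])
    fix e v w assume e: "e \<in> Dm d" and v: "v \<in> tangent_space EA e" and w: "w \<in> tangent_space EA e"
    have w0: "wedge (\<lambda>e v. 0) \<alpha> e v w = 0" for \<alpha> by (simp add: wedge_def)
    show "(\<chi> i. ext_deriv EA (\<lambda>e v. soldering M EE e v $ i) e v w) =
        - (\<chi> i. \<Sum>j\<in>UNIV. wedge (\<lambda>e v. \<gg>_mat (phi d e v) (mu d e v) $ i $ j) (\<lambda>e v. soldering M EE e v $ j) e v w) +
        vector [KK d e * wedge (\<lambda>e v. soldering M EE e v $ 2) (\<lambda>e v. soldering M EE e v $ 3) e v w,
          wedge (\<lambda>e v. soldering M EE e v $ 1) (\<lambda>e v. soldering M EE e v $ 3) e v w, 0]"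
      unfolding vec_eq_iff forall_3 sum_3 vector_add_component vector_uminus_component vec_lambda_beta \<gg>_mat_nth vector_3 w0
      using structure_equations[OF d(1) e v w] by simp
  qed
qed

end

section \<open>Hartogs extension on a manifold\<close>

text \<open>The local coordinates at \<open>p\<close> show that the set over which \<^const>\<open>analytic_dim\<close> minimises is not
  empty.\<close>

lemma analytic_dim_attained:
  fixes A :: "('a, 3) atlas"
  assumes cA: "compatible_charts A" and p: "p \<in> points A" "p \<in> V"
  shows "\<exists>W (f :: nat \<Rightarrow> 'a \<Rightarrow> complex). openin (mtop A) W \<and> p \<in> W \<and>
     (\<forall>i<analytic_dim A V p. holo_fun A W (f i)) \<and> {q \<in> V \<inter> W. \<forall>i<analytic_dim A V p. f i q = 0} = {p}"
proof -
  let ?P = "\<lambda>d. \<exists>W (f :: nat \<Rightarrow> 'a \<Rightarrow> complex). openin (mtop A) W \<and> p \<in> W \<and>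
     (\<forall>i<d. holo_fun A W (f i)) \<and> {q \<in> V \<inter> W. \<forall>i<d. f i q = 0} = {p}"
  obtain U \<kappa> where U: "(U, \<kappa>) \<in> A" "p \<in> U" using pointsE[OF p(1)] by blast
  define c :: "nat \<Rightarrow> 3" where "c i = (if i = 0 then 1 else if i = 1 then 2 else 3)" for i
  define f where "f i q = \<kappa> q $ c i - \<kappa> p $ c i" for i q
  have "?P 3"
  proof (intro exI conjI allI impI)
    show "openin (mtop A) U" by (rule openin_chart[OF cA U(1)])
    show "p \<in> U" by (rule U(2))
    show "holo_fun A U (f i)" for i
    proof (rule holo_funI[OF cA])
      fix q assume q: "q \<in> U"
      then have "q \<in> points A" using chart_subset_points[OF U(1)] by blast
      then show "holo_near A q (f i)"
        unfolding f_def by (intro holo_near_diff[OF cA] holo_near_coord[OF cA U(1) q] holo_near_const[OF cA])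
    qed
    have "q = p" if "q \<in> U" "\<forall>i<3. f i q = 0" for q
    proof -
      have "\<kappa> q $ j = \<kappa> p $ j" for j
        using exhaust_3[of j] that(2)[THEN spec[of _ 0]] that(2)[THEN spec[of _ 1]] that(2)[THEN spec[of _ 2]]
        by (elim disjE) (simp_all add: f_def c_def)
      then have "\<kappa> q = \<kappa> p" by (simp add: vec_eq_iff)
      then show ?thesis using inj_onD[OF chart_inv(1)[OF cA U(1)]] that(1) U(2) by blast
    qed
    then show "{q \<in> V \<inter> U. \<forall>i<3. f i q = 0} = {p}" using p(2) U(2) by (auto simp: f_def)
  qed
  then show ?thesis unfolding analytic_dim_def by (rule LeastI)
qed

text \<open>Codimension two in dimension three leaves \<open>analytic_dim\<close> equal to 0 or 1,
  and this is the assumption \<open>isolated\<close>.\<close>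

lemma thin_analytic_chart:
  fixes A :: "('a, 3) atlas"
  assumes cA: "compatible_charts A" and U: "(U, \<kappa>) \<in> A" and V: "analytic_subvariety A U0 V" "openin (mtop A) U0"
    and dim: "\<And>p. p \<in> V \<Longrightarrow> analytic_dim A V p + 2 \<le> 3"
  shows "thin_analytic (\<kappa> ` (V \<inter> U))"
proof
  have VU0: "V \<subseteq> U0" using V(1) unfolding analytic_subvariety_def by blast
  have U0p: "U0 \<subseteq> points A" using openin_subset[OF V(2)] unfolding topspace_mtop[OF cA] .
  let ?i = "inv_into U \<kappa>"
  have hf: "holo_at (\<lambda>z. f (?i z)) z" if "holo_fun A W f" "z \<in> \<kappa> ` (U \<inter> W)" for f W z
    using that U unfolding holo_fun_def holo_Cn_iff by blast
  have mem: "z \<in> \<kappa> ` (V \<inter> U) \<longleftrightarrow> ?i z \<in> V" if "z \<in> \<kappa> ` U" for z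
  proof -
    from that obtain q where q: "q \<in> U" "z = \<kappa> q" by blast
    have iz: "?i z = q" using chart_inv(4)[OF cA U q(1)] q(2) by simp
    have "z \<in> \<kappa> ` (V \<inter> U) \<longleftrightarrow> q \<in> V" unfolding q(2) using q(1) inj_onD[OF chart_inv(1)[OF cA U]] by blast
    then show ?thesis unfolding iz .
  qed
  {
    fix z assume z: "z \<in> \<kappa> ` (V \<inter> U)"
    then obtain p where p: "p \<in> V" "p \<in> U" "z = \<kappa> p" by blast
    have "p \<in> U0" using p(1) VU0 by blast
    from conjunct2[OF V(1)[unfolded analytic_subvariety_def], THEN bspec, OF this]
    obtain W F where W: "openin (mtop A) W" "p \<in> W" "finite F" "\<forall>f\<in>F. holo_fun A W f"
        "V \<inter> W = {q \<in> W. \<forall>f\<in>F. f q = 0}"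
      by (elim exE conjE) (rule that)
    let ?W = "\<kappa> ` (U \<inter> W)" and ?F = "(\<lambda>f z. f (?i z)) ` F"
    have "\<kappa> ` (V \<inter> U) \<inter> ?W = {z \<in> ?W. \<forall>f\<in>?F. f z = 0}"
    proof -
      have "z \<in> \<kappa> ` (V \<inter> U) \<longleftrightarrow> (\<forall>f\<in>?F. f z = 0)" if z: "z \<in> ?W" for z
      proof -
        have iW: "?i z \<in> W" using z chart_inv(4)[OF cA U] by auto
        have "z \<in> \<kappa> ` U" using z by blast
        from mem[OF this] have "z \<in> \<kappa> ` (V \<inter> U) \<longleftrightarrow> ?i z \<in> V \<inter> W" using iW by blast
        then show ?thesis unfolding W(5) using iW by simp
      qed
      moreover have "\<kappa> ` (V \<inter> U) \<inter> ?W = {z \<in> ?W. z \<in> \<kappa> ` (V \<inter> U)}" by blast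
      ultimately show ?thesis by (simp only: cong: conj_cong)
    qed
    then show "\<exists>W F. open W \<and> z \<in> W \<and> finite F \<and> (\<forall>f\<in>F. \<forall>z\<in>W. holo_at f z) \<and>
      \<kappa> ` (V \<inter> U) \<inter> W = {z \<in> W. \<forall>f\<in>F. f z = 0}"
    proof (intro exI[of _ ?W] exI[of _ ?F] conjI)
      show "open ?W" by (rule open_chart_image[OF cA W(1) U])
      show "z \<in> ?W" using p W(2) by blast
      show "finite ?F" using W(3) by blast
      show "\<forall>f\<in>?F. \<forall>z\<in>?W. holo_at f z" using hf[OF bspec[OF W(4)]] by blast
    qed
    have pA: "p \<in> points A" using p(1) VU0 U0p by blast
    obtain W and f :: "nat \<Rightarrow> 'a \<Rightarrow> complex" where W: "openin (mtop A) W" "p \<in> W"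
      "\<forall>i<analytic_dim A V p. holo_fun A W (f i)" "{q \<in> V \<inter> W. \<forall>i<analytic_dim A V p. f i q = 0} = {p}"
      using analytic_dim_attained[OF cA pA p(1)] by (elim exE conjE) (rule that)
    \<comment> \<open>In dimension 0 the point is isolated in \<open>V\<close> without any equation,
      and the zero function takes the place of the single one.\<close>
    define g where "g = (if analytic_dim A V p = 0 then (\<lambda>q. 0) else f 0)"
    have d: "analytic_dim A V p = 0 \<or> analytic_dim A V p = 1" using dim[OF p(1)] by linarith
    have Wp: "q \<in> points A" if "q \<in> W" for q
      using openin_subset[OF W(1)] that unfolding topspace_mtop[OF cA] by blast
    have g: "holo_fun A W g" using d W(3) holo_funI[OF cA holo_near_const[OF cA Wp]] by (auto simp: g_def)
    have gz: "{q \<in> V \<inter> W. g q = 0} = {p}" using d W(4) by (auto simp: g_def)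
    let ?W = "\<kappa> ` (U \<inter> W)"
    have "{w \<in> \<kappa> ` (V \<inter> U) \<inter> ?W. g (?i w) = 0} = {z}"
    proof (intro equalityI subsetI)
      fix w assume w: "w \<in> {w \<in> \<kappa> ` (V \<inter> U) \<inter> ?W. g (?i w) = 0}"
      then obtain q where q: "q \<in> U" "q \<in> W" "w = \<kappa> q" by blast
      have "?i w = q" using q chart_inv(4)[OF cA U] by simp
      moreover have "?i w \<in> V" using mem[of w] w q by blast
      ultimately have "q \<in> {q \<in> V \<inter> W. g q = 0}" using w q by simp
      then show "w \<in> {z}" unfolding gz using q(3) p(3) by simp
    next
      fix w assume "w \<in> {z}"
      moreover have "g p = 0" using gz by blast
      ultimately show "w \<in> {w \<in> \<kappa> ` (V \<inter> U) \<inter> ?W. g (?i w) = 0}"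
        using p W(2) chart_inv(4)[OF cA U p(2)] by auto
    qed
    then show "\<exists>W f. open W \<and> z \<in> W \<and> (\<forall>z\<in>W. holo_at f z) \<and> {w \<in> \<kappa> ` (V \<inter> U) \<inter> W. f w = 0} = {z}"
      using open_chart_image[OF cA W(1) U] hf[OF g] p W(2) by (intro exI[of _ ?W] exI[of _ "\<lambda>z. g (?i z)"]) blast
  }
qed

theorem Hartogs_manifold:
  fixes A :: "('a, 3) atlas"
  assumes cA: "compatible_charts A" and S: "closedin (mtop A) S" "codim_ge 2 A S" and s: "s \<in> S"
    and U: "(U, \<kappa>) \<in> A" "s \<in> U"
  obtains W where "openin (mtop A) W" "s \<in> W" "W \<subseteq> U"
    "\<forall>Q. openin (mtop A) Q \<longrightarrow> Q \<subseteq> W \<longrightarrow> Q \<noteq> {} \<longrightarrow> Q - S \<noteq> {}"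
    "\<forall>h. (\<forall>p\<in>U - S. holo_near A p h) \<longrightarrow>
       (\<exists>h'. (\<forall>p\<in>W. holo_near A p h') \<and> (\<forall>p\<in>W - S. h' p = h p))"
proof -
  obtain U0 V where V: "openin (mtop A) U0" "s \<in> U0" "analytic_subvariety A U0 V"
      "\<forall>p\<in>V. analytic_dim A V p + 2 \<le> CARD(3)" "S \<inter> U0 \<subseteq> V"
    using S(2) s unfolding codim_ge_def by (metis (no_types, lifting))
  have dim: "analytic_dim A V p + 2 \<le> 3" if "p \<in> V" for p using V(4) that by simp
  interpret thin_analytic "\<kappa> ` (V \<inter> U)" by (rule thin_analytic_chart[OF cA U(1) V(3,1) dim])
  let ?\<Omega> = "\<kappa> ` (U \<inter> U0)" and ?S = "\<kappa> ` (S \<inter> U)" and ?i = "inv_into U \<kappa>"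
  have inj: "inj_on \<kappa> U" by (rule chart_inv(1)[OF cA U(1)])
  have \<Omega>S: "?\<Omega> - ?S = \<kappa> ` (U \<inter> (U0 - S))"
    using inj_onD[OF inj] by auto
  have oX: "openin (mtop A) (U0 - S)" using V(1) S(1) by (rule openin_diff)
  have o1: "open ?\<Omega>" by (rule open_chart_image[OF cA V(1) U(1)])
  have s1: "\<kappa> s \<in> ?\<Omega>" using U V(2) by blast
  have o2: "open (?\<Omega> - ?S)" unfolding \<Omega>S by (rule open_chart_image[OF cA oX U(1)])
  have sub: "?S \<inter> ?\<Omega> \<subseteq> \<kappa> ` (V \<inter> U)"
  proof
    fix z assume "z \<in> ?S \<inter> ?\<Omega>"
    then obtain q q' where "q \<in> S" "q \<in> U" "z = \<kappa> q" "q' \<in> U" "q' \<in> U0" "z = \<kappa> q'" by blast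
    then show "z \<in> \<kappa> ` (V \<inter> U)" using inj_onD[OF inj, of q q'] V(5) by blast
  qed
  have memS: "\<kappa> q \<in> ?S \<longleftrightarrow> q \<in> S" if "q \<in> U" for q using that inj_onD[OF inj] by blast
  show ?thesis
  proof (rule Hartogs_thin[OF o1 s1 o2 sub thin_V])
    fix W' :: "(complex^3) set"
    assume W': "open W'" "\<kappa> s \<in> W'" "W' \<subseteq> ?\<Omega>"
      "\<And>Q. open Q \<Longrightarrow> Q \<subseteq> W' \<Longrightarrow> Q \<noteq> {} \<Longrightarrow> Q - ?S \<noteq> {}"
      "\<And>h. (\<And>z. z \<in> ?\<Omega> - ?S \<Longrightarrow> holo_at h z) \<Longrightarrow> \<exists>h'. (\<forall>z\<in>W'. holo_at h' z) \<and> (\<forall>z\<in>W' - ?S. h' z = h z)"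
    let ?W = "U \<inter> \<kappa> -` W'"
    show thesis
    proof (rule that[of ?W])
      show "openin (mtop A) ?W" by (rule open_chart_preimage[OF cA U(1) W'(1)])
      show "s \<in> ?W" using U W'(2) by simp
      show "?W \<subseteq> U" by blast
      show "\<forall>Q. openin (mtop A) Q \<longrightarrow> Q \<subseteq> ?W \<longrightarrow> Q \<noteq> {} \<longrightarrow> Q - S \<noteq> {}"
      proof (intro allI impI)
        fix Q assume Q: "openin (mtop A) Q" "Q \<subseteq> ?W" "Q \<noteq> {}"
        have "open (\<kappa> ` (U \<inter> Q))" by (rule open_chart_image[OF cA Q(1) U(1)])
        moreover have "\<kappa> ` (U \<inter> Q) \<subseteq> W'" using Q(2) by blast
        moreover have "U \<inter> Q \<noteq> {}" using Q(2,3) by blast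
        then have "\<kappa> ` (U \<inter> Q) \<noteq> {}" by simp
        ultimately have "\<kappa> ` (U \<inter> Q) - ?S \<noteq> {}" using W'(4) by simp
        then obtain q where "q \<in> U" "q \<in> Q" "\<kappa> q \<notin> ?S" by blast
        then show "Q - S \<noteq> {}" using memS by blast
      qed
      show "\<forall>h. (\<forall>p\<in>U - S. holo_near A p h) \<longrightarrow>
         (\<exists>h'. (\<forall>p\<in>?W. holo_near A p h') \<and> (\<forall>p\<in>?W - S. h' p = h p))"
      proof (intro allI impI)
        fix h :: "'a \<Rightarrow> complex" assume h: "\<forall>p\<in>U - S. holo_near A p h"
        have "holo_at (\<lambda>z. h (?i z)) z" if "z \<in> ?\<Omega> - ?S" for z
        proof -
          from that[unfolded \<Omega>S] obtain p where p: "p \<in> U" "p \<notin> S" "z = \<kappa> p" by blast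
          have "holo_near A p h" using h p by blast
          then show ?thesis unfolding holo_near_iff[OF cA U(1) p(1)] p(3) by (rule eventually_nhds_x_imp_x)
        qed
        from W'(5)[OF this] obtain h' where h': "\<forall>z\<in>W'. holo_at h' z" "\<forall>z\<in>W' - ?S. h' z = h (?i z)" by blast
        show "\<exists>h'. (\<forall>p\<in>?W. holo_near A p h') \<and> (\<forall>p\<in>?W - S. h' p = h p)"
        proof (intro exI[of _ "\<lambda>q. h' (\<kappa> q)"] conjI ballI)
          fix p assume p: "p \<in> ?W"
          show "holo_near A p (\<lambda>q. h' (\<kappa> q))"
            by (rule holo_near_chart_fun[OF cA U(1)], use p in blast,
                rule eventually_mono[OF eventually_nhds_in_open[OF W'(1)]], use p in blast, use h'(1) in blast)
        next
          fix p assume p: "p \<in> ?W - S"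
          then show "h' (\<kappa> p) = h p" using h'(2) memS[of p] chart_inv(4)[OF cA U(1), of p] by auto
        qed
      qed
    qed
  qed
qed

section \<open>The image of a conservation law in the frame bundle\<close>

locale law =
  fixes M :: "('a, 3) atlas" and S :: "'a set" and E :: "('a, 'e) gstruct"
  assumes M: "complex_manifold M" and S: "closedin (mtop M) S" "codim_ge 2 M S"
    and E: "scalar_conservation_law (open_sub M (- S)) E"
begin

definition X where "X = points M - S"
abbreviation "N \<equiv> open_sub M X"
abbreviation "T \<equiv> total E"
definition Img where "Img = to_frame E ` points T"

lemma cM: "compatible_charts M"
  using M unfolding complex_manifold_def by blast

lemma oX: "openin (mtop M) X"
  using openin_diff[OF openin_topspace S(1)] unfolding X_def topspace_mtop[OF cM] .

text \<open>\<open>- S\<close> may contain elements of the type outside \<open>M\<close>, and then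
  it is not open in \<open>mtop M\<close>. The open set \<open>X\<close> gives the same
  submanifold.\<close>

lemma N_eq: "open_sub M (- S) = N"
  by (subst open_sub_Int_points) (simp add: X_def Diff_eq Int_commute)

lemmas cN = compatible_open_sub[OF cM oX]

lemma points_N: "points N = X"
  by (auto simp: points_open_sub X_def)

lemma EN: "scalar_conservation_law N E"
  using E unfolding N_eq .

lemma GE: "G_structure N E"
  using EN unfolding scalar_conservation_law_def by (rule conjunct1)

lemma PE: "principal_G_bundle N E"
  using GE unfolding G_structure_def by (rule conjunct1)

lemma cT: "compatible_charts T"
  using PE unfolding principal_G_bundle_def complex_manifold_def by blast

lemma hmap_proj: "e \<in> points T \<Longrightarrow> hmap T N e (proj E)"
  using PE unfolding principal_G_bundle_def holo_map_iff[OF cT cN] by blast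

lemma proj_X: "e \<in> points T \<Longrightarrow> proj E e \<in> X"
  using hmapD(2)[OF hmap_proj] by (simp add: points_N)

lemma hmap_N_M: "hmap A N x F \<longleftrightarrow> hmap A M x F \<and> F x \<in> X"
  by (rule hmap_open_sub_cod[OF cM oX])

lemma hmap_proj_M: "e \<in> points T \<Longrightarrow> hmap T M e (proj E)"
  using hmap_proj unfolding hmap_N_M by (rule conjunct1)

lemma hmap_to_frame: "e \<in> points T \<Longrightarrow> hmap T (frame_bundle N) e (to_frame E)"
  using GE unfolding G_structure_def holo_map_iff[OF cT compatible_frame_bundle[OF cN]] by blast

lemma to_frame_frames: "e \<in> points T \<Longrightarrow> to_frame E e \<in> frames N"
  using hmapD(2)[OF hmap_to_frame] by (simp add: points_frame_bundle[OF cN])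

lemma fst_to_frame: "e \<in> points T \<Longrightarrow> fst (to_frame E e) = proj E e"
  using GE unfolding G_structure_def by blast

lemma to_frame_act: "e \<in> points T \<Longrightarrow> k \<in> G_group \<Longrightarrow> to_frame E (act E e k) = frame_act N k (to_frame E e)"
  using GE unfolding G_structure_def by blast

lemma act_points: "e \<in> points T \<Longrightarrow> k \<in> G_group \<Longrightarrow> act E e k \<in> points T"
proof -
  assume ek: "e \<in> points T" "k \<in> G_group"
  have "hmap (prod_atlas T G_atlas) T (e, k) (\<lambda>(e, k). act E e k)"
    using PE ek unfolding principal_G_bundle_def holo_map_iff[OF compatible_prod_atlas[OF cT compatible_G_atlas] cT]
      points_prod_atlas[OF cT compatible_G_atlas] points_G_atlas by blast
  from hmapD(2)[OF this] show ?thesis by simp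
qed

text \<open>Local triviality in usable form: \<open>biholo\<close> is replaced by statements at
  points, and the fibres over \<open>U\<close> are exactly the images of the group.\<close>

lemma trivialization:
  assumes "p \<in> X"
  obtains U \<psi> where "openin (mtop N) U" "p \<in> U" "U \<subseteq> X"
    "\<And>x. x \<in> U \<times> G_group \<Longrightarrow> hmap (prod_atlas (open_sub N U) G_atlas) T x \<psi>"
    "\<And>x. x \<in> U \<times> G_group \<Longrightarrow> \<psi> x \<in> points T"
    "\<And>e. e \<in> points T \<Longrightarrow> proj E e \<in> U \<Longrightarrow> \<exists>k\<in>G_group. e = \<psi> (proj E e, k)"
    "\<And>q k. q \<in> U \<Longrightarrow> k \<in> G_group \<Longrightarrow> proj E (\<psi> (q, k)) = q"
    "\<And>q k l. q \<in> U \<Longrightarrow> k \<in> G_group \<Longrightarrow> l \<in> G_group \<Longrightarrow> \<psi> (q, k ** l) = act E (\<psi> (q, k)) l"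
proof -
  have "\<forall>m\<in>points N. \<exists>U \<psi>. openin (mtop N) U \<and> m \<in> U \<and>
        biholo (prod_atlas (open_sub N U) G_atlas) (open_sub T (proj E -` U)) \<psi> \<and>
        (\<forall>p\<in>U. \<forall>k\<in>G_group. proj E (\<psi> (p, k)) = p \<and>
           (\<forall>l\<in>G_group. \<psi> (p, k ** l) = act E (\<psi> (p, k)) l))"
    using PE unfolding principal_G_bundle_def by (elim conjE)
  from bspec[OF this, of p] assms obtain U \<psi> where U0: "openin (mtop N) U \<and> p \<in> U \<and>
        biholo (prod_atlas (open_sub N U) G_atlas) (open_sub T (proj E -` U)) \<psi> \<and>
        (\<forall>p\<in>U. \<forall>k\<in>G_group. proj E (\<psi> (p, k)) = p \<and>
           (\<forall>l\<in>G_group. \<psi> (p, k ** l) = act E (\<psi> (p, k)) l))"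
    unfolding points_N by (elim exE meta_impE) 
  then have U: "openin (mtop N) U" "p \<in> U" "biholo (prod_atlas (open_sub N U) G_atlas) (open_sub T (proj E -` U)) \<psi>"
    and \<psi>: "\<And>q k. q \<in> U \<Longrightarrow> k \<in> G_group \<Longrightarrow> proj E (\<psi> (q, k)) = q"
    "\<And>q k l. q \<in> U \<Longrightarrow> k \<in> G_group \<Longrightarrow> l \<in> G_group \<Longrightarrow> \<psi> (q, k ** l) = act E (\<psi> (q, k)) l"
    by simp_all
  have UX: "U \<subseteq> X" using openin_subset[OF U(1)] unfolding topspace_mtop[OF cN] points_N .
  have cU: "compatible_charts (open_sub N U)" by (rule compatible_open_sub[OF cN U(1)])
  have cQ: "compatible_charts (prod_atlas (open_sub N U) G_atlas)" by (rule compatible_prod_atlas[OF cU compatible_G_atlas])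
  have pQ: "points (prod_atlas (open_sub N U) G_atlas) = U \<times> G_group"
    using UX by (auto simp: points_prod_atlas[OF cU compatible_G_atlas] points_open_sub[of N] points_N points_G_atlas)
  define P where "P = proj E -` U \<inter> points T"
  have oP: "openin (mtop T) P"
  proof -
    have "holo_map T N (proj E)" using PE unfolding principal_G_bundle_def by blast
    then have "continuous_map (mtop T) (mtop N) (proj E)" unfolding holo_map_def by blast
    from openin_continuous_map_preimage[OF this U(1)]
    have "openin (mtop T) {x \<in> points T. proj E x \<in> U}" unfolding topspace_mtop[OF cT] .
    moreover have "{x \<in> points T. proj E x \<in> U} = P" unfolding P_def by blast
    ultimately show ?thesis by simp
  qed
  have b: "biholo (prod_atlas (open_sub N U) G_atlas) (open_sub T P) \<psi>"
    using U(3) unfolding P_def by (subst (asm) open_sub_Int_points)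
  have pP: "points (open_sub T P) = P" unfolding P_def by (auto simp: points_open_sub)
  have bij: "bij_betw \<psi> (U \<times> G_group) P" using b unfolding biholo_def pQ pP by blast
  have hm: "holo_map (prod_atlas (open_sub N U) G_atlas) (open_sub T P) \<psi>" using b unfolding biholo_def by blast
  show ?thesis
  proof (rule that[of U \<psi>, OF U(1,2) UX _ _ _ \<psi>])
    show "hmap (prod_atlas (open_sub N U) G_atlas) T x \<psi>" if "x \<in> U \<times> G_group" for x
      using hm that unfolding holo_map_iff[OF cQ compatible_open_sub[OF cT oP]] pQ hmap_open_sub_cod[OF cT oP] by blast
    show "\<psi> x \<in> points T" if "x \<in> U \<times> G_group" for x
      using bij_betwE[OF bij] that unfolding P_def by blast
    show "\<exists>k\<in>G_group. e = \<psi> (proj E e, k)" if e: "e \<in> points T" "proj E e \<in> U" for e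
    proof -
      have "e \<in> \<psi> ` (U \<times> G_group)" using bij_betw_imp_surj_on[OF bij] e unfolding P_def by blast
      then obtain q k where "q \<in> U" "k \<in> G_group" "e = \<psi> (q, k)" by blast
      then show ?thesis using \<psi>(1) by auto
    qed
  qed
qed

text \<open>In a trivialization the two points are images of group elements \<open>k\<close> and
  \<open>k'\<close>, and \<open>matrix_inv k ** k'\<close> moves the first to the second.\<close>

lemma fiber:
  assumes "e \<in> points T" "e' \<in> points T" "proj E e = proj E e'"
  shows "\<exists>k\<in>G_group. e' = act E e k"
proof -
  obtain U \<psi> where "openin (mtop N) U" "proj E e \<in> U" "U \<subseteq> X"
    and "\<And>x. x \<in> U \<times> G_group \<Longrightarrow> hmap (prod_atlas (open_sub N U) G_atlas) T x \<psi>"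
    "\<And>x. x \<in> U \<times> G_group \<Longrightarrow> \<psi> x \<in> points T"
    and surj: "\<And>e. e \<in> points T \<Longrightarrow> proj E e \<in> U \<Longrightarrow> \<exists>k\<in>G_group. e = \<psi> (proj E e, k)"
    and "\<And>q k. q \<in> U \<Longrightarrow> k \<in> G_group \<Longrightarrow> proj E (\<psi> (q, k)) = q"
    and eq: "\<And>q k l. q \<in> U \<Longrightarrow> k \<in> G_group \<Longrightarrow> l \<in> G_group \<Longrightarrow> \<psi> (q, k ** l) = act E (\<psi> (q, k)) l"
    by (rule trivialization[OF proj_X[OF assms(1)]]) (rule that; (assumption | blast))
  obtain k where k: "k \<in> G_group" "e = \<psi> (proj E e, k)" using surj[OF assms(1)] \<open>proj E e \<in> U\<close> by blast
  obtain k' where k': "k' \<in> G_group" "e' = \<psi> (proj E e, k')" using surj[OF assms(2)] \<open>proj E e \<in> U\<close> assms(3) by metis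
  have l: "matrix_inv k ** k' \<in> G_group" by (rule G_mult_in[OF G_inv_in[OF k(1)] k'(1)])
  have "k ** (matrix_inv k ** k') = k'" by (simp add: matrix_mul_assoc G_inv_mult(2)[OF k(1)])
  then have "e' = act E (\<psi> (proj E e, k)) (matrix_inv k ** k')"
    using eq[OF \<open>proj E e \<in> U\<close> k(1) l] k'(2) by simp
  then show ?thesis using l k(2) by metis
qed

lemma fr_N: "p \<in> X \<Longrightarrow> fr N (U', \<kappa>) p m = fr M (U, \<kappa>) p m"
  unfolding fr_def by (simp add: tangent_space_open_sub[OF cM oX])

lemma mt_N: "(U, \<kappa>) \<in> M \<Longrightarrow> fst e \<in> U \<Longrightarrow> fst e \<in> X \<Longrightarrow> mt N (U \<inter> X, \<kappa>) e = mt M (U, \<kappa>) e"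
  unfolding mt_def by (simp add: chart_vec_open_sub[OF cM oX])

lemma frame_act_N: "fst e \<in> X \<Longrightarrow> frame_act N k e = frame_act M k e"
  unfolding frame_act_def by (simp add: split_beta tangent_space_open_sub[OF cM oX])

lemma frames_N: "e \<in> frames N \<longleftrightarrow> e \<in> frames M \<and> fst e \<in> X"
proof (cases "fst e \<in> X")
  case True
  then have "fst e \<in> points M" by (simp add: X_def)
  then show ?thesis using True unfolding frames_def points_N by (auto simp: tangent_space_open_sub[OF cM oX])
next
  case False
  then show ?thesis unfolding frames_def points_N by auto
qed

lemma ImgE:
  assumes "u \<in> Img"
  obtains e where "e \<in> points T" "to_frame E e = u" "proj E e = fst u"
proof -
  from assms obtain e where e: "e \<in> points T" "u = to_frame E e" unfolding Img_def by blast
  show ?thesis by (rule that[OF e(1) e(2)[symmetric]]) (simp add: e fst_to_frame)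
qed

lemma Img_frames:
  assumes "u \<in> Img"
  shows "u \<in> frames M" "fst u \<in> X"
proof -
  have "u \<in> frames N" using assms unfolding Img_def using to_frame_frames by blast
  then show "u \<in> frames M" "fst u \<in> X" unfolding frames_N by simp_all
qed

lemma Img_det:
  assumes U: "(U, \<kappa>) \<in> M" "p \<in> U" and u: "fr M (U, \<kappa>) p m \<in> Img"
  shows "det m \<noteq> 0"
  using det_mt_nonzero[OF cM U(1) _ Img_frames(1)[OF u]] U by (simp add: mt_fr_self[OF cM U])

lemma Img_act:
  assumes U: "(U, \<kappa>) \<in> M" "p \<in> U" and u: "fr M (U, \<kappa>) p m \<in> Img" and k: "k \<in> G_group"
  shows "fr M (U, \<kappa>) p (k ** m) \<in> Img"
proof -
  obtain e where e: "e \<in> points T" "to_frame E e = fr M (U, \<kappa>) p m" "proj E e = p"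
    using ImgE[OF u] by (metis fst_fr)
  have "to_frame E (act E e (matrix_inv k)) = frame_act M (matrix_inv k) (fr M (U, \<kappa>) p m)"
    unfolding to_frame_act[OF e(1) G_inv_in[OF k]] e(2) using Img_frames(2)[OF u] by (rule frame_act_N)
  also have "\<dots> = fr M (U, \<kappa>) p (k ** m)" by (simp add: frame_act_fr G_inv_inv[OF k])
  finally show ?thesis unfolding Img_def using act_points[OF e(1) G_inv_in[OF k]] by (metis imageI)
qed

text \<open>With \<open>Img_act\<close>: the matrices of the frames in \<open>Img\<close> over one
  point form at most one orbit under left multiplication by the group.\<close>

lemma Img_orbit:
  assumes U: "(U, \<kappa>) \<in> M" "p \<in> U" and u: "fr M (U, \<kappa>) p m \<in> Img" "fr M (U, \<kappa>) p m' \<in> Img"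
  shows "\<exists>k\<in>G_group. m' = k ** m"
proof -
  obtain e where e: "e \<in> points T" "to_frame E e = fr M (U, \<kappa>) p m" "proj E e = p"
    using ImgE[OF u(1)] by (metis fst_fr)
  obtain e' where e': "e' \<in> points T" "to_frame E e' = fr M (U, \<kappa>) p m'" "proj E e' = p"
    using ImgE[OF u(2)] by (metis fst_fr)
  obtain k where k: "k \<in> G_group" "e' = act E e k" using fiber[OF e(1) e'(1)] e(3) e'(3) by auto
  have "fr M (U, \<kappa>) p m' = frame_act M k (fr M (U, \<kappa>) p m)"
    unfolding e'(2)[symmetric] k(2) to_frame_act[OF e(1) k(1)] e(2) by (rule frame_act_N) (use Img_frames(2)[OF u(1)] in simp)
  then have "fr M (U, \<kappa>) p m' = fr M (U, \<kappa>) p (matrix_inv k ** m)" by (simp add: frame_act_fr)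
  then have "m' = matrix_inv k ** m" using mt_fr_self[OF cM U] by metis
  then show ?thesis using G_inv_in[OF k(1)] by blast
qed

text \<open>The group acts freely on frames because their matrices are invertible. This is why the
  law can be replaced by its set of frames \<open>Img\<close>.\<close>

lemma inj_to_frame: "inj_on (to_frame E) (points T)"
proof (rule inj_onI)
  fix e e' assume e: "e \<in> points T" "e' \<in> points T" "to_frame E e = to_frame E e'"
  then have "proj E e = proj E e'" using fst_to_frame by metis
  then obtain k where k: "k \<in> G_group" "e' = act E e k" using fiber e by blast
  let ?u = "to_frame E e"
  have uF: "?u \<in> frames M" "fst ?u \<in> X" using to_frame_frames[OF e(1)] frames_N by auto
  then have "fst ?u \<in> points M" by (simp add: X_def)
  then obtain U \<kappa> where U: "(U, \<kappa>) \<in> M" "fst ?u \<in> U" by (rule pointsE)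
  let ?m = "mt M (U, \<kappa>) ?u"
  have u: "fr M (U, \<kappa>) (fst ?u) ?m = ?u" by (rule fr_mt[OF cM U uF(1)])
  have "?u = frame_act M k ?u" using to_frame_act[OF e(1) k(1)] e(3) k(2) frame_act_N[OF uF(2)] by simp
  also have "\<dots> = fr M (U, \<kappa>) (fst ?u) (matrix_inv k ** ?m)" by (subst u[symmetric], rule frame_act_fr)
  finally have "?m = matrix_inv k ** ?m" using mt_fr_self[OF cM U] by metis
  then have "?m ** inv3 ?m = matrix_inv k ** (?m ** inv3 ?m)" unfolding matrix_mul_assoc by simp
  then have "matrix_inv k = mat 1" using inv3_inverse(1)[OF det_mt_nonzero[OF cM U uF(1)]] by simp
  then have "k = mat 1" using G_inv_mult(2)[OF k(1)] by simp
  then show "e = e'" using k(2) e(1) PE unfolding principal_G_bundle_def by metis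
qed

definition lift where "lift = inv_into (points T) (to_frame E)"

lemma lift: "u \<in> Img \<Longrightarrow> lift u \<in> points T" "u \<in> Img \<Longrightarrow> to_frame E (lift u) = u"
  unfolding lift_def Img_def by (rule inv_into_into, assumption) (rule f_inv_into_f)

lemma lift_to_frame: "e \<in> points T \<Longrightarrow> lift (to_frame E e) = e"
  unfolding lift_def by (rule inv_into_f_f[OF inj_to_frame])

text \<open>A map into the bundle is holomorphic once its composition with \<open>to_frame E\<close> is: in a
  trivialization the group coordinate is recovered from the matrix of the frame.\<close>

lemma hmap_into_T:
  assumes cY: "compatible_charts Y" and tF: "hmap Y (frame_bundle N) y (\<lambda>q. to_frame E (F q))"
    and ev: "eventually (\<lambda>q. F q \<in> points T) (nh Y y)"
  shows "hmap Y T y F"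
proof -
  have y: "y \<in> points Y" by (rule hmapD(1)[OF tF])
  have Fy: "F y \<in> points T" by (rule nh_self[OF cY ev y])
  let ?p = "proj E (F y)"
  have pX: "?p \<in> X" by (rule proj_X[OF Fy])
  obtain U \<psi> where U: "openin (mtop N) U" "?p \<in> U" "U \<subseteq> X"
    and h\<psi>: "\<And>x. x \<in> U \<times> G_group \<Longrightarrow> hmap (prod_atlas (open_sub N U) G_atlas) T x \<psi>"
    and \<psi>T: "\<And>x. x \<in> U \<times> G_group \<Longrightarrow> \<psi> x \<in> points T"
    and surj: "\<And>e. e \<in> points T \<Longrightarrow> proj E e \<in> U \<Longrightarrow> \<exists>k\<in>G_group. e = \<psi> (proj E e, k)"
    and p\<psi>: "\<And>q k. q \<in> U \<Longrightarrow> k \<in> G_group \<Longrightarrow> proj E (\<psi> (q, k)) = q"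
    and a\<psi>: "\<And>q k l. q \<in> U \<Longrightarrow> k \<in> G_group \<Longrightarrow> l \<in> G_group \<Longrightarrow> \<psi> (q, k ** l) = act E (\<psi> (q, k)) l"
    by (rule trivialization[OF pX]) (rule that; (assumption | blast))
  have cU: "compatible_charts (open_sub N U)" by (rule compatible_open_sub[OF cN U(1)])
  obtain U1 \<kappa> where c: "(U1, \<kappa>) \<in> N" "?p \<in> U1" using pX pointsE[of ?p N] unfolding points_N by blast
  have hpF: "hmap Y N y (\<lambda>q. proj E (F q))"
  proof (rule hmap_cong[OF cY])
    show "hmap Y N y (\<lambda>q. fst (to_frame E (F q)))"
      by (rule hmap_compose[OF tF hmap_frame_fst[OF cN to_frame_frames[OF Fy]]])
    show "eventually (\<lambda>q. fst (to_frame E (F q)) = proj E (F q)) (nh Y y)"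
      using ev by eventually_elim (rule fst_to_frame)
  qed
  have hpU: "hmap Y (open_sub N U) y (\<lambda>q. proj E (F q))"
    unfolding hmap_open_sub_cod[OF cN U(1)] using hpF U(2) by blast
  define \<sigma> where "\<sigma> p = \<psi> (p, mat 1)" for p
  define \<eta> where "\<eta> p = mt N (U1, \<kappa>) (to_frame E (\<sigma> p))" for p
  have \<sigma>T: "\<sigma> p \<in> points T" "proj E (\<sigma> p) = p" if "p \<in> U" for p
    using \<psi>T p\<psi> that G_one_in by (auto simp: \<sigma>_def)
  have h\<sigma>: "hmap N T ?p \<sigma>"
  proof -
    have pp: "?p \<in> points (open_sub N U)" using U pX by (auto simp: points_open_sub[of N] points_N)
    have "hmap (open_sub N U) T ?p \<sigma>"
      unfolding \<sigma>_def
    proof (rule hmap_compose[where G = \<psi>])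
      show "hmap (open_sub N U) (prod_atlas (open_sub N U) G_atlas) ?p (\<lambda>p. (p, mat 1))"
      proof (rule hmap_pair[OF cU compatible_G_atlas cU hmap_id[OF pp]])
        show "hmap (open_sub N U) G_atlas ?p (\<lambda>p. mat 1)"
          by (rule hmap_GI[OF cU pp]) (simp_all add: G_one_in holo_near_const[OF cU pp])
      qed
      show "hmap (prod_atlas (open_sub N U) G_atlas) T (?p, mat 1) \<psi>" using h\<psi> U(2) G_one_in by blast
    qed
    then show ?thesis unfolding hmap_open_sub_dom[OF cN U(1) U(2)] .
  qed
  have h\<eta>: "holo_near N ?p (\<lambda>p. \<eta> p $ i $ j)" for i j
    unfolding \<eta>_def
  proof (rule hmapD(4)[OF hmap_compose[OF h\<sigma> hmap_to_frame[OF \<sigma>T(1)[OF U(2)]]]])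
    show "holo_near (frame_bundle N) (to_frame E (\<sigma> ?p)) (\<lambda>u. mt N (U1, \<kappa>) u $ i $ j)"
      by (rule holo_near_mt[OF cN to_frame_frames[OF \<sigma>T(1)[OF U(2)]] c(1)]) (simp add: fst_to_frame \<sigma>T U(2) c(2))
  qed
  \<comment> \<open>If \<open>F q\<close> is the image under \<psi> of a group element k, its frame
    has the matrix k^-1 times that of the section; solving for k gives this expression.\<close>
  define K where "K q = matrix_inv (mt N (U1, \<kappa>) (to_frame E (F q)) ** inv3 (\<eta> (proj E (F q))))" for q
  have det\<eta>: "det (\<eta> p) \<noteq> 0" if "p \<in> U" "p \<in> U1" for p
    unfolding \<eta>_def by (rule det_mt_nonzero[OF cN c(1) _ to_frame_frames]) (simp_all add: \<sigma>T that fst_to_frame)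
  have main: "K q \<in> G_group \<and> \<psi> (proj E (F q), K q) = F q \<and>
      mt N (U1, \<kappa>) (to_frame E (F q)) ** inv3 (\<eta> (proj E (F q))) \<in> G_group"
    if q: "F q \<in> points T" "proj E (F q) \<in> U" "proj E (F q) \<in> U1" for q
  proof -
    let ?q = "proj E (F q)"
    obtain k where k: "k \<in> G_group" "F q = \<psi> (?q, k)" using surj[OF q(1,2)] by blast
    have "F q = act E (\<sigma> ?q) k" using a\<psi>[OF q(2) G_one_in k(1)] k(2) by (simp add: \<sigma>_def)
    then have "to_frame E (F q) = frame_act N k (to_frame E (\<sigma> ?q))" using to_frame_act[OF \<sigma>T(1)[OF q(2)] k(1)] by simp
    also have "to_frame E (\<sigma> ?q) = fr N (U1, \<kappa>) ?q (\<eta> ?q)"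
      using fr_mt[OF cN c(1) _ to_frame_frames[OF \<sigma>T(1)[OF q(2)]]] q(3)
      by (simp add: \<eta>_def fst_to_frame \<sigma>T q(2))
    finally have "mt N (U1, \<kappa>) (to_frame E (F q)) = matrix_inv k ** \<eta> ?q"
      by (simp add: frame_act_fr mt_fr_self[OF cN c(1) q(3)])
    then have "mt N (U1, \<kappa>) (to_frame E (F q)) ** inv3 (\<eta> ?q) = matrix_inv k"
      by (simp add: matrix_mul_assoc[symmetric] inv3_inverse(1)[OF det\<eta>[OF q(2,3)]])
    then show ?thesis using k G_inv_in[OF k(1)] by (simp add: K_def G_inv_inv[OF k(1)])
  qed
  have evq: "eventually (\<lambda>q. F q \<in> points T \<and> proj E (F q) \<in> U \<and> proj E (F q) \<in> U1) (nh Y y)"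
    using ev hmap_eventually[OF hpF nh_open[OF cN U(1,2)]] hmap_eventually[OF hpF nh_chart[OF cN c]]
    by eventually_elim blast
  have hK: "hmap Y G_atlas y K"
    unfolding K_def[abs_def]
  proof (rule hmap_G_inv[OF cY], rule hmap_GI[OF cY y])
    show "eventually (\<lambda>q. mt N (U1, \<kappa>) (to_frame E (F q)) ** inv3 (\<eta> (proj E (F q))) \<in> G_group) (nh Y y)"
      using evq by eventually_elim (use main in blast)
    have "holo_near Y y (\<lambda>q. mt N (U1, \<kappa>) (to_frame E (F q)) $ i $ j)" for i j
      by (rule hmapD(4)[OF tF], rule holo_near_mt[OF cN to_frame_frames[OF Fy] c(1)]) (simp add: fst_to_frame[OF Fy] c(2))
    then have "holo_near Y y (\<lambda>q. (mt N (U1, \<kappa>) (to_frame E (F q)) ** inv3 (\<eta> (proj E (F q)))) $ i $ j)" for i j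
      by (intro holo_near_mat_mult[OF cY y] holo_near_inv3[OF cY y] hmapD(4)[OF hpF h\<eta>] det\<eta> U(2) c(2))
    then show "holo_near Y y (\<lambda>q. (mt N (U1, \<kappa>) (to_frame E (F q)) ** inv3 (\<eta> (proj E (F q)))) $ 2 $ 2)"
      "holo_near Y y (\<lambda>q. (mt N (U1, \<kappa>) (to_frame E (F q)) ** inv3 (\<eta> (proj E (F q)))) $ 3 $ 2)" by this+
  qed
  have Ky: "(?p, K y) \<in> U \<times> G_group" using main[OF Fy U(2) c(2)] U(2) by blast
  have "hmap Y T y (\<lambda>q. \<psi> (proj E (F q), K q))"
    by (rule hmap_compose[OF hmap_pair[OF cU compatible_G_atlas cY hpU hK] h\<psi>[OF Ky]])
  then show ?thesis
  proof (rule hmap_cong[OF cY])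
    show "eventually (\<lambda>q. \<psi> (proj E (F q), K q) = F q) (nh Y y)"
      using evq by eventually_elim (use main in blast)
  qed
qed

text \<open>The structure equations are pulled back along the section defined by the coframe \<open>m\<close>.\<close>

lemma adapted_pullback:
  assumes U: "(U, \<kappa>) \<in> M" and W: "openin (mtop M) W" "W \<subseteq> U" "W \<subseteq> X"
    and m: "\<And>p i j. p \<in> W \<Longrightarrow> holo_near M p (\<lambda>q. m q $ i $ j)"
    and I: "\<And>p. p \<in> W \<Longrightarrow> fr M (U, \<kappa>) p (m p) \<in> Img" and p: "p \<in> W"
  shows "adapted M (U, \<kappa>) m p"
proof -
  let ?c = "(U \<inter> X, \<kappa>)"
  have c: "?c \<in> N" by (rule chart_open_sub[OF cM oX U])
  have pX: "p \<in> X" "p \<in> U" "p \<in> U \<inter> X" using p W by auto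
  have pM: "p \<in> points M" "p \<in> points N" using pX(1) by (simp_all only: points_N, simp add: X_def)
  note hN = holo_near_open_sub[OF cM oX pX(1)] and nN = nh_open_sub[OF cM oX pX(1)]
  define \<sigma> where "\<sigma> q = lift (fr M (U, \<kappa>) q (m q))" for q
  have \<sigma>: "\<sigma> q \<in> points T" "to_frame E (\<sigma> q) = fr M (U, \<kappa>) q (m q)" "proj E (\<sigma> q) = q" if "q \<in> W" for q
  proof -
    show 1: "\<sigma> q \<in> points T" "to_frame E (\<sigma> q) = fr M (U, \<kappa>) q (m q)" using lift[OF I[OF that]] by (simp_all add: \<sigma>_def)
    show "proj E (\<sigma> q) = q" using fst_to_frame[OF 1(1)] 1(2) by simp
  qed
  have evW: "eventually (\<lambda>q. q \<in> W) (nh N p)" unfolding nN by (rule nh_open[OF cM W(1) p])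
  have mt\<sigma>: "mt N ?c (to_frame E (\<sigma> q)) = m q" if "q \<in> W" for q
  proof -
    have q: "q \<in> U" "q \<in> X" using that W by auto
    show ?thesis using mt_N[OF U, of "fr M (U, \<kappa>) q (m q)"] q by (simp add: \<sigma>(2)[OF that] mt_fr_self[OF cM U])
  qed
  have "hmap N (frame_bundle N) p (\<lambda>q. to_frame E (\<sigma> q))"
  proof (rule hmap_frameI[OF cN cN _ _ c])
    show "hmap N N p (\<lambda>q. fst (to_frame E (\<sigma> q)))"
      by (rule hmap_cong[OF cN hmap_id[OF pM(2)]], rule eventually_mono[OF evW]) (simp add: \<sigma>)
    show "eventually (\<lambda>q. to_frame E (\<sigma> q) \<in> frames N) (nh N p)"
      by (rule eventually_mono[OF evW]) (rule to_frame_frames[OF \<sigma>(1)])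
    show "fst (to_frame E (\<sigma> p)) \<in> U \<inter> X" using pX by (simp add: \<sigma>(2)[OF p])
    show "holo_near N p (\<lambda>q. mt N ?c (to_frame E (\<sigma> q)) $ i $ j)" for i j
      by (rule holo_near_cong[OF cN _ m[OF p, of i j, folded hN]], rule eventually_mono[OF evW]) (simp add: mt\<sigma>)
  qed
  then have h\<sigma>: "hmap N T p \<sigma>"
    by (rule hmap_into_T[OF cN]) (rule eventually_mono[OF evW], rule \<sigma>(1))
  let ?e = "\<sigma> p"
  have e: "?e \<in> points T" by (rule \<sigma>(1)[OF p])
  have pe: "proj E ?e = p" by (rule \<sigma>(3)[OF p])
  obtain W' \<phi> \<mu> K where SE: "?e \<in> W'"
    "\<And>e v w. e \<in> W' \<Longrightarrow> v \<in> tangent_space T e \<Longrightarrow> w \<in> tangent_space T e \<Longrightarrow>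
       (\<chi> i. ext_deriv T (\<lambda>e v. soldering N E e v $ i) e v w) =
       - (\<chi> i. \<Sum>j\<in>UNIV. wedge (\<lambda>e v. \<gg>_mat (\<phi> e v) (\<mu> e v) $ i $ j) (\<lambda>e v. soldering N E e v $ j) e v w)
       + vector [K e * wedge (\<lambda>e v. soldering N E e v $ 2) (\<lambda>e v. soldering N E e v $ 3) e v w,
          wedge (\<lambda>e v. soldering N E e v $ 1) (\<lambda>e v. soldering N E e v $ 3) e v w, 0]"
    using conjunct2[OF EN[unfolded scalar_conservation_law_def Let_def], THEN bspec, OF e]
    by (elim exE conjE) (rule that, assumption, (drule bspec, assumption)+, assumption)
  define d where "d a = dv N ?c a p" for a
  \<comment> \<open>The coordinate vectors at \<open>p\<close> pushed forward by the section. On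
    them the soldering form yields the columns of \<open>m p\<close>, and its exterior derivative
    yields \<open>curl\<close>.\<close>
  define v where "v a = pushforward T \<sigma> p (d a)" for a
  have td: "d a \<in> tangent_space N p" for a unfolding d_def by (rule chart_vec_tangent[OF cN c pX(3)])
  have tv: "v a \<in> tangent_space T ?e" for a unfolding v_def by (rule pushforward_tangent[OF cT h\<sigma> td])
  have va: "v a f = d a (\<lambda>q. f (\<sigma> q))" if "holo_near T ?e f" for a f
    using that by (simp add: v_def pushforward_def)
  have dM: "d a f = dv M (U, \<kappa>) a p f" for a f unfolding d_def by (simp add: chart_vec_open_sub[OF cM oX U pX(2,1)])
  have Fh: "holo_near T ?e (\<lambda>e. mt N ?c (to_frame E e) $ i $ b)" for i b
    by (rule hmapD(4)[OF hmap_to_frame[OF e]], rule holo_near_mt[OF cN to_frame_frames[OF e] c]) (use pX in \<open>simp add: \<sigma>(2)[OF p]\<close>)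
  have fh: "holo_near T ?e (\<lambda>e. \<kappa> (proj E e) $ b)" for b
    by (rule hmapD(4)[OF hmap_proj[OF e]], rule holo_near_coord[OF cN c]) (simp only: pe pX(3))
  have vF: "v a (\<lambda>e. mt N ?c (to_frame E e) $ i $ b) = dv M (U, \<kappa>) a p (\<lambda>q. m q $ i $ b)" for a i b
    unfolding va[OF Fh] dM[symmetric]
    by (rule tv_cong[OF cN td _ pM(2)], rule eventually_mono[OF evW]) (simp add: mt\<sigma>)
  have vf: "v a (\<lambda>e. \<kappa> (proj E e) $ b) = (if a = b then 1 else 0)" for a b
  proof -
    have "v a (\<lambda>e. \<kappa> (proj E e) $ b) = d a (\<lambda>q. \<kappa> q $ b)"
      unfolding va[OF fh] by (rule tv_cong[OF cN td _ pM(2)], rule eventually_mono[OF evW]) (simp add: \<sigma>(3))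
    also have "\<dots> = axis a 1 $ b" unfolding d_def by (rule chart_vec_coord[OF cN c pX(3)])
    finally show ?thesis by (simp add: axis_def)
  qed
  have sold: "soldering N E q w $ i = (\<Sum>b\<in>UNIV. mt N ?c (to_frame E q) $ i $ b * w (\<lambda>e. \<kappa> (proj E e) $ b))"
    if q: "q \<in> points T" "proj E q \<in> U \<inter> X" and w: "w \<in> tangent_space T q" for q w i
  proof -
    have t: "pushforward N (proj E) q w \<in> tangent_space N (fst (to_frame E q))"
      unfolding fst_to_frame[OF q(1)] by (rule pushforward_tangent[OF cN hmap_proj[OF q(1)] w])
    have "fst (to_frame E q) \<in> U \<inter> X" using q by (simp add: fst_to_frame)
    from frame_apply[OF cN c this to_frame_frames[OF q(1)] t]
    have "soldering N E q w = mt N ?c (to_frame E q) *v (\<chi> b. pushforward N (proj E) q w (\<lambda>q. \<kappa> q $ b))"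
      unfolding soldering_def .
    then show ?thesis
      by (simp add: matrix_vector_mult_def pushforward_apply[where F = "proj E" and p = q, OF holo_near_coord[OF cN c q(2)]])
  qed
  have ext: "ext_deriv T (\<lambda>e v. soldering N E e v $ i) ?e (v a) (v b) = curl M (U, \<kappa>) m i a b p" for i a b
  proof -
    have "ext_deriv T (\<lambda>e v. soldering N E e v $ i) ?e (v a) (v b) =
      (\<Sum>k\<in>UNIV. v a (\<lambda>e. mt N ?c (to_frame E e) $ i $ k) * v b (\<lambda>e. \<kappa> (proj E e) $ k) -
         v b (\<lambda>e. mt N ?c (to_frame E e) $ i $ k) * v a (\<lambda>e. \<kappa> (proj E e) $ k))"
    proof (rule ext_deriv_form[OF cT e Fh fh _ tv tv])
      have "eventually (\<lambda>q. proj E q \<in> U \<inter> X) (nh T ?e)"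
        by (rule hmap_eventually[OF hmap_proj[OF e] nh_chart[OF cN c]]) (simp only: pe pX(3))
      with nh_points[OF cT e]
      show "eventually (\<lambda>q. \<forall>v\<in>tangent_space T q. soldering N E q v $ i =
          (\<Sum>k\<in>UNIV. mt N ?c (to_frame E q) $ i $ k * v (\<lambda>e. \<kappa> (proj E e) $ k))) (nh T ?e)"
        by eventually_elim (intro ballI sold)
    qed
    then show ?thesis unfolding vF vf curl_def sum_subtractf by (simp add: if_distrib cong: if_cong)
  qed
  have so: "soldering N E ?e (v a) $ i = m p $ i $ a" for a i
  proof -
    have "proj E ?e \<in> U \<inter> X" by (simp only: pe pX(3))
    then show ?thesis by (simp add: sold[OF e _ tv] vf mt\<sigma>[OF p] if_distrib cong: if_cong)
  qed
  show ?thesis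
  proof (rule adapted_if_structure_equations[where f = "\<lambda>a. \<phi> ?e (v a)" and u = "\<lambda>a. \<mu> ?e (v a)" and K = "K ?e"])
    fix a b
    note eq = SE(2)[OF SE(1) tv[of a] tv[of b], unfolded vec_eq_iff forall_3 sum_3 vector_add_component
        vector_uminus_component vec_lambda_beta \<gg>_mat_nth vector_3 wedge_def ext so]
    show "curl M (U, \<kappa>) m 1 a b p = - 2 * (\<phi> ?e (v a) * m p $ 1 $ b - \<phi> ?e (v b) * m p $ 1 $ a) +
        K ?e * (m p $ 2 $ a * m p $ 3 $ b - m p $ 2 $ b * m p $ 3 $ a)"
      using eq by (simp add: algebra_simps)
    show "curl M (U, \<kappa>) m 2 a b p = - (\<phi> ?e (v a) * m p $ 2 $ b - \<phi> ?e (v b) * m p $ 2 $ a) +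
        (m p $ 1 $ a * m p $ 3 $ b - m p $ 1 $ b * m p $ 3 $ a)"
      using eq by (simp add: algebra_simps)
    show "curl M (U, \<kappa>) m 3 a b p = - (\<mu> ?e (v a) * m p $ 2 $ b - \<mu> ?e (v b) * m p $ 2 $ a) +
        (\<phi> ?e (v a) * m p $ 3 $ b - \<phi> ?e (v b) * m p $ 3 $ a)"
      using eq by (simp add: algebra_simps)
  qed
qed

text \<open>The matrix of the frame along the section at the identity of a trivialization.\<close>

lemma local_coframe:
  assumes U: "(U, \<kappa>) \<in> M" and p: "p \<in> U" "p \<in> X"
  shows "\<exists>W m. openin (mtop M) W \<and> p \<in> W \<and> W \<subseteq> U \<inter> X \<and> (\<forall>q\<in>W. \<forall>i j. holo_near M q (\<lambda>q. m q $ i $ j)) \<and>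
    (\<forall>q\<in>W. fr M (U, \<kappa>) q (m q) \<in> Img)"
proof -
  obtain V \<psi> where V: "openin (mtop N) V" "p \<in> V" "V \<subseteq> X"
    and h\<psi>: "\<And>x. x \<in> V \<times> G_group \<Longrightarrow> hmap (prod_atlas (open_sub N V) G_atlas) T x \<psi>"
    and \<psi>T: "\<And>x. x \<in> V \<times> G_group \<Longrightarrow> \<psi> x \<in> points T"
    and "\<And>e. e \<in> points T \<Longrightarrow> proj E e \<in> V \<Longrightarrow> \<exists>k\<in>G_group. e = \<psi> (proj E e, k)"
    and p\<psi>: "\<And>q k. q \<in> V \<Longrightarrow> k \<in> G_group \<Longrightarrow> proj E (\<psi> (q, k)) = q"
    and "\<And>q k l. q \<in> V \<Longrightarrow> k \<in> G_group \<Longrightarrow> l \<in> G_group \<Longrightarrow> \<psi> (q, k ** l) = act E (\<psi> (q, k)) l"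
    by (rule trivialization[OF p(2)]) (rule that; (assumption | blast))
  have cV: "compatible_charts (open_sub N V)" by (rule compatible_open_sub[OF cN V(1)])
  have VM: "openin (mtop M) V" using V(1) unfolding openin_open_sub[OF cM oX] by blast
  let ?c = "(U \<inter> X, \<kappa>)"
  have c: "?c \<in> N" by (rule chart_open_sub[OF cM oX U])
  define \<sigma> where "\<sigma> p = \<psi> (p, mat 1)" for p
  define m where "m p = mt N ?c (to_frame E (\<sigma> p))" for p
  have \<sigma>T: "\<sigma> q \<in> points T" "proj E (\<sigma> q) = q" if "q \<in> V" for q using \<psi>T p\<psi> that G_one_in by (auto simp: \<sigma>_def)
  show ?thesis
  proof (intro exI[of _ "V \<inter> U"] exI[of _ m] conjI ballI allI)
    show "openin (mtop M) (V \<inter> U)" using VM openin_chart[OF cM U] by (rule openin_Int)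
    show "p \<in> V \<inter> U" using V p by blast
    show "V \<inter> U \<subseteq> U \<inter> X" using V by blast
    fix q assume q: "q \<in> V \<inter> U"
    then have qV: "q \<in> V" "q \<in> U" "q \<in> X" "q \<in> U \<inter> X" using V(3) by auto
    have fq: "fst (to_frame E (\<sigma> q)) = q" by (simp add: fst_to_frame \<sigma>T qV(1))
    have qq: "q \<in> points (open_sub N V)" using qV by (auto simp: points_open_sub[of N] points_N)
    have "hmap (open_sub N V) T q \<sigma>"
      unfolding \<sigma>_def
    proof (rule hmap_compose[where G = \<psi>])
      show "hmap (open_sub N V) (prod_atlas (open_sub N V) G_atlas) q (\<lambda>p. (p, mat 1))"
      proof (rule hmap_pair[OF cV compatible_G_atlas cV hmap_id[OF qq]])
        show "hmap (open_sub N V) G_atlas q (\<lambda>p. mat 1)"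
          by (rule hmap_GI[OF cV qq]) (simp_all add: G_one_in holo_near_const[OF cV qq])
      qed
      show "hmap (prod_atlas (open_sub N V) G_atlas) T (q, mat 1) \<psi>" using h\<psi> qV(1) G_one_in by blast
    qed
    then have h\<sigma>: "hmap N T q \<sigma>" unfolding hmap_open_sub_dom[OF cN V(1) qV(1)] .
    fix i j
    have "holo_near N q (\<lambda>p. m p $ i $ j)"
      unfolding m_def
    proof (rule hmapD(4)[OF hmap_compose[OF h\<sigma> hmap_to_frame[OF \<sigma>T(1)[OF qV(1)]]]])
      show "holo_near (frame_bundle N) (to_frame E (\<sigma> q)) (\<lambda>u. mt N ?c u $ i $ j)"
        by (rule holo_near_mt[OF cN to_frame_frames[OF \<sigma>T(1)[OF qV(1)]] c]) (simp only: fq qV(4))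
    qed
    then show "holo_near M q (\<lambda>p. m p $ i $ j)" unfolding holo_near_open_sub[OF cM oX qV(3)] .
  next
    fix q assume q: "q \<in> V \<inter> U"
    then have qV: "q \<in> V" "q \<in> X" "q \<in> U \<inter> X" using V(3) by auto
    have fq: "fst (to_frame E (\<sigma> q)) = q" by (simp add: fst_to_frame \<sigma>T qV(1))
    have "fr N ?c (fst (to_frame E (\<sigma> q))) (m q) = to_frame E (\<sigma> q)"
      unfolding m_def by (rule fr_mt[OF cN c _ to_frame_frames[OF \<sigma>T(1)[OF qV(1)]]]) (simp only: fq qV(3))
    then have "fr M (U, \<kappa>) q (m q) = to_frame E (\<sigma> q)" unfolding fq fr_N[OF qV(2), of "U \<inter> X" \<kappa> _ U] .
    then show "fr M (U, \<kappa>) q (m q) \<in> Img" unfolding Img_def using \<sigma>T(1)[OF qV(1)] by (metis imageI)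
  qed
qed

lemma frequently_off_S:
  assumes p: "p \<in> points M"
  shows "frequently (\<lambda>q. q \<notin> S) (nh M p)"
proof (cases "p \<in> S")
  case False
  show ?thesis unfolding frequently_def
  proof
    assume "eventually (\<lambda>q. \<not> q \<notin> S) (nh M p)"
    from nh_self[OF cM this p] show False using False by simp
  qed
next
  case True
  obtain U \<kappa> where U: "(U, \<kappa>) \<in> M" "p \<in> U" using pointsE[OF p] by blast
  obtain W where W: "openin (mtop M) W" "p \<in> W" "W \<subseteq> U"
    "\<forall>Q. openin (mtop M) Q \<longrightarrow> Q \<subseteq> W \<longrightarrow> Q \<noteq> {} \<longrightarrow> Q - S \<noteq> {}"
    "\<forall>h. (\<forall>p\<in>U - S. holo_near M p h) \<longrightarrow>
       (\<exists>h'. (\<forall>p\<in>W. holo_near M p h') \<and> (\<forall>p\<in>W - S. h' p = h p))"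
    using Hartogs_manifold[OF cM S True U] .
  show ?thesis unfolding frequently_def
  proof
    assume "eventually (\<lambda>q. \<not> q \<notin> S) (nh M p)"
    then obtain Q where Q: "openin (mtop M) Q" "p \<in> Q" "\<And>q. q \<in> Q \<Longrightarrow> \<not> q \<notin> S"
      using eventually_nhE[OF cM _ p] by blast
    have "openin (mtop M) (Q \<inter> W)" using Q(1) W(1) by (rule openin_Int)
    moreover have "Q \<inter> W \<noteq> {}" using Q(2) W(2) by blast
    ultimately have "Q \<inter> W - S \<noteq> {}" using W(4)[THEN spec, of "Q \<inter> W"] by blast
    then show False using Q(3) by blast
  qed
qed

text \<open>How identities reach the points of \<open>S\<close>: each is written as the vanishing of
  a function that is holomorphic there as well.\<close>

lemma zero_by_density:
  assumes f: "holo_near M p f" and z: "eventually (\<lambda>q. q \<notin> S \<longrightarrow> f q = 0) (nh M p)"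
  shows "f p = 0"
proof (rule holo_near_frequently_zero[OF cM f])
  show "frequently (\<lambda>q. f q = 0) (nh M p)"
    using frequently_eventually_frequently[OF frequently_off_S[OF holo_near_points[OF cM f]] z]
    by (rule frequently_elim1) blast
qed

section \<open>Adapted coframes across the exceptional set\<close>

text \<open>The normalisation of the determinant refers to the chart \<open>c\<close>. It leaves the
  matrices \<open>G_mat g h\<close> with g = 1 or g = -1 and arbitrary shear.\<close>

definition good where
  "good c p m \<longleftrightarrow> (\<forall>i j. holo_near M p (\<lambda>q. m q $ i $ j)) \<and>
     eventually (\<lambda>q. fr M c q (m q) \<in> Img \<and> det (m q) = 1) (nh M p)"

lemma goodD:
  assumes "good c p m" "p \<in> points M"
  shows "holo_near M p (\<lambda>q. m q $ i $ j)" "fr M c p (m p) \<in> Img" "det (m p) = 1" "eventually (\<lambda>q. good c q m) (nh M p)"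
proof -
  have h: "\<And>i j. holo_near M p (\<lambda>q. m q $ i $ j)" and e: "eventually (\<lambda>q. fr M c q (m q) \<in> Img \<and> det (m q) = 1) (nh M p)"
    using assms(1) unfolding good_def by simp_all
  show "holo_near M p (\<lambda>q. m q $ i $ j)" by (rule h)
  show "fr M c p (m p) \<in> Img" "det (m p) = 1" using nh_self[OF cM e assms(2)] by simp_all
  have "eventually (\<lambda>q. \<forall>i j. holo_near M q (\<lambda>q. m q $ i $ j)) (nh M p)"
    by (intro eventually_all_finite eventually_holo_near[OF cM] h)
  with eventually_eventually_nh[OF cM e] show "eventually (\<lambda>q. good c q m) (nh M p)"
    unfolding good_def by eventually_elim blast
qed

context
  fixes U \<kappa>
  assumes U: "(U, \<kappa>) \<in> M"
begin

lemma UX: "p \<in> U \<Longrightarrow> p \<notin> S \<Longrightarrow> p \<in> X" "p \<in> U \<Longrightarrow> p \<in> points M"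
  using subsetD[OF chart_subset_points[OF U]] by (simp_all add: X_def)

text \<open>\<open>G_mat g h\<close> has determinant \<open>g\<^sup>2\<close>, so a local square
  root of the reciprocal of the determinant normalises a coframe.\<close>

lemma good_exists:
  assumes p: "p \<in> U" "p \<notin> S"
  shows "\<exists>m. good (U, \<kappa>) p m"
proof -
  obtain W m0 where W: "openin (mtop M) W" "p \<in> W" "W \<subseteq> U \<inter> X"
    "\<forall>q\<in>W. \<forall>i j. holo_near M q (\<lambda>q. m0 q $ i $ j)" "\<forall>q\<in>W. fr M (U, \<kappa>) q (m0 q) \<in> Img"
    using local_coframe[OF U p(1) UX(1)[OF p]] by (elim exE conjE) (rule that)
  have pM: "p \<in> points M" by (rule UX(2)[OF p(1)])
  have h0: "holo_near M p (\<lambda>q. m0 q $ i $ j)" for i j using W(2,4) by blast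
  have nz: "det (m0 q) \<noteq> 0" if "q \<in> W" for q
    by (rule Img_det[OF U]) (use that W in blast)+
  obtain r where r: "holo_near M p r" "\<forall>q. (r q)\<^sup>2 = inverse (det (m0 q))"
    using holo_near_sqrt[OF cM holo_near_inverse[OF cM holo_near_det3[OF cM pM h0] nz[OF W(2)]]] nz[OF W(2)] by auto
  have rnz: "r q \<noteq> 0" if "q \<in> W" for q using r(2)[THEN spec, of q] nz[OF that] by auto
  have hG: "holo_near M p (\<lambda>q. G_mat (r q) 0 $ i $ j)" for i j
    using exhaust_3[of i] exhaust_3[of j]
    by (elim disjE) (simp_all add: r(1) holo_near_const[OF cM pM] power2_eq_square holo_near_mult[OF cM]
        holo_near_inverse[OF cM] rnz[OF W(2)])
  have "good (U, \<kappa>) p (\<lambda>q. G_mat (r q) 0 ** m0 q)"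
    unfolding good_def
  proof (intro conjI allI)
    show "holo_near M p (\<lambda>q. (G_mat (r q) 0 ** m0 q) $ i $ j)" for i j
      by (rule holo_near_mat_mult[OF cM pM hG h0])
    show "eventually (\<lambda>q. fr M (U, \<kappa>) q (G_mat (r q) 0 ** m0 q) \<in> Img \<and> det (G_mat (r q) 0 ** m0 q) = 1) (nh M p)"
    proof (rule eventually_mono[OF nh_open[OF cM W(1,2)]])
      fix q assume q: "q \<in> W"
      have "fr M (U, \<kappa>) q (G_mat (r q) 0 ** m0 q) \<in> Img"
        by (rule Img_act[OF U _ _ G_mat_in[OF rnz[OF q]]]) (use q W in blast)+
      moreover have "det (G_mat (r q) 0 ** m0 q) = 1"
        using nz[OF q] r(2) by (simp add: det_mul det_G_mat[OF rnz[OF q]])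
      ultimately show "fr M (U, \<kappa>) q (G_mat (r q) 0 ** m0 q) \<in> Img \<and> det (G_mat (r q) 0 ** m0 q) = 1" by blast
    qed
  qed
  then show ?thesis by blast
qed

lemma good_change:
  assumes q: "q \<in> U" and m: "good (U, \<kappa>) q m" "good (U, \<kappa>) q m'"
  shows "\<exists>g h. g\<^sup>2 = 1 \<and> m' q = G_mat g h ** m q"
proof -
  note d = goodD[OF m(1) UX(2)[OF q]] and d' = goodD[OF m(2) UX(2)[OF q]]
  obtain k where k: "k \<in> G_group" "m' q = k ** m q" using Img_orbit[OF U q d(2) d'(2)] by blast
  obtain g h where g: "g \<noteq> 0" "k = G_mat g h" using k(1) by (rule G_group_cases)
  have "det (m' q) = g\<^sup>2 * det (m q)" unfolding k(2) g(2) by (simp add: det_mul det_G_mat[OF g(1)])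
  then have "g\<^sup>2 = 1" using d(3) d'(3) by simp
  then show ?thesis using k(2) g(2) by blast
qed

text \<open>Two coframes of determinant \<open>1\<close> differ by \<open>G_mat g h\<close> with \<open>g = 1\<close> or \<open>g = -1\<close>. The sign is
  locally constant, so that the derivatives of the second rows differ by the same sign.\<close>

lemma good_sign:
  assumes p: "p \<in> U" and m: "good (U, \<kappa>) p m" "good (U, \<kappa>) p m'"
  shows "\<exists>g h. g\<^sup>2 = 1 \<and> m' p = G_mat g h ** m p \<and>
    (\<forall>i j. dv M (U, \<kappa>) j p (\<lambda>q. m' q $ 2 $ i) = g * dv M (U, \<kappa>) j p (\<lambda>q. m q $ 2 $ i))"
proof -
  have pM: "p \<in> points M" by (rule UX(2)[OF p])
  note d = goodD[OF m(1) pM] and d' = goodD[OF m(2) pM]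
  obtain g h where g: "g\<^sup>2 = 1" "m' p = G_mat g h ** m p" using good_change[OF p m] by blast
  let ?D = "\<lambda>j. dv M (U, \<kappa>) j p"
  let ?f = "\<lambda>i q. m q $ 2 $ i" and ?f' = "\<lambda>i q. m' q $ 2 $ i"
  have t: "?D j \<in> tangent_space M p" for j by (rule chart_vec_tangent[OF cM U p])
  have fp: "?f' i p = g * ?f i p" for i unfolding g(2) by (rule G_mat_mult_nth)
  \<comment> \<open>Products of two entries of the second row are the same for both coframes near
    \<open>p\<close>. Their derivatives give linear relations, which can be solved because some
    entry \<open>k\<close> is non-zero at \<open>p\<close>.\<close>
  have prod: "?f k p * ?D j (?f i) + ?f i p * ?D j (?f k) = ?f' k p * ?D j (?f' i) + ?f' i p * ?D j (?f' k)" for i j k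
  proof -
    have "?D j (\<lambda>q. ?f' k q * ?f' i q) = ?D j (\<lambda>q. ?f k q * ?f i q)"
    proof (rule tv_cong[OF cM t _ pM])
      show "eventually (\<lambda>q. ?f' k q * ?f' i q = ?f k q * ?f i q) (nh M p)"
        using d(4) d'(4) nh_chart[OF cM U p]
      proof eventually_elim
        case (elim q)
        obtain g h where gq: "g\<^sup>2 = 1" "m' q = G_mat g h ** m q" using good_change[OF elim(3,1,2)] by blast
        have "?f' k q * ?f' i q = g\<^sup>2 * (?f k q * ?f i q)"
          unfolding gq(2) G_mat_mult_nth by (simp add: power2_eq_square mult_ac)
        then show ?case using gq(1) by simp
      qed
    qed
    then show ?thesis unfolding tv_mult[OF t d(1) d(1)] tv_mult[OF t d'(1) d'(1)] by simp
  qed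
  have "\<exists>k. ?f k p \<noteq> 0"
  proof (rule ccontr)
    assume "\<nexists>k. ?f k p \<noteq> 0"
    then have "det (m p) = 0" by (simp add: det_3)
    then show False using d(3) by simp
  qed
  then obtain k where k: "?f k p \<noteq> 0" by blast
  have gg: "g * g = 1" using g(1) by (simp add: power2_eq_square)
  have gx: "g * x = y \<Longrightarrow> x = g * y" for x y using gg by (metis mult.assoc mult_1)
  have Dk: "?D j (?f' k) = g * ?D j (?f k)" for j
  proof (rule gx)
    have two: "x + x = y + y \<Longrightarrow> x = y" for x y :: complex by simp
    have "?f k p * ?D j (?f k) = ?f k p * (g * ?D j (?f' k))"
      using two[OF prod[of k j k, unfolded fp]] by (simp only: mult_ac)
    then show "g * ?D j (?f' k) = ?D j (?f k)" using mult_left_cancel[OF k] by metis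
  qed
  have "?D j (?f' i) = g * ?D j (?f i)" for i j
  proof (rule gx)
    have "?f k p * (g * ?D j (?f' i)) = ?f k p * ?D j (?f i) + ?f i p * ?D j (?f k) - (g * g) * (?f i p * ?D j (?f k))"
      using prod[of k j i] unfolding fp Dk by (simp add: algebra_simps)
    then show "g * ?D j (?f' i) = ?D j (?f i)" using k gg by simp
  qed
  then show ?thesis using g by blast
qed

text \<open>A separate choice at every point, with no continuity; only expressions that do not
  depend on the choice are formed from it.\<close>

definition gm where "gm q = (SOME m. good (U, \<kappa>) q m)"

lemma gm: "q \<in> U \<Longrightarrow> q \<notin> S \<Longrightarrow> good (U, \<kappa>) q (gm q)"
  unfolding gm_def by (rule someI_ex[OF good_exists])

text \<open>By invariance the germ chosen at \<open>p\<close> may be used at all nearby points, and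
  for one fixed germ the expression is holomorphic.\<close>

lemma holo_near_selected:
  assumes p: "p \<in> U - S" and F: "\<And>q m. q \<in> U \<Longrightarrow> good (U, \<kappa>) q m \<Longrightarrow> holo_near M q (F m)"
    and inv: "\<And>q m m'. q \<in> U \<Longrightarrow> good (U, \<kappa>) q m \<Longrightarrow> good (U, \<kappa>) q m' \<Longrightarrow> F m' q = F m q"
  shows "holo_near M p (\<lambda>q. F (gm q) q)"
proof -
  have pU: "p \<in> U" "p \<notin> S" using p by auto
  have g: "good (U, \<kappa>) p (gm p)" by (rule gm[OF pU])
  have "eventually (\<lambda>q. q \<in> X) (nh M p)" by (rule nh_open[OF cM oX UX(1)[OF pU]])
  with goodD(4)[OF g UX(2)[OF pU(1)]] nh_chart[OF cM U pU(1)]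
  have "eventually (\<lambda>q. F (gm p) q = F (gm q) q) (nh M p)"
  proof eventually_elim
    case (elim q)
    have "q \<notin> S" using elim(3) by (simp add: X_def)
    then show ?case using inv[OF elim(2) gm[OF elim(2)] elim(1)] by simp
  qed
  then show ?thesis by (rule holo_near_cong[OF cM _ F[OF pU(1) g]])
qed

text \<open>The first equation of \<open>adapted\<close>, written out for determinant 1. The
  non-zero constant on the right stems from the torsion term
  \<open>\<omega>\<^sup>1 \<and> \<omega>\<^sup>3\<close>.\<close>

lemma coframe_identity:
  assumes p: "p \<in> U" "p \<notin> S" and m: "good (U, \<kappa>) p m"
  defines "P \<equiv> \<lambda>i j k. m p $ 2 $ i * dv M (U, \<kappa>) j p (\<lambda>q. m q $ 2 $ k)"
  shows "P 1 2 3 - P 1 3 2 + P 2 3 1 - P 2 1 3 + P 3 1 2 - P 3 2 1 = -1"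
proof -
  have pM: "p \<in> points M" by (rule UX(2)[OF p(1)])
  note d = goodD[OF m pM]
  obtain W0 where W0: "openin (mtop M) W0" "p \<in> W0" "\<And>q. q \<in> W0 \<Longrightarrow> good (U, \<kappa>) q m"
    using eventually_nhE[OF cM d(4) pM] by blast
  let ?W = "W0 \<inter> (U \<inter> X)"
  have "adapted M (U, \<kappa>) m p"
  proof (rule adapted_pullback[OF U, of ?W])
    show "openin (mtop M) ?W" using W0(1) openin_chart[OF cM U] oX by (intro openin_Int)
    show "p \<in> ?W" using W0(2) p UX(1)[OF p] by blast
    fix q assume q: "q \<in> ?W"
    then have qW: "q \<in> W0" "q \<in> U" by simp_all
    note g = goodD(1,2)[OF W0(3)[OF qW(1)] UX(2)[OF qW(2)]]
    show "holo_near M q (\<lambda>q. m q $ i $ j)" for i j by (rule g(1))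
    show "fr M (U, \<kappa>) q (m q) \<in> Img" by (rule g(2))
  next
    show "?W \<subseteq> U" "?W \<subseteq> X" by (simp_all add: le_infI2)
  qed
  then have "dwedge M (U, \<kappa>) m 2 2 p = - 1" unfolding adapted_def d(3) by blast
  then show ?thesis unfolding dwedge_def curl_def P_def by (simp add: algebra_simps)
qed

theorem coframe_across:
  assumes s: "s \<in> U" "s \<in> S"
  shows "\<exists>W m. openin (mtop M) W \<and> s \<in> W \<and> W \<subseteq> U \<and> (\<forall>q\<in>W. \<forall>i j. holo_near M q (\<lambda>q. m q $ i $ j)) \<and>
    (\<forall>q\<in>W. det (m q) \<noteq> 0) \<and> (\<forall>q\<in>W - S. fr M (U, \<kappa>) q (m q) \<in> Img)"
proof -
  obtain W where W: "openin (mtop M) W" "s \<in> W" "W \<subseteq> U"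
    "\<forall>Q. openin (mtop M) Q \<longrightarrow> Q \<subseteq> W \<longrightarrow> Q \<noteq> {} \<longrightarrow> Q - S \<noteq> {}"
    and ex: "\<forall>h. (\<forall>p\<in>U - S. holo_near M p h) \<longrightarrow>
       (\<exists>h'. (\<forall>p\<in>W. holo_near M p h') \<and> (\<forall>p\<in>W - S. h' p = h p))"
    using Hartogs_manifold[OF cM S s(2) U s(1)] .
  define ext where "ext h = (SOME h'. (\<forall>p\<in>W. holo_near M p h') \<and> (\<forall>p\<in>W - S. h' p = h p))" for h
  have ext: "holo_near M p (ext (\<lambda>q. F (gm q) q))" "p \<notin> S \<Longrightarrow> ext (\<lambda>q. F (gm q) q) p = F (gm p) p"
    if fx: "p \<in> W" "\<forall>q\<in>U. \<forall>m. good (U, \<kappa>) q m \<longrightarrow> holo_near M q (F m)"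
      "\<forall>q\<in>U. \<forall>m m'. good (U, \<kappa>) q m \<longrightarrow> good (U, \<kappa>) q m' \<longrightarrow> F m' q = F m q" for p F
  proof -
    let ?h = "\<lambda>q. F (gm q) q"
    have "holo_near M p ?h" if p: "p \<in> U - S" for p
    proof (rule holo_near_selected[where F = F, OF p])
      show "holo_near M q (F m)" if "q \<in> U" "good (U, \<kappa>) q m" for q m using fx(2) that by blast
      show "F m' q = F m q" if "q \<in> U" "good (U, \<kappa>) q m" "good (U, \<kappa>) q m'" for q m m' using fx(3) that by blast
    qed
    then have "\<forall>p\<in>U - S. holo_near M p ?h" by blast
    then have "\<exists>h'. (\<forall>p\<in>W. holo_near M p h') \<and> (\<forall>p\<in>W - S. h' p = ?h p)" using ex[THEN spec, of ?h] by blast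
    then have "(\<forall>p\<in>W. holo_near M p (ext ?h)) \<and> (\<forall>p\<in>W - S. ext ?h p = ?h p)" unfolding ext_def by (rule someI_ex)
    then show "holo_near M p (ext ?h)" "p \<notin> S \<Longrightarrow> ext ?h p = ?h p" using fx(1) by simp_all
  qed
  have hm: "holo_near M q (\<lambda>q. m q $ i $ j)" if "q \<in> U" "good (U, \<kappa>) q m" for q m i j
    by (rule goodD(1)[OF that(2) UX(2)[OF that(1)]])
  have hD: "holo_near M q (\<lambda>q. dv M (U, \<kappa>) j q (\<lambda>q. m q $ 2 $ k))" if "q \<in> U" "good (U, \<kappa>) q m" for q m j k
    by (rule holo_near_chart_vec[OF cM U that(1) hm[OF that]])
  note hI = holo_near_mult[OF cM] holo_near_diff[OF cM] hm hD
  \<comment> \<open>Sign and shear must drop out of each function to be extended. The first row sees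
    neither; \<open>b\<close>, \<open>P\<close> and \<open>R\<close> have two factors that change
    sign together; in the minors \<open>c\<close> the factors g and 1 / g cancel and the shear
    contributes a vanishing minor.\<close>
  define a where "a j = ext (\<lambda>q. gm q q $ 1 $ j)" for j
  define b where "b i j = ext (\<lambda>q. gm q q $ 2 $ i * gm q q $ 2 $ j)" for i j
  define c where "c i j = ext (\<lambda>q. gm q q $ 2 $ i * gm q q $ 3 $ j - gm q q $ 2 $ j * gm q q $ 3 $ i)" for i j
  define P where "P i j k = ext (\<lambda>q. gm q q $ 2 $ i * dv M (U, \<kappa>) j q (\<lambda>x. gm q x $ 2 $ k))" for i j k
  define R where "R j k = ext (\<lambda>q. dv M (U, \<kappa>) j q (\<lambda>x. gm q x $ 2 $ k) * dv M (U, \<kappa>) j q (\<lambda>x. gm q x $ 2 $ k))" for j k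
  have ha: "holo_near M p (a j)" and ea: "p \<notin> S \<Longrightarrow> a j p = gm p p $ 1 $ j" if p: "p \<in> W" for p j
  proof -
    let ?F = "\<lambda>m q. m q $ 1 $ j"
    have inv: "\<forall>q\<in>U. \<forall>m m'. good (U, \<kappa>) q m \<longrightarrow> good (U, \<kappa>) q m' \<longrightarrow> ?F m' q = ?F m q"
    proof (intro ballI allI impI)
      fix q m m' assume q: "q \<in> U" "good (U, \<kappa>) q m" "good (U, \<kappa>) q m'"
      obtain g h where g: "g\<^sup>2 = 1" "m' q = G_mat g h ** m q" using good_change[OF q] by blast
      show "?F m' q = ?F m q" unfolding g(2) G_mat_mult_nth g(1) by simp
    qed
    have hF: "\<forall>q\<in>U. \<forall>m. good (U, \<kappa>) q m \<longrightarrow> holo_near M q (?F m)" by (intro ballI allI impI hI; assumption)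
    show "holo_near M p (a j)" "p \<notin> S \<Longrightarrow> a j p = gm p p $ 1 $ j"
      unfolding a_def by (rule ext[where F = ?F, OF p hF inv]; assumption)+
  qed
  have hb: "holo_near M p (b i j)" and eb: "p \<notin> S \<Longrightarrow> b i j p = gm p p $ 2 $ i * gm p p $ 2 $ j" if p: "p \<in> W" for p i j
  proof -
    let ?F = "\<lambda>m q. m q $ 2 $ i * m q $ 2 $ j"
    have inv: "\<forall>q\<in>U. \<forall>m m'. good (U, \<kappa>) q m \<longrightarrow> good (U, \<kappa>) q m' \<longrightarrow> ?F m' q = ?F m q"
    proof (intro ballI allI impI)
      fix q m m' assume q: "q \<in> U" "good (U, \<kappa>) q m" "good (U, \<kappa>) q m'"
      obtain g h where g: "g\<^sup>2 = 1" "m' q = G_mat g h ** m q" using good_change[OF q] by blast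
      have "?F m' q = g\<^sup>2 * ?F m q" unfolding g(2) G_mat_mult_nth by (simp add: power2_eq_square mult_ac)
      then show "?F m' q = ?F m q" using g(1) by simp
    qed
    have hF: "\<forall>q\<in>U. \<forall>m. good (U, \<kappa>) q m \<longrightarrow> holo_near M q (?F m)" by (intro ballI allI impI hI; assumption)
    show "holo_near M p (b i j)" "p \<notin> S \<Longrightarrow> b i j p = gm p p $ 2 $ i * gm p p $ 2 $ j"
      unfolding b_def by (rule ext[where F = ?F, OF p hF inv]; assumption)+
  qed
  have hc: "holo_near M p (c i j)" and ec: "p \<notin> S \<Longrightarrow> c i j p = gm p p $ 2 $ i * gm p p $ 3 $ j - gm p p $ 2 $ j * gm p p $ 3 $ i"
    if p: "p \<in> W" for p i j
  proof -
    let ?F = "\<lambda>m q. m q $ 2 $ i * m q $ 3 $ j - m q $ 2 $ j * m q $ 3 $ i"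
    have inv: "\<forall>q\<in>U. \<forall>m m'. good (U, \<kappa>) q m \<longrightarrow> good (U, \<kappa>) q m' \<longrightarrow> ?F m' q = ?F m q"
    proof (intro ballI allI impI)
      fix q m m' assume q: "q \<in> U" "good (U, \<kappa>) q m" "good (U, \<kappa>) q m'"
      obtain g h where g: "g\<^sup>2 = 1" "m' q = G_mat g h ** m q" using good_change[OF q] by blast
      have "g \<noteq> 0" using g(1) by auto
      then show "?F m' q = ?F m q" unfolding g(2) G_mat_mult_nth by (simp add: field_simps)
    qed
    have hF: "\<forall>q\<in>U. \<forall>m. good (U, \<kappa>) q m \<longrightarrow> holo_near M q (?F m)" by (intro ballI allI impI hI; assumption)
    show "holo_near M p (c i j)" "p \<notin> S \<Longrightarrow> c i j p = gm p p $ 2 $ i * gm p p $ 3 $ j - gm p p $ 2 $ j * gm p p $ 3 $ i"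
      unfolding c_def by (rule ext[where F = ?F, OF p hF inv]; assumption)+
  qed
  have hP: "holo_near M p (P i j k)"
    and eP: "p \<notin> S \<Longrightarrow> P i j k p = gm p p $ 2 $ i * dv M (U, \<kappa>) j p (\<lambda>x. gm p x $ 2 $ k)" if p: "p \<in> W" for p i j k
  proof -
    let ?F = "\<lambda>m q. m q $ 2 $ i * dv M (U, \<kappa>) j q (\<lambda>x. m x $ 2 $ k)"
    have inv: "\<forall>q\<in>U. \<forall>m m'. good (U, \<kappa>) q m \<longrightarrow> good (U, \<kappa>) q m' \<longrightarrow> ?F m' q = ?F m q"
    proof (intro ballI allI impI)
      fix q m m' assume q: "q \<in> U" "good (U, \<kappa>) q m" "good (U, \<kappa>) q m'"
      obtain g h where g: "g\<^sup>2 = 1" "m' q = G_mat g h ** m q"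
        and D: "\<forall>i j. dv M (U, \<kappa>) j q (\<lambda>q. m' q $ 2 $ i) = g * dv M (U, \<kappa>) j q (\<lambda>q. m q $ 2 $ i)"
        using good_sign[OF q] by blast
      have "?F m' q = g\<^sup>2 * ?F m q" unfolding D[THEN spec, THEN spec] unfolding g(2) G_mat_mult_nth
        by (simp add: power2_eq_square mult_ac)
      then show "?F m' q = ?F m q" using g(1) by simp
    qed
    have hF: "\<forall>q\<in>U. \<forall>m. good (U, \<kappa>) q m \<longrightarrow> holo_near M q (?F m)" by (intro ballI allI impI hI; assumption)
    show "holo_near M p (P i j k)" "p \<notin> S \<Longrightarrow> P i j k p = gm p p $ 2 $ i * dv M (U, \<kappa>) j p (\<lambda>x. gm p x $ 2 $ k)"
      unfolding P_def by (rule ext[where F = ?F, OF p hF inv]; assumption)+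
  qed
  have hR: "holo_near M p (R j k)"
    and eR: "p \<notin> S \<Longrightarrow> R j k p = dv M (U, \<kappa>) j p (\<lambda>x. gm p x $ 2 $ k) * dv M (U, \<kappa>) j p (\<lambda>x. gm p x $ 2 $ k)"
    if p: "p \<in> W" for p j k
  proof -
    let ?F = "\<lambda>m q. dv M (U, \<kappa>) j q (\<lambda>x. m x $ 2 $ k) * dv M (U, \<kappa>) j q (\<lambda>x. m x $ 2 $ k)"
    have inv: "\<forall>q\<in>U. \<forall>m m'. good (U, \<kappa>) q m \<longrightarrow> good (U, \<kappa>) q m' \<longrightarrow> ?F m' q = ?F m q"
    proof (intro ballI allI impI)
      fix q m m' assume q: "q \<in> U" "good (U, \<kappa>) q m" "good (U, \<kappa>) q m'"
      obtain g h where g: "g\<^sup>2 = 1" "m' q = G_mat g h ** m q"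
        and D: "\<forall>i j. dv M (U, \<kappa>) j q (\<lambda>q. m' q $ 2 $ i) = g * dv M (U, \<kappa>) j q (\<lambda>q. m q $ 2 $ i)"
        using good_sign[OF q] by blast
      have "?F m' q = g\<^sup>2 * ?F m q" unfolding D[THEN spec, THEN spec]
        by (simp add: power2_eq_square mult_ac)
      then show "?F m' q = ?F m q" using g(1) by simp
    qed
    have hF: "\<forall>q\<in>U. \<forall>m. good (U, \<kappa>) q m \<longrightarrow> holo_near M q (?F m)" by (intro ballI allI impI hI; assumption)
    show "holo_near M p (R j k)"
      "p \<notin> S \<Longrightarrow> R j k p = dv M (U, \<kappa>) j p (\<lambda>x. gm p x $ 2 $ k) * dv M (U, \<kappa>) j p (\<lambda>x. gm p x $ 2 $ k)"
      unfolding R_def by (rule ext[where F = ?F, OF p hF inv]; assumption)+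
  qed
  have sM: "s \<in> points M" by (rule UX(2)[OF s(1)])
  have evW: "eventually (\<lambda>q. q \<in> W) (nh M p)" if "p \<in> W" for p by (rule nh_open[OF cM W(1) that])
  have id: "P 1 2 3 s - P 1 3 2 s + P 2 3 1 s - P 2 1 3 s + P 3 1 2 s - P 3 2 1 s - (- 1) = 0"
  proof (rule zero_by_density)
    show "holo_near M s (\<lambda>q. P 1 2 3 q - P 1 3 2 q + P 2 3 1 q - P 2 1 3 q + P 3 1 2 q - P 3 2 1 q - (- 1))"
      by (intro holo_near_diff[OF cM] holo_near_add[OF cM] hP[OF W(2)] holo_near_const[OF cM sM])
    show "eventually (\<lambda>q. q \<notin> S \<longrightarrow> P 1 2 3 q - P 1 3 2 q + P 2 3 1 q - P 2 1 3 q + P 3 1 2 q - P 3 2 1 q - (- 1) = 0) (nh M s)"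
    proof (rule eventually_mono[OF evW[OF W(2)]], rule impI)
      fix q assume q: "q \<in> W" "q \<notin> S"
      have qU: "q \<in> U" using q(1) W(3) by blast
      from coframe_identity[OF qU q(2) gm[OF qU q(2)]]
      show "P 1 2 3 q - P 1 3 2 q + P 2 3 1 q - P 2 1 3 q + P 3 1 2 q - P 3 2 1 q - (- 1) = 0"
        unfolding eP[OF q] by simp
    qed
  qed
  have sq: "P i j k s * P i j k s - b i i s * R j k s = 0" for i j k
  proof (rule zero_by_density)
    show "holo_near M s (\<lambda>q. P i j k q * P i j k q - b i i q * R j k q)"
      by (intro holo_near_diff[OF cM] holo_near_mult[OF cM] hP[OF W(2)] hb[OF W(2)] hR[OF W(2)])
    show "eventually (\<lambda>q. q \<notin> S \<longrightarrow> P i j k q * P i j k q - b i i q * R j k q = 0) (nh M s)"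
      by (rule eventually_mono[OF evW[OF W(2)]], rule impI) (simp add: eP eb eR)
  qed
  have "\<exists>i. b i i s \<noteq> 0"
  proof (rule ccontr)
    assume "\<nexists>i. b i i s \<noteq> 0"
    then have "P i j k s = 0" for i j k using sq[of i j k] by simp
    then show False using id by simp
  qed
  then obtain i where i: "b i i s \<noteq> 0" by blast
  obtain r where r: "holo_near M s r" "\<forall>q. (r q)\<^sup>2 = b i i q"
    using holo_near_sqrt[OF cM hb[OF W(2)] i] by blast
  have rs: "r s \<noteq> 0" using r(2)[THEN spec, of s] i by auto
  have "eventually (\<lambda>q. q \<in> W \<and> holo_near M q r \<and> r q \<noteq> 0) (nh M s)"
    using evW[OF W(2)] eventually_holo_near[OF cM r(1)] holo_near_nonzero[OF cM r(1) rs] by eventually_elim blast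
  then obtain W2 where W2: "openin (mtop M) W2" "s \<in> W2" "\<And>q. q \<in> W2 \<Longrightarrow> q \<in> W \<and> holo_near M q r \<and> r q \<noteq> 0"
    using eventually_nhE[OF cM _ sM] by blast
  \<comment> \<open>Off \<open>S\<close> the root \<open>r\<close> is plus or minus the entry of
    \<open>gm\<close> in row 2 and column \<open>i\<close>. Dividing by it recovers the second row
    up to sign, and the third up to the same sign and the shear that makes its entry
    \<open>i\<close> zero.\<close>
  define m :: "'a \<Rightarrow> complex^3^3" where
    "m q = (\<chi> l j. if l = 1 then a j q else if l = 2 then b i j q / r q else c i j q / r q)" for q
  have m_nth: "m q $ 1 $ j = a j q" "m q $ 2 $ j = b i j q / r q" "m q $ 3 $ j = c i j q / r q" for q j
    by (simp_all add: m_def)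
  have hmm: "holo_near M q (\<lambda>q. m q $ l $ j)" if q: "q \<in> W2" for q l j
  proof -
    have qW: "q \<in> W" "holo_near M q r" "r q \<noteq> 0" using W2(3)[OF q] by simp_all
    show ?thesis using exhaust_3[of l]
      by (elim disjE) (simp_all only: m_nth ha[OF qW(1)] holo_near_divide[OF cM hb[OF qW(1)] qW(2,3)] holo_near_divide[OF cM hc[OF qW(1)] qW(2,3)])
  qed
  have off: "fr M (U, \<kappa>) q (m q) \<in> Img \<and> det (m q) = 1" if q: "q \<in> W2" "q \<notin> S" for q
  proof -
    have qW: "q \<in> W" "r q \<noteq> 0" using W2(3)[OF q(1)] by simp_all
    have qU: "q \<in> U" using qW(1) W(3) by blast
    note g = goodD[OF gm[OF qU q(2)] UX(2)[OF qU]]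
    let ?\<mu> = "gm q q"
    let ?e = "?\<mu> $ 2 $ i / r q" and ?h = "- ?\<mu> $ 3 $ i / r q"
    have rr: "(r q)\<^sup>2 = ?\<mu> $ 2 $ i * ?\<mu> $ 2 $ i" using r(2) eb[OF qW(1) q(2), of i i] by simp
    have "?e\<^sup>2 = ?\<mu> $ 2 $ i * ?\<mu> $ 2 $ i / (r q)\<^sup>2" by (simp add: power_divide power2_eq_square)
    then have e2: "?e\<^sup>2 = 1" unfolding rr[symmetric] using qW(2) by simp
    have e0: "?e \<noteq> 0" using e2 by auto
    have ie: "inverse ?e = ?e" using e2 inverse_unique[of ?e ?e] by (simp add: power2_eq_square)
    have "m q = G_mat ?e ?h ** ?\<mu>"
      unfolding mat3_eq_iff forall_3 m_nth G_mat_mult_nth ea[OF qW(1) q(2)] eb[OF qW(1) q(2)] ec[OF qW(1) q(2)] e2 ie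
      by (simp add: diff_divide_distrib mult_ac)
    moreover have "fr M (U, \<kappa>) q (G_mat ?e ?h ** ?\<mu>) \<in> Img" by (rule Img_act[OF U qU g(2) G_mat_in[OF e0]])
    moreover have "det (G_mat ?e ?h ** ?\<mu>) = 1" unfolding det_mul det_G_mat[OF e0] e2 g(3) by simp
    ultimately show ?thesis by simp
  qed
  \<comment> \<open>The rows remain independent at points of \<open>S\<close>, because determinant 1
    is an identity that passes there.\<close>
  have det1: "det (m q) - 1 = 0" if q: "q \<in> W2" for q
  proof (rule zero_by_density)
    have qM: "q \<in> points M" using W2(3)[OF q] W(3) UX(2) by blast
    show "holo_near M q (\<lambda>q. det (m q) - 1)"
      by (intro holo_near_diff[OF cM] holo_near_det3[OF cM qM] hmm[OF q] holo_near_const[OF cM qM])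
    show "eventually (\<lambda>q. q \<notin> S \<longrightarrow> det (m q) - 1 = 0) (nh M q)"
      by (rule eventually_mono[OF nh_open[OF cM W2(1) q]]) (simp add: off)
  qed
  show ?thesis
  proof (intro exI[of _ W2] exI[of _ m] conjI ballI allI)
    show "W2 \<subseteq> U" using W2(3) W(3) by blast
    show "det (m q) \<noteq> 0" if "q \<in> W2" for q using det1[OF that] by auto
    show "fr M (U, \<kappa>) q (m q) \<in> Img" if "q \<in> W2 - S" for q using off[of q] that by blast
  qed (rule W2 hmm, assumption?)+
qed

end

text \<open>All admissible coframes at once. At points of \<open>S\<close> only holomorphy and
  invertibility are demanded; being adapted and agreement up to the group follow there by
  density.\<close>

definition AD :: "(('a, 3) chart \<times> 'a set \<times> ('a \<Rightarrow> complex^3^3)) set" where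
  "AD = {(c, W, m). c \<in> M \<and> W \<subseteq> fst c \<and> openin (mtop M) W \<and> (\<forall>p\<in>W. \<forall>i j. holo_near M p (\<lambda>q. m q $ i $ j)) \<and>
    (\<forall>p\<in>W. det (m p) \<noteq> 0) \<and> (\<forall>p\<in>W - S. fr M c p (m p) \<in> Img)}"

lemma AD_D:
  assumes "(c, W, m) \<in> AD"
  shows "c \<in> M" "W \<subseteq> fst c" "openin (mtop M) W" "p \<in> W \<Longrightarrow> holo_near M p (\<lambda>q. m q $ i $ j)"
    "p \<in> W \<Longrightarrow> det (m p) \<noteq> 0" "p \<in> W \<Longrightarrow> p \<notin> S \<Longrightarrow> fr M c p (m p) \<in> Img"
  using assms unfolding AD_def by simp_all

lemma AD_adapted:
  assumes d: "(c, W, m) \<in> AD" and p: "p \<in> W"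
  shows "adapted M c m p"
proof -
  obtain U \<kappa> where c: "c = (U, \<kappa>)" by (cases c)
  note D = AD_D[OF d[unfolded c], unfolded fst_conv]
  have WU: "q \<in> U" if "q \<in> W" for q using D(2) that by blast
  have WM: "q \<in> points M" if "q \<in> W" for q using subsetD[OF chart_subset_points[OF D(1)] WU[OF that]] .
  have off: "adapted M (U, \<kappa>) m q" if q: "q \<in> W" "q \<notin> S" for q
  proof (rule adapted_pullback[OF D(1), of "W \<inter> X"])
    show "openin (mtop M) (W \<inter> X)" using D(3) oX by (rule openin_Int)
    show "W \<inter> X \<subseteq> U" "W \<inter> X \<subseteq> X" using D(2) by (simp_all add: le_infI1)
    show "q \<in> W \<inter> X" using q WM[OF q(1)] by (simp add: X_def)
    fix q assume "q \<in> W \<inter> X"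
    then have q: "q \<in> W" "q \<notin> S" by (simp_all add: X_def)
    show "holo_near M q (\<lambda>q. m q $ i $ j)" for i j by (rule D(4)[OF q(1)])
    show "fr M (U, \<kappa>) q (m q) \<in> Img" by (rule D(6)[OF q])
  qed
  have ev: "eventually (\<lambda>q. q \<notin> S \<longrightarrow> adapted M (U, \<kappa>) m q) (nh M p)"
    by (rule eventually_mono[OF nh_open[OF cM D(3) p]]) (use off in blast)
  have hw: "holo_near M p (dwedge M (U, \<kappa>) m i j)" for i j
    by (rule holo_near_dwedge[OF cM D(1) WU[OF p] D(4)[OF p]])
  have hd: "holo_near M p (\<lambda>q. det (m q))" by (rule holo_near_det3[OF cM WM[OF p] D(4)[OF p]])
  have 1: "dwedge M (U, \<kappa>) m 2 2 p + det (m p) = 0"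
    by (rule zero_by_density[of p "\<lambda>q. dwedge M (U, \<kappa>) m 2 2 q + det (m q)"], rule holo_near_add[OF cM hw hd],
        rule eventually_mono[OF ev]) (simp add: adapted_def)
  have 2: "dwedge M (U, \<kappa>) m 1 2 p + 2 * dwedge M (U, \<kappa>) m 2 1 p = 0"
    by (rule zero_by_density[of p "\<lambda>q. dwedge M (U, \<kappa>) m 1 2 q + 2 * dwedge M (U, \<kappa>) m 2 1 q"],
        rule holo_near_add[OF cM hw holo_near_cmult[OF cM hw]], rule eventually_mono[OF ev]) (simp add: adapted_def)
  have 3: "dwedge M (U, \<kappa>) m 3 2 p - dwedge M (U, \<kappa>) m 2 3 p = 0"
    by (rule zero_by_density[of p "\<lambda>q. dwedge M (U, \<kappa>) m 3 2 q - dwedge M (U, \<kappa>) m 2 3 q"],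
        rule holo_near_diff[OF cM hw hw], rule eventually_mono[OF ev]) (simp add: adapted_def)
  from 1 2 3 show ?thesis unfolding c adapted_def by (simp add: eq_neg_iff_add_eq_0)
qed

text \<open>Off \<open>S\<close> both coframes lie in one orbit of \<open>Img\<close>, so the
  holomorphic matrix \<open>T\<close> takes values in the group. The group is given by polynomial
  equations, and \<open>zero_by_density\<close> carries each of them to \<open>S\<close>.\<close>

lemma AD_trans:
  assumes d: "(c, W, m) \<in> AD" "(c', W', m') \<in> AD" and p: "p \<in> W" "p \<in> W'"
  shows "\<exists>k\<in>G_group. m p ** jac M c c' p = k ** m' p"
proof -
  obtain U \<kappa> where c: "c = (U, \<kappa>)" by (cases c)
  obtain U' \<kappa>' where c': "c' = (U', \<kappa>')" by (cases c')
  note D = AD_D[OF d(1)[unfolded c], unfolded fst_conv] and D' = AD_D[OF d(2)[unfolded c'], unfolded fst_conv]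
  have WU: "q \<in> U" if "q \<in> W" for q using D(2) that by blast
  have WU': "q \<in> U'" if "q \<in> W'" for q using D'(2) that by blast
  have pM: "p \<in> points M" using subsetD[OF chart_subset_points[OF D(1)] WU[OF p(1)]] .
  let ?J = "\<lambda>q. m q ** jac M (U, \<kappa>) (U', \<kappa>') q"
  define T where "T q = ?J q ** inv3 (m' q)" for q
  have off: "T q \<in> G_group" if q: "q \<in> W" "q \<in> W'" "q \<notin> S" for q
  proof -
    let ?u = "fr M (U, \<kappa>) q (m q)"
    have u: "?u \<in> Img" by (rule D(6)[OF q(1,3)])
    have "mt M (U', \<kappa>') ?u = ?J q" by (rule mt_fr[OF cM D(1) WU[OF q(1)] D'(1) WU'[OF q(2)]])
    moreover have "fr M (U', \<kappa>') (fst ?u) (mt M (U', \<kappa>') ?u) = ?u"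
      by (rule fr_mt[OF cM D'(1) _ Img_frames(1)[OF u]]) (simp add: WU'[OF q(2)])
    ultimately have "fr M (U', \<kappa>') q (?J q) \<in> Img" using u by simp
    then obtain k where k: "k \<in> G_group" "?J q = k ** m' q"
      using Img_orbit[OF D'(1) WU'[OF q(2)] D'(6)[OF q(2,3)]] by blast
    have "T q = k" unfolding T_def k(2)
      by (simp add: matrix_mul_assoc[symmetric] inv3_inverse(1)[OF D'(5)[OF q(2)]])
    then show ?thesis using k(1) by simp
  qed
  have "eventually (\<lambda>q. q \<notin> S \<longrightarrow> T q \<in> G_group) (nh M p)"
    using nh_open[OF cM D(3) p(1)] nh_open[OF cM D'(3) p(2)] by eventually_elim (use off in blast)
  then have ev: "eventually (\<lambda>q. q \<notin> S \<longrightarrow> P (T q)) (nh M p)" if "\<And>k. k \<in> G_group \<Longrightarrow> P k" for P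
    by (rule eventually_mono) (use that in blast)
  have h: "holo_near M p (\<lambda>q. T q $ i $ j)" for i j
    unfolding T_def
    by (intro holo_near_mat_mult[OF cM pM] holo_near_inv3[OF cM pM] D(4)[OF p(1)] D'(4)[OF p(2)]
        holo_near_jac[OF cM D(1) WU[OF p(1)] D'(1) WU'[OF p(2)]] D'(5)[OF p(2)])
  have z: "T p $ i $ j = 0" if "\<And>k. k \<in> G_group \<Longrightarrow> k $ i $ j = 0" for i j
    by (rule zero_by_density[of p "\<lambda>q. T q $ i $ j"], rule h, rule ev[where P = "\<lambda>k. k $ i $ j = 0"], rule that)
  have "T p $ 1 $ 1 - T p $ 2 $ 2 * T p $ 2 $ 2 = 0"
    by (rule zero_by_density[of p "\<lambda>q. T q $ 1 $ 1 - T q $ 2 $ 2 * T q $ 2 $ 2"], intro holo_near_diff[OF cM] holo_near_mult[OF cM] h,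
        rule ev[where P = "\<lambda>k. k $ 1 $ 1 - k $ 2 $ 2 * k $ 2 $ 2 = 0"])
      (simp add: G_nth(1) power2_eq_square)
  moreover have "T p $ 2 $ 2 * T p $ 3 $ 3 - 1 = 0"
    by (rule zero_by_density[of p "\<lambda>q. T q $ 2 $ 2 * T q $ 3 $ 3 - 1"],
        intro holo_near_diff[OF cM] holo_near_mult[OF cM] holo_near_const[OF cM pM] h,
        rule ev[where P = "\<lambda>k. k $ 2 $ 2 * k $ 3 $ 3 - 1 = 0"])
      (simp add: G_nth)
  moreover have "T p $ 1 $ 2 = 0" "T p $ 1 $ 3 = 0" "T p $ 2 $ 1 = 0" "T p $ 2 $ 3 = 0" "T p $ 3 $ 1 = 0"
    by (rule z, simp add: G_nth)+
  ultimately have "T p \<in> G_group" by (intro G_groupI) (simp_all only: power2_eq_square right_minus_eq)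
  moreover have "T p ** m' p = ?J p" unfolding T_def
    by (simp add: matrix_mul_assoc[symmetric] inv3_inverse(2)[OF D'(5)[OF p(2)]])
  ultimately show ?thesis unfolding c c' by metis
qed

lemma AD_cover:
  assumes p: "p \<in> points M"
  shows "\<exists>c W m. (c, W, m) \<in> AD \<and> p \<in> W"
proof -
  obtain U \<kappa> where U: "(U, \<kappa>) \<in> M" "p \<in> U" using p by (rule pointsE)
  have "\<exists>W m. openin (mtop M) W \<and> p \<in> W \<and> W \<subseteq> U \<and> (\<forall>q\<in>W. \<forall>i j. holo_near M q (\<lambda>q. m q $ i $ j)) \<and>
    (\<forall>q\<in>W. det (m q) \<noteq> 0) \<and> (\<forall>q\<in>W - S. fr M (U, \<kappa>) q (m q) \<in> Img)"
  proof (cases "p \<in> S")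
    case True
    show ?thesis by (rule coframe_across[OF U True])
  next
    case False
    then have pX: "p \<in> X" using p by (simp add: X_def)
    obtain W m where W: "openin (mtop M) W" "p \<in> W" "W \<subseteq> U \<inter> X"
      "\<forall>q\<in>W. \<forall>i j. holo_near M q (\<lambda>q. m q $ i $ j)" "\<forall>q\<in>W. fr M (U, \<kappa>) q (m q) \<in> Img"
      using local_coframe[OF U pX] by (elim exE conjE) (rule that)
    have "det (m q) \<noteq> 0" if q: "q \<in> W" for q
      by (rule Img_det[OF U(1) _ bspec[OF W(5) q]]) (use W(3) q in blast)
    then show ?thesis using W by (intro exI[of _ W] exI[of _ m]) blast
  qed
  then obtain W m where "openin (mtop M) W" "p \<in> W" "W \<subseteq> U" "\<forall>q\<in>W. \<forall>i j. holo_near M q (\<lambda>q. m q $ i $ j)"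
    "\<forall>q\<in>W. det (m q) \<noteq> 0" "\<forall>q\<in>W - S. fr M (U, \<kappa>) q (m q) \<in> Img"
    by (elim exE conjE) (rule that)
  then have "((U, \<kappa>), W, m) \<in> AD" "p \<in> W" using U(1) unfolding AD_def by simp_all
  then show ?thesis by blast
qed

lemma adapted_family: "adapted_family M AD"
proof
  show "complex_manifold M" by (rule M)
  show "c \<in> M" "W \<subseteq> fst c" "openin (mtop M) W" if "(c, W, m) \<in> AD" for c W m by (rule AD_D[OF that])+
  show "holo_near M p (\<lambda>q. m q $ i $ j)" if "(c, W, m) \<in> AD" "p \<in> W" for c W m p i j by (rule AD_D(4)[OF that])
  show "det (m p) \<noteq> 0" if "(c, W, m) \<in> AD" "p \<in> W" for c W m p by (rule AD_D(5)[OF that])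
  show "adapted M c m p" if "(c, W, m) \<in> AD" "p \<in> W" for c W m p by (rule AD_adapted[OF that])
  show "\<exists>k\<in>G_group. m p ** jac M c c' p = k ** m' p"
    if "(c, W, m) \<in> AD" "(c', W', m') \<in> AD" "p \<in> W" "p \<in> W'" for c W m c' W' m' p by (rule AD_trans[OF that])
  show "\<exists>c W m. (c, W, m) \<in> AD \<and> p \<in> W" if "p \<in> points M" for p by (rule AD_cover[OF that])
qed

sublocale F: adapted_family M AD
  by (rule adapted_family)

section \<open>The extension restricts to the given structure\<close>

text \<open>Over a point off \<open>S\<close> both sides are the full orbit of the value of any
  coframe in \<open>AD\<close> there.\<close>

lemma points_off_S: "e \<in> points F.EA \<and> fst e \<notin> S \<longleftrightarrow> e \<in> Img"
proof
  assume e: "e \<in> points F.EA \<and> fst e \<notin> S"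
  obtain d where d: "d \<in> AD" "e \<in> F.Dm d" using F.EA_E[OF conjunct1[OF e]] by blast
  note E = F.DmE[OF d(2,1)]
  have d3: "(fst d, fst (snd d), snd (snd d)) \<in> AD" using d(1) by simp
  have c: "(fst (fst d), snd (fst d)) \<in> M" "fst e \<in> fst (fst d)" using AD_D(1,2)[OF d3] E(1) by auto
  have "fr M (fst (fst d), snd (fst d)) (fst e) (F.tT d e ** snd (snd d) (fst e)) \<in> Img"
    by (rule Img_act[OF c _ E(2)]) (use AD_D(6)[OF d3 E(1) conjunct2[OF e]] in simp)
  then show "e \<in> Img" using E(3) by (simp add: F.sg_def)
next
  assume e: "e \<in> Img"
  have eX: "fst e \<in> X" by (rule Img_frames(2)[OF e])
  then have pM: "fst e \<in> points M" "fst e \<notin> S" by (simp_all add: X_def)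
  obtain c W m where d: "(c, W, m) \<in> AD" "fst e \<in> W" using AD_cover[OF pM(1)] by blast
  obtain U \<kappa> where c: "c = (U, \<kappa>)" by (cases c)
  note D = AD_D[OF d(1)[unfolded c], unfolded fst_conv]
  have U: "fst e \<in> U" using D(2) d(2) by blast
  have u: "fr M (U, \<kappa>) (fst e) (mt M (U, \<kappa>) e) = e" by (rule fr_mt[OF cM D(1) U Img_frames(1)[OF e]])
  have "fr M (U, \<kappa>) (fst e) (mt M (U, \<kappa>) e) \<in> Img" unfolding u by (rule e)
  then obtain k where k: "k \<in> G_group" "mt M (U, \<kappa>) e = k ** m (fst e)"
    using Img_orbit[OF D(1) U D(6)[OF d(2) pM(2)]] by blast
  have "F.sg (c, W, m) (fst e, k) = e" using u unfolding k(2) by (simp add: F.sg_def c)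
  moreover have "F.sg (c, W, m) (fst e, k) \<in> F.Dm (c, W, m)" by (rule F.DmI[OF d(1) _ k(1)]) (simp add: d(2))
  ultimately have "e \<in> F.Dm (c, W, m)" by simp
  then show "e \<in> points F.EA \<and> fst e \<notin> S" using F.EA_I[OF d(1)] pM(2) by blast
qed

lemma openin_Img: "openin (mtop F.EA) Img"
proof -
  have "holo_map F.EA M fst" unfolding holo_map_iff[OF F.cEA cM] using F.hmap_fst by blast
  then have "continuous_map (mtop F.EA) (mtop M) fst" unfolding holo_map_def by blast
  from openin_continuous_map_preimage[OF this oX]
  have "openin (mtop F.EA) {e \<in> points F.EA. fst e \<in> X}" unfolding topspace_mtop[OF F.cEA] .
  moreover have "{e \<in> points F.EA. fst e \<in> X} = Img"
    using points_off_S F.fst_points by (auto simp: X_def)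
  ultimately show ?thesis by simp
qed

lemma restrict_EE: "total (restrict_G F.EE (- S)) = open_sub F.EA Img"
proof -
  have "fst -` (- S) \<inter> points F.EA = Img" using points_off_S by blast
  then show ?thesis
    unfolding restrict_G_def F.EE_def by (simp add: open_sub_Int_points[of F.EA "fst -` (- S)"])
qed

lemma points_restrict: "points (open_sub F.EA Img) = Img"
  using points_off_S by (auto simp: points_open_sub)

text \<open>By \<open>hmap_into_T\<close> it is enough that the inclusion of \<open>Img\<close> into
  the frame bundle of \<open>N\<close> is holomorphic. The inclusion into the frame bundle of
  \<open>M\<close> is, and the matrices in the restricted chart are the same.\<close>

lemma hmap_lift:
  assumes e: "e \<in> Img"
  shows "hmap F.EA T e lift"
proof (rule hmap_into_T[OF F.cEA])
  have eP: "e \<in> points F.EA" using e points_off_S by blast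
  have evI: "eventually (\<lambda>q. q \<in> Img) (nh F.EA e)" by (rule nh_open[OF F.cEA openin_Img e])
  show "eventually (\<lambda>q. lift q \<in> points T) (nh F.EA e)" by (rule eventually_mono[OF evI]) (rule lift(1))
  have eM: "fst e \<in> points M" "fst e \<in> X" using Img_frames(2)[OF e] by (simp_all add: X_def)
  obtain U \<kappa> where U: "(U, \<kappa>) \<in> M" "fst e \<in> U" using eM(1) by (rule pointsE)
  have hF: "hmap F.EA (frame_bundle M) e (\<lambda>e. e)"
  proof -
    have "holo_map F.EA (frame_bundle M) (\<lambda>e. e)"
      using F.G_structure_EE unfolding G_structure_def by (simp add: F.EE_def)
    then show ?thesis unfolding holo_map_iff[OF F.cEA compatible_frame_bundle[OF cM]] using eP by blast
  qed
  have hN: "hmap F.EA N e fst" unfolding hmap_N_M using F.hmap_fst[OF eP] eM(2) by blast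
  have "hmap F.EA (frame_bundle N) e (\<lambda>e. e)"
  proof (rule hmap_frameI[OF cN F.cEA hN _ chart_open_sub[OF cM oX U(1)]])
    show "eventually (\<lambda>q. q \<in> frames N) (nh F.EA e)"
      by (rule eventually_mono[OF evI]) (simp add: frames_N Img_frames)
    show "fst e \<in> U \<inter> X" using U(2) eM(2) by blast
    fix i j
    have "holo_near F.EA e (\<lambda>q. mt M (U, \<kappa>) q $ i $ j)"
      by (rule hmapD(4)[OF hF holo_near_mt[OF cM Img_frames(1)[OF e] U]])
    then show "holo_near F.EA e (\<lambda>q. mt N (U \<inter> X, \<kappa>) q $ i $ j)"
    proof (rule holo_near_cong[OF F.cEA, rotated])
      show "eventually (\<lambda>q. mt M (U, \<kappa>) q $ i $ j = mt N (U \<inter> X, \<kappa>) q $ i $ j) (nh F.EA e)"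
        using evI hmap_eventually[OF F.hmap_fst[OF eP] nh_chart[OF cM U]]
        by eventually_elim (simp add: mt_N[OF U(1)] Img_frames)
    qed
  qed
  then show "hmap F.EA (frame_bundle N) e (\<lambda>q. to_frame E (lift q))"
    by (rule hmap_cong[OF F.cEA]) (rule eventually_mono[OF evI], simp add: lift)
qed

text \<open>In the glued atlas a frame is given by its base point and its group coordinate
  \<open>F.tT d\<close>, a matrix product of holomorphic functions.\<close>

lemma hmap_to_frame_EA:
  assumes e: "e \<in> points T"
  shows "hmap T F.EA e (to_frame E)"
proof -
  have I: "to_frame E q \<in> Img" if "q \<in> points T" for q using that unfolding Img_def by (rule imageI)
  have P: "to_frame E q \<in> points F.EA" if "q \<in> points T" for q using I[OF that] points_off_S by blast
  obtain d where d: "d \<in> AD" "to_frame E e \<in> F.Dm d" using P[OF e] by (rule F.EA_E)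
  note D = F.AD[OF d(1)]
  have pW: "proj E e \<in> fst (snd d)" using F.DmE(1)[OF d(2,1)] by (simp add: fst_to_frame[OF e])
  have pU: "proj E e \<in> fst (fst d)" using pW D(2) by blast
  have pX: "proj E e \<in> X" by (rule proj_X[OF e])
  have ev: "eventually (\<lambda>q. to_frame E q \<in> F.Dm d \<and> fst (to_frame E q) = proj E q) (nh T e)"
    using nh_points[OF cT e] hmap_eventually[OF hmap_proj_M[OF e] nh_open[OF cM D(3) pW]]
    by eventually_elim (simp add: F.Dm_iff[OF d(1) P] fst_to_frame)
  have H: "hmap T G_atlas e (\<lambda>q. F.tT d (to_frame E q))"
  proof -
    have "holo_near T e (\<lambda>q. mt N (fst (fst d) \<inter> X, snd (fst d)) (to_frame E q) $ i $ j)" for i j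
      by (rule hmapD(4)[OF hmap_to_frame[OF e] holo_near_mt[OF cN to_frame_frames[OF e] chart_open_sub[OF cM oX D(1)]]])
        (use pU pX fst_to_frame[OF e] in simp)
    then have 1: "holo_near T e (\<lambda>q. mt M (fst d) (to_frame E q) $ i $ j)" for i j
    proof (rule holo_near_cong[OF cT, rotated])
      show "eventually (\<lambda>q. mt N (fst (fst d) \<inter> X, snd (fst d)) (to_frame E q) $ i $ j =
          mt M (fst d) (to_frame E q) $ i $ j) (nh T e)"
        using nh_points[OF cT e] hmap_eventually[OF hmap_proj_M[OF e] nh_chart[OF cM D(1) pU]]
        by eventually_elim (use mt_N[OF D(1)] in \<open>simp add: fst_to_frame proj_X\<close>)
    qed
    have "holo_near T e (\<lambda>q. snd (snd d) (proj E q) $ i $ j)" for i j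
      by (rule hmapD(4)[OF hmap_proj_M[OF e] D(4)[OF pW]])
    then have "holo_near T e (\<lambda>q. (mt M (fst d) (to_frame E q) ** inv3 (snd (snd d) (proj E q))) $ i $ j)" for i j
      by (intro holo_near_mat_mult[OF cT e] holo_near_inv3[OF cT e] 1 D(5)[OF pW])
    then have h: "holo_near T e (\<lambda>q. F.tT d (to_frame E q) $ i $ j)" for i j
      by (rule holo_near_cong[OF cT, rotated]) (rule eventually_mono[OF ev], simp add: F.tT_def)
    show ?thesis
    proof (rule hmap_GI[OF cT e _ h h])
      show "eventually (\<lambda>q. F.tT d (to_frame E q) \<in> G_group) (nh T e)"
        by (rule eventually_mono[OF ev]) (use F.DmE(2)[OF _ d(1)] in blast)
    qed
  qed
  have "hmap T F.EA e (\<lambda>q. F.sg d (proj E q, F.tT d (to_frame E q)))"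
    by (rule F.hmap_sg[OF cT d(1) hmap_proj_M[OF e] pW H])
  then show ?thesis
  proof (rule hmap_cong[OF cT])
    show "eventually (\<lambda>q. F.sg d (proj E q, F.tT d (to_frame E q)) = to_frame E q) (nh T e)"
      by (rule eventually_mono[OF ev]) (use F.DmE(3)[OF _ d(1)] in metis)
  qed
qed

text \<open>Off \<open>S\<close> the total space of the extension is the set \<open>Img\<close>
  itself, so \<open>lift\<close>, the inverse of \<open>to_frame E\<close>, is the isomorphism. Its
  equivariance follows from that of \<open>to_frame E\<close> by injectivity.\<close>

theorem isomorphic: "G_isomorphic (restrict_G F.EE (- S)) E"
proof -
  let ?R = "open_sub F.EA Img"
  note cR = compatible_open_sub[OF F.cEA openin_Img]
  have bt: "bij_betw (to_frame E) (points T) Img" unfolding Img_def using inj_to_frame by (rule inj_on_imp_bij_betw)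
  have bl: "bij_betw lift Img (points T)" unfolding lift_def by (rule bij_betw_inv_into[OF bt])
  have inv: "inv_into Img lift e = to_frame E e" if e: "e \<in> points T" for e
  proof -
    have u: "to_frame E e \<in> Img" using e unfolding Img_def by (rule imageI)
    have "inv_into Img lift (lift (to_frame E e)) = to_frame E e"
      by (rule inv_into_f_f[OF bij_betw_imp_inj_on[OF bl] u])
    then show ?thesis unfolding lift_to_frame[OF e] .
  qed
  have "biholo ?R T lift"
    unfolding biholo_def points_restrict holo_map_iff[OF cR cT] holo_map_iff[OF cT cR]
  proof (intro conjI ballI bl)
    show "hmap ?R T e lift" if "e \<in> Img" for e
      using hmap_lift[OF that] unfolding hmap_open_sub_dom[OF F.cEA openin_Img that] .
    show "hmap T ?R e (inv_into Img lift)" if e: "e \<in> points T" for e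
    proof (rule hmap_cong[OF cT])
      have "to_frame E e \<in> Img" using e unfolding Img_def by (rule imageI)
      then show "hmap T ?R e (to_frame E)" unfolding hmap_open_sub_cod[OF F.cEA openin_Img] using hmap_to_frame_EA[OF e] by blast
      show "eventually (\<lambda>q. to_frame E q = inv_into Img lift q) (nh T e)"
        by (rule eventually_mono[OF nh_points[OF cT e]]) (simp add: inv)
    qed
  qed
  moreover have "lift (frame_act M k u) = act E (lift u) k" if u: "u \<in> Img" and k: "k \<in> G_group" for u k
  proof -
    have "to_frame E (act E (lift u) k) = frame_act M k u"
      unfolding to_frame_act[OF lift(1)[OF u] k] lift(2)[OF u] by (rule frame_act_N[OF Img_frames(2)[OF u]])
    then show ?thesis using lift_to_frame[OF act_points[OF lift(1)[OF u] k]] by simp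
  qed
  moreover have "proj E (lift u) = fst u" if "u \<in> Img" for u
    using fst_to_frame[OF lift(1)[OF that]] lift(2)[OF that] by simp
  ultimately show ?thesis
    unfolding G_isomorphic_def restrict_EE points_restrict
    by (intro exI[of _ lift]) (simp add: restrict_G_def F.EE_def lift(2))
qed

end

theorem mainTheorem10:
  fixes M :: "('a, 3) atlas" and S :: "'a set" and E :: "('a, 'e) gstruct"
  assumes "complex_manifold M"
    and "closedin (mtop M) S"
    and "codim_ge 2 M S"
    and "scalar_conservation_law (open_sub M (- S)) E"
  shows "\<exists>E' :: ('a, ('a, 3) frame) gstruct.
           scalar_conservation_law M E' \<and> G_isomorphic (restrict_G E' (- S)) E"
proof -
  interpret law M S E using assms by unfold_locales
  show ?thesis using F.scalar_conservation_law_EE isomorphic by blast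
qed

end
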